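(* Let $d\in\{1,2,3\}$, $\nu>0$, and consider the model without regression terms, $Y=X$. Consider the following assumptions. (1) $\pi(\theta|\alpha)$ is a proper density in $\theta\in(0,\infty)$, continuously differentiable in $\theta$, continuous in $\alpha$, finite for all $\theta,\alpha\in(0,\infty)$, not depending on $n$, with $\pi(\theta_0|\alpha)>0$ for all $\alpha>0$. (2) There exist positive constants $C_{\pi,1},C_{\pi,2},C_{\pi,3}$ (which may depend on $\nu,d,T,\alpha_0,\theta_0$) with $C_{\pi,1}+C_{\pi,2}<1/2$ and $C_{\pi,3}<1$ such that for all sufficiently large $n$, $$\sup_{\alpha\in[\underline\alpha_n,\overline\alpha_n]}\ \sup_{\theta\in(\theta_0/2,2\theta_0)}\Big|\frac{\partial\log\pi(\theta|\alpha)}{\partial\theta}\Big|\le n^{C_{\pi,1}},\quad \sup_{\alpha\in[\underline\alpha_n,\overline\alpha_n]}\ \sup_{\theta\in(\theta_0/2,2\theta_0)}\frac{\pi(\theta|\alpha)}{\pi(\theta_0|\alpha)}\le n^{C_{\pi,2}},\quad \inf_{\alpha\in[\underline\alpha_n,\overline\alpha_n]}\log\pi(\theta_0|\alpha)\ge -n^{C_{\pi,3}}.$$ (3) $\pi(\alpha)$ is a proper continuous density on $(0,\infty)$ not depending on $n$, $\pi(\alpha_0)>0$, $\int_0^\infty\pi(\theta_0|\alpha)\pi(\alpha)d\alpha<\infty$, and there exist positive constants $\underline{c_\pi}<(\nu+d/2)\underline\kappa$ and $\overline{c_\pi}<(\nu+d/2)\overline\kappa$ such that for all sufficiently large $n$,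 $$\max\Big\{\int_0^{\underline\alpha_n}\alpha^{-n(\nu+d/2)}\pi(\alpha)d\alpha,\ \int_0^{\underline\alpha_n}\alpha^{-n(\nu+d/2)}\pi(\theta_0|\alpha)\pi(\alpha)d\alpha\Big\}\le\exp(\underline{c_\pi}\,n\log n),$$ $$\max\Big\{\int_{\overline\alpha_n}^\infty\alpha^{n(\nu+d/2)}\pi(\alpha)d\alpha,\ \int_{\overline\alpha_n}^\infty\alpha^{n(\nu+d/2)}\pi(\theta_0|\alpha)\pi(\alpha)d\alpha\Big\}\le\exp(\overline{c_\pi}\,n\log n).$$ (4) $\sup_{s^*\in\mathcal S}\min_{1\le i\le n}\|s^*-s_i\|\to0$ as $n\to\infty$. (5) There is a positive deterministic sequence $\varsigma_n\to0$ such that $\sup_{\alpha\in[\underline\alpha_n,\overline\alpha_n]}\varsigma_n(\alpha)\le\varsigma_n$, where $$\varsigma_n(\alpha)=\max\Big\{\sup_{s^*\in\mathcal S\setminus\mathcal S_n}\Big|\tfrac{E_{(\theta_0/\alpha^{2\nu},\alpha)}\{e_n(s^*;\alpha)^2\}}{E_{(\sigma_0^2,\alpha_0)}\{e_n(s^*;\alpha)^2\}}-1\Big|,\ \sup_{s^*\in\mathcal S\setminus\mathcal S_n}\Big|\tfrac{E_{(\theta_0/\alpha^{2\nu},\alpha)}\{e_n(s^*;\alpha)^2\}}{E_{(\sigma_0^2,\alpha_0)}\{e_n(s^*;\alpha_0)^2\}}-1\Big|\Big\}.$$ Then: (i) Under (1) and (4), for any fixed $\alpha>0$, as $n\to\infty$,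 almost surely $P_{(\sigma_0^2,\alpha_0)}$, $$\Pi\Big[\sup_{s^*\in\mathcal S\setminus\mathcal S_n}\Big|\tfrac{E_{(\sigma^2,\alpha)}\{e_n(s^*;\alpha)^2\}}{E_{(\sigma_0^2,\alpha_0)}\{e_n(s^*;\alpha)^2\}}-1\Big|>\max\{16n^{-1/2}\log n,\,2\varsigma_n(\alpha)\}\ \Big|\ Y_n,\alpha\Big]\to0,$$ $$\Pi\Big[\sup_{s^*\in\mathcal S\setminus\mathcal S_n}\Big|\tfrac{E_{(\sigma^2,\alpha)}\{e_n(s^*;\alpha)^2\}}{E_{(\sigma_0^2,\alpha_0)}\{e_n(s^*;\alpha_0)^2\}}-1\Big|>\max\{16n^{-1/2}\log n,\,2\varsigma_n(\alpha)\}\ \Big|\ Y_n,\alpha\Big]\to0.$$ (ii) Under (1)–(5), as $n\to\infty$, almost surely $P_{(\sigma_0^2,\alpha_0)}$, $$\Pi\Big[\sup_{s^*\in\mathcal S\setminus\mathcal S_n}\Big|\tfrac{E_{(\sigma^2,\alpha)}\{e_n(s^*;\alpha)^2\}}{E_{(\sigma_0^2,\alpha_0)}\{e_n(s^*;\alpha)^2\}}-1\Big|>\max(16n^{-1/2}\log n,\,2\varsigma_n)\ \Big|\ Y_n\Big]\to0,$$ $$\Pi\Big[\sup_{s^*\in\mathcal S\setminus\mathcal S_n}\Big|\tfrac{E_{(\sigma^2,\alpha)}\{e_n(s^*;\alpha)^2\}}{E_{(\sigma_0^2,\alpha_0)}\{e_n(s^*;\alpha_0)^2\}}-1\Big|>\max(16n^{-1/2}\log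 n,\,2\varsigma_n)\ \Big|\ Y_n\Big]\to0.$$
   Context: Setup. $0<T<\infty$, $\mathcal S=[0,T]^d$, $\nu>0$ known. For $\alpha>0$, $K_{\alpha,\nu}(x)=\frac{2^{1-\nu}}{\Gamma(\nu)}(\alpha\|x\|)^{\nu}\mathcal K_\nu(\alpha\|x\|)$, $K_{\alpha,\nu}(0)=1$, with $\mathcal K_\nu$ the modified Bessel function of the second kind. $X$ is a mean-zero Gaussian process on $\mathcal S$; $E_{(\sigma^2,\alpha)}$ and $P_{(\sigma^2,\alpha)}$ refer to the covariance $\sigma^2K_{\alpha,\nu}(s-t)$. The fixed true parameters are $\sigma_0^2,\alpha_0>0$; $\theta_0=\sigma_0^2\alpha_0^{2\nu}$. For each $n$, $\mathcal S_n=\{s_1,\ldots,s_n\}\subset\mathcal S$ consists of $n$ distinct points (the sets need not be nested), $Y_n=(Y(s_1),\ldots,Y(s_n))^\top$, $R_\alpha$ is the matrix with entries $K_{\alpha,\nu}(s_i-s_j)$. The log-likelihood is $\mathcal L_n(\sigma^2,\alpha)=-\frac{1}{2\sigma^2}Y_n^\top R_\alpha^{-1}Y_n-\frac n2\log\sigma^2-\frac12\log|R_\alpha|$. With $\theta=\sigma^2\alpha^{2\nu}$, the prior of $(\theta,\alpha)$ has density $\pi(\theta|\alpha)\pi(\alpha)$. Under $\Pi(\cdot|Y_n)$, $(\theta,\alpha)$ has density proportional to $\exp\{\mathcal L_n(\theta/\alpha^{2\nu},\alpha)\}\pi(\theta|\alpha)\pi(\alpha)$; under $\Pi(\cdot|Y_n,\alpha)$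 ($\alpha$ given), $\theta$ has density proportional to $\exp\{\mathcal L_n(\theta/\alpha^{2\nu},\alpha)\}\pi(\theta|\alpha)$; in both cases $\sigma^2=\theta/\alpha^{2\nu}$. Prediction: for $s^*\in\mathcal S$, $r_\alpha(s^* )=(K_{\alpha,\nu}(s_1-s^* ),\ldots,K_{\alpha,\nu}(s_n-s^* ))^\top$, $\widehat Y(s^*;\alpha)=r_\alpha(s^* )^\top R_\alpha^{-1}Y_n$, and $e_n(s^*;\alpha)=\widehat Y(s^*;\alpha)-Y(s^* )$. Thus $$E_{(\sigma^2,\alpha)}\{e_n(s^*;\alpha)^2\}=\sigma^2\{1-r_\alpha(s^* )^\top R_\alpha^{-1}r_\alpha(s^* )\},$$ $$E_{(\sigma_0^2,\alpha_0)}\{e_n(s^*;\alpha)^2\}=\sigma_0^2\{1-2r_\alpha(s^* )^\top R_\alpha^{-1}r_{\alpha_0}(s^* )+r_\alpha(s^* )^\top R_\alpha^{-1}R_{\alpha_0}R_\alpha^{-1}r_\alpha(s^* )\}.$$ Constants: $\underline\alpha_n=n^{-\underline\kappa}$, $\overline\alpha_n=n^{\overline\kappa}$, with $$\underline\kappa=\tfrac12\min\Big\{\tfrac{0.9}{(2d+0.94)(8\nu+3d-0.9)},\tfrac{1}{4(3\nu+d)},0.01\Big\},\qquad \overline\kappa=\tfrac12\min\Big\{\tfrac{0.9}{(2d+0.94)(8\nu+5d+0.9)},\tfrac{1}{2(2\nu+d)},0.01\Big\}.$$ *)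

theory Defs
  imports
    "HOL-Probability.Probability"
    "Jordan_Normal_Form.Gauss_Jordan_Elimination"
    "Jordan_Normal_Form.Determinant"
begin

(* Modified Bessel function of the second kind, by its integral representation on x > 0. *)
definition bessel_K :: "real \<Rightarrow> real \<Rightarrow> real" where
  "bessel_K \<nu> x = (LBINT t:{0<..}. exp (- x * cosh t) * cosh (\<nu> * t))"

definition matern :: "real \<Rightarrow> real \<Rightarrow> 'a::real_normed_vector \<Rightarrow> real" where
  "matern \<nu> \<alpha> x =
     (if x = 0 then 1
      else 2 powr (1 - \<nu>) / Gamma \<nu> * (\<alpha> * norm x) powr \<nu> * bessel_K \<nu> (\<alpha> * norm x))"

definition cube :: "real \<Rightarrow> (real ^ 'd) set" where
  "cube T = cbox 0 (\<chi> i. T)"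

(* Point masses are allowed, so that degenerate linear combinations of a Gaussian process are covered. *)
definition gaussian_rv :: "'w measure \<Rightarrow> ('w \<Rightarrow> real) \<Rightarrow> bool" where
  "gaussian_rv M X \<longleftrightarrow> X \<in> borel_measurable M \<and>
     ((\<exists>\<mu>. AE \<omega> in M. X \<omega> = \<mu>) \<or>
      (\<exists>\<mu> \<sigma>. \<sigma> > 0 \<and> distributed M lborel X (\<lambda>x. ennreal (normal_density \<mu> \<sigma> x))))"

definition centred_gaussian_process ::
    "'w measure \<Rightarrow> 'a set \<Rightarrow> ('a \<Rightarrow> 'a \<Rightarrow> real) \<Rightarrow> ('a \<Rightarrow> 'w \<Rightarrow> real) \<Rightarrow> bool" where
  "centred_gaussian_process M S C X \<longleftrightarrow>
     prob_space M \<and>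
     (\<forall>F c. finite F \<and> F \<subseteq> S \<longrightarrow> gaussian_rv M (\<lambda>\<omega>. \<Sum>u\<in>F. c u * X u \<omega>)) \<and>
     (\<forall>u\<in>S. integral\<^sup>L M (X u) = 0) \<and>
     (\<forall>u\<in>S. \<forall>v\<in>S. integral\<^sup>L M (\<lambda>\<omega>. X u \<omega> * X v \<omega>) = C u v)"

(* A design of size n is given by the points s i with i < n; the values s i for i \<ge> n are unused. *)
definition corr_mat :: "real \<Rightarrow> nat \<Rightarrow> (nat \<Rightarrow> 'a::real_normed_vector) \<Rightarrow> real \<Rightarrow> real mat" where
  "corr_mat \<nu> n s \<alpha> = Matrix.mat n n (\<lambda>(i, j). matern \<nu> \<alpha> (s i - s j))"

definition corr_inv :: "real \<Rightarrow> nat \<Rightarrow> (nat \<Rightarrow> 'a::real_normed_vector) \<Rightarrow> real \<Rightarrow> real mat" where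
  "corr_inv \<nu> n s \<alpha> = the (mat_inverse (corr_mat \<nu> n s \<alpha>))"

definition corr_vec ::
    "real \<Rightarrow> nat \<Rightarrow> (nat \<Rightarrow> 'a::real_normed_vector) \<Rightarrow> real \<Rightarrow> 'a \<Rightarrow> real Matrix.vec" where
  "corr_vec \<nu> n s \<alpha> x = Matrix.vec n (\<lambda>i. matern \<nu> \<alpha> (s i - x))"

definition obs_vec :: "nat \<Rightarrow> (nat \<Rightarrow> 'a) \<Rightarrow> ('a \<Rightarrow> 'w \<Rightarrow> real) \<Rightarrow> 'w \<Rightarrow> real Matrix.vec" where
  "obs_vec n s Y \<omega> = Matrix.vec n (\<lambda>i. Y (s i) \<omega>)"

definition log_lik ::
    "real \<Rightarrow> nat \<Rightarrow> (nat \<Rightarrow> 'a::real_normed_vector) \<Rightarrow> real Matrix.vec \<Rightarrow> real \<Rightarrow> real \<Rightarrow> real" where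
  "log_lik \<nu> n s y \<sigma>2 \<alpha> =
     - (1 / (2 * \<sigma>2)) * scalar_prod y (mult_mat_vec (corr_inv \<nu> n s \<alpha>) y)
     - real n / 2 * ln \<sigma>2
     - 1 / 2 * ln (Determinant.det (corr_mat \<nu> n s \<alpha>))"

(* Meaningful for a normalising integral in (0, \<infinity>); otherwise ennreal division gives a
   measure that is not a probability measure. *)
definition normalized_density :: "'b measure \<Rightarrow> ('b \<Rightarrow> real) \<Rightarrow> 'b measure" where
  "normalized_density M w = density M (\<lambda>x. ennreal (w x) / (\<integral>\<^sup>+ z. ennreal (w z) \<partial>M))"

(* Posteriors of \<theta> given \<alpha>, and of (\<theta>, \<alpha>); f \<theta> \<alpha> stands for \<pi>(\<theta>|\<alpha>) and g \<alpha> for \<pi>(\<alpha>). *)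
definition posterior_given ::
    "real \<Rightarrow> (real \<Rightarrow> real \<Rightarrow> real) \<Rightarrow> nat \<Rightarrow> (nat \<Rightarrow> 'a::real_normed_vector) \<Rightarrow>
     real Matrix.vec \<Rightarrow> real \<Rightarrow> real measure" where
  "posterior_given \<nu> f n s y \<alpha> =
     normalized_density (restrict_space lborel {0<..})
       (\<lambda>\<theta>. exp (log_lik \<nu> n s y (\<theta> / \<alpha> powr (2 * \<nu>)) \<alpha>) * f \<theta> \<alpha>)"

definition posterior ::
    "real \<Rightarrow> (real \<Rightarrow> real \<Rightarrow> real) \<Rightarrow> (real \<Rightarrow> real) \<Rightarrow> nat \<Rightarrow>
     (nat \<Rightarrow> 'a::real_normed_vector) \<Rightarrow> real Matrix.vec \<Rightarrow> (real \<times> real) measure" where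
  "posterior \<nu> f g n s y =
     normalized_density (restrict_space lborel ({0<..} \<times> {0<..}))
       (\<lambda>(\<theta>, \<alpha>). exp (log_lik \<nu> n s y (\<theta> / \<alpha> powr (2 * \<nu>)) \<alpha>) * f \<theta> \<alpha> * g \<alpha>)"

definition pred_error ::
    "real \<Rightarrow> nat \<Rightarrow> (nat \<Rightarrow> 'a::real_normed_vector) \<Rightarrow> ('a \<Rightarrow> 'w \<Rightarrow> real) \<Rightarrow>
     'a \<Rightarrow> real \<Rightarrow> 'w \<Rightarrow> real" where
  "pred_error \<nu> n s Y x \<alpha> \<omega> =
     scalar_prod (corr_vec \<nu> n s \<alpha> x) (mult_mat_vec (corr_inv \<nu> n s \<alpha>) (obs_vec n s Y \<omega>)) - Y x \<omega>"

definition pred_mse ::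
    "'w measure \<Rightarrow> real \<Rightarrow> nat \<Rightarrow> (nat \<Rightarrow> 'a::real_normed_vector) \<Rightarrow> ('a \<Rightarrow> 'w \<Rightarrow> real) \<Rightarrow>
     real \<Rightarrow> 'a \<Rightarrow> real" where
  "pred_mse M \<nu> n s Y \<alpha> x = integral\<^sup>L M (\<lambda>\<omega>. (pred_error \<nu> n s Y x \<alpha> \<omega>)\<^sup>2)"

(* The supremum is taken in the extended reals, so that an unbounded ratio gives \<infinity>. *)
definition ratio_dev :: "'a set \<Rightarrow> ('a \<Rightarrow> real) \<Rightarrow> ('a \<Rightarrow> real) \<Rightarrow> ereal" where
  "ratio_dev A u v = (SUP x\<in>A. ereal \<bar>u x / v x - 1\<bar>)"

(* P \<sigma>2 \<alpha> is the probability measure under which Y has covariance \<sigma>2 * matern \<nu> \<alpha>. *)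
definition varsigma ::
    "(real \<Rightarrow> real \<Rightarrow> 'w measure) \<Rightarrow> real \<Rightarrow> real \<Rightarrow> real \<Rightarrow> 'a set \<Rightarrow> nat \<Rightarrow>
     (nat \<Rightarrow> 'a::real_normed_vector) \<Rightarrow> ('a \<Rightarrow> 'w \<Rightarrow> real) \<Rightarrow> real \<Rightarrow> ereal" where
  "varsigma P \<nu> \<sigma>2\<^sub>0 \<alpha>\<^sub>0 S n s Y \<alpha> =
     (let \<theta>\<^sub>0 = \<sigma>2\<^sub>0 * \<alpha>\<^sub>0 powr (2 * \<nu>);
          A = S - s ` {..<n};
          m = pred_mse (P (\<theta>\<^sub>0 / \<alpha> powr (2 * \<nu>)) \<alpha>) \<nu> n s Y \<alpha>
      in max (ratio_dev A m (pred_mse (P \<sigma>2\<^sub>0 \<alpha>\<^sub>0) \<nu> n s Y \<alpha>))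
             (ratio_dev A m (pred_mse (P \<sigma>2\<^sub>0 \<alpha>\<^sub>0) \<nu> n s Y \<alpha>\<^sub>0)))"

definition kappa_lo :: "real \<Rightarrow> nat \<Rightarrow> real" where
  "kappa_lo \<nu> d = 1 / 2 * Min {0.9 / ((2 * real d + 0.94) * (8 * \<nu> + 3 * real d - 0.9)),
                               1 / (4 * (3 * \<nu> + real d)), 0.01}"

definition kappa_hi :: "real \<Rightarrow> nat \<Rightarrow> real" where
  "kappa_hi \<nu> d = 1 / 2 * Min {0.9 / ((2 * real d + 0.94) * (8 * \<nu> + 5 * real d + 0.9)),
                               1 / (2 * (2 * \<nu> + real d)), 0.01}"

definition alpha_lo :: "real \<Rightarrow> nat \<Rightarrow> nat \<Rightarrow> real" where
  "alpha_lo \<nu> d n = real n powr (- kappa_lo \<nu> d)"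

definition alpha_hi :: "real \<Rightarrow> nat \<Rightarrow> nat \<Rightarrow> real" where
  "alpha_hi \<nu> d n = real n powr kappa_hi \<nu> d"

definition cond_prior_regular :: "real \<Rightarrow> (real \<Rightarrow> real \<Rightarrow> real) \<Rightarrow> bool" where
  "cond_prior_regular \<theta>\<^sub>0 f \<longleftrightarrow>
     (\<forall>\<theta>>0. \<forall>\<alpha>>0. 0 \<le> f \<theta> \<alpha>) \<and>
     (\<forall>\<alpha>>0. (\<integral>\<^sup>+ \<theta>\<in>{0<..}. ennreal (f \<theta> \<alpha>) \<partial>lborel) = 1) \<and>
     (\<forall>\<alpha>>0. (\<lambda>\<theta>. f \<theta> \<alpha>) C1_differentiable_on {0<..}) \<and>
     (\<forall>\<theta>>0. continuous_on {0<..} (\<lambda>\<alpha>. f \<theta> \<alpha>)) \<and>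
     (\<forall>\<alpha>>0. 0 < f \<theta>\<^sub>0 \<alpha>)"

(* Where f \<theta> \<alpha> = 0 the totalised ln has no meaning, but this cannot happen here when f is regular:
   a bounded logarithmic derivative keeps f positive on the whole of (\<theta>\<^sub>0/2, 2\<theta>\<^sub>0), as f \<theta>\<^sub>0 \<alpha> > 0. *)
definition cond_prior_growth ::
    "real \<Rightarrow> nat \<Rightarrow> real \<Rightarrow> (real \<Rightarrow> real \<Rightarrow> real) \<Rightarrow> bool" where
  "cond_prior_growth \<nu> d \<theta>\<^sub>0 f \<longleftrightarrow>
     (\<exists>C1 C2 C3. 0 < C1 \<and> 0 < C2 \<and> 0 < C3 \<and> C1 + C2 < 1 / 2 \<and> C3 < 1 \<and>
       (\<forall>\<^sub>F n in sequentially.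
         (SUP \<alpha>\<in>{alpha_lo \<nu> d n..alpha_hi \<nu> d n}. SUP \<theta>\<in>{\<theta>\<^sub>0 / 2<..<2 * \<theta>\<^sub>0}.
            ereal \<bar>deriv (\<lambda>t. ln (f t \<alpha>)) \<theta>\<bar>) \<le> ereal (real n powr C1) \<and>
         (SUP \<alpha>\<in>{alpha_lo \<nu> d n..alpha_hi \<nu> d n}. SUP \<theta>\<in>{\<theta>\<^sub>0 / 2<..<2 * \<theta>\<^sub>0}.
            ereal (f \<theta> \<alpha> / f \<theta>\<^sub>0 \<alpha>)) \<le> ereal (real n powr C2) \<and>
         (INF \<alpha>\<in>{alpha_lo \<nu> d n..alpha_hi \<nu> d n}. ereal (ln (f \<theta>\<^sub>0 \<alpha>)))
            \<ge> ereal (- (real n powr C3))))"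

definition range_prior_tails ::
    "real \<Rightarrow> nat \<Rightarrow> real \<Rightarrow> real \<Rightarrow> (real \<Rightarrow> real \<Rightarrow> real) \<Rightarrow> (real \<Rightarrow> real) \<Rightarrow> bool" where
  "range_prior_tails \<nu> d \<theta>\<^sub>0 \<alpha>\<^sub>0 f g \<longleftrightarrow>
     (\<forall>\<alpha>>0. 0 \<le> g \<alpha>) \<and>
     (\<integral>\<^sup>+ \<alpha>\<in>{0<..}. ennreal (g \<alpha>) \<partial>lborel) = 1 \<and>
     continuous_on {0<..} g \<and>
     0 < g \<alpha>\<^sub>0 \<and>
     (\<integral>\<^sup>+ \<alpha>\<in>{0<..}. ennreal (f \<theta>\<^sub>0 \<alpha> * g \<alpha>) \<partial>lborel) < \<infinity> \<and>
     (\<exists>c_lo c_hi.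
       0 < c_lo \<and> c_lo < (\<nu> + real d / 2) * kappa_lo \<nu> d \<and>
       0 < c_hi \<and> c_hi < (\<nu> + real d / 2) * kappa_hi \<nu> d \<and>
       (\<forall>\<^sub>F n in sequentially.
         max (\<integral>\<^sup>+ \<alpha>\<in>{0<..alpha_lo \<nu> d n}.
                ennreal (\<alpha> powr (- (real n * (\<nu> + real d / 2))) * g \<alpha>) \<partial>lborel)
             (\<integral>\<^sup>+ \<alpha>\<in>{0<..alpha_lo \<nu> d n}.
                ennreal (\<alpha> powr (- (real n * (\<nu> + real d / 2))) * f \<theta>\<^sub>0 \<alpha> * g \<alpha>) \<partial>lborel)
           \<le> ennreal (exp (c_lo * real n * ln (real n))) \<and>
         max (\<integral>\<^sup>+ \<alpha>\<in>{alpha_hi \<nu> d n..}.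
                ennreal (\<alpha> powr (real n * (\<nu> + real d / 2)) * g \<alpha>) \<partial>lborel)
             (\<integral>\<^sup>+ \<alpha>\<in>{alpha_hi \<nu> d n..}.
                ennreal (\<alpha> powr (real n * (\<nu> + real d / 2)) * f \<theta>\<^sub>0 \<alpha> * g \<alpha>) \<partial>lborel)
           \<le> ennreal (exp (c_hi * real n * ln (real n)))))"

definition space_filling :: "'a::real_normed_vector set \<Rightarrow> (nat \<Rightarrow> nat \<Rightarrow> 'a) \<Rightarrow> bool" where
  "space_filling S s \<longleftrightarrow>
     (\<lambda>n. SUP x\<in>S. Min ((\<lambda>i. norm (x - s n i)) ` {..<n})) \<longlonglongrightarrow> 0"

end

theory Submission
  imports Defs "HOL-Real_Asymp.Real_Asymp"
begin

text \<open>
  Write $k_\alpha = \alpha^{-2\nu} K_{\alpha,\nu}$, let $A_\alpha$ be its matrix on the design, and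
  $q(\alpha) = Y_n^\top A_\alpha^{-1} Y_n$. In the parameter $\theta$ the likelihood is proportional to
  $\det(A_\alpha)^{-1/2}\, \theta^{-n/2} e^{-q(\alpha)/2\theta}$, and the mean squared prediction error under
  $(\theta/\alpha^{2\nu}, \alpha)$ is linear in $\theta$. So the ratios in the theorem can exceed the threshold only if
  $|\theta/\theta_0 - 1| > 5 n^{-1/2} \log n$, and everything follows from
  $|q(\alpha)/\theta_0 - n| \le 2 n^{1/2} \log n$, almost surely for all large $n$, uniformly in $\alpha$.
  The kernel is a mixture of Gaussian kernels, so $A_\alpha$ is decreasing in $\alpha$ and
  $A_\beta \ge (\alpha/\beta)^{2\nu+d} A_\alpha$ for $\alpha \le \beta$; hence $q$ is increasing, and only
  the end points $\underline\alpha_n$, $\overline\alpha_n$ matter.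

  At such a point, $q(\alpha)$ differs from the chi-square variable $q(\alpha_0)/\theta_0$ by a form of constant sign whose
  expectation is $|\mathrm{tr}(A_\alpha^{-1} A_{\alpha_0}) - n|$, and this is $o(n^{1/2})$: small scales
  of the mixture change little between $\alpha$ and $\alpha_0$, while for large scales the Gaussian kernel has a trace against
  $A_\alpha^{-1}$ bounded independently of the design. The latter holds because
  $|\sum_j c_j e^{i \omega \cdot s_j}|^2$ is at most a constant times $(1+|\omega|^2)^{\nu+d/2}\, c^\top A_\alpha c$, as one sees by
  reproducing $e^{i \omega \cdot x}$ on the cube through a band-limited bump function.

  For $\alpha$ outside $[\underline\alpha_n, \overline\alpha_n]$ the scaling inequality bounds the marginal likelihood by
  the integrands of the tail assumptions, and $\log\det A_{\alpha_0} - \log\det A_\alpha \le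
  \mathrm{tr}(A_\alpha^{-1} A_{\alpha_0}) - n$ compares it with the mass near $\alpha_0$.
\<close>

section \<open>Positive definite matrices\<close>

text \<open>Design points may lie arbitrarily close together, so no eigenvalue of the matrices is
  bounded below. Every comparison is therefore one of quadratic forms, traces or log-determinants of
  two kernels on the same design, where the ill-conditioning cancels. The constant sign of the
  perturbation matters for the same reason: a nonnegative Gaussian form has an exponential tail
  governed by its mean alone, so no norm of a matrix difference has to be estimated. The constants
  follow from e = n^(-1/2) log n. The bound on q puts the maximiser q/n of the likelihood within
  relative distance 2e of \<open>\<theta>\<^sub>0\<close>. Outside relative distance 5e from
  \<open>\<theta>\<^sub>0\<close>, q/(n \<theta>) stays at distance at least e from 1, which costs a
  factor exp(-(log n)^2/12) and beats every power of n. Within 5e, (1 + 5e)(1 + z) - 1 <= max(16 e,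
  2 z) as soon as e <= 1/20. In the trace estimate the mixture is cut at the scale n^(-2/3), where n
  times the scale and its power -1/2 both equal n^(1/3); this leaves a factor n^(1/6) for the growth
  of the range parameter.\<close>

definition qform :: "nat \<Rightarrow> (nat \<Rightarrow> nat \<Rightarrow> real) \<Rightarrow> (nat \<Rightarrow> real) \<Rightarrow> real" where
  "qform n A c = (\<Sum>i<n. \<Sum>j<n. c i * c j * A i j)"

definition sym_on :: "nat \<Rightarrow> (nat \<Rightarrow> nat \<Rightarrow> real) \<Rightarrow> bool" where
  "sym_on n A \<longleftrightarrow> (\<forall>i<n. \<forall>j<n. A i j = A j i)"

definition psd :: "nat \<Rightarrow> (nat \<Rightarrow> nat \<Rightarrow> real) \<Rightarrow> bool" where
  "psd n A \<longleftrightarrow> sym_on n A \<and> (\<forall>c. 0 \<le> qform n A c)"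

definition pd :: "nat \<Rightarrow> (nat \<Rightarrow> nat \<Rightarrow> real) \<Rightarrow> bool" where
  "pd n A \<longleftrightarrow> sym_on n A \<and> (\<forall>c. (\<exists>i<n. c i \<noteq> 0) \<longrightarrow> 0 < qform n A c)"

text \<open>The trace of A B once one factor is symmetric. The entrywise form needs no matrix
  product and commutes with sums and integrals over the entries.\<close>

definition tr_prod :: "nat \<Rightarrow> (nat \<Rightarrow> nat \<Rightarrow> real) \<Rightarrow> (nat \<Rightarrow> nat \<Rightarrow> real) \<Rightarrow> real" where
  "tr_prod n A B = (\<Sum>i<n. \<Sum>j<n. A i j * B i j)"

lemma sum_unit:
  fixes f :: "'a \<Rightarrow> real"
  assumes "finite I" "j \<in> I"
  shows "(\<Sum>i\<in>I. (if i = j then 1 else 0) * f i) = f j"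
  using assms by (simp add: if_distrib[of "\<lambda>x. x * _"] cong: if_cong)

text \<open>Elimination one pivot at a time: subtracting the rank-one matrix of row \<open>m\<close>
  leaves the Schur complement, which is again nonnegative on the later indices. The vanishing of
  \<open>V k i\<close> for i < k is recorded because it makes the determinant of the factor a
  product of diagonal entries.\<close>

lemma psd_cholesky_aux:
  fixes A :: "nat \<Rightarrow> nat \<Rightarrow> real"
  assumes "m \<le> n"
    and "\<And>i j. i \<in> {m..<n} \<Longrightarrow> j \<in> {m..<n} \<Longrightarrow> A i j = A j i"
    and "\<And>c. 0 \<le> (\<Sum>i\<in>{m..<n}. \<Sum>j\<in>{m..<n}. c i * c j * A i j)"
  shows "\<exists>V. (\<forall>i\<in>{m..<n}. \<forall>j\<in>{m..<n}. A i j = (\<Sum>k\<in>{m..<n}. V k i * V k j)) \<and>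
             (\<forall>k i. i < k \<longrightarrow> V k i = 0)"
  using assms
proof (induction "n - m" arbitrary: m A)
  case 0
  then show ?case by (intro exI[of _ "\<lambda>_ _. 0"]) auto
next
  case (Suc l)
  then have mn: "m < n" by simp
  let ?I = "{Suc m..<n}"
  have I: "{m..<n} = insert m ?I" using mn by auto
  have symm: "A i j = A j i" if "i \<in> {m..<n}" "j \<in> {m..<n}" for i j using Suc(4) that by blast
  \<comment> \<open>The form at \<open>c\<close> with its coordinate \<open>m\<close> replaced by
    \<open>t\<close>, as a quadratic polynomial in \<open>t\<close>. The choices of \<open>t\<close>
    below give the sign of the pivot, the zero row and the completed square.\<close>
  have form: "0 \<le> t\<^sup>2 * A m m + 2 * t * (\<Sum>j\<in>?I. c j * A m j) + (\<Sum>i\<in>?I. \<Sum>j\<in>?I. c i * c j * A i j)" for t c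
  proof -
    let ?c = "c(m := t)"
    have "0 \<le> (\<Sum>i\<in>{m..<n}. \<Sum>j\<in>{m..<n}. ?c i * ?c j * A i j)" by (rule Suc(5))
    also have "\<dots> = t\<^sup>2 * A m m + (\<Sum>j\<in>?I. t * c j * A m j) + ((\<Sum>i\<in>?I. c i * t * A i m) + (\<Sum>i\<in>?I. \<Sum>j\<in>?I. c i * c j * A i j))"
      unfolding I by (simp add: sum.distrib power2_eq_square)
    also have "(\<Sum>i\<in>?I. c i * t * A i m) = (\<Sum>j\<in>?I. t * c j * A m j)"
      by (intro sum.cong refl) (use symm mn in auto)
    finally show ?thesis by (simp add: sum_distrib_left mult_ac)
  qed
  \<comment> \<open>For a zero pivot the quotient is 0 by convention, which is right because the
    whole row then vanishes.\<close>
  define V0 where "V0 i = A m i / sqrt (A m m)" for i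
  have Amm: "0 \<le> A m m" using form[of 1 "\<lambda>_. 0"] by simp
  have zero: "A m j = 0" if "A m m = 0" "j \<in> {m..<n}" for j
  proof (cases "j = m")
    case False
    then have j: "j \<in> ?I" using that by auto
    \<comment> \<open>With a zero pivot the form is affine in \<open>t\<close>, and it is
      nonnegative for all \<open>t\<close> only if its slope is 0.\<close>
    have q: "0 \<le> 2 * t * A m j + A j j" for t
    proof -
      have e: "(\<Sum>i\<in>?I. \<Sum>k\<in>?I. (if i = j then 1 else 0) * (if k = j then 1 else 0) * A i k) = A j j"
        using sum_unit[of ?I j "\<lambda>i. \<Sum>k\<in>?I. (if k = j then 1 else 0) * A i k"] sum_unit[of ?I j "A j"] j
        by (simp only: sum_distrib_left mult.assoc finite_atLeastLessThan)
      have e2: "(\<Sum>k\<in>?I. (if k = j then 1 else 0) * A m k) = A m j"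
        using sum_unit[of ?I j "A m"] j by simp
      show ?thesis using form[of t "\<lambda>k. if k = j then 1 else 0"] unfolding e e2 using that by simp
    qed
    show ?thesis
    proof (rule ccontr)
      assume "A m j \<noteq> 0"
      then show False using q[of "-(A j j + 1) / (2 * A m j)"] by (simp add: field_simps)
    qed
  qed (use that in auto)
  define A' where "A' i j = A i j - V0 i * V0 j" for i j
  have VV: "V0 i * V0 j = A m i * A m j / A m m" for i j
    using Amm by (simp add: V0_def real_sqrt_mult_self)
  have VVm: "V0 m * V0 j = A m j" if "j \<in> {m..<n}" for j
    using zero[OF _ that] by (cases "A m m = 0") (auto simp: VV)
  have VVm': "V0 j * V0 m = A m j" if "j \<in> {m..<n}" for j
    using VVm[OF that] by (simp add: mult.commute)
  have psd': "0 \<le> (\<Sum>i\<in>?I. \<Sum>j\<in>?I. c i * c j * A' i j)" for c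
  proof -
    let ?S = "\<Sum>j\<in>?I. c j * A m j"
    have "(\<Sum>i\<in>?I. \<Sum>j\<in>?I. c i * c j * A' i j) =
      (\<Sum>i\<in>?I. \<Sum>j\<in>?I. c i * c j * A i j) - (\<Sum>i\<in>?I. \<Sum>j\<in>?I. (c i * A m i) * (c j * A m j) / A m m)"
      unfolding A'_def VV by (simp add: sum_subtractf[symmetric] algebra_simps)
    also have "(\<Sum>i\<in>?I. \<Sum>j\<in>?I. (c i * A m i) * (c j * A m j) / A m m) = ?S\<^sup>2 / A m m"
      by (simp add: power2_eq_square sum_product sum_divide_distrib)
    also have "0 \<le> (\<Sum>i\<in>?I. \<Sum>j\<in>?I. c i * c j * A i j) - ?S\<^sup>2 / A m m"
    proof (cases "A m m = 0")
      case True then show ?thesis using form[of 0 c] by simp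
    next
      case False
      then show ?thesis using form[of "- ?S / A m m" c] by (simp add: field_simps power2_eq_square)
    qed
    finally show ?thesis .
  qed
  have "\<exists>V. (\<forall>i\<in>?I. \<forall>j\<in>?I. A' i j = (\<Sum>k\<in>?I. V k i * V k j)) \<and> (\<forall>k i. i < k \<longrightarrow> V k i = 0)"
    by (rule Suc(1)) (use Suc(2) mn psd' symm in \<open>auto simp: A'_def\<close>)
  then obtain V where V: "\<And>i j. i \<in> ?I \<Longrightarrow> j \<in> ?I \<Longrightarrow> A' i j = (\<Sum>k\<in>?I. V k i * V k j)"
    and V0: "\<And>k i. i < k \<Longrightarrow> V k i = 0" by blast
  define W where "W k i = (if i < k then 0 else if k = m then V0 i else V k i)" for k i
  show ?case
  proof (intro exI[of _ W] conjI ballI allI impI)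
    fix i j assume ij: "i \<in> {m..<n}" "j \<in> {m..<n}"
    have "(\<Sum>k\<in>{m..<n}. W k i * W k j) = V0 i * V0 j + (\<Sum>k\<in>?I. V k i * V k j)"
    proof -
      have "(\<Sum>k\<in>?I. W k i * W k j) = (\<Sum>k\<in>?I. V k i * V k j)"
        by (intro sum.cong refl) (auto simp: W_def V0)
      then show ?thesis unfolding I using ij by (auto simp: W_def)
    qed
    also have "\<dots> = A i j"
    proof (cases "i = m \<or> j = m")
      case True
      then have "(\<Sum>k\<in>?I. V k i * V k j) = 0" by (intro sum.neutral) (auto simp: V0)
      then show ?thesis using True ij VVm VVm' symm by auto
    next
      case False
      then have "i \<in> ?I" "j \<in> ?I" using ij by auto
      from V[OF this] show ?thesis by (simp add: A'_def)
    qed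
    finally show "A i j = (\<Sum>k\<in>{m..<n}. W k i * W k j)" by simp
  qed (auto simp: W_def)
qed

lemma psd_cholesky:
  assumes "psd n A"
  obtains V where "\<And>i j. i < n \<Longrightarrow> j < n \<Longrightarrow> A i j = (\<Sum>k<n. V k i * V k j)"
    and "\<And>k i. i < k \<Longrightarrow> V k i = 0"
  using psd_cholesky_aux[of 0 n A] assms
  by (auto simp: psd_def sym_on_def qform_def atLeast0LessThan)

lemma qform_gram:
  assumes "\<And>i j. i < n \<Longrightarrow> j < n \<Longrightarrow> A i j = (\<Sum>k<m. V k i * V k j)"
  shows "qform n A c = (\<Sum>k<m. (\<Sum>i<n. c i * V k i)\<^sup>2)"
proof -
  have "qform n A c = (\<Sum>i<n. \<Sum>j<n. \<Sum>k<m. (c i * V k i) * (c j * V k j))"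
    unfolding qform_def by (intro sum.cong refl) (simp add: assms sum_distrib_left mult_ac)
  also have "\<dots> = (\<Sum>i<n. \<Sum>k<m. \<Sum>j<n. (c i * V k i) * (c j * V k j))"
    by (intro sum.cong refl sum.swap)
  also have "\<dots> = (\<Sum>k<m. \<Sum>i<n. \<Sum>j<n. (c i * V k i) * (c j * V k j))"
    by (rule sum.swap)
  finally show ?thesis by (simp add: power2_eq_square sum_product)
qed

text \<open>Lets inequalities between quadratic forms pass to traces against a nonnegative matrix,
  once that matrix is written as a Gram matrix.\<close>

lemma tr_prod_gram:
  assumes "\<And>i j. i < n \<Longrightarrow> j < n \<Longrightarrow> A i j = (\<Sum>k<m. V k i * V k j)"
  shows "tr_prod n B A = (\<Sum>k<m. qform n B (V k))"
proof -
  have "tr_prod n B A = (\<Sum>i<n. \<Sum>j<n. \<Sum>k<m. V k i * V k j * B i j)"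
    unfolding tr_prod_def by (intro sum.cong refl) (simp add: assms sum_distrib_left mult_ac)
  also have "\<dots> = (\<Sum>i<n. \<Sum>k<m. \<Sum>j<n. V k i * V k j * B i j)"
    by (intro sum.cong refl sum.swap)
  also have "\<dots> = (\<Sum>k<m. \<Sum>i<n. \<Sum>j<n. V k i * V k j * B i j)"
    by (rule sum.swap)
  finally show ?thesis by (simp add: qform_def)
qed

lemma tr_prod_commute: "tr_prod n A B = tr_prod n B A"
  by (simp add: tr_prod_def mult.commute)

lemma tr_prod_nonneg:
  assumes "psd n A" "psd n B" shows "0 \<le> tr_prod n A B"
proof -
  obtain V where "\<And>i j. i < n \<Longrightarrow> j < n \<Longrightarrow> B i j = (\<Sum>k<n. V k i * V k j)"
    using psd_cholesky[OF assms(2)] by metis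
  from tr_prod_gram[OF this, where B=A] show ?thesis
    using assms(1) by (simp add: psd_def sum_nonneg)
qed

lemma tr_prod_mono:
  assumes "psd n G" "\<And>c. qform n A c \<le> qform n B c" shows "tr_prod n A G \<le> tr_prod n B G"
proof -
  obtain V where V: "\<And>i j. i < n \<Longrightarrow> j < n \<Longrightarrow> G i j = (\<Sum>k<n. V k i * V k j)"
    using psd_cholesky[OF assms(1)] by metis
  have *: "tr_prod n B G = (\<Sum>k<n. qform n B (V k))" for B by (rule tr_prod_gram) (rule V)
  show ?thesis unfolding * by (intro sum_mono assms)
qed

lemma pd_imp_psd: assumes "pd n A" shows "psd n A"
  unfolding psd_def
proof (intro conjI allI)
  fix c show "0 \<le> qform n A c"
  proof (cases "\<exists>i<n. c i \<noteq> 0")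
    case True then show ?thesis using assms by (auto simp: pd_def intro: less_imp_le)
  next
    case False then show ?thesis by (auto simp: qform_def intro!: sum_nonneg)
  qed
qed (use assms in \<open>auto simp: pd_def\<close>)

lemma psd_diag_nonneg: assumes "psd n A" "i < n" shows "0 \<le> A i i"
proof -
  obtain V where "\<And>i j. i < n \<Longrightarrow> j < n \<Longrightarrow> A i j = (\<Sum>k<n. V k i * V k j)"
    using psd_cholesky[OF assms(1)] by metis
  then show ?thesis using assms(2) by (simp add: sum_nonneg)
qed

section \<open>Determinants and inverses of positive definite matrices\<close>

definition fmat :: "nat \<Rightarrow> (nat \<Rightarrow> nat \<Rightarrow> real) \<Rightarrow> real mat" where
  "fmat n A = Matrix.mat n n (\<lambda>(i, j). A i j)"

definition fdet :: "nat \<Rightarrow> (nat \<Rightarrow> nat \<Rightarrow> real) \<Rightarrow> real" where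
  "fdet n A = Determinant.det (fmat n A)"

text \<open>Outside the invertible case the value of \<open>the\<close> is arbitrary; positive
  definiteness excludes that case. Only inverse and determinant go through the matrix library, the
  rest works with entry functions because the entries are integrals.\<close>

definition finv :: "nat \<Rightarrow> (nat \<Rightarrow> nat \<Rightarrow> real) \<Rightarrow> nat \<Rightarrow> nat \<Rightarrow> real" where
  "finv n A i j = the (mat_inverse (fmat n A)) $$ (i, j)"

lemma fmat_carrier [simp]: "fmat n A \<in> carrier_mat n n" by (simp add: fmat_def)

lemma fmat_mult: "fmat n A * fmat n B = fmat n (\<lambda>i j. \<Sum>k<n. A i k * B k j)"
  by (rule eq_matI) (auto simp: fmat_def scalar_prod_def atLeast0LessThan)

lemma fmat_cong: "(\<And>i j. i < n \<Longrightarrow> j < n \<Longrightarrow> A i j = B i j) \<Longrightarrow> fmat n A = fmat n B"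
  by (auto simp: fmat_def)

lemma fmat_transpose: "transpose_mat (fmat n A) = fmat n (\<lambda>i j. A j i)"
  by (rule eq_matI) (auto simp: fmat_def)

lemma fdet_mult: "fdet n (\<lambda>i j. \<Sum>k<n. A i k * B k j) = fdet n A * fdet n B"
  using det_mult[of "fmat n A" n "fmat n B"] by (simp add: fdet_def fmat_mult)

lemma fdet_transpose: "fdet n (\<lambda>i j. A j i) = fdet n A"
  using det_transpose[of "fmat n A" n] by (simp add: fdet_def fmat_transpose)

lemma fdet_cong: "(\<And>i j. i < n \<Longrightarrow> j < n \<Longrightarrow> A i j = B i j) \<Longrightarrow> fdet n A = fdet n B"
  unfolding fdet_def using fmat_cong[of n A B] by metis

lemma fdet_gram:
  assumes "\<And>i j. i < n \<Longrightarrow> j < n \<Longrightarrow> A i j = (\<Sum>k<n. V k i * V k j)"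
  shows "fdet n A = (fdet n V)\<^sup>2"
proof -
  have "fdet n A = fdet n (\<lambda>i j. \<Sum>k<n. V k i * V k j)"
    by (rule fdet_cong) (rule assms)
  also have "\<dots> = fdet n V * fdet n V"
    using fdet_mult[of n "\<lambda>i k. V k i" V] fdet_transpose[of n V] by metis
  finally show ?thesis by (simp add: power2_eq_square)
qed

lemma fdet_triangular:
  assumes "\<And>k i. i < k \<Longrightarrow> V k i = 0" shows "fdet n V = (\<Prod>i<n. V i i)"
proof -
  have "fdet n V = prod_list (diag_mat (fmat n V))"
    unfolding fdet_def
  proof (rule det_upper_triangular[of _ n])
    show "upper_triangular (fmat n V)"
      by (rule upper_triangularI) (simp add: fmat_def assms)
  qed simp
  also have "\<dots> = (\<Prod>i<n. V i i)"
    by (simp add: prod_list_diag_prod fmat_def atLeast0LessThan)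
  finally show ?thesis .
qed

lemma fdet_scale: "fdet n (\<lambda>i j. a * A i j) = a ^ n * fdet n A"
proof -
  have "fmat n (\<lambda>i j. a * A i j) = a \<cdot>\<^sub>m fmat n A" by (rule eq_matI) (auto simp: fmat_def)
  moreover have "dim_col (fmat n A) = n" by (simp add: fmat_def)
  ultimately show ?thesis unfolding fdet_def by (metis det_smult)
qed

text \<open>Hadamard's inequality: the triangular factor gives the determinant as the product of the
  \<open>(V i i)\<^sup>2\<close>, and the diagonal entry \<open>A i i\<close> is the sum of the
  squares in column i, of which \<open>(V i i)\<^sup>2\<close> is one.\<close>

lemma hadamard:
  assumes "psd n A" shows "fdet n A \<le> (\<Prod>i<n. A i i)"
proof -
  obtain V where V: "\<And>i j. i < n \<Longrightarrow> j < n \<Longrightarrow> A i j = (\<Sum>k<n. V k i * V k j)"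
    and V0: "\<And>k i. i < k \<Longrightarrow> V k i = 0"
    using psd_cholesky[OF assms] by metis
  have "fdet n A = (fdet n V)\<^sup>2" by (rule fdet_gram) (rule V)
  also have "fdet n V = (\<Prod>i<n. V i i)" by (rule fdet_triangular) (rule V0)
  also have "(\<Prod>i<n. V i i)\<^sup>2 = (\<Prod>i<n. (V i i)\<^sup>2)" by (rule prod_power_distrib)
  also have "\<dots> \<le> (\<Prod>i<n. A i i)"
  proof (intro prod_mono conjI)
    fix i assume "i \<in> {..<n}"
    then have i: "i < n" by simp
    have "V i i * V i i \<le> (\<Sum>k<n. V k i * V k i)"
      by (rule member_le_sum) (use i in auto)
    then show "(V i i)\<^sup>2 \<le> A i i" using V[OF i i] by (simp add: power2_eq_square)
  qed auto
  finally show ?thesis .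
qed

text \<open>Hadamard's inequality combined with x <= exp(x - 1) for each diagonal entry; the loss is
  small when the matrix is close to the identity.\<close>

lemma fdet_le_exp_trace:
  assumes "psd n A" shows "fdet n A \<le> exp ((\<Sum>i<n. A i i) - real n)"
proof -
  have "fdet n A \<le> (\<Prod>i<n. A i i)" by (rule hadamard[OF assms])
  also have "\<dots> \<le> (\<Prod>i<n. exp (A i i - 1))"
  proof (intro prod_mono conjI)
    fix i assume "i \<in> {..<n}"
    then show "0 \<le> A i i" using psd_diag_nonneg[OF assms] by simp
    show "A i i \<le> exp (A i i - 1)" using exp_ge_add_one_self[of "A i i - 1"] by simp
  qed
  also have "\<dots> = exp ((\<Sum>i<n. A i i) - real n)"
    by (simp add: exp_sum[symmetric] sum_subtractf)
  finally show ?thesis .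
qed

lemma pd_mult_ne:
  assumes "pd n A" "v \<in> carrier_vec n" "v \<noteq> 0\<^sub>v n"
  shows "fmat n A *\<^sub>v v \<noteq> 0\<^sub>v n"
proof
  assume z: "fmat n A *\<^sub>v v = 0\<^sub>v n"
  have "\<exists>i<n. v $ i \<noteq> 0" using assms(2,3) by (metis carrier_vecD eq_vecI index_zero_vec(1,2))
  then have "0 < qform n A (\<lambda>i. v $ i)" using assms(1) by (auto simp: pd_def)
  moreover have "qform n A (\<lambda>i. v $ i) = (\<Sum>i<n. v $ i * (fmat n A *\<^sub>v v) $ i)"
    unfolding qform_def using assms(2)
    by (intro sum.cong refl) (auto simp: fmat_def scalar_prod_def sum_distrib_left atLeast0LessThan mult_ac)
  ultimately show False unfolding z by simp
qed

lemma pd_det_pos: assumes "pd n A" shows "0 < fdet n A"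
proof -
  have "fdet n A \<noteq> 0"
    using pd_mult_ne[OF assms] det_0_iff_vec_prod_zero_field[of "fmat n A" n] by (auto simp: fdet_def)
  moreover obtain V where "\<And>i j. i < n \<Longrightarrow> j < n \<Longrightarrow> A i j = (\<Sum>k<n. V k i * V k j)"
    using psd_cholesky[OF pd_imp_psd[OF assms]] by metis
  from fdet_gram[OF this] have "fdet n A \<ge> 0" by simp
  ultimately show ?thesis by simp
qed

lemma finv_mat:
  assumes "pd n A"
  shows "the (mat_inverse (fmat n A)) = fmat n (finv n A)"
    and "fmat n A * fmat n (finv n A) = 1\<^sub>m n" "fmat n (finv n A) * fmat n A = 1\<^sub>m n"
proof -
  have "Determinant.det (fmat n A) \<noteq> 0" using pd_det_pos[OF assms] by (simp add: fdet_def)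
  then have "fmat n A \<in> Units (ring_mat TYPE(real) n ())"
    by (intro det_non_zero_imp_unit) auto
  then obtain B where B: "mat_inverse (fmat n A) = Some B"
    using mat_inverse(1)[of "fmat n A" n, where b="()"] by (cases "mat_inverse (fmat n A)") auto
  from mat_inverse(2)[OF fmat_carrier B]
  have B': "fmat n A * B = 1\<^sub>m n" "B * fmat n A = 1\<^sub>m n" "B \<in> carrier_mat n n" by auto
  have "B = fmat n (finv n A)"
    using B'(3) by (intro eq_matI) (auto simp: fmat_def finv_def B[unfolded fmat_def])
  with B' B show "the (mat_inverse (fmat n A)) = fmat n (finv n A)"
    "fmat n A * fmat n (finv n A) = 1\<^sub>m n" "fmat n (finv n A) * fmat n A = 1\<^sub>m n" by auto
qed

lemma finv_right:
  assumes "pd n A" "i < n" "j < n"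
  shows "(\<Sum>k<n. A i k * finv n A k j) = (if i = j then 1 else 0)"
proof -
  have "(fmat n A * fmat n (finv n A)) $$ (i, j) = (1\<^sub>m n :: real mat) $$ (i, j)"
    by (simp add: finv_mat(2)[OF assms(1)])
  then show ?thesis using assms(2,3) unfolding fmat_mult by (simp add: fmat_def)
qed

lemma finv_left:
  assumes "pd n A" "i < n" "j < n"
  shows "(\<Sum>k<n. finv n A i k * A k j) = (if i = j then 1 else 0)"
proof -
  have "(fmat n (finv n A) * fmat n A) $$ (i, j) = (1\<^sub>m n :: real mat) $$ (i, j)"
    by (simp add: finv_mat(3)[OF assms(1)])
  then show ?thesis using assms(2,3) unfolding fmat_mult by (simp add: fmat_def)
qed

text \<open>With B the inverse, B A B^T is evaluated in both orders: it equals B since A B^T = 1 by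
  the symmetry of A, and it equals B^T since B A = 1.\<close>

lemma finv_sym:
  assumes "pd n A" "i < n" "j < n" shows "finv n A i j = finv n A j i"
proof -
  let ?B = "finv n A"
  have sA: "A k l = A l k" if "k < n" "l < n" for k l using assms(1) that by (auto simp: pd_def sym_on_def)
  have "?B i j = (\<Sum>k<n. ?B i k * (\<Sum>l<n. A k l * ?B j l))"
  proof -
    have "(\<Sum>l<n. A k l * ?B j l) = (if j = k then 1 else 0)" if "k < n" for k
      using finv_left[OF assms(1,3) that] sA that by (simp add: mult.commute)
    then have "(\<Sum>k<n. ?B i k * (\<Sum>l<n. A k l * ?B j l)) = (\<Sum>k<n. ?B i k * (if j = k then 1 else 0))"
      by (intro sum.cong refl) simp
    also have "\<dots> = ?B i j" using assms(3) by (simp add: if_distrib cong: if_cong)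
    finally show ?thesis by simp
  qed
  also have "\<dots> = (\<Sum>l<n. (\<Sum>k<n. ?B i k * A k l) * ?B j l)"
    by (simp add: sum_distrib_left sum_distrib_right mult.assoc) (rule sum.swap)
  also have "\<dots> = (\<Sum>l<n. (if i = l then 1 else 0) * ?B j l)"
    by (intro sum.cong refl) (simp add: finv_left[OF assms(1,2)])
  also have "\<dots> = ?B j i" using assms(2) by (simp add: if_distrib[of "\<lambda>x. x * _"] cong: if_cong)
  finally show ?thesis .
qed

lemma finv_qform_eq:
  assumes "pd n A"
  defines "c y \<equiv> \<lambda>i. \<Sum>j<n. finv n A i j * y j"
  shows "qform n A (c y) = qform n (finv n A) y" "(\<Sum>i<n. c y i * y i) = qform n (finv n A) y"
proof -
  let ?B = "finv n A"
  show *: "(\<Sum>i<n. c y i * y i) = qform n ?B y"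
    unfolding qform_def c_def by (simp add: sum_distrib_left sum_distrib_right mult_ac)
  have Ac: "(\<Sum>j<n. A i j * c y j) = y i" if "i < n" for i
  proof -
    have "(\<Sum>j<n. A i j * c y j) = (\<Sum>k<n. (\<Sum>j<n. A i j * ?B j k) * y k)"
      unfolding c_def by (simp add: sum_distrib_left sum_distrib_right mult.assoc) (rule sum.swap)
    also have "\<dots> = (\<Sum>k<n. (if i = k then 1 else 0) * y k)"
      by (intro sum.cong refl) (simp add: finv_right[OF assms(1) that])
    also have "\<dots> = y i" using that by (simp add: if_distrib[of "\<lambda>x. x * _"] cong: if_cong)
    finally show ?thesis .
  qed
  have "qform n A (c y) = (\<Sum>i<n. c y i * (\<Sum>j<n. A i j * c y j))"
    unfolding qform_def by (simp add: sum_distrib_left mult_ac)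
  also have "\<dots> = (\<Sum>i<n. c y i * y i)" by (intro sum.cong refl) (simp add: Ac)
  finally show "qform n A (c y) = qform n ?B y" using * by simp
qed

text \<open>Expands the nonnegative form of A at c - A^(-1) y. Together with
  \<open>finv_qform_eq\<close> this is the variational formula y^T A^(-1) y = max over c of 2 c^T y
  - c^T A c, from which the reversal of order under inversion is immediate.\<close>

lemma finv_qform_ge:
  assumes "pd n A"
  shows "2 * (\<Sum>i<n. c i * y i) - qform n A c \<le> qform n (finv n A) y"
proof -
  define c' where "c' i = (\<Sum>j<n. finv n A i j * y j)" for i
  have sA: "A k l = A l k" if "k < n" "l < n" for k l using assms(1) that by (auto simp: pd_def sym_on_def)
  have Ac: "(\<Sum>j<n. A i j * c' j) = y i" if "i < n" for i
  proof -
    have "(\<Sum>j<n. A i j * c' j) = (\<Sum>k<n. (\<Sum>j<n. A i j * finv n A j k) * y k)"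
      unfolding c'_def by (simp add: sum_distrib_left sum_distrib_right mult.assoc) (rule sum.swap)
    also have "\<dots> = (\<Sum>k<n. (if i = k then 1 else 0) * y k)"
      by (intro sum.cong refl) (simp add: finv_right[OF assms(1) that])
    also have "\<dots> = y i" using that by (simp add: if_distrib[of "\<lambda>x. x * _"] cong: if_cong)
    finally show ?thesis .
  qed
  have "0 \<le> qform n A (\<lambda>i. c i - c' i)" using pd_imp_psd[OF assms] by (simp add: psd_def)
  also have "\<dots> = (\<Sum>i<n. \<Sum>j<n. c i * c j * A i j) - (\<Sum>i<n. \<Sum>j<n. c i * c' j * A i j)
     - (\<Sum>i<n. \<Sum>j<n. c' i * c j * A i j) + (\<Sum>i<n. \<Sum>j<n. c' i * c' j * A i j)"
    unfolding qform_def by (simp add: sum_subtractf[symmetric] sum.distrib[symmetric] algebra_simps)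
  also have "(\<Sum>i<n. \<Sum>j<n. c i * c' j * A i j) = (\<Sum>i<n. c i * (\<Sum>j<n. A i j * c' j))"
    unfolding sum_distrib_left[of "c _"] by (intro sum.cong refl) (simp add: mult_ac)
  also have "\<dots> = (\<Sum>i<n. c i * y i)" by (intro sum.cong refl) (simp add: Ac)
  also have "(\<Sum>i<n. \<Sum>j<n. c' i * c j * A i j) = (\<Sum>j<n. c j * (\<Sum>i<n. A j i * c' i))"
    unfolding sum_distrib_left[of "c _"] by (subst sum.swap) (intro sum.cong refl, simp add: sA mult_ac)
  also have "\<dots> = (\<Sum>i<n. c i * y i)" by (intro sum.cong refl) (simp add: Ac)
  finally show ?thesis using finv_qform_eq(1)[OF assms, of y] by (simp add: qform_def c'_def)
qed

lemma finv_antimono: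
  assumes "pd n A" "pd n B" "\<And>c. qform n A c \<le> qform n B c"
  shows "qform n (finv n B) y \<le> qform n (finv n A) y"
proof -
  let ?c = "\<lambda>i. \<Sum>j<n. finv n B i j * y j"
  have "qform n (finv n B) y = 2 * (\<Sum>i<n. ?c i * y i) - qform n B ?c"
    using finv_qform_eq[OF assms(2), of y] by simp
  also have "\<dots> \<le> 2 * (\<Sum>i<n. ?c i * y i) - qform n A ?c" using assms(3)[of ?c] by simp
  also have "\<dots> \<le> qform n (finv n A) y" by (rule finv_qform_ge[OF assms(1)])
  finally show ?thesis .
qed

text \<open>Dual norm estimate: inserting c = A^(-1) y into the hypothesis gives q^2 <= K q for the
  form q to be bounded. It converts a bound on a linear functional of the coefficients into a bound
  on a form of the inverse.\<close>

lemma finv_qform_le: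
  assumes "pd n A" "0 \<le> K" "\<And>c. (\<Sum>i<n. c i * y i)\<^sup>2 \<le> K * qform n A c"
  shows "qform n (finv n A) y \<le> K"
proof -
  let ?c = "\<lambda>i. \<Sum>j<n. finv n A i j * y j"
  let ?q = "qform n (finv n A) y"
  have "?q\<^sup>2 \<le> K * ?q" using assms(3)[of ?c] finv_qform_eq[OF assms(1), of y] by simp
  moreover have "0 \<le> ?q"
    using finv_qform_eq(1)[OF assms(1), of y] pd_imp_psd[OF assms(1)] by (metis psd_def)
  ultimately show ?thesis using assms(2) by (cases "?q = 0") (auto simp: power2_eq_square)
qed

lemma pd_finv_psd: assumes "pd n A" shows "psd n (finv n A)"
  unfolding psd_def sym_on_def using finv_sym[OF assms] finv_qform_eq(1)[OF assms] pd_imp_psd[OF assms]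
  by (metis psd_def)

lemma tr_prod_finv: assumes "pd n A" shows "tr_prod n (finv n A) A = real n"
proof -
  have "tr_prod n (finv n A) A = (\<Sum>i<n. \<Sum>j<n. finv n A i j * A j i)"
    unfolding tr_prod_def using assms by (intro sum.cong refl) (auto simp: pd_def sym_on_def)
  also have "\<dots> = (\<Sum>i<n. 1)" by (intro sum.cong refl) (simp add: finv_left[OF assms])
  finally show ?thesis by simp
qed

lemma finv_scale:
  assumes "pd n A" "0 < a" "i < n" "j < n"
  shows "finv n (\<lambda>i j. a * A i j) i j = finv n A i j / a"
proof -
  have pd: "pd n (\<lambda>i j. a * A i j)"
  proof -
    have "qform n (\<lambda>i j. a * A i j) c = a * qform n A c" for c
      by (simp add: qform_def sum_distrib_left mult_ac)
    then show ?thesis using assms(1,2) by (auto simp: pd_def sym_on_def)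
  qed
  let ?B = "finv n (\<lambda>i j. a * A i j)"
  have "?B i j = (\<Sum>k<n. ?B i k * (if k = j then 1 else 0))"
    using assms(4) by (simp add: if_distrib cong: if_cong)
  also have "\<dots> = (\<Sum>k<n. ?B i k * (\<Sum>l<n. A k l * finv n A l j))"
    by (intro sum.cong refl) (simp add: finv_right[OF assms(1) _ assms(4)])
  also have "\<dots> = (\<Sum>l<n. (\<Sum>k<n. ?B i k * (a * A k l)) * finv n A l j / a)"
    using assms(2) by (simp add: sum_distrib_left sum_distrib_right mult.assoc) (subst sum.swap, simp add: mult_ac sum_divide_distrib)
  also have "\<dots> = (\<Sum>l<n. (if i = l then 1 else 0) * finv n A l j / a)"
    by (intro sum.cong refl) (simp add: finv_left[OF pd assms(3)])
  also have "\<dots> = finv n A i j / a"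
    using assms(3) by (simp add: if_distrib[of "\<lambda>x. x * _"] if_distrib[of "\<lambda>x. x / _"] cong: if_cong)
  finally show ?thesis .
qed

text \<open>With A^(-1) = U^T U, the matrix M = U A' U^T has determinant det A' / det A and trace
  tr(A^(-1) A'), and \<open>fdet_le_exp_trace\<close> applies to it.\<close>

lemma ln_det_diff_le:
  assumes A: "pd n A" and A': "pd n A'"
  shows "ln (fdet n A') - ln (fdet n A) \<le> tr_prod n (finv n A) A' - real n"
proof -
  obtain U where U: "\<And>i j. i < n \<Longrightarrow> j < n \<Longrightarrow> finv n A i j = (\<Sum>k<n. U k i * U k j)"
    using psd_cholesky[OF pd_finv_psd[OF A]] by metis
  define M where "M k l = (\<Sum>j<n. (\<Sum>i<n. U k i * A' i j) * U l j)" for k l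
  have M_alt: "M k l = (\<Sum>i<n. \<Sum>j<n. U k i * U l j * A' i j)" for k l
    unfolding M_def sum_distrib_right by (subst sum.swap) (simp add: mult_ac)
  have sA: "A' k l = A' l k" if "k < n" "l < n" for k l using A' that by (auto simp: pd_def sym_on_def)
  have Mpsd: "psd n M"
    unfolding psd_def sym_on_def
  proof (intro conjI allI impI)
    fix k l show "M k l = M l k"
      unfolding M_alt by (subst sum.swap) (intro sum.cong refl, simp add: sA mult_ac)
    fix c
    have "qform n M c = qform n A' (\<lambda>i. \<Sum>k<n. c k * U k i)"
    proof -
      have "qform n M c = (\<Sum>k<n. \<Sum>l<n. \<Sum>i<n. \<Sum>j<n. c k * U k i * (c l * U l j) * A' i j)"
        unfolding qform_def M_alt by (simp add: sum_distrib_left mult_ac)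
      also have "\<dots> = (\<Sum>k<n. \<Sum>i<n. \<Sum>l<n. \<Sum>j<n. c k * U k i * (c l * U l j) * A' i j)"
        by (intro sum.cong refl sum.swap)
      also have "\<dots> = (\<Sum>i<n. \<Sum>k<n. \<Sum>l<n. \<Sum>j<n. c k * U k i * (c l * U l j) * A' i j)"
        by (rule sum.swap)
      also have "\<dots> = (\<Sum>i<n. \<Sum>k<n. \<Sum>j<n. \<Sum>l<n. c k * U k i * (c l * U l j) * A' i j)"
        by (intro sum.cong refl sum.swap)
      also have "\<dots> = (\<Sum>i<n. \<Sum>j<n. \<Sum>k<n. \<Sum>l<n. c k * U k i * (c l * U l j) * A' i j)"
        by (intro sum.cong refl sum.swap)
      also have "\<dots> = qform n A' (\<lambda>i. \<Sum>k<n. c k * U k i)"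
        unfolding qform_def sum_product by (simp only: sum_distrib_right)
      finally show ?thesis .
    qed
    then show "0 \<le> qform n M c" using pd_imp_psd[OF A'] by (simp add: psd_def)
  qed
  have "(\<Sum>k<n. M k k) = tr_prod n A' (finv n A)"
  proof -
    have "tr_prod n A' (finv n A) = (\<Sum>k<n. qform n A' (U k))" by (rule tr_prod_gram) (rule U)
    then show ?thesis by (simp add: qform_def M_alt)
  qed
  then have trM: "(\<Sum>k<n. M k k) = tr_prod n (finv n A) A'" by (simp only: tr_prod_commute)
  have "fdet n M = fdet n (\<lambda>k j. \<Sum>i<n. U k i * A' i j) * fdet n (\<lambda>j l. U l j)"
    unfolding M_def by (rule fdet_mult)
  also have "\<dots> = fdet n U * fdet n A' * fdet n U" using fdet_mult[of n U A'] fdet_transpose[of n U] by simp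
  also have "\<dots> = fdet n (finv n A) * fdet n A'"
  proof -
    have "fdet n (finv n A) = (fdet n U)\<^sup>2" by (rule fdet_gram) (rule U)
    then show ?thesis by (simp add: power2_eq_square)
  qed
  finally have dM: "fdet n M = fdet n (finv n A) * fdet n A'" .
  have "fdet n A * fdet n (finv n A) = 1"
    using det_mult[of "fmat n A" n "fmat n (finv n A)"] by (simp add: fdet_def finv_mat[OF A])
  then have "fdet n (finv n A) = 1 / fdet n A" using pd_det_pos[OF A] by (simp add: field_simps)
  with dM have "fdet n M = fdet n A' / fdet n A" by simp
  then have "fdet n A' / fdet n A \<le> exp (tr_prod n (finv n A) A' - real n)"
    using fdet_le_exp_trace[OF Mpsd] trM by simp
  then have "ln (fdet n A' / fdet n A) \<le> tr_prod n (finv n A) A' - real n"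
    using pd_det_pos[OF A] pd_det_pos[OF A'] by (metis divide_pos_pos exp_gt_zero ln_exp ln_le_cancel_iff)
  then show ?thesis using pd_det_pos[OF A] pd_det_pos[OF A'] by (simp add: ln_div)
qed

text \<open>The log-determinant inequality with the roles exchanged, where tr(A'^(-1) A) <=
  tr(A'^(-1) A') = n.\<close>

lemma fdet_mono:
  assumes A: "pd n A" and A': "pd n A'" and le: "\<And>c. qform n A c \<le> qform n A' c"
  shows "ln (fdet n A) \<le> ln (fdet n A')"
proof -
  have "tr_prod n (finv n A') A \<le> tr_prod n (finv n A') A'"
    using tr_prod_mono[OF pd_finv_psd[OF A'], of A A'] le by (simp add: tr_prod_commute)
  then show ?thesis using ln_det_diff_le[OF A' A] tr_prod_finv[OF A'] by simp
qed

section \<open>A band-limited bump function\<close>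

text \<open>A constant of its own keeps the simplifier from opening the case distinction at 0 behind
  \<open>sinc\<close>.\<close>

definition sincf :: "real \<Rightarrow> real" where "sincf x = sinc x"

lemma sincf_measurable [measurable]: "sincf \<in> borel_measurable borel"
  unfolding sincf_def[abs_def] by measurable

text \<open>Up to normalisation the Fourier transform of a plateau function: the indicator of
  [-a, a], smoothed by m uniform windows, which equals 1 on |x| < a - m. The first factor comes from
  the indicator, and the m further ones supply the decay in \<xi>.\<close>

definition bump :: "real \<Rightarrow> nat \<Rightarrow> real \<Rightarrow> real" where
  "bump a m \<xi> = a / pi * sincf (a * \<xi>) * sincf \<xi> ^ m"

lemma abs_sinc_le_1: "\<bar>sincf x\<bar> \<le> 1"
  using abs_sin_x_le_abs_x[of x] by (auto simp: sincf_def abs_divide divide_le_eq_1)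

lemma abs_sinc_mult_le: "\<bar>sincf x\<bar> * \<bar>x\<bar> \<le> 1"
  using abs_sin_le_one[of x] by (simp add: sincf_def abs_divide)

text \<open>Both factors are at most 1 and at most 1/|x|; adding the two resulting bounds for the
  product produces the weight 1 + x^2.\<close>

lemma sinc_mult_sq_le:
  assumes "1 \<le> a" shows "\<bar>sincf (a * x) * sincf x\<bar> \<le> 2 / (1 + x\<^sup>2)"
proof -
  have 1: "\<bar>sincf (a * x)\<bar> * \<bar>x\<bar> \<le> 1"
  proof -
    have "\<bar>sincf (a * x)\<bar> * \<bar>x\<bar> \<le> \<bar>sincf (a * x)\<bar> * \<bar>a * x\<bar>"
      using assms by (intro mult_left_mono) (auto simp: abs_mult mult_le_cancel_right1)
    also have "\<dots> \<le> 1" by (rule abs_sinc_mult_le)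
    finally show ?thesis .
  qed
  have "\<bar>sincf (a * x)\<bar> * \<bar>sincf x\<bar> \<le> 1 * 1"
    by (intro mult_mono abs_sinc_le_1) auto
  moreover have "(\<bar>sincf (a * x)\<bar> * \<bar>x\<bar>) * (\<bar>sincf x\<bar> * \<bar>x\<bar>) \<le> 1 * 1"
    by (intro mult_mono abs_sinc_mult_le 1) auto
  moreover have "\<bar>sincf (a * x)\<bar> * \<bar>sincf x\<bar> * (1 + x\<^sup>2) =
      \<bar>sincf (a * x)\<bar> * \<bar>sincf x\<bar> + (\<bar>sincf (a * x)\<bar> * \<bar>x\<bar>) * (\<bar>sincf x\<bar> * \<bar>x\<bar>)"
  proof -
    have "x\<^sup>2 = \<bar>x\<bar> * \<bar>x\<bar>" by (simp add: power2_eq_square)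
    then show ?thesis by (simp only: distrib_left mult_1_right mult_ac)
  qed
  ultimately have "\<bar>sincf (a * x)\<bar> * \<bar>sincf x\<bar> * (1 + x\<^sup>2) \<le> 2" by linarith
  then show ?thesis by (simp add: abs_mult pos_le_divide_eq add_pos_nonneg)
qed

lemma integrable_inverse_1_plus_square:
  "integrable lborel (\<lambda>x::real. 1 / (1 + x\<^sup>2))"
proof -
  have "set_integrable lborel (einterval (-\<infinity>) \<infinity>) (\<lambda>x::real. inverse (1 + x\<^sup>2))"
  proof (rule interval_integral_FTC_nonneg(1)[where F=arctan and A="-pi/2" and B="pi/2"])
    show "((arctan \<circ> real_of_ereal) \<longlongrightarrow> - pi / 2) (at_right (- \<infinity>))"
      unfolding ereal_tendsto_simps using tendsto_arctan_at_bot by simp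
    show "((arctan \<circ> real_of_ereal) \<longlongrightarrow> pi / 2) (at_left \<infinity>)"
      unfolding ereal_tendsto_simps using tendsto_arctan_at_top by simp
  qed (auto intro!: DERIV_arctan continuous_intros simp: add_nonneg_eq_0_iff)
  then show ?thesis by (simp add: set_integrable_def einterval_def inverse_eq_divide)
qed

lemma abs_bump_le:
  assumes "1 \<le> a" "1 \<le> m" shows "\<bar>bump a m \<xi>\<bar> \<le> 2 * a / pi * (1 / (1 + \<xi>\<^sup>2))"
proof -
  obtain k where m: "m = Suc k" using assms(2) by (cases m) auto
  have "\<bar>bump a m \<xi>\<bar> = a / pi * \<bar>sincf (a * \<xi>) * sincf \<xi>\<bar> * \<bar>sincf \<xi>\<bar> ^ k"
    using assms(1) unfolding bump_def m by (simp add: abs_mult power_abs)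
  also have "\<dots> \<le> a / pi * (2 / (1 + \<xi>\<^sup>2)) * 1"
    using assms(1) by (intro mult_mono sinc_mult_sq_le power_le_one abs_sinc_le_1) auto
  finally show ?thesis by (simp add: mult_ac)
qed

lemma bump_measurable [measurable]: "bump a m \<in> borel_measurable borel"
  unfolding bump_def by measurable

lemma integrable_bump:
  assumes "1 \<le> a" "1 \<le> m" shows "integrable lborel (bump a m)"
proof (rule Bochner_Integration.integrable_bound)
  show "integrable lborel (\<lambda>\<xi>. 2 * a / pi * (1 / (1 + \<xi>\<^sup>2)))"
    by (intro integrable_mult_right integrable_inverse_1_plus_square)
  show "AE x in lborel. norm (bump a m x) \<le> norm (2 * a / pi * (1 / (1 + x\<^sup>2)))"
    using abs_bump_le[OF assms] assms(1) by (auto intro!: AE_I2 simp del: times_divide_eq_right)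
qed auto

lemma integrable_bump_iexp:
  assumes "1 \<le> a" "1 \<le> m"
  shows "integrable lborel (\<lambda>\<xi>. of_real (bump a m \<xi>) * iexp (\<xi> * x))"
  by (rule Bochner_Integration.integrable_bound[OF integrable_bump[OF assms]]) (auto simp: norm_mult)

lemma sinc_eq_integral:
  "complex_of_real (sincf t) = (CLBINT u. of_real (indicator {-1..1} u / 2) * iexp (t * u))"
  and sinc_integrable: "integrable lborel (\<lambda>u. complex_of_real (indicator {-1..1} u / 2) * iexp (t * u))"
proof -
  have "set_integrable lborel {-1..1} (\<lambda>u. iexp (t * u))"
    unfolding set_integrable_def
    by (rule borel_integrable_compact) (auto intro!: continuous_intros)
  then show "integrable lborel (\<lambda>u. complex_of_real (indicator {-1..1} u / 2) * iexp (t * u))"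
    unfolding set_integrable_def by (simp add: scaleR_conv_of_real)
  have "(CLBINT u. of_real (indicator {-1..1} u / 2) * iexp (t * u)) = (1 / 2) * (CLBINT u:{-1..1}. iexp (t * u))"
    unfolding set_lebesgue_integral_def by (simp add: scaleR_conv_of_real mult_ac)
  also have "(CLBINT u:{-1..1}. iexp (t * u)) = 2 * of_real (sincf t)"
  proof (cases "t = 0")
    case True
    then show ?thesis by (simp add: set_lebesgue_integral_def scaleR_conv_of_real sincf_def)
  next
    case False
    have "(CLBINT u=ereal (-1)..ereal 1. iexp (t * u)) = iexp (t * 1) / (\<i> * t) - iexp (t * (-1)) / (\<i> * t)"
    proof (rule interval_integral_FTC_finite)
      show "continuous_on {min (-1) 1..max (-1) 1} (\<lambda>u. iexp (t * u))" by (intro continuous_intros)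
      fix u :: real
      have "((\<lambda>z. exp (\<i> * (of_real t * z)) / (\<i> * t)) has_field_derivative iexp (t * u)) (at (of_real u))"
        using False by (auto intro!: derivative_eq_intros simp: mult.commute[of "exp _"])
      from has_vector_derivative_real_field[OF this]
      show "((\<lambda>u. iexp (t * u) / (\<i> * t)) has_vector_derivative iexp (t * u)) (at u within {min (-1) 1..max (-1) 1})"
        by (auto simp: o_def intro: has_vector_derivative_at_within)
    qed
    also have "\<dots> = 2 * of_real (sincf t)"
      using False by (simp add: sincf_def complex_eq_iff Re_divide Im_divide exp_minus Re_exp Im_exp field_simps power2_eq_square)
    finally show ?thesis by (subst (asm) interval_integral_Icc) auto
  qed
  finally show "complex_of_real (sincf t) = (CLBINT u. of_real (indicator {-1..1} u / 2) * iexp (t * u))" by simp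
qed


text \<open>Identifies \<open>sincf\<close> as the characteristic function of the uniform law on
  [-1, 1], which makes Levy's inversion theorem available.\<close>

lemma sincf_char:
  defines "M \<equiv> density lborel (\<lambda>u. ennreal (indicator {-1..1} u / 2))"
  shows "real_distribution M" "char M t = of_real (sincf t)" "A \<in> sets borel \<Longrightarrow> measure M A = measure lborel ({-1..1} \<inter> A) / 2"
proof -
  have em: "emeasure M A = emeasure lborel ({-1..1} \<inter> A) / 2" if "A \<in> sets borel" for A
  proof -
    have "emeasure M A = (\<integral>\<^sup>+u. (1/2) * indicator ({-1..1} \<inter> A) u \<partial>lborel)"
      unfolding M_def using that
      by (subst emeasure_density) (auto intro!: nn_integral_cong simp: indicator_def ennreal_divide_numeral[symmetric] divide_ennreal_def)
    also have "\<dots> = emeasure lborel ({-1..1} \<inter> A) / 2"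
      using that by (subst nn_integral_cmult_indicator) (auto simp: divide_ennreal_def mult.commute)
    finally show ?thesis .
  qed
  show "measure M A = measure lborel ({-1..1} \<inter> A) / 2" if "A \<in> sets borel"
  proof -
    have "emeasure lborel ({-1..1} \<inter> A) \<le> emeasure lborel {-1..1::real}"
      by (intro emeasure_mono) auto
    then have "emeasure lborel ({-1..1} \<inter> A) \<noteq> \<infinity>" by (auto simp: top_unique)
    then have "emeasure M A = ennreal (measure lborel ({-1..1} \<inter> A) / 2)"
      unfolding em[OF that] by (subst emeasure_eq_ennreal_measure) (auto simp: divide_ennreal ennreal_numeral[symmetric] simp del: ennreal_numeral)
    then show ?thesis by (simp add: measure_def)
  qed
  have "prob_space M"
    by (rule prob_spaceI) (use em[of UNIV] in \<open>auto simp: M_def\<close>)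
  then show "real_distribution M" unfolding real_distribution_def real_distribution_axioms_def by (simp add: M_def)
  show "char M t = of_real (sincf t)"
    unfolding char_def M_def sinc_eq_integral by (subst integral_density) (auto simp: scaleR_conv_of_real)
qed

text \<open>Levy inversion for the uniform law on [-1, 1] and the interval from -a - x to a - x.
  This interval contains [-1, 1] when |x| < a - 1, so its mass is 1, and the inversion integrand is
  2 pi times the bump times the exponential.\<close>

lemma bump_transform_aux:
  assumes "1 \<le> a" "\<bar>x\<bar> < a - 1"
  shows "(CLBINT \<xi>. of_real (bump a 1 \<xi>) * iexp (\<xi> * x)) = 1"
proof -
  define M where "M = density lborel (\<lambda>u. ennreal (indicator {-1..1::real} u / 2))"
  interpret real_distribution M unfolding M_def by (rule sincf_char)
  have mz: "measure M {c} = 0" for c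
  proof -
    have "emeasure lborel ({-1..1} \<inter> {c}) = 0"
      by (rule emeasure_lborel_countable) (auto intro: countable_subset[of _ "{c}"])
    then show ?thesis unfolding M_def by (subst sincf_char(3)) (auto simp: measure_def)
  qed
  let ?b = "a - x" and ?c = "- a - x"
  have "{-1..1} \<inter> {?c<..?b} = {-1..1::real}" using assms by auto
  then have m1: "measure M {?c<..?b} = 1"
    unfolding M_def by (subst sincf_char(3)) auto
  define I where "I F T = (CLBINT t. indicator {-real T..real T} t *\<^sub>R F t)" for F :: "real \<Rightarrow> complex" and T :: nat
  have I: "(CLBINT t=ereal (- real T)..ereal (real T). F t) = I F T" for F T
    unfolding I_def by (subst interval_integral_Icc) (auto simp: set_lebesgue_integral_def)
  have L: "(\<lambda>T. 1 / (2 * pi) * I (\<lambda>t. (iexp (-(t * ?c)) - iexp (-(t * ?b))) / (\<i> * t) * char M t) T) \<longlonglongrightarrow> 1"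
    using Levy_Inversion[of ?c ?b] assms mz m1 by (simp add: I[symmetric])
  let ?f = "\<lambda>\<xi>. complex_of_real (bump a 1 \<xi>) * iexp (\<xi> * x)"
  have eq: "(iexp (-(t * ?c)) - iexp (-(t * ?b))) / (\<i> * t) * char M t = (2 * pi) * ?f t" if "t \<noteq> 0" for t
  proof -
    have "iexp (-(t * ?c)) - iexp (-(t * ?b)) = iexp (t * x) * (iexp (t * a) - iexp (-(t * a)))"
      by (simp add: right_diff_distrib exp_add[symmetric]) (simp add: algebra_simps)
    also have "iexp (t * a) - iexp (-(t * a)) = 2 * \<i> * of_real (sin (t * a))"
      by (simp add: complex_eq_iff Re_exp Im_exp)
    finally show ?thesis
      using that assms(1) by (simp add: M_def sincf_char(2) bump_def sincf_def[of "a * _"] field_simps)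
  qed
  \<comment> \<open>Inversion only yields a limit of truncated integrals. The factor
    \<open>sincf \<xi>\<close> in the bump makes the integrand absolutely integrable, so dominated
    convergence identifies the limit.\<close>
  have "(\<lambda>T. I ?f T) \<longlonglongrightarrow> (CLBINT t. ?f t)"
    unfolding I_def
  proof (rule integral_dominated_convergence)
    show "integrable lborel (\<lambda>t. norm (?f t))"
      using integrable_bump_iexp[of a 1 x] assms(1) by (intro integrable_norm) auto
    show "AE t in lborel. (\<lambda>T::nat. indicator {-real T..real T} t *\<^sub>R ?f t) \<longlonglongrightarrow> ?f t"
    proof (intro AE_I2 tendsto_eventually)
      fix t :: real
      show "\<forall>\<^sub>F T::nat in sequentially. indicator {-real T..real T} t *\<^sub>R ?f t = ?f t"
        using eventually_ge_at_top[of "nat \<lceil>\<bar>t\<bar>\<rceil>"]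
        by eventually_elim (auto simp: indicator_def; linarith)
    qed
  qed (auto simp: indicator_def)
  moreover have "I ?f T = 1 / (2 * pi) * I (\<lambda>t. (iexp (-(t * ?c)) - iexp (-(t * ?b))) / (\<i> * t) * char M t) T" for T
  proof -
    have "I (\<lambda>t. (iexp (-(t * ?c)) - iexp (-(t * ?b))) / (\<i> * t) * char M t) T = I (\<lambda>t. (2 * pi) * ?f t) T"
      unfolding I_def
    proof (rule integral_cong_AE)
      show "AE t in lborel. indicator {-real T..real T} t *\<^sub>R ((iexp (-(t * ?c)) - iexp (-(t * ?b))) / (\<i> * t) * char M t)
         = indicator {-real T..real T} t *\<^sub>R ((2 * pi) * ?f t)"
        using AE_lborel_singleton[of 0] by eventually_elim (use eq in metis)
    qed (simp_all add: M_def sincf_char(2))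
    also have "\<dots> = (2 * pi) * I ?f T"
      unfolding I_def integral_mult_right_zero[symmetric] by (simp add: scaleR_conv_of_real mult_ac)
    finally show ?thesis by simp
  qed
  ultimately show ?thesis using L LIMSEQ_unique by simp
qed

text \<open>Each further factor $\mathrm{sinc}\,\xi$ averages the transform over a window of half-width 1.\<close>
lemma bump_transform:
  assumes "1 \<le> a" "1 \<le> m" "\<bar>x\<bar> < a - real m"
  shows "(CLBINT \<xi>. of_real (bump a m \<xi>) * iexp (\<xi> * x)) = 1"
  using assms(2,3)
proof (induction m arbitrary: x rule: dec_induct)
  case base then show ?case using bump_transform_aux[OF assms(1)] by simp
next
  case (step m)
  let ?F = "\<lambda>\<xi> u. of_real (bump a m \<xi>) * iexp (\<xi> * x) * (of_real (indicator {-1..1} u / 2) * iexp (\<xi> * u))"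
  have int: "integrable (lborel \<Otimes>\<^sub>M lborel) (\<lambda>(\<xi>, u). ?F \<xi> u)"
  proof (rule lborel_pair.Fubini_integrable)
    show "integrable lborel (\<lambda>\<xi>. LBINT u. norm (case (\<xi>, u) of (\<xi>, u) \<Rightarrow> ?F \<xi> u))"
    proof -
      have "(LBINT u. norm (?F \<xi> u)) = \<bar>bump a m \<xi>\<bar>" for \<xi>
        by (simp add: norm_mult)
      then show ?thesis using integrable_bump[of a m] assms(1) step(1) by simp
    qed
    show "AE \<xi> in lborel. integrable lborel (\<lambda>u. case (\<xi>, u) of (\<xi>, u) \<Rightarrow> ?F \<xi> u)"
      by (intro AE_I2) (use sinc_integrable in \<open>auto intro!: integrable_mult_right simp del: of_real_divide\<close>)
  qed (auto simp: split_beta')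
  have "(CLBINT \<xi>. of_real (bump a (Suc m) \<xi>) * iexp (\<xi> * x)) = (CLBINT \<xi>. CLBINT u. ?F \<xi> u)"
  proof (intro Bochner_Integration.integral_cong refl)
    fix \<xi>
    have "(CLBINT u. ?F \<xi> u) = of_real (bump a m \<xi>) * iexp (\<xi> * x) * of_real (sincf \<xi>)"
      unfolding sinc_eq_integral by (rule integral_mult_right_zero)
    then show "of_real (bump a (Suc m) \<xi>) * iexp (\<xi> * x) = (CLBINT u. ?F \<xi> u)"
      by (simp add: bump_def mult_ac)
  qed
  also have "\<dots> = (CLBINT u. CLBINT \<xi>. ?F \<xi> u)"
    using lborel_pair.Fubini_integral[OF int] by simp
  also have "\<dots> = (CLBINT u. of_real (indicator {-1..1::real} u / 2))"
  proof (intro Bochner_Integration.integral_cong refl)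
    fix u :: real
    have "(CLBINT \<xi>. ?F \<xi> u) = (CLBINT \<xi>. of_real (indicator {-1..1} u / 2) * (of_real (bump a m \<xi>) * iexp (\<xi> * (x + u))))"
      by (intro Bochner_Integration.integral_cong refl) (simp add: exp_add[symmetric] algebra_simps)
    also have "\<dots> = of_real (indicator {-1..1} u / 2) * (CLBINT \<xi>. of_real (bump a m \<xi>) * iexp (\<xi> * (x + u)))"
      by (rule integral_mult_right_zero)
    also have "\<dots> = of_real (indicator {-1..1::real} u / 2)"
    proof (cases "u \<in> {-1..1}")
      case True
      then have "\<bar>x + u\<bar> < a - real m" using step(4) by auto
      from step(3)[OF this] show ?thesis by simp
    qed simp
    finally show "(CLBINT \<xi>. ?F \<xi> u) = of_real (indicator {-1..1} u / 2)" .
  qed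
  also have "\<dots> = of_real (LBINT u. indicator {-1..1::real} u / 2)" by (rule integral_complex_of_real)
  finally show ?case by simp
qed

section \<open>Pointwise bounds for exponential sums\<close>

text \<open>Frequencies are functions of the coordinate index rather than vectors, so that integrals
  of products of one-dimensional factors fall under the lemmas for product measures.\<close>

definition freq :: "('d::finite \<Rightarrow> real) measure" where
  "freq = (\<Pi>\<^sub>M i\<in>UNIV. lborel)"

definition pairing :: "('d::finite \<Rightarrow> real) \<Rightarrow> real ^ 'd \<Rightarrow> real" where
  "pairing \<xi> x = (\<Sum>i\<in>UNIV. \<xi> i * x $ i)"

definition sq_norm :: "('d::finite \<Rightarrow> real) \<Rightarrow> real" where
  "sq_norm \<xi> = (\<Sum>i\<in>UNIV. (\<xi> i)\<^sup>2)"

text \<open>The Fourier transform of the signed measure with mass \<open>c j\<close> at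
  \<open>s j\<close>; the quadratic forms depend on the design through its squared modulus.\<close>

definition trig_sum :: "nat \<Rightarrow> (nat \<Rightarrow> real ^ 'd::finite) \<Rightarrow> (nat \<Rightarrow> real) \<Rightarrow> ('d \<Rightarrow> real) \<Rightarrow> complex" where
  "trig_sum n s c \<xi> = (\<Sum>j<n. of_real (c j) * iexp (pairing \<xi> (s j)))"

interpretation freq: product_sigma_finite "\<lambda>_::'d::finite. lborel :: real measure"
  by standard

lemma sigma_finite_freq: "sigma_finite_measure (freq :: ('d::finite \<Rightarrow> real) measure)"
  unfolding freq_def by (rule freq.sigma_finite) simp

lemma pairing_measurable [measurable]: "(\<lambda>\<xi>. pairing \<xi> x) \<in> borel_measurable freq"
  unfolding pairing_def freq_def by measurable

lemma sq_norm_measurable [measurable]: "sq_norm \<in> borel_measurable freq"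
  unfolding sq_norm_def freq_def by measurable

lemma trig_sum_measurable [measurable]: "trig_sum n s c \<in> borel_measurable freq"
  unfolding trig_sum_def by measurable

lemma sq_norm_nonneg: "0 \<le> sq_norm \<xi>" by (simp add: sq_norm_def sum_nonneg)

text \<open>Peetre's inequality, which moves a polynomial weight from the sum of two frequencies to
  the summands.\<close>

lemma one_plus_sq_norm_le: "1 + sq_norm (\<lambda>i. \<xi> i + \<omega> i) \<le> 2 * (1 + sq_norm \<omega>) * (1 + sq_norm \<xi>)"
proof -
  have "sq_norm (\<lambda>i. \<xi> i + \<omega> i) \<le> (\<Sum>i\<in>UNIV. 2 * (\<xi> i)\<^sup>2 + 2 * (\<omega> i)\<^sup>2)"
    unfolding sq_norm_def
  proof (rule sum_mono)
    fix i show "(\<xi> i + \<omega> i)\<^sup>2 \<le> 2 * (\<xi> i)\<^sup>2 + 2 * (\<omega> i)\<^sup>2"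
      using sum_squares_bound[of "\<xi> i" "\<omega> i"] by (simp add: power2_sum)
  qed
  also have "\<dots> = 2 * sq_norm \<xi> + 2 * sq_norm \<omega>" by (simp add: sq_norm_def sum.distrib sum_distrib_left)
  finally have "sq_norm (\<lambda>i. \<xi> i + \<omega> i) \<le> 2 * sq_norm \<xi> + 2 * sq_norm \<omega>" .
  then show ?thesis
  proof -
    have "2 * (1 + sq_norm \<omega>) * (1 + sq_norm \<xi>) = 2 + 2 * sq_norm \<omega> + 2 * sq_norm \<xi> + 2 * (sq_norm \<omega> * sq_norm \<xi>)"
      by (simp add: algebra_simps)
    moreover have "0 \<le> sq_norm \<omega> * sq_norm \<xi>" by (intro mult_nonneg_nonneg sq_norm_nonneg)
    ultimately show ?thesis using \<open>sq_norm (\<lambda>i. \<xi> i + \<omega> i) \<le> 2 * sq_norm \<xi> + 2 * sq_norm \<omega>\<close> by linarith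
  qed
qed

lemma one_plus_sum_le_prod:
  fixes f :: "'a \<Rightarrow> real"
  assumes "finite I" "\<And>i. i \<in> I \<Longrightarrow> 0 \<le> f i" shows "1 + sum f I \<le> (\<Prod>i\<in>I. 1 + f i)"
  using assms
proof (induction I rule: finite_induct)
  case (insert i I)
  have "1 + (f i + sum f I) \<le> (1 + f i) * (1 + sum f I)"
    using insert.prems by (simp add: algebra_simps sum_nonneg)
  also have "\<dots> \<le> (1 + f i) * (\<Prod>i\<in>I. 1 + f i)"
    using insert by (intro mult_left_mono) auto
  finally show ?case using insert by simp
qed auto

lemma iexp_pairing: "iexp (pairing \<xi> x) = (\<Prod>i\<in>UNIV. iexp (\<xi> i * x $ i))"
  by (simp add: pairing_def exp_sum[symmetric] sum_distrib_left)

lemma bump_transform_shift: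
  assumes "1 \<le> a" "1 \<le> m" "\<bar>x\<bar> < a - real m"
  shows "integrable lborel (\<lambda>\<xi>. of_real (bump a m (\<xi> - w)) * iexp (\<xi> * x))" (is "integrable _ ?f")
    and "(CLBINT \<xi>. of_real (bump a m (\<xi> - w)) * iexp (\<xi> * x)) = iexp (w * x)"
proof -
  have eq: "?f (w + 1 * \<xi>) = iexp (w * x) * (of_real (bump a m \<xi>) * iexp (\<xi> * x))" for \<xi>
    by (simp add: exp_add[symmetric] algebra_simps)
  show "integrable lborel ?f"
    using integrable_bump_iexp[OF assms(1,2), of x] lborel_integrable_real_affine_iff[of 1 ?f w]
    unfolding eq by simp
  show "(CLBINT \<xi>. ?f \<xi>) = iexp (w * x)"
    using bump_transform[OF assms] lborel_integral_real_affine[of 1 ?f w]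
    unfolding eq by simp
qed

text \<open>The transform of the bump shifted to \<omega> is exp(i \<omega> x) on the plateau. All
  points lie there, so integrating against the shifted bump returns the value of the exponential sum
  at \<omega>.\<close>

lemma reproduce:
  fixes s :: "nat \<Rightarrow> real ^ 'd::finite"
  assumes "1 \<le> a" "1 \<le> m" "\<And>j i. j < n \<Longrightarrow> \<bar>s j $ i\<bar> < a - real m"
  shows "integrable freq (\<lambda>\<xi>. (\<Prod>i\<in>UNIV. of_real (bump a m (\<xi> i - \<omega> i))) * trig_sum n s c \<xi>)"
    and "(LINT \<xi>|freq. (\<Prod>i\<in>UNIV. of_real (bump a m (\<xi> i - \<omega> i))) * trig_sum n s c \<xi>) = trig_sum n s c \<omega>"
proof -
  let ?g = "\<lambda>j \<xi>. \<Prod>i\<in>UNIV. (of_real (bump a m (\<xi> i - \<omega> i)) * iexp (\<xi> i * s j $ i) :: complex)"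
  have eq: "(\<Prod>i\<in>UNIV. of_real (bump a m (\<xi> i - \<omega> i))) * trig_sum n s c \<xi> = (\<Sum>j<n. of_real (c j) * ?g j \<xi>)" for \<xi>
    unfolding trig_sum_def iexp_pairing by (simp add: sum_distrib_left prod.distrib mult_ac)
  have int: "integrable freq (?g j)" if "j < n" for j
    unfolding freq_def
    by (rule freq.product_integrable_prod) (use bump_transform_shift(1)[OF assms(1,2) assms(3)[OF that]] in auto)
  have val: "(LINT \<xi>|freq. ?g j \<xi>) = iexp (pairing \<omega> (s j))" if "j < n" for j
    unfolding freq_def
    by (subst freq.product_integral_prod)
      (use bump_transform_shift[OF assms(1,2) assms(3)[OF that]] in \<open>auto simp: iexp_pairing simp del: of_real_mult\<close>)
  show "integrable freq (\<lambda>\<xi>. (\<Prod>i\<in>UNIV. of_real (bump a m (\<xi> i - \<omega> i))) * trig_sum n s c \<xi>)"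
    unfolding eq using int by (intro Bochner_Integration.integrable_sum integrable_mult_right) auto
  have "(LINT \<xi>|freq. (\<Sum>j<n. of_real (c j) * ?g j \<xi>)) = (\<Sum>j<n. LINT \<xi>|freq. of_real (c j) * ?g j \<xi>)"
    by (rule Bochner_Integration.integral_sum) (use int in \<open>auto intro!: integrable_mult_right\<close>)
  also have "\<dots> = trig_sum n s c \<omega>"
    unfolding trig_sum_def by (intro sum.cong refl) (subst integral_mult_right_zero, simp only: val lessThan_iff)
  finally show "(LINT \<xi>|freq. (\<Prod>i\<in>UNIV. of_real (bump a m (\<xi> i - \<omega> i))) * trig_sum n s c \<xi>) = trig_sum n s c \<omega>"
    unfolding eq .
qed

text \<open>The m squared factors decay like (1 + x^2)^(-m), and N <= m - 1 leaves one power of 1 +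
  x^2 for integrability after the weight is absorbed.\<close>

lemma bump_sq_weight_le:
  assumes "1 \<le> a" "N + 1 \<le> real m" "0 \<le> N"
  shows "(bump a m x)\<^sup>2 * (1 + x\<^sup>2) powr N \<le> (a / pi)\<^sup>2 * 2 ^ m * (1 / (1 + x\<^sup>2))"
proof -
  have p: "0 < 1 + x\<^sup>2" by (simp add: add_pos_nonneg)
  have "(sincf x)\<^sup>2 \<le> 2 / (1 + x\<^sup>2)"
    using sinc_mult_sq_le[of 1 x] by (simp add: power2_eq_square abs_mult)
  then have "((sincf x)\<^sup>2) ^ m \<le> (2 / (1 + x\<^sup>2)) ^ m" by (intro power_mono) auto
  moreover have "(sincf (a * x))\<^sup>2 \<le> 1" using abs_sinc_le_1[of "a * x"] by (simp add: abs_square_le_1)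
  ultimately have "(sincf (a * x))\<^sup>2 * ((sincf x)\<^sup>2) ^ m \<le> 1 * (2 / (1 + x\<^sup>2)) ^ m"
    by (intro mult_mono) auto
  moreover have "(bump a m x)\<^sup>2 = (a / pi)\<^sup>2 * ((sincf (a * x))\<^sup>2 * ((sincf x)\<^sup>2) ^ m)"
    by (simp add: bump_def power_mult_distrib power_divide power_mult[symmetric] mult.commute)
  ultimately have "(bump a m x)\<^sup>2 \<le> (a / pi)\<^sup>2 * (2 / (1 + x\<^sup>2)) ^ m"
    by (auto intro: mult_left_mono)
  then have "(bump a m x)\<^sup>2 * (1 + x\<^sup>2) powr N \<le> (a / pi)\<^sup>2 * (2 / (1 + x\<^sup>2)) ^ m * (1 + x\<^sup>2) powr (real m - 1)"
    using p assms by (intro mult_mono powr_mono) auto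
  also have "\<dots> = (a / pi)\<^sup>2 * 2 ^ m * (1 / (1 + x\<^sup>2))"
  proof -
    have "(1 + x\<^sup>2) powr (real m - 1) = (1 + x\<^sup>2) ^ m / (1 + x\<^sup>2)" using p by (simp add: powr_diff powr_realpow)
    then show ?thesis using p by (simp add: power_divide)
  qed
  finally show ?thesis .
qed

text \<open>The growth in \<omega> comes from the shift alone: \<open>one_plus_sq_norm_le\<close>
  splits off the weight at \<omega>, and what remains is a product of integrals that do not depend
  on \<omega>.\<close>

lemma bump_weighted_norm:
  fixes N a :: real
  assumes "1 \<le> a" "N + 1 \<le> real m" "0 \<le> N"
  shows "\<exists>C>0. \<forall>\<omega> :: 'd::finite \<Rightarrow> real.
    (\<integral>\<^sup>+ \<xi>. ennreal ((\<Prod>i\<in>UNIV. (bump a m (\<xi> i - \<omega> i))\<^sup>2) * (1 + sq_norm \<xi>) powr N) \<partial>freq) \<le> ennreal (C * (1 + sq_norm \<omega>) powr N)"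
proof -
  let ?h = "\<lambda>x::real. (a / pi)\<^sup>2 * 2 ^ m * (1 / (1 + x\<^sup>2))"
  define I where "I = (LBINT x. ?h x)"
  have hint: "integrable lborel ?h" by (intro integrable_mult_right integrable_inverse_1_plus_square)
  have h0: "0 \<le> ?h x" for x by (simp add: add_pos_nonneg)
  have I0: "0 \<le> I" unfolding I_def by (intro integral_nonneg_AE AE_I2 h0)
  have nnI: "(\<integral>\<^sup>+ x. ennreal (?h (x - w)) \<partial>lborel) = ennreal I" for w
  proof -
    have "(\<integral>\<^sup>+ x. ennreal (?h x) \<partial>lborel) = ennreal I"
      unfolding I_def by (rule nn_integral_eq_integral[OF hint]) (intro AE_I2 h0)
    then show ?thesis
      using nn_integral_real_affine[of "\<lambda>x. ennreal (?h (x - w))" 1 w] by simp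
  qed
  let ?C = "2 powr N * (I ^ CARD('d) + 1)"
  show ?thesis
  proof (intro exI[of _ ?C] conjI allI)
    show "0 < ?C" using I0 by (intro mult_pos_pos add_nonneg_pos) auto
    fix \<omega> :: "'d \<Rightarrow> real"
    have pt: "(\<Prod>i\<in>UNIV. (bump a m (\<xi> i - \<omega> i))\<^sup>2) * (1 + sq_norm \<xi>) powr N
       \<le> 2 powr N * (1 + sq_norm \<omega>) powr N * (\<Prod>i\<in>UNIV. ?h (\<xi> i - \<omega> i))" for \<xi> :: "'d \<Rightarrow> real"
    proof -
      let ?\<eta> = "\<lambda>i. \<xi> i - \<omega> i"
      have "1 + sq_norm \<xi> \<le> 2 * (1 + sq_norm \<omega>) * (1 + sq_norm ?\<eta>)"
        using one_plus_sq_norm_le[of ?\<eta> \<omega>] by simp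
      also have "\<dots> \<le> 2 * (1 + sq_norm \<omega>) * (\<Prod>i\<in>UNIV. 1 + (?\<eta> i)\<^sup>2)"
        unfolding sq_norm_def[of ?\<eta>]
        by (intro mult_left_mono one_plus_sum_le_prod) (auto simp: sq_norm_nonneg add_nonneg_nonneg)
      finally have "(1 + sq_norm \<xi>) powr N \<le> (2 * (1 + sq_norm \<omega>) * (\<Prod>i\<in>UNIV. 1 + (?\<eta> i)\<^sup>2)) powr N"
        using assms(3) by (intro powr_mono2) (auto simp: sq_norm_nonneg add_nonneg_nonneg)
      also have "\<dots> = 2 powr N * (1 + sq_norm \<omega>) powr N * (\<Prod>i\<in>UNIV. (1 + (?\<eta> i)\<^sup>2) powr N)"
        by (simp add: powr_mult prod_powr_distrib sq_norm_nonneg prod_nonneg add_nonneg_nonneg del: distrib_left_numeral)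
      finally have "(\<Prod>i\<in>UNIV. (bump a m (?\<eta> i))\<^sup>2) * (1 + sq_norm \<xi>) powr N \<le>
        (\<Prod>i\<in>UNIV. (bump a m (?\<eta> i))\<^sup>2) * (2 powr N * (1 + sq_norm \<omega>) powr N * (\<Prod>i\<in>UNIV. (1 + (?\<eta> i)\<^sup>2) powr N))"
        by (intro mult_left_mono prod_nonneg) auto
      also have "\<dots> = 2 powr N * (1 + sq_norm \<omega>) powr N * (\<Prod>i\<in>UNIV. (bump a m (?\<eta> i))\<^sup>2 * (1 + (?\<eta> i)\<^sup>2) powr N)"
        by (simp add: prod.distrib mult_ac)
      also have "\<dots> \<le> 2 powr N * (1 + sq_norm \<omega>) powr N * (\<Prod>i\<in>UNIV. ?h (?\<eta> i))"
        by (intro mult_left_mono prod_mono conjI bump_sq_weight_le assms) auto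
      finally show ?thesis .
    qed
    have "(\<integral>\<^sup>+ \<xi>. ennreal ((\<Prod>i\<in>UNIV. (bump a m (\<xi> i - \<omega> i))\<^sup>2) * (1 + sq_norm \<xi>) powr N) \<partial>freq)
      \<le> (\<integral>\<^sup>+ \<xi>. ennreal (2 powr N * (1 + sq_norm \<omega>) powr N) * (\<Prod>i\<in>UNIV. ennreal (?h (\<xi> i - \<omega> i))) \<partial>freq)"
      by (intro nn_integral_mono) (use pt h0 in \<open>auto simp: prod_ennreal ennreal_mult[symmetric] prod_nonneg simp del: times_divide_eq_right intro!: ennreal_leI\<close>)
    also have "\<dots> = ennreal (2 powr N * (1 + sq_norm \<omega>) powr N) * (\<integral>\<^sup>+ \<xi>. (\<Prod>i\<in>UNIV. ennreal (?h (\<xi> i - \<omega> i))) \<partial>freq)"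
      unfolding freq_def by (rule nn_integral_cmult) measurable
    also have "(\<integral>\<^sup>+ \<xi>. (\<Prod>i\<in>UNIV. ennreal (?h (\<xi> i - \<omega> i))) \<partial>freq) = ennreal (I ^ CARD('d))"
      unfolding freq_def by (subst freq.product_nn_integral_prod) (use I0 in \<open>auto simp: nnI ennreal_power simp del: times_divide_eq_right\<close>)
    also have "ennreal (2 powr N * (1 + sq_norm \<omega>) powr N) * ennreal (I ^ CARD('d)) = ennreal (2 powr N * (1 + sq_norm \<omega>) powr N * I ^ CARD('d))"
      using I0 by (simp add: ennreal_mult)
    also have "\<dots> \<le> ennreal (?C * (1 + sq_norm \<omega>) powr N)"
      by (intro ennreal_leI) (simp add: algebra_simps)
    finally show "(\<integral>\<^sup>+ \<xi>. ennreal ((\<Prod>i\<in>UNIV. (bump a m (\<xi> i - \<omega> i))\<^sup>2) * (1 + sq_norm \<xi>) powr N) \<partial>freq) \<le> ennreal (?C * (1 + sq_norm \<omega>) powr N)" .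
  qed
qed

text \<open>Point evaluation of a function of exponential type $T$, bounded by a weighted $L^2$ norm; the constant depends neither on the number nor on the position of the points.\<close>
lemma trig_sum_pointwise_le:
  fixes N T :: real
  assumes "0 \<le> N" "0 \<le> T"
  shows "\<exists>C>0. \<forall>n (s :: nat \<Rightarrow> real ^ 'd::finite) c \<omega>. (\<forall>j<n. \<forall>i. \<bar>s j $ i\<bar> \<le> T) \<longrightarrow>
    ennreal ((norm (trig_sum n s c \<omega>))\<^sup>2) \<le> ennreal (C * (1 + sq_norm \<omega>) powr N) * (\<integral>\<^sup>+ \<xi>. ennreal ((norm (trig_sum n s c \<xi>))\<^sup>2 * (1 + sq_norm \<xi>) powr (- N)) \<partial>freq)"
proof -
  \<comment> \<open>m exceeds N by at least 1, as the decay of the bump requires, and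
    \<open>a\<close> leaves the plateau |x| < T + 1, which contains every coordinate of the
    points.\<close>
  define m where "m = nat \<lceil>N\<rceil> + 1"
  define a where "a = T + real m + 1"
  have am: "1 \<le> a" "1 \<le> m" "N + 1 \<le> real m" using assms by (auto simp: a_def m_def) 
  from bump_weighted_norm[OF am(1,3) assms(1)]
  obtain C where C: "0 < C" and Cb: "\<And>\<omega> :: 'd \<Rightarrow> real. (\<integral>\<^sup>+ \<xi>. ennreal ((\<Prod>i\<in>UNIV. (bump a m (\<xi> i - \<omega> i))\<^sup>2) * (1 + sq_norm \<xi>) powr N) \<partial>freq) \<le> ennreal (C * (1 + sq_norm \<omega>) powr N)"
    by blast
  show ?thesis
  proof (intro exI[of _ C] conjI C allI impI)
    fix n and s :: "nat \<Rightarrow> real ^ 'd" and c and \<omega> :: "'d \<Rightarrow> real"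
    assume s: "\<forall>j<n. \<forall>i. \<bar>s j $ i\<bar> \<le> T"
    have s': "\<bar>s j $ i\<bar> < a - real m" if "j < n" for j i
    proof -
      have "\<bar>s j $ i\<bar> \<le> T" using s that by blast
      then show ?thesis by (simp add: a_def)
    qed
    let ?B = "\<lambda>\<xi>. \<Prod>i\<in>UNIV. bump a m (\<xi> i - \<omega> i)"
    have [measurable]: "?B \<in> borel_measurable freq" unfolding freq_def by measurable
    have "ennreal (norm (trig_sum n s c \<omega>)) = ennreal (norm (LINT \<xi>|freq. of_real (?B \<xi>) * trig_sum n s c \<xi>))"
      using reproduce(2)[OF am(1,2) s', where \<omega>=\<omega> and c=c] by simp
    also have "\<dots> \<le> (\<integral>\<^sup>+ \<xi>. norm (of_real (?B \<xi>) * trig_sum n s c \<xi>) \<partial>freq)"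
      using reproduce(1)[OF am(1,2) s', where \<omega>=\<omega> and c=c] by (intro integral_norm_bound_ennreal) simp
    \<comment> \<open>The weight (1 + |\<xi>|^2)^(N/2) is inserted together with its inverse, so
      that Cauchy-Schwarz separates a norm of the bump from the norm of the exponential sum that the
      Matern spectral density controls.\<close>
    also have "\<dots> = (\<integral>\<^sup>+ \<xi>. ennreal (\<bar>?B \<xi>\<bar> * (1 + sq_norm \<xi>) powr (N / 2)) * ennreal (norm (trig_sum n s c \<xi>) * (1 + sq_norm \<xi>) powr (- N / 2)) \<partial>freq)"
    proof (intro nn_integral_cong)
      fix \<xi> :: "'d \<Rightarrow> real"
      have "(1 + sq_norm \<xi>) powr (N / 2) * (1 + sq_norm \<xi>) powr (- N / 2) = 1"
        using sq_norm_nonneg[of \<xi>] by (simp add: powr_add[symmetric])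
      moreover have "\<bar>?B \<xi>\<bar> * (1 + sq_norm \<xi>) powr (N / 2) * (norm (trig_sum n s c \<xi>) * (1 + sq_norm \<xi>) powr (- N / 2)) =
          \<bar>?B \<xi>\<bar> * norm (trig_sum n s c \<xi>) * ((1 + sq_norm \<xi>) powr (N / 2) * (1 + sq_norm \<xi>) powr (- N / 2))"
        by (simp only: mult_ac)
      ultimately have "\<bar>?B \<xi>\<bar> * norm (trig_sum n s c \<xi>) = \<bar>?B \<xi>\<bar> * (1 + sq_norm \<xi>) powr (N / 2) * (norm (trig_sum n s c \<xi>) * (1 + sq_norm \<xi>) powr (- N / 2))"
        by simp
      then have "norm (of_real (?B \<xi>) * trig_sum n s c \<xi>) = \<bar>?B \<xi>\<bar> * (1 + sq_norm \<xi>) powr (N / 2) * (norm (trig_sum n s c \<xi>) * (1 + sq_norm \<xi>) powr (- N / 2))"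
        by (simp only: norm_mult norm_of_real)
      then show "ennreal (norm (of_real (?B \<xi>) * trig_sum n s c \<xi>)) =
          ennreal (\<bar>?B \<xi>\<bar> * (1 + sq_norm \<xi>) powr (N / 2)) * ennreal (norm (trig_sum n s c \<xi>) * (1 + sq_norm \<xi>) powr (- N / 2))"
        by (simp add: ennreal_mult)
    qed
    finally have "(ennreal (norm (trig_sum n s c \<omega>)))\<^sup>2 \<le> \<dots>\<^sup>2" by (rule power_mono) simp
    also have "\<dots> \<le> (\<integral>\<^sup>+ \<xi>. (ennreal (\<bar>?B \<xi>\<bar> * (1 + sq_norm \<xi>) powr (N / 2)))\<^sup>2 \<partial>freq) *
        (\<integral>\<^sup>+ \<xi>. (ennreal (norm (trig_sum n s c \<xi>) * (1 + sq_norm \<xi>) powr (- N / 2)))\<^sup>2 \<partial>freq)"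
      by (rule Cauchy_Schwarz_nn_integral) measurable
    also have "(\<integral>\<^sup>+ \<xi>. (ennreal (\<bar>?B \<xi>\<bar> * (1 + sq_norm \<xi>) powr (N / 2)))\<^sup>2 \<partial>freq) =
        (\<integral>\<^sup>+ \<xi>. ennreal ((\<Prod>i\<in>UNIV. (bump a m (\<xi> i - \<omega> i))\<^sup>2) * (1 + sq_norm \<xi>) powr N) \<partial>freq)"
      by (intro nn_integral_cong) (simp add: ennreal_power power_mult_distrib prod_power_distrib power2_eq_square[of "_ powr _"] powr_add[symmetric])
    also have "\<dots> \<le> ennreal (C * (1 + sq_norm \<omega>) powr N)" by (rule Cb)
    also have "(\<integral>\<^sup>+ \<xi>. (ennreal (norm (trig_sum n s c \<xi>) * (1 + sq_norm \<xi>) powr (- N / 2)))\<^sup>2 \<partial>freq) =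
        (\<integral>\<^sup>+ \<xi>. ennreal ((norm (trig_sum n s c \<xi>))\<^sup>2 * (1 + sq_norm \<xi>) powr (- N)) \<partial>freq)"
      by (intro nn_integral_cong) (simp add: ennreal_power power_mult_distrib power2_eq_square[of "_ powr _"] powr_add[symmetric])
    finally show "ennreal ((norm (trig_sum n s c \<omega>))\<^sup>2) \<le> ennreal (C * (1 + sq_norm \<omega>) powr N) * (\<integral>\<^sup>+ \<xi>. ennreal ((norm (trig_sum n s c \<xi>))\<^sup>2 * (1 + sq_norm \<xi>) powr (- N)) \<partial>freq)"
      by (simp add: ennreal_power mult_right_mono)
  qed
qed

section \<open>The Matern kernel as a Gaussian mixture\<close>

lemma nn_integral_gamma:
  fixes s b :: real assumes "0 < s" "0 < b"
  shows "(\<integral>\<^sup>+ t\<in>{0<..}. ennreal (t powr (s - 1) * exp (- b * t)) \<partial>lborel) = ennreal (Gamma s / b powr s)"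
proof -
  let ?f = "\<lambda>t. ennreal (indicator {0..} t * t powr (s - 1) / exp t)"
  have "ennreal (Gamma s) = (\<integral>\<^sup>+ t. ?f t \<partial>lborel)" by (rule Gamma_conv_nn_integral_real[OF assms(1)])
  also have "\<dots> = ennreal b * (\<integral>\<^sup>+ t. ?f (0 + b * t) \<partial>lborel)"
    using assms(2) by (subst nn_integral_real_affine[of _ b 0]) auto
  also have "(\<integral>\<^sup>+ t. ?f (0 + b * t) \<partial>lborel) = (\<integral>\<^sup>+ t. ennreal (b powr (s - 1)) * (ennreal (t powr (s - 1) * exp (- b * t)) * indicator {0<..} t) \<partial>lborel)"
  proof (intro nn_integral_cong_AE)
    show "AE t in lborel. ?f (0 + b * t) = ennreal (b powr (s - 1)) * (ennreal (t powr (s - 1) * exp (- b * t)) * indicator {0<..} t)"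
      using AE_lborel_singleton[of 0]
    proof eventually_elim
      case (elim t)
      then show ?case using assms
        by (cases "0 < t") (auto simp: powr_mult ennreal_mult[symmetric] exp_minus field_simps zero_le_mult_iff indicator_def)
    qed
  qed
  also have "\<dots> = ennreal (b powr (s - 1)) * (\<integral>\<^sup>+ t\<in>{0<..}. ennreal (t powr (s - 1) * exp (- b * t)) \<partial>lborel)"
    by (rule nn_integral_cmult) measurable
  finally have e: "ennreal (Gamma s) = ennreal (b powr s) * (\<integral>\<^sup>+ t\<in>{0<..}. ennreal (t powr (s - 1) * exp (- b * t)) \<partial>lborel)"
    using assms(2) by (simp add: mult.assoc[symmetric] ennreal_mult[symmetric] powr_diff)
  have "ennreal (1 / b powr s) * ennreal (Gamma s) = (ennreal (1 / b powr s) * ennreal (b powr s)) * (\<integral>\<^sup>+ t\<in>{0<..}. ennreal (t powr (s - 1) * exp (- b * t)) \<partial>lborel)"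
    unfolding e by (simp only: mult.assoc)
  also have "ennreal (1 / b powr s) * ennreal (b powr s) = 1"
    using assms(2) by (simp add: ennreal_mult[symmetric])
  finally show ?thesis using Gamma_real_pos[OF assms(1)] by (simp add: ennreal_mult[symmetric])
qed

lemma integrable_gamma:
  fixes s b :: real assumes "0 < s" "0 < b"
  shows "set_integrable lborel {0<..} (\<lambda>t. t powr (s - 1) * exp (- b * t))"
  unfolding set_integrable_def
proof (rule integrableI_nonneg)
  have "(\<integral>\<^sup>+ t. ennreal (indicator {0<..} t *\<^sub>R (t powr (s - 1) * exp (- b * t))) \<partial>lborel) = 
      (\<integral>\<^sup>+ t\<in>{0<..}. ennreal (t powr (s - 1) * exp (- b * t)) \<partial>lborel)"
    by (intro nn_integral_cong) (auto simp: indicator_def)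
  then show "(\<integral>\<^sup>+ t. ennreal (indicator {0<..} t *\<^sub>R (t powr (s - 1) * exp (- b * t))) \<partial>lborel) < \<infinity>"
    using nn_integral_gamma[OF assms] by simp
qed auto

lemma integral_gamma:
  fixes s b :: real assumes "0 < s" "0 < b"
  shows "(LBINT t:{0<..}. t powr (s - 1) * exp (- b * t)) = Gamma s / b powr s"
proof -
  have "ennreal (LBINT t:{0<..}. t powr (s - 1) * exp (- b * t)) = 
    (\<integral>\<^sup>+ t. ennreal (indicator {0<..} t *\<^sub>R (t powr (s - 1) * exp (- b * t))) \<partial>lborel)"
    using integrable_gamma[OF assms] unfolding set_integrable_def set_lebesgue_integral_def
    by (intro nn_integral_eq_integral[symmetric]) auto
  also have "\<dots> = (\<integral>\<^sup>+ t\<in>{0<..}. ennreal (t powr (s - 1) * exp (- b * t)) \<partial>lborel)"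
    by (intro nn_integral_cong) (auto simp: indicator_def)
  finally have "ennreal (LBINT t:{0<..}. t powr (s - 1) * exp (- b * t)) = ennreal (Gamma s / b powr s)"
    using nn_integral_gamma[OF assms] by simp
  moreover have "0 \<le> (LBINT t:{0<..}. t powr (s - 1) * exp (- b * t))"
    unfolding set_lebesgue_integral_def by (intro integral_nonneg_AE AE_I2) auto
  ultimately show ?thesis using Gamma_real_pos[OF assms(1)] by (simp add: ennreal_inj)
qed

definition gauss_kernel :: "real \<Rightarrow> 'a::real_normed_vector \<Rightarrow> real" where
  "gauss_kernel t x = exp (- (norm x)\<^sup>2 / (4 * t))"

text \<open>The density of a Gamma law with shape \<nu> and rate \<alpha>^2, up to the factor
  \<alpha>^(2 \<nu>). Without that factor \<alpha> enters through the exponential alone, hence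
  monotonically.\<close>

definition mix_weight :: "real \<Rightarrow> real \<Rightarrow> real \<Rightarrow> real" where
  "mix_weight \<nu> \<alpha> t = t powr (\<nu> - 1) * exp (- \<alpha>\<^sup>2 * t) / Gamma \<nu>"

text \<open>The Matern covariance divided by $\alpha^{2\nu}$, as a scale mixture of Gaussian kernels.\<close>
definition kern :: "real \<Rightarrow> real \<Rightarrow> 'a::real_normed_vector \<Rightarrow> real" where
  "kern \<nu> \<alpha> x = (LBINT t:{0<..}. mix_weight \<nu> \<alpha> t * gauss_kernel t x)"

lemma gauss_kernel_nonneg: "0 \<le> gauss_kernel t x" by (simp add: gauss_kernel_def)

lemma gauss_kernel_le_1: "0 < t \<Longrightarrow> gauss_kernel t x \<le> 1" by (simp add: gauss_kernel_def)

lemma gauss_kernel_measurable [measurable]: "(\<lambda>t. gauss_kernel t x) \<in> borel_measurable borel"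
  unfolding gauss_kernel_def by measurable

lemma mix_weight_measurable [measurable]: "mix_weight \<nu> \<alpha> \<in> borel_measurable borel"
  unfolding mix_weight_def[abs_def] by measurable

lemma mix_weight_nonneg: "0 < \<nu> \<Longrightarrow> 0 \<le> mix_weight \<nu> \<alpha> t"
  using Gamma_real_pos[of \<nu>] by (simp add: mix_weight_def)

lemma integrable_mix_weight:
  assumes "0 < \<nu>" "0 < \<alpha>" shows "set_integrable lborel {0<..} (mix_weight \<nu> \<alpha>)"
  using integrable_gamma[OF assms(1), of "\<alpha>\<^sup>2"] assms(2) unfolding mix_weight_def
  by (simp add: set_integrable_def)

lemma integral_mix_weight:
  assumes "0 < \<nu>" "0 < \<alpha>" shows "(LBINT t:{0<..}. mix_weight \<nu> \<alpha> t) = \<alpha> powr (- 2 * \<nu>)"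
proof -
  have "(LBINT t:{0<..}. mix_weight \<nu> \<alpha> t) = (LBINT t:{0<..}. t powr (\<nu> - 1) * exp (- \<alpha>\<^sup>2 * t)) / Gamma \<nu>"
    unfolding mix_weight_def by simp
  also have "\<dots> = 1 / (\<alpha>\<^sup>2) powr \<nu>"
    using assms Gamma_real_pos[OF assms(1)] by (subst integral_gamma) (auto simp: less_imp_neq[THEN not_sym])
  also have "\<dots> = \<alpha> powr (- 2 * \<nu>)"
    using assms by (simp add: powr_powr[symmetric] powr_minus_divide)
  finally show ?thesis .
qed

lemma integrable_mix_weight_gauss_kernel:
  assumes "0 < \<nu>" "0 < \<alpha>" shows "set_integrable lborel {0<..} (\<lambda>t. mix_weight \<nu> \<alpha> t * gauss_kernel t x)"
  unfolding set_integrable_def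
proof (rule Bochner_Integration.integrable_bound)
  show "integrable lborel (\<lambda>t. indicator {0<..} t *\<^sub>R mix_weight \<nu> \<alpha> t)"
    using integrable_mix_weight[OF assms] by (simp add: set_integrable_def)
  show "AE t in lborel. norm (indicator {0<..} t *\<^sub>R (mix_weight \<nu> \<alpha> t * gauss_kernel t x)) \<le> norm (indicator {0<..} t *\<^sub>R mix_weight \<nu> \<alpha> t)"
    using mix_weight_nonneg[OF assms(1)] gauss_kernel_le_1
    by (intro AE_I2) (auto simp: indicator_def abs_mult gauss_kernel_nonneg intro!: mult_right_le_one_le)
qed auto

lemma kern_0: assumes "0 < \<nu>" "0 < \<alpha>" shows "kern \<nu> \<alpha> 0 = \<alpha> powr (- 2 * \<nu>)"
  unfolding kern_def using integral_mix_weight[OF assms] by (simp add: gauss_kernel_def)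

text \<open>The substitution u = k e^t turns \<alpha>^2 u + r^2/(4u) into \<alpha> r cosh t and du/u
  into dt. Folding the real line at t = 0 then combines e^(\<nu> t) and e^(-\<nu> t) into 2
  cosh(\<nu> t).\<close>

lemma bessel_K_mixture:
  assumes \<nu>: "0 < \<nu>" and \<alpha>: "0 < \<alpha>" and r: "0 < r"
  shows "(LBINT u:{0<..}. u powr (\<nu> - 1) * exp (- \<alpha>\<^sup>2 * u) * exp (- r\<^sup>2 / (4 * u))) = 2 * (r / (2 * \<alpha>)) powr \<nu> * bessel_K \<nu> (\<alpha> * r)"
proof -
  \<comment> \<open>The value of u at which \<alpha>^2 u and r^2/(4u) coincide, so that t = 0 is the
    centre of symmetry of the exponent.\<close>
  define k where "k = r / (2 * \<alpha>)"
  have k: "0 < k" and rk: "r = 2 * \<alpha> * k" using assms by (auto simp: k_def)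
  define h where "h t = k powr \<nu> * (exp (\<nu> * t) * exp (- (\<alpha> * r) * cosh t))" for t :: real
  define f where "f u = u powr (\<nu> - 1) * exp (- \<alpha>\<^sup>2 * u) * exp (- r\<^sup>2 / (4 * u))" for u :: real
  have hc: "continuous_on UNIV h"
    unfolding h_def[abs_def] by (intro continuous_intros)
  then have hm [measurable]: "h \<in> borel_measurable borel"
    by (intro borel_measurable_continuous_onI)
  have fi: "set_integrable lborel {0<..} f"
    unfolding set_integrable_def
  proof (rule Bochner_Integration.integrable_bound)
    show "integrable lborel (\<lambda>u. indicator {0<..} u *\<^sub>R (u powr (\<nu> - 1) * exp (- \<alpha>\<^sup>2 * u)))"
      using integrable_gamma[OF \<nu>, of "\<alpha>\<^sup>2"] \<alpha> by (simp add: set_integrable_def)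
    show "AE u in lborel. norm (indicator {0<..} u *\<^sub>R f u) \<le> norm (indicator {0<..} u *\<^sub>R (u powr (\<nu> - 1) * exp (- \<alpha>\<^sup>2 * u)))"
      by (intro AE_I2) (auto simp: indicator_def f_def abs_mult intro!: mult_right_le_one_le)
  qed (simp add: f_def)
  have hg: "h (ln u - ln k) * (1 / u) = f u" if u: "0 < u" for u
  proof -
    have "exp (\<nu> * (ln u - ln k)) = u powr \<nu> / k powr \<nu>"
      using u k by (simp add: powr_def exp_diff[symmetric] right_diff_distrib)
    then have 1: "k powr \<nu> * exp (\<nu> * (ln u - ln k)) = u powr \<nu>" using k by simp
    have "cosh (ln u - ln k) = (u / k + k / u) / 2"
      using u k by (simp add: cosh_def exp_diff exp_minus)
    then have "\<alpha> * r * cosh (ln u - ln k) = \<alpha>\<^sup>2 * u + r\<^sup>2 / (4 * u)"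
      unfolding rk using \<alpha> k u by (simp add: field_simps power2_eq_square)
    then have 2: "exp (- (\<alpha> * r) * cosh (ln u - ln k)) = exp (- \<alpha>\<^sup>2 * u) * exp (- r\<^sup>2 / (4 * u))"
      by (simp add: exp_add[symmetric])
    have "h (ln u - ln k) = (k powr \<nu> * exp (\<nu> * (ln u - ln k))) * exp (- (\<alpha> * r) * cosh (ln u - ln k))"
      by (simp only: h_def mult.assoc)
    also have "\<dots> = u powr \<nu> * (exp (- \<alpha>\<^sup>2 * u) * exp (- r\<^sup>2 / (4 * u)))" by (simp only: 1 2)
    finally show ?thesis using u by (simp add: f_def powr_diff)
  qed
  have e0: "einterval 0 \<infinity> = {0<..}" by (auto simp: einterval_def)
  have eU: "einterval (-\<infinity>) \<infinity> = UNIV" by (auto simp: einterval_def)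
  have c1: "((ereal \<circ> (\<lambda>u. ln u - ln k) \<circ> real_of_ereal) \<longlongrightarrow> -\<infinity>) (at_right 0)"
  proof -
    have "filterlim (\<lambda>u. ln k + - ln u) at_top (at_right 0)"
      by (rule filterlim_tendsto_add_at_top[OF tendsto_const]) (use ln_at_0 in \<open>simp add: filterlim_uminus_at_top\<close>)
    then have "filterlim (\<lambda>u. ln u - ln k) at_bot (at_right 0)"
      by (subst filterlim_uminus_at_bot) simp
    then show ?thesis unfolding zero_ereal_def ereal_tendsto_simps
      by (simp add: ereal_tendsto_simps o_def)
  qed
  have c2: "((ereal \<circ> (\<lambda>u. ln u - ln k) \<circ> real_of_ereal) \<longlongrightarrow> \<infinity>) (at_left \<infinity>)"
  proof -
    have "filterlim (\<lambda>u. - ln k + ln u) at_top at_top"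
      by (rule filterlim_tendsto_add_at_top[OF tendsto_const ln_at_top])
    then have "filterlim (\<lambda>u. ln u - ln k) at_top at_top" by simp
    then show ?thesis unfolding ereal_tendsto_simps by (simp add: ereal_tendsto_simps o_def)
  qed
  have c3: "set_integrable lborel (einterval 0 \<infinity>) (\<lambda>x. h (ln x - ln k) * (1 / x))"
  proof -
    have "(\<lambda>x. indicator {0<..} x *\<^sub>R (h (ln x - ln k) * (1 / x))) = (\<lambda>x. indicator {0<..} x *\<^sub>R f x)"
    proof
      fix x :: real
      show "indicator {0<..} x *\<^sub>R (h (ln x - ln k) * (1 / x)) = indicator {0<..} x *\<^sub>R f x"
        using hg[of x] by (cases "0 < x") (auto simp: indicator_def)
    qed
    then show ?thesis using fi unfolding e0 set_integrable_def by simp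
  qed
  \<comment> \<open>The substitution is applied in the direction t = ln u - ln k, so that the
    integrability of \<open>h\<close> is obtained from that of \<open>f\<close>.\<close>
  have sub: "set_integrable lborel (einterval (-\<infinity>) \<infinity>) h"
    "(LBINT x=-\<infinity>..\<infinity>. h x) = (LBINT x=0..\<infinity>. h (ln x - ln k) * (1 / x))"
  proof -
    have D: "DERIV (\<lambda>u. ln u - ln k) x :> 1 / x" if "0 < ereal x" for x
      using that by (auto intro!: derivative_eq_intros)
    have Cg: "isCont (\<lambda>x::real. 1 / x) x" if "0 < ereal x" for x
      using that by (auto intro!: continuous_intros)
    have Ch: "isCont h x" for x using hc by (simp add: continuous_on_eq_continuous_at)
    have h0: "0 \<le> h x" for x by (simp add: h_def)
    have g0: "0 \<le> 1 / x" if "0 \<le> ereal x" for x using that by simp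
    show "set_integrable lborel (einterval (-\<infinity>) \<infinity>) h"
      by (rule interval_integral_substitution_nonneg(1)[OF _ D Ch Cg h0 g0 c1 c2 c3]) auto
    show "(LBINT x=-\<infinity>..\<infinity>. h x) = (LBINT x=0..\<infinity>. h (ln x - ln k) * (1 / x))"
      by (rule interval_integral_substitution_nonneg(2)[OF _ D Ch Cg h0 g0 c1 c2 c3]) auto
  qed
  have hi: "integrable lborel h" using sub(1) unfolding eU by (simp add: set_integrable_def)
  have "(LBINT u:{0<..}. f u) = (LBINT x=0..\<infinity>. h (ln x - ln k) * (1 / x))"
  proof -
    have "(LBINT x=0..\<infinity>. h (ln x - ln k) * (1 / x)) = (LBINT x:{0<..}. h (ln x - ln k) * (1 / x))"
      unfolding interval_lebesgue_integral_def e0 by simp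
    also have "\<dots> = (LBINT u:{0<..}. f u)"
      by (rule set_lebesgue_integral_cong) (use hg in auto)
    finally show ?thesis by simp
  qed
  also have "\<dots> = (LBINT x. h x)"
    using sub(2) unfolding interval_lebesgue_integral_def[of _ "-\<infinity>"] eU set_lebesgue_integral_def by simp
  also have "\<dots> = (LBINT x. indicator {0<..} x * h x + indicator {..<0} x * h x)"
    by (rule integral_cong_AE) (use AE_lborel_singleton[of 0] in \<open>auto simp: indicator_def elim!: eventually_mono\<close>)
  also have "\<dots> = (LBINT x. indicator {0<..} x * h x) + (LBINT x. indicator {..<0} x * h x)"
    by (rule Bochner_Integration.integral_add) (use integrable_mult_indicator[OF _ hi] in auto)
  also have "(LBINT x. indicator {..<0} x * h x) = (LBINT x. indicator {0<..} x * h (- x))"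
    by (subst lborel_integral_real_affine[of "-1" _ 0]) (auto simp: indicator_def intro!: Bochner_Integration.integral_cong)
  also have "(LBINT x. indicator {0<..} x * h x) + (LBINT x. indicator {0<..} x * h (- x)) = (LBINT x. indicator {0<..} x * h x + indicator {0<..} x * h (- x))"
  proof (rule Bochner_Integration.integral_add[symmetric])
    have "integrable lborel (\<lambda>x. h (0 + (-1) * x))" by (rule lborel_integrable_real_affine[OF hi]) simp
    then show "integrable lborel (\<lambda>x. indicator {0<..} x * h (- x))"
      using integrable_mult_indicator[of "{0<..}" lborel "\<lambda>x. h (- x)"] by simp
  qed (use integrable_mult_indicator[OF _ hi] in auto)
  also have "\<dots> = (LBINT x. (2 * k powr \<nu>) * (indicator {0<..} x * (exp (- (\<alpha> * r) * cosh x) * cosh (\<nu> * x))))"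
  proof (intro Bochner_Integration.integral_cong refl)
    fix x :: real
    have "2 * cosh (\<nu> * x) = exp (\<nu> * x) + exp (\<nu> * (- x))" by (simp add: cosh_def)
    then show "indicator {0<..} x * h x + indicator {0<..} x * h (- x) = (2 * k powr \<nu>) * (indicator {0<..} x * (exp (- (\<alpha> * r) * cosh x) * cosh (\<nu> * x)))"
      by (simp add: h_def indicator_def distrib_right[symmetric] distrib_left[symmetric])
  qed
  also have "\<dots> = (2 * k powr \<nu>) * (LBINT x. indicator {0<..} x * (exp (- (\<alpha> * r) * cosh x) * cosh (\<nu> * x)))"
    by (rule integral_mult_right_zero)
  also have "\<dots> = 2 * k powr \<nu> * bessel_K \<nu> (\<alpha> * r)"
    by (simp add: bessel_K_def set_lebesgue_integral_def)
  finally show ?thesis by (simp add: f_def k_def)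
qed

lemma matern_eq_kern:
  assumes "0 < \<nu>" "0 < \<alpha>" shows "matern \<nu> \<alpha> x = \<alpha> powr (2 * \<nu>) * kern \<nu> \<alpha> x"
proof (cases "x = 0")
  case True
  then show ?thesis using assms by (simp add: matern_def kern_0 powr_add[symmetric])
next
  case False
  then have r: "0 < norm x" by simp
  have "kern \<nu> \<alpha> x = (LBINT u:{0<..}. u powr (\<nu> - 1) * exp (- \<alpha>\<^sup>2 * u) * exp (- (norm x)\<^sup>2 / (4 * u))) / Gamma \<nu>"
    unfolding kern_def mix_weight_def gauss_kernel_def by simp
  also have "\<dots> = 2 * (norm x / (2 * \<alpha>)) powr \<nu> * bessel_K \<nu> (\<alpha> * norm x) / Gamma \<nu>"
    by (simp only: bessel_K_mixture[OF assms r])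
  finally have "\<alpha> powr (2 * \<nu>) * kern \<nu> \<alpha> x = \<alpha> powr (2 * \<nu>) * (2 * (norm x / (2 * \<alpha>)) powr \<nu>) / Gamma \<nu> * bessel_K \<nu> (\<alpha> * norm x)"
    by simp
  also have "\<alpha> powr (2 * \<nu>) * (2 * (norm x / (2 * \<alpha>)) powr \<nu>) = 2 powr (1 - \<nu>) * (\<alpha> * norm x) powr \<nu>"
  proof -
    have "\<alpha> powr (2 * \<nu>) = \<alpha> powr \<nu> * \<alpha> powr \<nu>" by (simp add: powr_add[symmetric])
    then show ?thesis using assms r by (simp add: powr_divide powr_mult powr_diff)
  qed
  finally show ?thesis using False by (simp add: matern_def)
qed

section \<open>Spectral representation\<close>

lemma integral_double_sum:
  fixes f :: "nat \<Rightarrow> nat \<Rightarrow> 'a \<Rightarrow> real"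
  assumes "\<And>i j. i < n \<Longrightarrow> j < n \<Longrightarrow> integrable M (f i j)"
  shows "integrable M (\<lambda>x. \<Sum>i<n. \<Sum>j<n. a i j * f i j x)"
    and "(LINT x|M. (\<Sum>i<n. \<Sum>j<n. a i j * f i j x)) = (\<Sum>i<n. \<Sum>j<n. a i j * (LINT x|M. f i j x))"
proof -
  have 1: "integrable M (\<lambda>x. \<Sum>j<n. a i j * f i j x)" if "i < n" for i
    using assms that by (intro Bochner_Integration.integrable_sum integrable_mult_right) auto
  then show "integrable M (\<lambda>x. \<Sum>i<n. \<Sum>j<n. a i j * f i j x)"
    by (rule Bochner_Integration.integrable_sum) simp
  have "(LINT x|M. (\<Sum>i<n. \<Sum>j<n. a i j * f i j x)) = (\<Sum>i<n. LINT x|M. (\<Sum>j<n. a i j * f i j x))"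
    using 1 by (intro Bochner_Integration.integral_sum) auto
  also have "\<dots> = (\<Sum>i<n. \<Sum>j<n. LINT x|M. a i j * f i j x)"
  proof (intro sum.cong refl Bochner_Integration.integral_sum)
    fix i j assume "i \<in> {..<n}" "j \<in> {..<n}"
    then show "integrable M (\<lambda>x. a i j * f i j x)" using assms[of i j] by simp
  qed
  finally show "(LINT x|M. (\<Sum>i<n. \<Sum>j<n. a i j * f i j x)) = (\<Sum>i<n. \<Sum>j<n. a i j * (LINT x|M. f i j x))" by simp
qed

lemma normal_iexp:
  fixes \<sigma> y :: real assumes "0 < \<sigma>"
  shows "integrable lborel (\<lambda>\<xi>. complex_of_real (normal_density 0 \<sigma> \<xi>) * iexp (\<xi> * y))"
    and "(CLBINT \<xi>. of_real (normal_density 0 \<sigma> \<xi>) * iexp (\<xi> * y)) = of_real (exp (- (\<sigma>\<^sup>2 * y\<^sup>2) / 2))"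
proof -
  show "integrable lborel (\<lambda>\<xi>. complex_of_real (normal_density 0 \<sigma> \<xi>) * iexp (\<xi> * y))"
    by (rule Bochner_Integration.integrable_bound[OF integrable_normal_density[OF assms, of 0]]) (auto simp: norm_mult)
  let ?f = "\<lambda>\<xi>. complex_of_real (normal_density 0 \<sigma> \<xi>) * iexp (\<xi> * y)"
  have "(CLBINT \<xi>. ?f \<xi>) = \<bar>\<sigma>\<bar> *\<^sub>R (CLBINT z. ?f (0 + \<sigma> * z))"
    by (rule lborel_integral_real_affine) (use assms in auto)
  also have "\<dots> = (CLBINT z. \<sigma> *\<^sub>R ?f (0 + \<sigma> * z))" using assms by simp
  also have "\<dots> = (CLBINT z. std_normal_density z *\<^sub>R iexp (\<sigma> * y * z))"
  proof (intro Bochner_Integration.integral_cong refl)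
    fix z :: real
    have "\<sigma> * normal_density 0 \<sigma> (\<sigma> * z) = std_normal_density z"
      using assms by (simp add: normal_density_def real_sqrt_mult power_mult_distrib)
    then have "complex_of_real \<sigma> * of_real (normal_density 0 \<sigma> (\<sigma> * z)) = of_real (std_normal_density z)"
      by (metis of_real_mult)
    then have "\<sigma> *\<^sub>R ?f (0 + \<sigma> * z) = of_real (std_normal_density z) * iexp (\<sigma> * z * y)"
      by (simp only: scaleR_conv_of_real add_0 mult.assoc[symmetric])
    then show "\<sigma> *\<^sub>R ?f (0 + \<sigma> * z) = std_normal_density z *\<^sub>R iexp (\<sigma> * y * z)"
      by (simp only: scaleR_conv_of_real mult_ac)
  qed
  also have "\<dots> = char std_normal_distribution (\<sigma> * y)"
    unfolding char_def by (subst integral_density) auto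
  also have "\<dots> = of_real (exp (- (\<sigma>\<^sup>2 * y\<^sup>2) / 2))"
    by (simp add: char_std_normal_distribution power_mult_distrib)
  finally show "(CLBINT \<xi>. ?f \<xi>) = of_real (exp (- (\<sigma>\<^sup>2 * y\<^sup>2) / 2))" .
qed

text \<open>The density of independent normal coordinates with variance 1/(2t), whose characteristic
  function exp(-|x|^2/(4t)) is the Gaussian kernel at scale t.\<close>

definition gauss_weight :: "real \<Rightarrow> ('d::finite \<Rightarrow> real) \<Rightarrow> real" where
  "gauss_weight t \<xi> = (t / pi) powr (real CARD('d) / 2) * exp (- t * sq_norm \<xi>)"

lemma gauss_weight_nonneg: "0 \<le> gauss_weight t \<xi>" by (simp add: gauss_weight_def)

lemma gauss_weight_measurable [measurable]: "gauss_weight t \<in> borel_measurable freq"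
  unfolding gauss_weight_def[abs_def] by measurable

lemma gauss_weight_prod:
  assumes "0 < t" shows "gauss_weight t \<xi> = (\<Prod>i\<in>UNIV. normal_density 0 (1 / sqrt (2 * t)) (\<xi> i))"
proof -
  have 1: "normal_density 0 (1 / sqrt (2 * t)) x = (t / pi) powr (1 / 2) * exp (- t * x\<^sup>2)" for x
    using assms by (simp add: normal_density_def powr_half_sqrt power_divide real_sqrt_divide real_sqrt_mult power_mult_distrib mult_ac)
  show ?thesis
    unfolding 1 prod.distrib gauss_weight_def sq_norm_def
    using assms by (simp add: exp_sum[symmetric] sum_distrib_left sum_negf powr_power)
qed

lemma gauss_kernel_spectral:
  fixes x :: "real ^ 'd::finite" assumes "0 < t"
  shows "integrable freq (\<lambda>\<xi>. complex_of_real (gauss_weight t \<xi>) * iexp (pairing \<xi> x))"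
    and "(LINT \<xi>|freq. complex_of_real (gauss_weight t \<xi>) * iexp (pairing \<xi> x)) = of_real (gauss_kernel t x)"
proof -
  let ?\<sigma> = "1 / sqrt (2 * t)"
  have \<sigma>: "0 < ?\<sigma>" using assms by simp
  have eq: "complex_of_real (gauss_weight t \<xi>) * iexp (pairing \<xi> x) = (\<Prod>i\<in>UNIV. of_real (normal_density 0 ?\<sigma> (\<xi> i)) * iexp (\<xi> i * x $ i))" for \<xi>
    by (simp add: gauss_weight_prod[OF assms] iexp_pairing prod.distrib)
  show "integrable freq (\<lambda>\<xi>. complex_of_real (gauss_weight t \<xi>) * iexp (pairing \<xi> x))"
    unfolding eq freq_def by (rule freq.product_integrable_prod) (use normal_iexp(1)[OF \<sigma>] in auto)
  have "(LINT \<xi>|freq. complex_of_real (gauss_weight t \<xi>) * iexp (pairing \<xi> x)) = (\<Prod>i\<in>UNIV. of_real (exp (- (?\<sigma>\<^sup>2 * (x $ i)\<^sup>2) / 2)))"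
    unfolding eq freq_def
    by (subst freq.product_integral_prod) (use normal_iexp[OF \<sigma>] in \<open>auto simp del: of_real_divide\<close>)
  also have "\<dots> = of_real (\<Prod>i\<in>UNIV. exp (- (x $ i)\<^sup>2 / (4 * t)))"
    using assms by (simp add: power_divide)
  also have "(\<Prod>i\<in>UNIV. exp (- (x $ i)\<^sup>2 / (4 * t))) = gauss_kernel t x"
  proof -
    have "(norm x)\<^sup>2 = (\<Sum>i\<in>UNIV. (x $ i)\<^sup>2)"
      unfolding power2_norm_eq_inner by (simp add: inner_vec_def power2_eq_square)
    then show ?thesis by (simp add: exp_sum[symmetric] gauss_kernel_def sum_divide_distrib[symmetric] sum_negf)
  qed
  finally show "(LINT \<xi>|freq. complex_of_real (gauss_weight t \<xi>) * iexp (pairing \<xi> x)) = of_real (gauss_kernel t x)" .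
qed

lemma gauss_kernel_spectral_cos:
  fixes x :: "real ^ 'd::finite" assumes "0 < t"
  shows "integrable freq (\<lambda>\<xi>. gauss_weight t \<xi> * cos (pairing \<xi> x))"
    and "(LINT \<xi>|freq. gauss_weight t \<xi> * cos (pairing \<xi> x)) = gauss_kernel t x"
proof -
  have eq: "Re (complex_of_real (gauss_weight t \<xi>) * iexp (pairing \<xi> x)) = gauss_weight t \<xi> * cos (pairing \<xi> x)" for \<xi>
    by (simp add: Re_exp)
  show "integrable freq (\<lambda>\<xi>. gauss_weight t \<xi> * cos (pairing \<xi> x))"
    using integrable_Re[OF gauss_kernel_spectral(1)[OF assms, of x]] unfolding eq .
  show "(LINT \<xi>|freq. gauss_weight t \<xi> * cos (pairing \<xi> x)) = gauss_kernel t x"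
    using integral_Re[OF gauss_kernel_spectral(1)[OF assms, of x]] unfolding eq gauss_kernel_spectral(2)[OF assms, of x] by simp
qed

lemma nn_integral_gauss_weight:
  assumes "0 < t" shows "(\<integral>\<^sup>+ \<xi>. ennreal (gauss_weight t \<xi>) \<partial>(freq :: ('d::finite \<Rightarrow> real) measure)) = 1"
proof -
  have "integrable (freq :: ('d \<Rightarrow> real) measure) (\<lambda>\<xi>. gauss_weight t \<xi>)"
    using gauss_kernel_spectral_cos(1)[OF assms, of "0 :: real ^ 'd"] by (simp add: pairing_def)
  then have "(\<integral>\<^sup>+ \<xi>. ennreal (gauss_weight t \<xi>) \<partial>(freq :: ('d \<Rightarrow> real) measure)) = ennreal (LINT \<xi>|(freq :: ('d \<Rightarrow> real) measure). gauss_weight t \<xi>)"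
    by (rule nn_integral_eq_integral) (simp add: gauss_weight_nonneg)
  also have "(LINT \<xi>|(freq :: ('d \<Rightarrow> real) measure). gauss_weight t \<xi>) = 1" using gauss_kernel_spectral_cos(2)[OF assms, of "0 :: real ^ 'd"] by (simp add: pairing_def gauss_kernel_def)
  finally show ?thesis by simp
qed

lemma pairing_diff: "pairing \<xi> (x - y) = pairing \<xi> x - pairing \<xi> y"
  by (simp add: pairing_def right_diff_distrib sum_subtractf)

lemma Re_trig_sum: "Re (trig_sum n s c \<xi>) = (\<Sum>j<n. c j * cos (pairing \<xi> (s j)))"
  and Im_trig_sum: "Im (trig_sum n s c \<xi>) = (\<Sum>j<n. c j * sin (pairing \<xi> (s j)))"
  by (simp_all add: trig_sum_def Re_exp Im_exp)

lemma norm_trig_sum_sq: "(norm (trig_sum n s c \<xi>))\<^sup>2 = qform n (\<lambda>i j. cos (pairing \<xi> (s i - s j))) c"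
  unfolding cmod_power2 Re_trig_sum Im_trig_sum qform_def pairing_diff cos_diff
  by (simp add: power2_eq_square sum_product sum.distrib[symmetric] algebra_simps)

lemma qform_gauss_kernel:
  fixes s :: "nat \<Rightarrow> real ^ 'd::finite" assumes "0 < t"
  shows "(\<integral>\<^sup>+ \<xi>. ennreal (gauss_weight t \<xi> * (norm (trig_sum n s c \<xi>))\<^sup>2) \<partial>freq) = ennreal (qform n (\<lambda>i j. gauss_kernel t (s i - s j)) c)"
    and "0 \<le> qform n (\<lambda>i j. gauss_kernel t (s i - s j)) c"
proof -
  have eq: "gauss_weight t \<xi> * (norm (trig_sum n s c \<xi>))\<^sup>2 = (\<Sum>i<n. \<Sum>j<n. c i * c j * (gauss_weight t \<xi> * cos (pairing \<xi> (s i - s j))))" for \<xi>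
    unfolding norm_trig_sum_sq qform_def by (simp add: sum_distrib_left mult_ac)
  have int: "integrable freq (\<lambda>\<xi>. gauss_weight t \<xi> * (norm (trig_sum n s c \<xi>))\<^sup>2)"
    unfolding eq by (rule integral_double_sum(1)) (rule gauss_kernel_spectral_cos(1)[OF assms])
  have val: "(LINT \<xi>|freq. gauss_weight t \<xi> * (norm (trig_sum n s c \<xi>))\<^sup>2) = qform n (\<lambda>i j. gauss_kernel t (s i - s j)) c"
    unfolding eq qform_def by (subst integral_double_sum(2)) (simp_all add: gauss_kernel_spectral_cos[OF assms])
  show "(\<integral>\<^sup>+ \<xi>. ennreal (gauss_weight t \<xi> * (norm (trig_sum n s c \<xi>))\<^sup>2) \<partial>freq) = ennreal (qform n (\<lambda>i j. gauss_kernel t (s i - s j)) c)"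
    unfolding val[symmetric] by (rule nn_integral_eq_integral[OF int]) (auto simp: gauss_weight_nonneg)
  show "0 \<le> qform n (\<lambda>i j. gauss_kernel t (s i - s j)) c"
    unfolding val[symmetric] by (intro integral_nonneg_AE AE_I2) (auto simp: gauss_weight_nonneg)
qed

lemma qform_kern:
  fixes s :: "nat \<Rightarrow> 'a::real_normed_vector" assumes "0 < \<nu>" "0 < \<alpha>"
  shows "set_integrable lborel {0<..} (\<lambda>t. mix_weight \<nu> \<alpha> t * qform n (\<lambda>i j. gauss_kernel t (s i - s j)) c)"
    and "qform n (\<lambda>i j. kern \<nu> \<alpha> (s i - s j)) c = (LBINT t:{0<..}. mix_weight \<nu> \<alpha> t * qform n (\<lambda>i j. gauss_kernel t (s i - s j)) c)"
proof -
  have eq: "indicator {0<..} t *\<^sub>R (mix_weight \<nu> \<alpha> t * qform n (\<lambda>i j. gauss_kernel t (s i - s j)) c) =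
     (\<Sum>i<n. \<Sum>j<n. c i * c j * (indicator {0<..} t *\<^sub>R (mix_weight \<nu> \<alpha> t * gauss_kernel t (s i - s j))))" for t
    unfolding qform_def by (simp add: sum_distrib_left mult_ac)
  note int = integrable_mix_weight_gauss_kernel[OF assms, unfolded set_integrable_def]
  show "set_integrable lborel {0<..} (\<lambda>t. mix_weight \<nu> \<alpha> t * qform n (\<lambda>i j. gauss_kernel t (s i - s j)) c)"
    unfolding set_integrable_def eq by (rule integral_double_sum(1)) (rule int)
  show "qform n (\<lambda>i j. kern \<nu> \<alpha> (s i - s j)) c = (LBINT t:{0<..}. mix_weight \<nu> \<alpha> t * qform n (\<lambda>i j. gauss_kernel t (s i - s j)) c)"
    unfolding set_lebesgue_integral_def eq
    by (subst integral_double_sum(2)) (simp_all add: int qform_def kern_def set_lebesgue_integral_def del: real_scaleR_def)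
qed

lemma qform_kern_nn:
  fixes s :: "nat \<Rightarrow> real ^ 'd::finite" assumes "0 < \<nu>" "0 < \<alpha>"
  shows "ennreal (qform n (\<lambda>i j. kern \<nu> \<alpha> (s i - s j)) c) = (\<integral>\<^sup>+ t\<in>{0<..}. ennreal (mix_weight \<nu> \<alpha> t * qform n (\<lambda>i j. gauss_kernel t (s i - s j)) c) \<partial>lborel)"
proof -
  have "ennreal (qform n (\<lambda>i j. kern \<nu> \<alpha> (s i - s j)) c) = 
    (\<integral>\<^sup>+ t. ennreal (indicator {0<..} t *\<^sub>R (mix_weight \<nu> \<alpha> t * qform n (\<lambda>i j. gauss_kernel t (s i - s j)) c)) \<partial>lborel)"
    unfolding qform_kern(2)[OF assms] set_lebesgue_integral_def
    using qform_kern(1)[OF assms] unfolding set_integrable_def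
    by (intro nn_integral_eq_integral[symmetric]) (auto simp: indicator_def mix_weight_nonneg assms qform_gauss_kernel(2))
  also have "\<dots> = (\<integral>\<^sup>+ t\<in>{0<..}. ennreal (mix_weight \<nu> \<alpha> t * qform n (\<lambda>i j. gauss_kernel t (s i - s j)) c) \<partial>lborel)"
    by (intro nn_integral_cong) (auto simp: indicator_def)
  finally show ?thesis .
qed

lemma qform_kern_nonneg:
  fixes s :: "nat \<Rightarrow> real ^ 'd::finite" assumes "0 < \<nu>" "0 < \<alpha>"
  shows "0 \<le> qform n (\<lambda>i j. kern \<nu> \<alpha> (s i - s j)) c"
  unfolding qform_kern(2)[OF assms] set_lebesgue_integral_def
  by (intro integral_nonneg_AE AE_I2) (auto simp: indicator_def mix_weight_nonneg assms qform_gauss_kernel(2))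

definition spectral_const :: "real \<Rightarrow> real \<Rightarrow> real" where
  "spectral_const \<nu> d = Gamma (\<nu> + d / 2) / (Gamma \<nu> * pi powr (d / 2))"

lemma spectral_const_pos: assumes "0 < \<nu>" "0 \<le> d" shows "0 < spectral_const \<nu> d"
  using assms by (auto simp: spectral_const_def intro!: divide_pos_pos mult_pos_pos Gamma_real_pos)

text \<open>Inserting the spectral form of the Gaussian kernel and exchanging the integrals leaves,
  for each frequency, a Gamma integral in t with exponent \<nu> + d/2 and rate \<alpha>^2 +
  |\<xi>|^2. Nonnegative integrals are used so that the exchange asks for measurability
  only.\<close>

lemma qform_kern_spectral:
  fixes s :: "nat \<Rightarrow> real ^ 'd::finite" assumes "0 < \<nu>" "0 < \<alpha>"
    and N_def: "N = \<nu> + real CARD('d) / 2"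
  shows "ennreal (qform n (\<lambda>i j. kern \<nu> \<alpha> (s i - s j)) c) =
    (\<integral>\<^sup>+ \<xi>. ennreal (spectral_const \<nu> (real CARD('d)) * (\<alpha>\<^sup>2 + sq_norm \<xi>) powr (- N) * (norm (trig_sum n s c \<xi>))\<^sup>2) \<partial>freq)"
proof -
  let ?F = "\<lambda>\<xi>. (norm (trig_sum n s c \<xi>))\<^sup>2"
  interpret sigma_finite_measure "freq :: ('d \<Rightarrow> real) measure" by (rule sigma_finite_freq)
  interpret P: pair_sigma_finite "lborel :: real measure" "freq :: ('d \<Rightarrow> real) measure" ..
  have N: "0 < N" using assms by (simp add: N_def add_pos_nonneg)
  have "ennreal (qform n (\<lambda>i j. kern \<nu> \<alpha> (s i - s j)) c) = (\<integral>\<^sup>+ t. (\<integral>\<^sup>+ \<xi>. ennreal (mix_weight \<nu> \<alpha> t * (gauss_weight t \<xi> * ?F \<xi>)) * indicator {0<..} t \<partial>freq) \<partial>lborel)"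
    unfolding qform_kern_nn[OF assms(1,2)]
  proof (intro nn_integral_cong)
    fix t :: real
    show "ennreal (mix_weight \<nu> \<alpha> t * qform n (\<lambda>i j. gauss_kernel t (s i - s j)) c) * indicator {0<..} t = (\<integral>\<^sup>+ \<xi>. ennreal (mix_weight \<nu> \<alpha> t * (gauss_weight t \<xi> * ?F \<xi>)) * indicator {0<..} t \<partial>freq)"
    proof (cases "0 < t")
      case True
      then show ?thesis
        by (simp add: ennreal_mult mix_weight_nonneg assms qform_gauss_kernel(2) gauss_weight_nonneg nn_integral_cmult qform_gauss_kernel(1)[OF True, symmetric] del: ennreal_mult')
    qed simp
  qed
  also have "\<dots> = (\<integral>\<^sup>+ \<xi>. (\<integral>\<^sup>+ t. ennreal (mix_weight \<nu> \<alpha> t * (gauss_weight t \<xi> * ?F \<xi>)) * indicator {0<..} t \<partial>lborel) \<partial>freq)"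
  proof (rule P.Fubini'[symmetric])
    have [measurable]: "(\<lambda>p. gauss_weight (fst p) (snd p)) \<in> borel_measurable (lborel \<Otimes>\<^sub>M (freq :: ('d \<Rightarrow> real) measure))"
      unfolding gauss_weight_def by measurable
    show "(\<lambda>(t, \<xi>). ennreal (mix_weight \<nu> \<alpha> t * (gauss_weight t \<xi> * ?F \<xi>)) * indicator {0<..} t) \<in> borel_measurable (lborel \<Otimes>\<^sub>M freq)"
      unfolding split_beta' by measurable
  qed
  also have "\<dots> = (\<integral>\<^sup>+ \<xi>. ennreal (spectral_const \<nu> (real CARD('d)) * (\<alpha>\<^sup>2 + sq_norm \<xi>) powr (- N) * ?F \<xi>) \<partial>freq)"
  proof (intro nn_integral_cong)
    fix \<xi> :: "'d \<Rightarrow> real"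
    have pos: "0 < \<alpha>\<^sup>2 + sq_norm \<xi>" using assms sq_norm_nonneg[of \<xi>] by (simp add: add_pos_nonneg)
    have G: "0 < Gamma \<nu>" "0 < Gamma N" using assms N by (auto intro: Gamma_real_pos)
    let ?K = "?F \<xi> / (Gamma \<nu> * pi powr (real CARD('d) / 2))"
    have K: "0 \<le> ?K" using G by simp
    have "(\<integral>\<^sup>+ t. ennreal (mix_weight \<nu> \<alpha> t * (gauss_weight t \<xi> * ?F \<xi>)) * indicator {0<..} t \<partial>lborel) =
      (\<integral>\<^sup>+ t. ennreal ?K * (ennreal (t powr (N - 1) * exp (- (\<alpha>\<^sup>2 + sq_norm \<xi>) * t)) * indicator {0<..} t) \<partial>lborel)"
    proof (intro nn_integral_cong)
      fix t :: real
      show "ennreal (mix_weight \<nu> \<alpha> t * (gauss_weight t \<xi> * ?F \<xi>)) * indicator {0<..} t = ennreal ?K * (ennreal (t powr (N - 1) * exp (- (\<alpha>\<^sup>2 + sq_norm \<xi>) * t)) * indicator {0<..} t)"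
      proof (cases "0 < t")
        case True
        have "t powr (N - 1) = t powr (\<nu> - 1) * t powr (real CARD('d) / 2)"
          by (simp add: N_def powr_add[symmetric] algebra_simps)
        moreover have "exp (- (\<alpha>\<^sup>2 + sq_norm \<xi>) * t) = exp (- \<alpha>\<^sup>2 * t) * exp (- t * sq_norm \<xi>)"
          by (simp add: exp_add[symmetric] algebra_simps)
        ultimately have "mix_weight \<nu> \<alpha> t * (gauss_weight t \<xi> * ?F \<xi>) = ?K * (t powr (N - 1) * exp (- (\<alpha>\<^sup>2 + sq_norm \<xi>) * t))"
          using True by (simp add: mix_weight_def gauss_weight_def powr_divide)
        then show ?thesis using True K by (simp add: ennreal_mult[symmetric])
      qed simp
    qed
    also have "\<dots> = ennreal ?K * ennreal (Gamma N / (\<alpha>\<^sup>2 + sq_norm \<xi>) powr N)"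
      by (subst nn_integral_cmult) (simp_all only: nn_integral_gamma[OF N pos], measurable)
    also have "\<dots> = ennreal (?K * (Gamma N / (\<alpha>\<^sup>2 + sq_norm \<xi>) powr N))"
      using K G by (intro ennreal_mult[symmetric]) auto
    also have "?K * (Gamma N / (\<alpha>\<^sup>2 + sq_norm \<xi>) powr N) = spectral_const \<nu> (real CARD('d)) * (\<alpha>\<^sup>2 + sq_norm \<xi>) powr (- N) * ?F \<xi>"
      by (simp add: powr_minus_divide spectral_const_def N_def[symmetric])
    finally show "(\<integral>\<^sup>+ t. ennreal (mix_weight \<nu> \<alpha> t * (gauss_weight t \<xi> * ?F \<xi>)) * indicator {0<..} t \<partial>lborel) =
       ennreal (spectral_const \<nu> (real CARD('d)) * (\<alpha>\<^sup>2 + sq_norm \<xi>) powr (- N) * ?F \<xi>)" .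
  qed
  finally show ?thesis .
qed

lemma qform_kern_antimono:
  fixes s :: "nat \<Rightarrow> real ^ 'd::finite" assumes "0 < \<nu>" "0 < \<alpha>" "\<alpha> \<le> \<beta>"
  shows "qform n (\<lambda>i j. kern \<nu> \<beta> (s i - s j)) c \<le> qform n (\<lambda>i j. kern \<nu> \<alpha> (s i - s j)) c"
proof -
  have b: "0 < \<beta>" using assms by simp
  have "mix_weight \<nu> \<beta> t \<le> mix_weight \<nu> \<alpha> t" if "0 < t" for t
    using assms that Gamma_real_pos[OF assms(1)]
    by (auto simp: mix_weight_def intro!: divide_right_mono mult_left_mono power_mono)
  then show ?thesis
    unfolding qform_kern(2)[OF assms(1,2)] qform_kern(2)[OF assms(1) b]
    by (intro set_integral_mono qform_kern(1) assms b) (auto intro!: mult_right_mono qform_gauss_kernel(2))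
qed

text \<open>On the spectral side, (\<alpha>/\<beta>)^2 (\<beta>^2 + |\<xi>|^2) <= \<alpha>^2 +
  |\<xi>|^2, raised to the power -N with 2N = 2\<nu> + d. Comparing the mixture weights cannot give
  this: for \<alpha> < \<beta> their quotient exp((\<beta>^2 - \<alpha>^2) t) is unbounded in
  t.\<close>

lemma qform_kern_scale:
  fixes s :: "nat \<Rightarrow> real ^ 'd::finite" assumes "0 < \<nu>" "0 < \<alpha>" "\<alpha> \<le> \<beta>"
  shows "(\<alpha> / \<beta>) powr (2 * \<nu> + real CARD('d)) * qform n (\<lambda>i j. kern \<nu> \<alpha> (s i - s j)) c \<le> qform n (\<lambda>i j. kern \<nu> \<beta> (s i - s j)) c"
proof -
  have b: "0 < \<beta>" using assms by simp
  define N where "N = \<nu> + real CARD('d) / 2"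
  have N: "0 < N" using assms by (simp add: N_def add_pos_nonneg)
  let ?G = "spectral_const \<nu> (real CARD('d))"
  have G: "0 \<le> ?G" using spectral_const_pos[OF assms(1)] by (simp add: less_imp_le)
  let ?k = "(\<alpha> / \<beta>) powr (2 * N)"
  have pt: "?k * (\<alpha>\<^sup>2 + sq_norm \<xi>) powr (- N) \<le> (\<beta>\<^sup>2 + sq_norm \<xi>) powr (- N)" for \<xi> :: "'d \<Rightarrow> real"
  proof -
    have p: "0 < \<alpha>\<^sup>2 + sq_norm \<xi>" "0 < \<beta>\<^sup>2 + sq_norm \<xi>" using assms b sq_norm_nonneg[of \<xi>] by (simp_all add: add_pos_nonneg)
    have "(\<alpha> / \<beta>)\<^sup>2 * (\<beta>\<^sup>2 + sq_norm \<xi>) = \<alpha>\<^sup>2 + (\<alpha> / \<beta>)\<^sup>2 * sq_norm \<xi>" using b by (simp add: power_divide distrib_left)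
    also have "\<dots> \<le> \<alpha>\<^sup>2 + 1 * sq_norm \<xi>"
      using assms b sq_norm_nonneg[of \<xi>] by (intro add_left_mono mult_right_mono) (auto simp: power_divide divide_le_eq power_mono)
    finally have "((\<alpha> / \<beta>)\<^sup>2 * (\<beta>\<^sup>2 + sq_norm \<xi>)) powr N \<le> (\<alpha>\<^sup>2 + sq_norm \<xi>) powr N"
      using p N by (intro powr_mono2) auto
    moreover have "((\<alpha> / \<beta>)\<^sup>2 * (\<beta>\<^sup>2 + sq_norm \<xi>)) powr N = ?k * (\<beta>\<^sup>2 + sq_norm \<xi>) powr N"
      using assms b p by (simp add: powr_mult powr_powr[symmetric])
    ultimately show ?thesis using p by (simp add: powr_minus_divide field_simps)
  qed
  have "ennreal (?k * qform n (\<lambda>i j. kern \<nu> \<alpha> (s i - s j)) c) = ennreal ?k * ennreal (qform n (\<lambda>i j. kern \<nu> \<alpha> (s i - s j)) c)"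
    by (simp add: ennreal_mult qform_kern_nonneg assms)
  also have "\<dots> = (\<integral>\<^sup>+ \<xi>. ennreal ?k * ennreal (?G * (\<alpha>\<^sup>2 + sq_norm \<xi>) powr (- N) * (norm (trig_sum n s c \<xi>))\<^sup>2) \<partial>freq)"
    unfolding qform_kern_spectral[OF assms(1,2) N_def] by (rule nn_integral_cmult[symmetric]) measurable
  also have "\<dots> \<le> (\<integral>\<^sup>+ \<xi>. ennreal (?G * (\<beta>\<^sup>2 + sq_norm \<xi>) powr (- N) * (norm (trig_sum n s c \<xi>))\<^sup>2) \<partial>freq)"
  proof (intro nn_integral_mono)
    fix \<xi> :: "'d \<Rightarrow> real"
    have "?k * (?G * (\<alpha>\<^sup>2 + sq_norm \<xi>) powr (- N) * (norm (trig_sum n s c \<xi>))\<^sup>2) = ?G * (?k * (\<alpha>\<^sup>2 + sq_norm \<xi>) powr (- N)) * (norm (trig_sum n s c \<xi>))\<^sup>2"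
      by simp
    also have "\<dots> \<le> ?G * (\<beta>\<^sup>2 + sq_norm \<xi>) powr (- N) * (norm (trig_sum n s c \<xi>))\<^sup>2"
      using G pt by (intro mult_right_mono mult_left_mono) auto
    finally show "ennreal ?k * ennreal (?G * (\<alpha>\<^sup>2 + sq_norm \<xi>) powr (- N) * (norm (trig_sum n s c \<xi>))\<^sup>2) \<le> ennreal (?G * (\<beta>\<^sup>2 + sq_norm \<xi>) powr (- N) * (norm (trig_sum n s c \<xi>))\<^sup>2)"
      using G by (simp add: ennreal_mult[symmetric] ennreal_leI)
  qed
  also have "\<dots> = ennreal (qform n (\<lambda>i j. kern \<nu> \<beta> (s i - s j)) c)"
    unfolding qform_kern_spectral[OF assms(1) b N_def] ..
  finally show ?thesis by (simp add: ennreal_le_iff qform_kern_nonneg assms b N_def)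
qed

section \<open>Trace bounds\<close>

lemma gauss_kernel_minus: "gauss_kernel t (x - y) = gauss_kernel t (y - x)"
  by (simp add: gauss_kernel_def norm_minus_commute)

lemma kern_minus: "kern \<nu> \<alpha> (x - y) = kern \<nu> \<alpha> (y - x)"
  unfolding kern_def by (subst gauss_kernel_minus) (rule refl)

lemma psd_gauss_kernel:
  fixes s :: "nat \<Rightarrow> real ^ 'd::finite" assumes "0 < t" shows "psd n (\<lambda>i j. gauss_kernel t (s i - s j))"
  unfolding psd_def sym_on_def using qform_gauss_kernel(2)[OF assms] gauss_kernel_minus by blast

lemma gauss_kernel_tendsto_0: assumes "x \<noteq> 0" shows "((\<lambda>t. gauss_kernel t x) \<longlongrightarrow> 0) (at_right 0)"
proof (rule tendsto_sandwich[OF _ _ tendsto_const])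
  have r: "0 < (norm x)\<^sup>2" using assms by simp
  show "((\<lambda>t. 4 * t / (norm x)\<^sup>2) \<longlongrightarrow> 0) (at_right 0)"
    by (rule tendsto_eq_intros refl | use r in simp)+
  show "\<forall>\<^sub>F t in at_right 0. gauss_kernel t x \<le> 4 * t / (norm x)\<^sup>2"
    using eventually_at_right_less[of 0]
  proof eventually_elim
    case (elim t)
    define y where "y = (norm x)\<^sup>2 / (4 * t)"
    have y: "0 < y" using elim r by (simp add: y_def)
    have "y \<le> exp y" using exp_ge_add_one_self[of y] by linarith
    then have "exp (- y) \<le> 1 / y" using y by (simp add: exp_minus inverse_eq_divide frac_le)
    then show ?case by (simp add: gauss_kernel_def y_def)
  qed
qed (auto simp: gauss_kernel_nonneg)

text \<open>As t tends to 0 the Gaussian matrices of distinct points tend to the identity, so the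
  form is positive for all small t. A vanishing mixture would force it to vanish for almost every t
  in that interval.\<close>

lemma pd_kern:
  fixes s :: "nat \<Rightarrow> real ^ 'd::finite"
  assumes "0 < \<nu>" "0 < \<alpha>" "inj_on s {..<n}"
  shows "pd n (\<lambda>i j. kern \<nu> \<alpha> (s i - s j))"
  unfolding pd_def sym_on_def
proof (intro conjI allI impI)
  fix c :: "nat \<Rightarrow> real" assume c: "\<exists>i<n. c i \<noteq> 0"
  let ?q = "\<lambda>t. qform n (\<lambda>i j. gauss_kernel t (s i - s j)) c"
  have "((\<lambda>t. gauss_kernel t (s i - s j)) \<longlongrightarrow> (if i = j then 1 else 0)) (at_right 0)" if "i < n" "j < n" for i j
  proof (cases "i = j")
    case False
    then have "s i - s j \<noteq> 0" using assms(3) that by (auto simp: inj_on_def)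
    from gauss_kernel_tendsto_0[OF this] False show ?thesis by simp
  qed (simp add: gauss_kernel_def)
  then have "(?q \<longlongrightarrow> (\<Sum>i<n. \<Sum>j<n. c i * c j * (if i = j then 1 else 0))) (at_right 0)"
    unfolding qform_def by (intro tendsto_intros) auto
  also have "(\<Sum>i<n. \<Sum>j<n. c i * c j * (if i = j then 1 else 0)) = (\<Sum>i<n. (c i)\<^sup>2)"
    by (intro sum.cong refl) (simp add: if_distrib power2_eq_square cong: if_cong)
  finally have lim: "(?q \<longlongrightarrow> (\<Sum>i<n. (c i)\<^sup>2)) (at_right 0)" .
  have "0 < (\<Sum>i<n. (c i)\<^sup>2)"
  proof -
    obtain i where "i < n" "c i \<noteq> 0" using c by blast
    then show ?thesis by (intro sum_pos2[of _ i]) auto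
  qed
  then have "\<forall>\<^sub>F t in at_right 0. 0 < ?q t" by (rule order_tendstoD(1)[OF lim])
  then obtain e where e: "0 < e" "\<And>t. 0 < t \<Longrightarrow> t < e \<Longrightarrow> 0 < ?q t"
    by (auto simp: eventually_at_right_field)
  have "qform n (\<lambda>i j. kern \<nu> \<alpha> (s i - s j)) c \<noteq> 0"
  proof
    assume "qform n (\<lambda>i j. kern \<nu> \<alpha> (s i - s j)) c = 0"
    then have "(LBINT t. indicator {0<..} t *\<^sub>R (mix_weight \<nu> \<alpha> t * ?q t)) = 0"
      using qform_kern(2)[OF assms(1,2), of n s c] by (simp only: set_lebesgue_integral_def)
    moreover have "AE t in lborel. 0 \<le> indicator {0<..} t *\<^sub>R (mix_weight \<nu> \<alpha> t * ?q t)"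
      by (intro AE_I2) (auto simp: indicator_def mix_weight_nonneg assms qform_gauss_kernel(2))
    ultimately have "AE t in lborel. indicator {0<..} t *\<^sub>R (mix_weight \<nu> \<alpha> t * ?q t) = 0"
      using integral_nonneg_eq_0_iff_AE qform_kern(1)[OF assms(1,2), of n s c] unfolding set_integrable_def by blast
    then have "AE t in lborel. t \<notin> {0<..<e}"
    proof eventually_elim
      case (elim t)
      show ?case
      proof
        assume t: "t \<in> {0<..<e}"
        then have "0 < mix_weight \<nu> \<alpha> t" using Gamma_real_pos[OF assms(1)] by (simp add: mix_weight_def)
        with e(2)[of t] t have "0 < mix_weight \<nu> \<alpha> t * ?q t" by simp
        with elim t show False by auto
      qed
    qed
    then have "emeasure lborel {0<..<e} = 0" by (subst (asm) AE_iff_null_sets[symmetric]) auto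
    then show False using e(1) by simp
  qed
  then show "0 < qform n (\<lambda>i j. kern \<nu> \<alpha> (s i - s j)) c"
    using qform_kern_nonneg[OF assms(1,2), of n s c] by simp
qed (rule kern_minus)

lemma powr_le_exp:
  fixes y N :: real assumes "0 < N" "0 \<le> y" shows "y powr N \<le> (2 * N) powr N * exp (y / 2)"
proof -
  have "y / (2 * N) \<le> exp (y / (2 * N))" using exp_ge_add_one_self[of "y / (2 * N)"] by linarith
  then have "(y / (2 * N)) powr N \<le> exp (y / (2 * N)) powr N" using assms by (intro powr_mono2) auto
  also have "\<dots> = exp (y / 2)" using assms by (simp add: exp_powr_real)
  finally have "(2 * N) powr N * (y / (2 * N)) powr N \<le> (2 * N) powr N * exp (y / 2)" by (intro mult_left_mono) auto
  moreover have "(2 * N) powr N * (y / (2 * N)) powr N = y powr N"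
    using assms by (simp add: powr_mult[symmetric])
  ultimately show ?thesis by simp
qed

text \<open>Half of the Gaussian exponent absorbs the polynomial weight, and the other half remains
  as the normalised weight at t/2. The factor t^(-N) is the price of replacing 1 + |\<xi>|^2 by 1 +
  t |\<xi>|^2 when t < 1.\<close>

lemma nn_integral_gauss_weight_weight:
  fixes N :: real
  assumes "0 < N" "0 < t"
  shows "(\<integral>\<^sup>+ \<xi>. ennreal (gauss_weight t \<xi> * (1 + sq_norm \<xi>) powr N) \<partial>(freq :: ('d::finite \<Rightarrow> real) measure))
    \<le> ennreal (2 powr (real CARD('d) / 2) * ((2 * N) powr N * exp (1 / 2)) * max 1 (t powr (- N)))"
proof -
  let ?C = "2 powr (real CARD('d) / 2) * ((2 * N) powr N * exp (1 / 2)) * max 1 (t powr (- N))"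
  have pt: "gauss_weight t \<xi> * (1 + sq_norm \<xi>) powr N \<le> ?C * gauss_weight (t / 2) \<xi>" for \<xi> :: "'d \<Rightarrow> real"
  proof -
    have n0: "0 \<le> sq_norm \<xi>" by (rule sq_norm_nonneg)
    have "(1 + sq_norm \<xi>) powr N \<le> max 1 (t powr (- N)) * (1 + t * sq_norm \<xi>) powr N"
    proof (cases "1 \<le> t")
      case True
      have "1 * sq_norm \<xi> \<le> t * sq_norm \<xi>" using True n0 by (intro mult_right_mono) auto
      then have "(1 + sq_norm \<xi>) powr N \<le> 1 * (1 + t * sq_norm \<xi>) powr N"
        using assms n0 by (auto intro!: powr_mono2)
      also have "\<dots> \<le> max 1 (t powr (- N)) * (1 + t * sq_norm \<xi>) powr N" by (intro mult_right_mono) auto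
      finally show ?thesis .
    next
      case False
      then have "1 + sq_norm \<xi> \<le> (1 / t) * (1 + t * sq_norm \<xi>)" using assms by (simp add: field_simps)
      then have "(1 + sq_norm \<xi>) powr N \<le> ((1 / t) * (1 + t * sq_norm \<xi>)) powr N"
        using assms n0 by (intro powr_mono2) auto
      also have "\<dots> = t powr (- N) * (1 + t * sq_norm \<xi>) powr N"
        using assms n0 by (simp add: powr_mult powr_divide powr_minus_divide)
      also have "\<dots> \<le> max 1 (t powr (- N)) * (1 + t * sq_norm \<xi>) powr N" by (intro mult_right_mono) auto
      finally show ?thesis .
    qed
    also have "\<dots> \<le> max 1 (t powr (- N)) * ((2 * N) powr N * exp ((1 + t * sq_norm \<xi>) / 2))"
      using assms n0 by (intro mult_left_mono powr_le_exp) auto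
    finally have "gauss_weight t \<xi> * (1 + sq_norm \<xi>) powr N \<le> gauss_weight t \<xi> * (max 1 (t powr (- N)) * ((2 * N) powr N * exp ((1 + t * sq_norm \<xi>) / 2)))"
      by (intro mult_left_mono gauss_weight_nonneg)
    also have "\<dots> = ?C * gauss_weight (t / 2) \<xi>"
    proof -
      have 1: "gauss_weight t \<xi> * exp ((1 + t * sq_norm \<xi>) / 2) = 2 powr (real CARD('d) / 2) * exp (1 / 2) * gauss_weight (t / 2) \<xi>"
      proof -
        have "exp (- t * sq_norm \<xi>) * exp ((1 + t * sq_norm \<xi>) / 2) = exp (1 / 2) * exp (- (t / 2) * sq_norm \<xi>)"
          by (simp add: exp_add[symmetric] field_simps)
        moreover have "(t / pi) powr (real CARD('d) / 2) = 2 powr (real CARD('d) / 2) * (t / 2 / pi) powr (real CARD('d) / 2)"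
          using assms by (simp add: powr_mult[symmetric])
        ultimately show ?thesis by (simp add: gauss_weight_def)
      qed
      have "gauss_weight t \<xi> * (max 1 (t powr (- N)) * ((2 * N) powr N * exp ((1 + t * sq_norm \<xi>) / 2))) =
        max 1 (t powr (- N)) * (2 * N) powr N * (gauss_weight t \<xi> * exp ((1 + t * sq_norm \<xi>) / 2))" by (simp only: mult_ac)
      also have "\<dots> = ?C * gauss_weight (t / 2) \<xi>" unfolding 1 by (simp only: mult_ac)
      finally show ?thesis .
    qed
    finally show ?thesis .
  qed
  have C: "0 \<le> ?C" by simp
  have "(\<integral>\<^sup>+ \<xi>. ennreal (gauss_weight t \<xi> * (1 + sq_norm \<xi>) powr N) \<partial>(freq :: ('d \<Rightarrow> real) measure))
    \<le> (\<integral>\<^sup>+ \<xi>. ennreal ?C * ennreal (gauss_weight (t / 2) \<xi>) \<partial>(freq :: ('d \<Rightarrow> real) measure))"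
  proof (intro nn_integral_mono)
    fix \<xi> :: "'d \<Rightarrow> real"
    show "ennreal (gauss_weight t \<xi> * (1 + sq_norm \<xi>) powr N) \<le> ennreal ?C * ennreal (gauss_weight (t / 2) \<xi>)"
      using pt[of \<xi>] by (subst ennreal_mult[symmetric]) (auto intro: ennreal_leI gauss_weight_nonneg)
  qed
  also have "\<dots> = ennreal ?C" by (subst nn_integral_cmult) (use assms in \<open>simp_all add: nn_integral_gauss_weight\<close>)
  finally show ?thesis .
qed

text \<open>The Gaussian matrix is the average, over Gaussian frequencies, of the rank-one matrices
  of the cosine and sine vectors. For each frequency the pointwise bound on exponential sums
  supplies the hypothesis of \<open>finv_qform_le\<close>, and the moments of the Gaussian weight
  give the power of t. Since d <= 3, the power -\<nu> - 3/2 dominates -\<nu> - d/2 for t < 1. The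
  comparison factor F lets one estimate serve all range parameters.\<close>

lemma trace_gauss_kernel_bound:
  assumes "0 < \<nu>" "0 < \<alpha>\<^sub>0" "0 \<le> T" "CARD('d::finite) \<le> 3"
  shows "\<exists>C>0. \<forall>n (s :: nat \<Rightarrow> real ^ 'd) A F t. (\<forall>j<n. \<forall>i. \<bar>s j $ i\<bar> \<le> T) \<longrightarrow> pd n A \<longrightarrow> 0 \<le> F \<longrightarrow>
     (\<forall>c. qform n (\<lambda>i j. kern \<nu> \<alpha>\<^sub>0 (s i - s j)) c \<le> F * qform n A c) \<longrightarrow> 0 < t \<longrightarrow>
     tr_prod n (finv n A) (\<lambda>i j. gauss_kernel t (s i - s j)) \<le> F * C * (1 + t powr (- \<nu> - 3 / 2))"
proof -
  define N where "N = \<nu> + real CARD('d) / 2"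
  have N: "0 < N" using assms by (simp add: N_def add_pos_nonneg)
  obtain C0 where C0: "0 < C0" and ptw: "\<And>n (s :: nat \<Rightarrow> real ^ 'd) c \<omega>. \<forall>j<n. \<forall>i. \<bar>s j $ i\<bar> \<le> T \<Longrightarrow>
    ennreal ((norm (trig_sum n s c \<omega>))\<^sup>2) \<le> ennreal (C0 * (1 + sq_norm \<omega>) powr N) * (\<integral>\<^sup>+ \<xi>. ennreal ((norm (trig_sum n s c \<xi>))\<^sup>2 * (1 + sq_norm \<xi>) powr (- N)) \<partial>freq)"
    using trig_sum_pointwise_le[of N T, where 'd='d] less_imp_le[OF N] assms(3) by blast
  define S where "S = spectral_const \<nu> (real CARD('d))"
  have S: "0 < S" unfolding S_def by (rule spectral_const_pos) (use assms in auto)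
  \<comment> \<open>With this constant \<open>\<alpha>\<^sub>0\<^sup>2 + sq_norm \<xi>\<close> is at
    most m (1 + |\<xi>|^2), which passes from the weight of the pointwise bound to the Matern
    spectral density.\<close>
  define m where "m = max 1 (\<alpha>\<^sub>0\<^sup>2)"
  have m: "1 \<le> m" by (simp add: m_def)
  define C1 where "C1 = C0 * m powr N / S"
  have C1: "0 < C1" using C0 S m by (simp add: C1_def)
  define D where "D = 2 powr (real CARD('d) / 2) * ((2 * N) powr N * exp (1 / 2))"
  have D: "0 < D" using N by (simp add: D_def)
  have main: "(norm (trig_sum n s c \<omega>))\<^sup>2 \<le> C1 * (1 + sq_norm \<omega>) powr N * qform n (\<lambda>i j. kern \<nu> \<alpha>\<^sub>0 (s i - s j)) c"
    if "\<forall>j<n. \<forall>i. \<bar>s j $ i\<bar> \<le> T" for n and s :: "nat \<Rightarrow> real ^ 'd" and c \<omega>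
  proof -
    let ?q = "qform n (\<lambda>i j. kern \<nu> \<alpha>\<^sub>0 (s i - s j)) c"
    have q0: "0 \<le> ?q" by (rule qform_kern_nonneg[OF assms(1,2)])
    have pt: "(1 + sq_norm \<xi>) powr (- N) \<le> m powr N * (\<alpha>\<^sub>0\<^sup>2 + sq_norm \<xi>) powr (- N)" for \<xi> :: "'d \<Rightarrow> real"
    proof -
      have p: "0 < 1 + sq_norm \<xi>" "0 < \<alpha>\<^sub>0\<^sup>2 + sq_norm \<xi>" using assms sq_norm_nonneg[of \<xi>] by (auto intro: add_pos_nonneg)
      have "1 * sq_norm \<xi> \<le> m * sq_norm \<xi>" using m sq_norm_nonneg[of \<xi>] by (intro mult_right_mono) auto
      moreover have "\<alpha>\<^sub>0\<^sup>2 \<le> m" by (simp add: m_def)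
      ultimately have "\<alpha>\<^sub>0\<^sup>2 + sq_norm \<xi> \<le> m * (1 + sq_norm \<xi>)" by (simp add: distrib_left)
      then have "(\<alpha>\<^sub>0\<^sup>2 + sq_norm \<xi>) powr N \<le> (m * (1 + sq_norm \<xi>)) powr N" using p N by (intro powr_mono2) auto
      also have "\<dots> = m powr N * (1 + sq_norm \<xi>) powr N" using p m by (simp add: powr_mult)
      finally show ?thesis using p by (simp add: powr_minus_divide field_simps)
    qed
    have "(\<integral>\<^sup>+ \<xi>. ennreal ((norm (trig_sum n s c \<xi>))\<^sup>2 * (1 + sq_norm \<xi>) powr (- N)) \<partial>freq) \<le>
      (\<integral>\<^sup>+ \<xi>. ennreal (m powr N / S) * ennreal (S * (\<alpha>\<^sub>0\<^sup>2 + sq_norm \<xi>) powr (- N) * (norm (trig_sum n s c \<xi>))\<^sup>2) \<partial>freq)"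
    proof (intro nn_integral_mono)
      fix \<xi> :: "'d \<Rightarrow> real"
      have "(norm (trig_sum n s c \<xi>))\<^sup>2 * (1 + sq_norm \<xi>) powr (- N) \<le> (norm (trig_sum n s c \<xi>))\<^sup>2 * (m powr N * (\<alpha>\<^sub>0\<^sup>2 + sq_norm \<xi>) powr (- N))"
        by (intro mult_left_mono pt) auto
      also have "\<dots> = m powr N / S * (S * (\<alpha>\<^sub>0\<^sup>2 + sq_norm \<xi>) powr (- N) * (norm (trig_sum n s c \<xi>))\<^sup>2)" using S by simp
      finally show "ennreal ((norm (trig_sum n s c \<xi>))\<^sup>2 * (1 + sq_norm \<xi>) powr (- N)) \<le> ennreal (m powr N / S) * ennreal (S * (\<alpha>\<^sub>0\<^sup>2 + sq_norm \<xi>) powr (- N) * (norm (trig_sum n s c \<xi>))\<^sup>2)"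
        using S by (subst ennreal_mult[symmetric]) (auto intro: ennreal_leI)
    qed
    also have "\<dots> = ennreal (m powr N / S) * ennreal ?q"
      unfolding qform_kern_spectral[OF assms(1,2) N_def] S_def[symmetric] by (rule nn_integral_cmult) measurable
    finally have "ennreal ((norm (trig_sum n s c \<omega>))\<^sup>2) \<le> ennreal (C0 * (1 + sq_norm \<omega>) powr N) * (ennreal (m powr N / S) * ennreal ?q)"
      using ptw[OF that, of c \<omega>] by (meson mult_left_mono order_trans zero_le)
    also have "\<dots> = ennreal (C1 * (1 + sq_norm \<omega>) powr N * ?q)"
      using C0 S q0 by (simp add: C1_def ennreal_mult[symmetric] mult_ac)
    finally show ?thesis using C1 q0 by (subst (asm) ennreal_le_iff) auto
  qed
  show ?thesis
  proof (intro exI[of _ "2 * C1 * D"] conjI allI impI)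
    show "0 < 2 * C1 * D" using C1 D by simp
    fix n and s :: "nat \<Rightarrow> real ^ 'd" and A and F t :: real
    assume s: "\<forall>j<n. \<forall>i. \<bar>s j $ i\<bar> \<le> T" and A: "pd n A" and F: "0 \<le> F"
      and le: "\<forall>c. qform n (\<lambda>i j. kern \<nu> \<alpha>\<^sub>0 (s i - s j)) c \<le> F * qform n A c" and t: "0 < t"
    let ?B = "finv n A"
    let ?c = "\<lambda>\<xi> j. cos (pairing \<xi> (s j))" and ?s = "\<lambda>\<xi> j. sin (pairing \<xi> (s j))"
    have q: "qform n ?B (?c \<xi>) + qform n ?B (?s \<xi>) \<le> 2 * F * C1 * (1 + sq_norm \<xi>) powr N" for \<xi>
    proof -
      have K: "0 \<le> F * (C1 * (1 + sq_norm \<xi>) powr N)" using F C1 by simp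
      have b: "(norm (trig_sum n s c \<xi>))\<^sup>2 \<le> F * (C1 * (1 + sq_norm \<xi>) powr N) * qform n A c" for c
      proof -
        have "(norm (trig_sum n s c \<xi>))\<^sup>2 \<le> C1 * (1 + sq_norm \<xi>) powr N * qform n (\<lambda>i j. kern \<nu> \<alpha>\<^sub>0 (s i - s j)) c" by (rule main[OF s])
        also have "\<dots> \<le> C1 * (1 + sq_norm \<xi>) powr N * (F * qform n A c)" using le C1 by (intro mult_left_mono) auto
        finally show ?thesis by (simp add: mult_ac)
      qed
      have "qform n ?B (?c \<xi>) \<le> F * (C1 * (1 + sq_norm \<xi>) powr N)"
      proof (rule finv_qform_le[OF A K])
        fix c
        show "(\<Sum>i<n. c i * cos (pairing \<xi> (s i)))\<^sup>2 \<le> F * (C1 * (1 + sq_norm \<xi>) powr N) * qform n A c"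
          using b[of c] unfolding cmod_power2 Re_trig_sum by (smt (verit) zero_le_power2)
      qed
      moreover have "qform n ?B (?s \<xi>) \<le> F * (C1 * (1 + sq_norm \<xi>) powr N)"
      proof (rule finv_qform_le[OF A K])
        fix c
        show "(\<Sum>i<n. c i * sin (pairing \<xi> (s i)))\<^sup>2 \<le> F * (C1 * (1 + sq_norm \<xi>) powr N) * qform n A c"
          using b[of c] unfolding cmod_power2 Im_trig_sum by (smt (verit) zero_le_power2)
      qed
      ultimately show ?thesis by simp
    qed
    have q0: "0 \<le> qform n ?B y" for y using pd_finv_psd[OF A] by (simp add: psd_def)
    \<comment> \<open>The addition formula for the cosine turns the two forms into a double sum over
      entries, whose integral is the trace.\<close>
    have eq: "gauss_weight t \<xi> * (qform n ?B (?c \<xi>) + qform n ?B (?s \<xi>)) = (\<Sum>i<n. \<Sum>j<n. ?B i j * (gauss_weight t \<xi> * cos (pairing \<xi> (s i - s j))))" for \<xi>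
      unfolding qform_def pairing_diff cos_diff
      by (simp add: sum.distrib[symmetric] sum_distrib_left algebra_simps)
    have int: "integrable freq (\<lambda>\<xi>. gauss_weight t \<xi> * (qform n ?B (?c \<xi>) + qform n ?B (?s \<xi>)))"
      unfolding eq by (rule integral_double_sum(1)) (rule gauss_kernel_spectral_cos(1)[OF t])
    have val: "(LINT \<xi>|freq. gauss_weight t \<xi> * (qform n ?B (?c \<xi>) + qform n ?B (?s \<xi>))) = tr_prod n ?B (\<lambda>i j. gauss_kernel t (s i - s j))"
      unfolding eq tr_prod_def by (subst integral_double_sum(2)) (simp_all add: gauss_kernel_spectral_cos[OF t])
    have "ennreal (tr_prod n ?B (\<lambda>i j. gauss_kernel t (s i - s j))) = (\<integral>\<^sup>+ \<xi>. ennreal (gauss_weight t \<xi> * (qform n ?B (?c \<xi>) + qform n ?B (?s \<xi>))) \<partial>freq)"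
      unfolding val[symmetric] by (rule nn_integral_eq_integral[OF int, symmetric]) (auto simp: gauss_weight_nonneg q0)
    also have "\<dots> \<le> (\<integral>\<^sup>+ \<xi>. ennreal (2 * F * C1) * ennreal (gauss_weight t \<xi> * (1 + sq_norm \<xi>) powr N) \<partial>(freq :: ('d \<Rightarrow> real) measure))"
    proof (intro nn_integral_mono)
      fix \<xi> :: "'d \<Rightarrow> real"
      have "gauss_weight t \<xi> * (qform n ?B (?c \<xi>) + qform n ?B (?s \<xi>)) \<le> gauss_weight t \<xi> * (2 * F * C1 * (1 + sq_norm \<xi>) powr N)"
        by (intro mult_left_mono q gauss_weight_nonneg)
      then show "ennreal (gauss_weight t \<xi> * (qform n ?B (?c \<xi>) + qform n ?B (?s \<xi>))) \<le> ennreal (2 * F * C1) * ennreal (gauss_weight t \<xi> * (1 + sq_norm \<xi>) powr N)"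
        using F C1 by (subst ennreal_mult[symmetric]) (auto intro!: ennreal_leI simp: gauss_weight_nonneg mult_ac)
    qed
    also have "\<dots> = ennreal (2 * F * C1) * (\<integral>\<^sup>+ \<xi>. ennreal (gauss_weight t \<xi> * (1 + sq_norm \<xi>) powr N) \<partial>(freq :: ('d \<Rightarrow> real) measure))"
      by (rule nn_integral_cmult) measurable
    also have "\<dots> \<le> ennreal (2 * F * C1) * ennreal (D * max 1 (t powr (- N)))"
      unfolding D_def by (intro mult_left_mono nn_integral_gauss_weight_weight N t) auto
    also have "\<dots> = ennreal (2 * F * C1 * (D * max 1 (t powr (- N))))"
      using F C1 D by (intro ennreal_mult[symmetric]) auto
    finally have "tr_prod n ?B (\<lambda>i j. gauss_kernel t (s i - s j)) \<le> 2 * F * C1 * (D * max 1 (t powr (- N)))"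
      using F C1 D by (subst (asm) ennreal_le_iff) auto
    also have "\<dots> \<le> 2 * F * C1 * (D * (1 + t powr (- \<nu> - 3 / 2)))"
    proof -
      have "max 1 (t powr (- N)) \<le> 1 + t powr (- \<nu> - 3 / 2)"
      proof (cases "1 \<le> t")
        case True
        then have "t powr (- N) \<le> t powr 0" using N by (intro powr_mono) auto
        then show ?thesis using t by simp
      next
        case False
        have "t powr (- N) \<le> t powr (- \<nu> - 3 / 2)"
          using False t assms(4) by (intro powr_mono') (auto simp: N_def)
        then show ?thesis by simp
      qed
      then show ?thesis using F C1 D by (intro mult_left_mono) auto
    qed
    finally show "tr_prod n ?B (\<lambda>i j. gauss_kernel t (s i - s j)) \<le> F * (2 * C1 * D) * (1 + t powr (- \<nu> - 3 / 2))"
      by (simp add: mult_ac)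
  qed
qed

section \<open>Comparison of the mixtures for two range parameters\<close>

lemma exp_diff_le:
  fixes a b t :: real
  assumes "0 \<le> t" "0 \<le> a" "a \<le> b"
  shows "exp (- a * t) - exp (- b * t) \<le> b * t" "0 \<le> exp (- a * t) - exp (- b * t)"
proof -
  have "exp (- a * t) - exp (- b * t) \<le> 1 - exp (- b * t)" using assms by simp
  also have "\<dots> \<le> b * t" using exp_ge_add_one_self[of "- b * t"] by simp
  finally show "exp (- a * t) - exp (- b * t) \<le> b * t" .
  show "0 \<le> exp (- a * t) - exp (- b * t)" using assms by (simp add: mult_right_mono)
qed

text \<open>Writes e^(-xt) - e^(-yt) = e^(-yt) (e^z - 1) with |z| <= 1. A relative bound is needed
  because at small scales the error must be a small multiple of the weight of the kernel itself,
  whose trace against the inverse is exactly n.\<close>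

lemma exp_diff_le_rel:
  fixes x y c t \<tau> :: real
  assumes "0 \<le> t" "t \<le> \<tau>" "0 \<le> x" "0 \<le> y" "x \<le> c" "y \<le> c" "c * \<tau> \<le> 1"
  shows "\<bar>exp (- x * t) - exp (- y * t)\<bar> \<le> 2 * c * \<tau> * exp (- y * t)"
proof -
  define z where "z = (y - x) * t"
  have "\<bar>z\<bar> \<le> c * \<tau>"
    unfolding z_def abs_mult using assms by (intro mult_mono) auto
  then have z: "\<bar>z\<bar> \<le> c * \<tau>" "\<bar>z\<bar> \<le> 1" using assms by auto
  have "\<bar>exp z - 1\<bar> \<le> 2 * \<bar>z\<bar>"
  proof (cases "0 \<le> z")
    case True
    then have "exp z \<le> 1 + z + z\<^sup>2" using z by (intro exp_bound) auto
    moreover have "z\<^sup>2 \<le> z" using True z by (simp add: power2_eq_square mult_left_le_one_le)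
    ultimately show ?thesis using True by (simp add: abs_if)
  next
    case False
    then have "exp z \<le> 1" by simp
    then show ?thesis using False exp_ge_add_one_self[of z] by linarith
  qed
  moreover have "exp (- x * t) - exp (- y * t) = exp (- y * t) * (exp z - 1)"
    by (simp add: z_def right_diff_distrib exp_add[symmetric] algebra_simps)
  ultimately have "\<bar>exp (- x * t) - exp (- y * t)\<bar> \<le> exp (- y * t) * (2 * \<bar>z\<bar>)"
    by (simp add: abs_mult)
  also have "\<dots> \<le> exp (- y * t) * (2 * (c * \<tau>))" using z by (intro mult_left_mono) auto
  finally show ?thesis by (simp add: mult_ac)
qed

lemma nn_integral_powr_tail:
  assumes "0 < \<tau>" shows "(\<integral>\<^sup>+ t\<in>{\<tau>..}. ennreal (t powr (- 3 / 2)) \<partial>lborel) = ennreal (2 * \<tau> powr (- 1 / 2))"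
proof -
  have "(\<integral>\<^sup>+ t. ennreal (t powr (- 3 / 2)) * indicator {\<tau>..} t \<partial>lborel) = ennreal (0 - (- 2 * \<tau> powr (- 1 / 2)))"
  proof (rule nn_integral_FTC_atLeast)
    fix t assume "\<tau> \<le> t"
    then show "DERIV (\<lambda>t. - 2 * t powr (- 1 / 2)) t :> t powr (- 3 / 2)"
      using assms by (auto intro!: derivative_eq_intros)
  next
    have "((\<lambda>t::real. t powr (- 1 / 2)) \<longlongrightarrow> 0) at_top"
      by (rule tendsto_neg_powr) (auto simp: filterlim_ident)
    from tendsto_mult_left[OF this, of "-2"]
    show "((\<lambda>t::real. - 2 * t powr (- 1 / 2)) \<longlongrightarrow> 0) at_top" by simp
  qed auto
  then show ?thesis by simp
qed

lemma integrable_mix_weight_tr: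
  fixes s :: "nat \<Rightarrow> 'a::real_normed_vector"
  assumes "0 < \<nu>" "0 < \<alpha>"
  shows "integrable lborel (\<lambda>t. indicator {0<..} t *\<^sub>R (mix_weight \<nu> \<alpha> t * tr_prod n B (\<lambda>i j. gauss_kernel t (s i - s j))))"
    and "tr_prod n B (\<lambda>i j. kern \<nu> \<alpha> (s i - s j)) = (LBINT t. indicator {0<..} t *\<^sub>R (mix_weight \<nu> \<alpha> t * tr_prod n B (\<lambda>i j. gauss_kernel t (s i - s j))))"
proof -
  have eq: "indicator {0<..} t *\<^sub>R (mix_weight \<nu> \<alpha> t * tr_prod n B (\<lambda>i j. gauss_kernel t (s i - s j))) =
     (\<Sum>i<n. \<Sum>j<n. B i j * (indicator {0<..} t *\<^sub>R (mix_weight \<nu> \<alpha> t * gauss_kernel t (s i - s j))))" for t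
    unfolding tr_prod_def by (simp add: sum_distrib_left mult_ac)
  note int = integrable_mix_weight_gauss_kernel[OF assms, unfolded set_integrable_def]
  show "integrable lborel (\<lambda>t. indicator {0<..} t *\<^sub>R (mix_weight \<nu> \<alpha> t * tr_prod n B (\<lambda>i j. gauss_kernel t (s i - s j))))"
    unfolding eq by (rule integral_double_sum(1)) (rule int)
  show "tr_prod n B (\<lambda>i j. kern \<nu> \<alpha> (s i - s j)) = (LBINT t. indicator {0<..} t *\<^sub>R (mix_weight \<nu> \<alpha> t * tr_prod n B (\<lambda>i j. gauss_kernel t (s i - s j))))"
    unfolding eq by (subst integral_double_sum(2)) (simp_all add: int tr_prod_def kern_def set_lebesgue_integral_def del: real_scaleR_def)
qed

text \<open>Small scales $t \le \tau$ of the mixture are compared with the kernel itself, large ones with the trace bound for Gaussian kernels.\<close>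
lemma trace_deviation_bound:
  assumes "0 < \<nu>" "0 < \<alpha>\<^sub>0" "0 \<le> T" "CARD('d::finite) \<le> 3"
  shows "\<exists>C>0. \<forall>n (s :: nat \<Rightarrow> real ^ 'd) \<alpha> \<tau>. (\<forall>j<n. \<forall>i. \<bar>s j $ i\<bar> \<le> T) \<longrightarrow> inj_on s {..<n} \<longrightarrow> 0 < \<alpha> \<longrightarrow> 0 < \<tau> \<longrightarrow>
     (max \<alpha> \<alpha>\<^sub>0)\<^sup>2 * \<tau> \<le> 1 \<longrightarrow>
     \<bar>tr_prod n (finv n (\<lambda>i j. kern \<nu> \<alpha> (s i - s j))) (\<lambda>i j. kern \<nu> \<alpha>\<^sub>0 (s i - s j)) - real n\<bar>
      \<le> 2 * (max \<alpha> \<alpha>\<^sub>0)\<^sup>2 * \<tau> * n + C * (max \<alpha> \<alpha>\<^sub>0) powr (2 * \<nu> + real CARD('d)) *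
          ((min \<alpha> \<alpha>\<^sub>0) powr (- 2 * \<nu>) + (max \<alpha> \<alpha>\<^sub>0)\<^sup>2 * \<tau> powr (- 1 / 2))"
proof -
  obtain C where C: "0 < C" and trb: "\<And>n (s :: nat \<Rightarrow> real ^ 'd) A F t. \<forall>j<n. \<forall>i. \<bar>s j $ i\<bar> \<le> T \<Longrightarrow> pd n A \<Longrightarrow> 0 \<le> F \<Longrightarrow>
     \<forall>c. qform n (\<lambda>i j. kern \<nu> \<alpha>\<^sub>0 (s i - s j)) c \<le> F * qform n A c \<Longrightarrow> 0 < t \<Longrightarrow>
     tr_prod n (finv n A) (\<lambda>i j. gauss_kernel t (s i - s j)) \<le> F * C * (1 + t powr (- \<nu> - 3 / 2))"
    using trace_gauss_kernel_bound[OF assms] by blast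
  have G: "0 < Gamma \<nu>" using assms(1) by (rule Gamma_real_pos)
  let ?p = "2 * \<nu> + real CARD('d)"
  define D where "D = C * \<alpha>\<^sub>0 powr (- ?p) * (1 + 2 / Gamma \<nu>)"
  have D: "0 < D" using C G assms(2) by (simp add: D_def add_pos_nonneg)
  show ?thesis
  proof (intro exI[of _ D] conjI D allI impI)
    fix n and s :: "nat \<Rightarrow> real ^ 'd" and \<alpha> \<tau> :: real
    assume s: "\<forall>j<n. \<forall>i. \<bar>s j $ i\<bar> \<le> T" "inj_on s {..<n}" and \<alpha>: "0 < \<alpha>" and \<tau>: "0 < \<tau>"
    define b where "b = max \<alpha> \<alpha>\<^sub>0"
    define a where "a = min \<alpha> \<alpha>\<^sub>0"
    assume "(max \<alpha> \<alpha>\<^sub>0)\<^sup>2 * \<tau> \<le> 1"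
    then have b\<tau>: "b\<^sup>2 * \<tau> \<le> 1" by (simp add: b_def)
    have ab: "0 < a" "0 < b" "a \<le> \<alpha>" "a \<le> \<alpha>\<^sub>0" "\<alpha> \<le> b" "\<alpha>\<^sub>0 \<le> b" using \<alpha> assms(2) by (auto simp: a_def b_def)
    let ?A = "\<lambda>i j. kern \<nu> \<alpha> (s i - s j)"
    let ?B = "finv n ?A"
    let ?g = "\<lambda>t. tr_prod n ?B (\<lambda>i j. gauss_kernel t (s i - s j))"
    have pdA: "pd n ?A" by (rule pd_kern[OF assms(1) \<alpha> s(2)])
    \<comment> \<open>The factor by which the form at \<alpha> dominates the one at
      \<open>\<alpha>\<^sub>0\<close>. For \<open>\<alpha>\<^sub>0 \<le> \<alpha>\<close> this is
      \<open>qform_kern_scale\<close>; otherwise \<open>b = \<alpha>\<^sub>0\<close>, F = 1 and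
      monotonicity suffices.\<close>
    define F where "F = (b / \<alpha>\<^sub>0) powr ?p"
    have F: "0 < F" using ab assms(2) by (simp add: F_def)
    have le: "\<forall>c. qform n (\<lambda>i j. kern \<nu> \<alpha>\<^sub>0 (s i - s j)) c \<le> F * qform n ?A c"
    proof
      fix c
      have "(\<alpha>\<^sub>0 / b) powr ?p * qform n (\<lambda>i j. kern \<nu> \<alpha>\<^sub>0 (s i - s j)) c \<le> qform n ?A c"
      proof (cases "\<alpha>\<^sub>0 \<le> \<alpha>")
        case True
        then have "b = \<alpha>" by (simp add: b_def)
        then show ?thesis using qform_kern_scale[OF assms(1,2) True] by simp
      next
        case False
        then have "b = \<alpha>\<^sub>0" by (simp add: b_def)
        then show ?thesis using qform_kern_antimono[OF assms(1) \<alpha>, of \<alpha>\<^sub>0] False assms(2) by simp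
      qed
      then have "F * ((\<alpha>\<^sub>0 / b) powr ?p * qform n (\<lambda>i j. kern \<nu> \<alpha>\<^sub>0 (s i - s j)) c) \<le> F * qform n ?A c"
        using F by (intro mult_left_mono) auto
      moreover have "F * (\<alpha>\<^sub>0 / b) powr ?p = 1"
        unfolding F_def using ab assms(2) by (simp add: powr_mult[symmetric])
      ultimately show "qform n (\<lambda>i j. kern \<nu> \<alpha>\<^sub>0 (s i - s j)) c \<le> F * qform n ?A c"
        by (simp add: mult.assoc[symmetric])
    qed
    have g0: "0 \<le> ?g t" if "0 < t" for t
      by (intro tr_prod_nonneg pd_finv_psd pdA psd_gauss_kernel that)
    have gb: "?g t \<le> F * C * (1 + t powr (- \<nu> - 3 / 2))" if "0 < t" for t
      using trb[OF s(1) pdA _ le that] F by simp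
    let ?h = "\<lambda>t. indicator {0<..} t *\<^sub>R (mix_weight \<nu> \<alpha>\<^sub>0 t * ?g t) - indicator {0<..} t *\<^sub>R (mix_weight \<nu> \<alpha> t * ?g t)"
    have dev: "tr_prod n ?B (\<lambda>i j. kern \<nu> \<alpha>\<^sub>0 (s i - s j)) - real n = (LBINT t. ?h t)"
      unfolding tr_prod_finv[OF pdA, symmetric] integrable_mix_weight_tr(2)[OF assms(1,2)] integrable_mix_weight_tr(2)[OF assms(1) \<alpha>, of n ?B s]
      by (rule Bochner_Integration.integral_diff[symmetric]) (intro integrable_mix_weight_tr assms \<alpha>)+
    have hint: "integrable lborel ?h"
      by (intro Bochner_Integration.integrable_diff integrable_mix_weight_tr assms \<alpha>)
    \<comment> \<open>Three majorants: the mixture for \<alpha> itself, which integrates to n; the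
      weight at the smaller parameter, of mass a^(-2\<nu>); and t^(-3/2) beyond \<tau>, of mass 2
      \<tau>^(-1/2).\<close>
    let ?u1 = "\<lambda>t. indicator {0<..} t *\<^sub>R (mix_weight \<nu> \<alpha> t * ?g t)"
    let ?u2 = "\<lambda>t. indicator {0<..} t *\<^sub>R mix_weight \<nu> a t"
    let ?u3 = "\<lambda>t::real. t powr (- 3 / 2) * indicator {\<tau>..} t"
    have pt: "\<bar>?h t\<bar> \<le> 2 * b\<^sup>2 * \<tau> * ?u1 t + (F * C * ?u2 t + F * C * b\<^sup>2 / Gamma \<nu> * ?u3 t)" for t
    proof (cases "0 < t")
      case False then show ?thesis using F C G \<tau> by (simp add: indicator_def)
    next
      case True
      have sq: "a\<^sup>2 \<le> \<alpha>\<^sup>2" "a\<^sup>2 \<le> \<alpha>\<^sub>0\<^sup>2" "\<alpha>\<^sup>2 \<le> b\<^sup>2" "\<alpha>\<^sub>0\<^sup>2 \<le> b\<^sup>2"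
        using ab by (auto intro: power_mono)
      define w where "w = t powr (\<nu> - 1) / Gamma \<nu>"
      have w: "0 \<le> w" using G by (simp add: w_def)
      have mw: "mix_weight \<nu> \<beta> t = w * exp (- \<beta>\<^sup>2 * t)" for \<beta> by (simp add: mix_weight_def w_def)
      define \<Delta> where "\<Delta> = \<bar>exp (- \<alpha>\<^sub>0\<^sup>2 * t) - exp (- \<alpha>\<^sup>2 * t)\<bar>"
      have \<Delta>: "0 \<le> \<Delta>" by (simp add: \<Delta>_def)
      have h: "\<bar>?h t\<bar> = w * \<Delta> * ?g t"
      proof -
        have "?h t = w * (exp (- \<alpha>\<^sub>0\<^sup>2 * t) - exp (- \<alpha>\<^sup>2 * t)) * ?g t"
          using True by (simp add: mw algebra_simps)
        then show ?thesis using w g0[OF True] by (simp add: abs_mult \<Delta>_def)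
      qed
      show ?thesis
      proof (cases "t \<le> \<tau>")
        case le: True
        have "\<Delta> \<le> 2 * b\<^sup>2 * \<tau> * exp (- \<alpha>\<^sup>2 * t)"
          using sq True le b\<tau> unfolding \<Delta>_def by (intro exp_diff_le_rel) auto
        then have "w * \<Delta> * ?g t \<le> w * (2 * b\<^sup>2 * \<tau> * exp (- \<alpha>\<^sup>2 * t)) * ?g t"
          using w g0[OF True] by (intro mult_right_mono mult_left_mono)
        also have "\<dots> = 2 * b\<^sup>2 * \<tau> * ?u1 t" using True by (simp add: mw)
        also have "\<dots> \<le> 2 * b\<^sup>2 * \<tau> * ?u1 t + (F * C * ?u2 t + F * C * b\<^sup>2 / Gamma \<nu> * ?u3 t)"
          using F C G mix_weight_nonneg[OF assms(1)] by (simp add: indicator_def)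
        finally show ?thesis using h by simp
      next
        case False
        have d0: "\<Delta> \<le> exp (- a\<^sup>2 * t) - exp (- b\<^sup>2 * t)"
        proof -
          have "exp (- b\<^sup>2 * t) \<le> exp (- \<alpha>\<^sup>2 * t)" "exp (- \<alpha>\<^sup>2 * t) \<le> exp (- a\<^sup>2 * t)"
            "exp (- b\<^sup>2 * t) \<le> exp (- \<alpha>\<^sub>0\<^sup>2 * t)" "exp (- \<alpha>\<^sub>0\<^sup>2 * t) \<le> exp (- a\<^sup>2 * t)"
            using sq True by auto
          then show ?thesis unfolding \<Delta>_def by linarith
        qed
        then have d1: "\<Delta> \<le> exp (- a\<^sup>2 * t)" using exp_gt_zero[of "- b\<^sup>2 * t"] by linarith
        have d2: "\<Delta> \<le> b\<^sup>2 * t" using d0 exp_diff_le(1)[of t "a\<^sup>2" "b\<^sup>2"] True sq by simp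
        have "w * \<Delta> * ?g t \<le> w * \<Delta> * (F * C * (1 + t powr (- \<nu> - 3 / 2)))"
          using w \<Delta> by (intro mult_left_mono gb True) auto
        also have "\<dots> = F * C * (w * \<Delta>) + F * C * t powr (- \<nu> - 3 / 2) * (w * \<Delta>)"
          by (simp add: algebra_simps)
        \<comment> \<open>The constant 1 in the Gaussian trace bound is paired with \<Delta> <=
          exp(-a^2 t), the singular power with \<Delta> <= b^2 t. The extra factor t, together with
          t^(\<nu> - 1) in the weight, brings the exponent to -3/2.\<close>
        also have "\<dots> \<le> F * C * (w * exp (- a\<^sup>2 * t)) + F * C * t powr (- \<nu> - 3 / 2) * (w * (b\<^sup>2 * t))"
          using F C w d1 d2 by (intro add_mono mult_left_mono) auto
        also have "F * C * (w * exp (- a\<^sup>2 * t)) = F * C * ?u2 t" using True by (simp add: mw)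
        also have "F * C * t powr (- \<nu> - 3 / 2) * (w * (b\<^sup>2 * t)) = F * C * b\<^sup>2 / Gamma \<nu> * ?u3 t"
        proof -
          have "t powr (- \<nu> - 3 / 2) * (t powr (\<nu> - 1) * t) = t powr (- \<nu> - 3 / 2) * (t powr (\<nu> - 1) * t powr 1)" using True by simp
          also have "\<dots> = t powr (- 3 / 2)" unfolding powr_add[symmetric] by simp
          finally show ?thesis using False by (simp add: w_def mult_ac)
        qed
        also have "F * C * ?u2 t + F * C * b\<^sup>2 / Gamma \<nu> * ?u3 t \<le> 2 * b\<^sup>2 * \<tau> * ?u1 t + (F * C * ?u2 t + F * C * b\<^sup>2 / Gamma \<nu> * ?u3 t)"
          using mix_weight_nonneg[OF assms(1)] g0[OF True] \<tau> by (simp add: indicator_def)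
        finally show ?thesis using h by simp
      qed
    qed
    have u1: "(\<integral>\<^sup>+ t. ennreal (?u1 t) \<partial>lborel) = ennreal (real n)"
      unfolding tr_prod_finv[OF pdA, symmetric] integrable_mix_weight_tr(2)[OF assms(1) \<alpha>, of n ?B s]
      by (rule nn_integral_eq_integral[OF integrable_mix_weight_tr(1)[OF assms(1) \<alpha>]])
        (auto simp: indicator_def mix_weight_nonneg assms g0)
    have u2: "(\<integral>\<^sup>+ t. ennreal (?u2 t) \<partial>lborel) = ennreal (a powr (- 2 * \<nu>))"
      unfolding integral_mix_weight[OF assms(1) ab(1), symmetric] set_lebesgue_integral_def
      by (rule nn_integral_eq_integral)
        (use integrable_mix_weight[OF assms(1) ab(1)] mix_weight_nonneg[OF assms(1)] in \<open>auto simp: set_integrable_def\<close>)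
    have u3: "(\<integral>\<^sup>+ t. ennreal (?u3 t) \<partial>lborel) = ennreal (2 * \<tau> powr (- 1 / 2))"
      unfolding nn_integral_powr_tail[OF \<tau>, symmetric] by (intro nn_integral_cong) (auto simp: indicator_def)
    have nn: "0 \<le> ?u1 t" "0 \<le> ?u2 t" "0 \<le> ?u3 t" for t
      using mix_weight_nonneg[OF assms(1)] g0[of t] by (auto simp: indicator_def)
    have [measurable]: "(\<lambda>t. ?g t) \<in> borel_measurable borel" unfolding tr_prod_def by measurable
    define K1 where "K1 = 2 * b\<^sup>2 * \<tau>"
    define K2 where "K2 = F * C"
    define K3 where "K3 = F * C * b\<^sup>2 / Gamma \<nu>"
    have K: "0 \<le> K1" "0 \<le> K2" "0 \<le> K3" using F C G \<tau> by (auto simp: K1_def K2_def K3_def)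
    have "ennreal \<bar>LBINT t. ?h t\<bar> \<le> (\<integral>\<^sup>+ t. ennreal \<bar>?h t\<bar> \<partial>lborel)"
      using integral_norm_bound_ennreal[OF hint] by simp
    also have "\<dots> \<le> (\<integral>\<^sup>+ t. ennreal K1 * ennreal (?u1 t) + (ennreal K2 * ennreal (?u2 t) + ennreal K3 * ennreal (?u3 t)) \<partial>lborel)"
    proof (intro nn_integral_mono)
      fix t
      have "ennreal \<bar>?h t\<bar> \<le> ennreal (K1 * ?u1 t + (K2 * ?u2 t + K3 * ?u3 t))" unfolding K1_def K2_def K3_def by (intro ennreal_leI pt)
      also have "\<dots> = ennreal K1 * ennreal (?u1 t) + (ennreal K2 * ennreal (?u2 t) + ennreal K3 * ennreal (?u3 t))"
        using K nn[of t] by (simp only: ennreal_plus ennreal_mult add_nonneg_nonneg mult_nonneg_nonneg)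
      finally show "ennreal \<bar>?h t\<bar> \<le> ennreal K1 * ennreal (?u1 t) + (ennreal K2 * ennreal (?u2 t) + ennreal K3 * ennreal (?u3 t))" .
    qed
    also have "\<dots> = ennreal K1 * ennreal (real n) + (ennreal K2 * ennreal (a powr (- 2 * \<nu>)) + ennreal K3 * ennreal (2 * \<tau> powr (- 1 / 2)))"
      unfolding u1[symmetric] u2[symmetric] u3[symmetric]
      by (simp add: nn_integral_add nn_integral_cmult)
    also have "\<dots> = ennreal (K1 * n + (K2 * a powr (- 2 * \<nu>) + K3 * (2 * \<tau> powr (- 1 / 2))))"
      using K by (simp only: ennreal_plus ennreal_mult add_nonneg_nonneg mult_nonneg_nonneg powr_ge_zero of_nat_0_le_iff zero_le_numeral)
    finally have "\<bar>LBINT t. ?h t\<bar> \<le> K1 * n + (K2 * a powr (- 2 * \<nu>) + K3 * (2 * \<tau> powr (- 1 / 2)))"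
      using K by (subst (asm) ennreal_le_iff) (auto intro!: add_nonneg_nonneg mult_nonneg_nonneg)
    also have "\<dots> \<le> K1 * n + D * b powr ?p * (a powr (- 2 * \<nu>) + b\<^sup>2 * \<tau> powr (- 1 / 2))"
    proof -
      have FC: "F * C * (1 + 2 / Gamma \<nu>) = D * b powr ?p"
        using ab assms(2) by (simp only: F_def D_def powr_divide powr_minus_divide less_imp_le) simp
      have "K2 * a powr (- 2 * \<nu>) + K3 * (2 * \<tau> powr (- 1 / 2)) = F * C * (1 * a powr (- 2 * \<nu>) + 2 / Gamma \<nu> * (b\<^sup>2 * \<tau> powr (- 1 / 2)))"
        by (simp add: K2_def K3_def algebra_simps)
      also have "\<dots> \<le> F * C * ((1 + 2 / Gamma \<nu>) * a powr (- 2 * \<nu>) + (1 + 2 / Gamma \<nu>) * (b\<^sup>2 * \<tau> powr (- 1 / 2)))"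
        using F C G by (intro mult_left_mono add_mono mult_right_mono) auto
      also have "\<dots> = D * b powr ?p * (a powr (- 2 * \<nu>) + b\<^sup>2 * \<tau> powr (- 1 / 2))"
        unfolding FC[symmetric] by (simp add: algebra_simps)
      finally show ?thesis by simp
    qed
    finally show "\<bar>tr_prod n ?B (\<lambda>i j. kern \<nu> \<alpha>\<^sub>0 (s i - s j)) - real n\<bar> \<le>
       2 * (max \<alpha> \<alpha>\<^sub>0)\<^sup>2 * \<tau> * n + D * (max \<alpha> \<alpha>\<^sub>0) powr ?p * ((min \<alpha> \<alpha>\<^sub>0) powr (- 2 * \<nu>) + (max \<alpha> \<alpha>\<^sub>0)\<^sup>2 * \<tau> powr (- 1 / 2))"
      unfolding dev by (simp only: a_def b_def K1_def)
  qed
qed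

section \<open>Chi-square concentration of Gaussian quadratic forms\<close>

definition centred_normal :: "'w measure \<Rightarrow> ('w \<Rightarrow> real) \<Rightarrow> real \<Rightarrow> bool" where
  "centred_normal M X v \<longleftrightarrow> X \<in> borel_measurable M \<and>
     ((v = 0 \<and> (AE \<omega> in M. X \<omega> = 0)) \<or>
      (0 < v \<and> distributed M lborel X (\<lambda>x. ennreal (normal_density 0 (sqrt v) x))))"

lemma centred_normal_measurable: "centred_normal M X v \<Longrightarrow> X \<in> borel_measurable M"
  by (simp add: centred_normal_def)

lemma centred_normal_nonneg: "centred_normal M X v \<Longrightarrow> 0 \<le> v"
  by (auto simp: centred_normal_def)

lemma nn_integral_normal_density:
  "0 < \<sigma> \<Longrightarrow> (\<integral>\<^sup>+ x. ennreal (normal_density \<mu> \<sigma> x) \<partial>lborel) = 1"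
  by (subst nn_integral_eq_integral) (auto simp: integral_normal_density)

lemma (in prob_space) centred_normal_exp:
  assumes "centred_normal M X v"
  shows "(\<integral>\<^sup>+ \<omega>. ennreal (exp (X \<omega>)) \<partial>M) = ennreal (exp (v / 2))"
proof (cases "v = 0")
  case True
  then have "AE \<omega> in M. X \<omega> = 0" using assms by (auto simp: centred_normal_def)
  then have "(\<integral>\<^sup>+ \<omega>. ennreal (exp (X \<omega>)) \<partial>M) = (\<integral>\<^sup>+ \<omega>. 1 \<partial>M)"
    by (intro nn_integral_cong_AE) (auto elim!: eventually_mono)
  then show ?thesis using True by (simp add: emeasure_space_1)
next
  case False
  then have v: "0 < v" and D: "distributed M lborel X (\<lambda>x. ennreal (normal_density 0 (sqrt v) x))"
    using assms by (auto simp: centred_normal_def)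
  have eq: "normal_density 0 (sqrt v) x * exp x = exp (v / 2) * normal_density v (sqrt v) x" for x
  proof -
    have "- (x\<^sup>2) / (2 * v) + x = v / 2 - (x - v)\<^sup>2 / (2 * v)"
      using v by (simp add: field_simps power2_eq_square)
    then have "exp (- (x\<^sup>2) / (2 * v)) * exp x = exp (v / 2) * exp (- (x - v)\<^sup>2 / (2 * v))"
      by (simp add: exp_add[symmetric])
    then show ?thesis using v by (simp add: normal_density_def)
  qed
  have "(\<integral>\<^sup>+ \<omega>. ennreal (exp (X \<omega>)) \<partial>M) = (\<integral>\<^sup>+ x. ennreal (normal_density 0 (sqrt v) x) * ennreal (exp x) \<partial>lborel)"
    by (rule distributed_nn_integral[OF D, symmetric]) simp
  also have "\<dots> = (\<integral>\<^sup>+ x. ennreal (exp (v / 2)) * ennreal (normal_density v (sqrt v) x) \<partial>lborel)"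
    by (simp add: ennreal_mult[symmetric] eq)
  also have "\<dots> = ennreal (exp (v / 2))"
    using v by (subst nn_integral_cmult) (auto simp: nn_integral_normal_density)
  finally show ?thesis .
qed

lemma (in prob_space) centred_normal_iexp:
  assumes "centred_normal M X v"
  shows "(LINT \<omega>|M. iexp (X \<omega>)) = complex_of_real (exp (- v / 2))"
proof (cases "v = 0")
  case True
  have [measurable]: "X \<in> borel_measurable M" using assms by (simp add: centred_normal_def)
  from True have "AE \<omega> in M. X \<omega> = 0" using assms by (auto simp: centred_normal_def)
  then have "(LINT \<omega>|M. iexp (X \<omega>)) = (LINT \<omega>|M. 1)"
    by (intro integral_cong_AE) (auto elim!: eventually_mono)
  then show ?thesis using True by (simp add: prob_space)
next
  case False
  then have v: "0 < v" and D: "distributed M lborel X (\<lambda>x. ennreal (normal_density 0 (sqrt v) x))"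
    using assms by (auto simp: centred_normal_def)
  have [measurable]: "X \<in> borel_measurable M" using assms by (simp add: centred_normal_def)
  have "(LINT \<omega>|M. iexp (X \<omega>)) = (LINT x|distr M lborel X. iexp x)"
    by (subst integral_distr) auto
  also have "distr M lborel X = density lborel (\<lambda>x. ennreal (normal_density 0 (sqrt v) x))"
    using D by (simp add: distributed_def)
  also have "(LINT x|density lborel (\<lambda>x. ennreal (normal_density 0 (sqrt v) x)). iexp x) = (CLBINT x. normal_density 0 (sqrt v) x *\<^sub>R iexp x)"
    by (subst integral_density) auto
  also have "\<dots> = complex_of_real (exp (- v / 2))"
    using normal_iexp(2)[of "sqrt v" 1] v by (simp add: scaleR_conv_of_real)
  finally show ?thesis .
qed

text \<open>The coefficient 1/(4v) is half the critical value 1/(2v), so the exponential only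
  doubles the variance in the density.\<close>

lemma (in prob_space) centred_normal_exp_square:
  assumes "centred_normal M X v" "0 < v"
  shows "(\<integral>\<^sup>+ \<omega>. ennreal (exp ((X \<omega>)\<^sup>2 / (4 * v))) \<partial>M) = ennreal (sqrt 2)"
proof -
  have D: "distributed M lborel X (\<lambda>x. ennreal (normal_density 0 (sqrt v) x))"
    using assms by (auto simp: centred_normal_def)
  have eq: "normal_density 0 (sqrt v) x * exp (x\<^sup>2 / (4 * v)) = sqrt 2 * normal_density 0 (sqrt (2 * v)) x" for x
  proof -
    have "- (x\<^sup>2) / (2 * v) + x\<^sup>2 / (4 * v) = - (x\<^sup>2) / (4 * v)"
      using assms(2) by (simp add: field_simps)
    then have "exp (- (x\<^sup>2) / (2 * v)) * exp (x\<^sup>2 / (4 * v)) = exp (- (x\<^sup>2) / (4 * v))"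
      by (simp only: exp_add[symmetric])
    then show ?thesis using assms(2) by (simp add: normal_density_def real_sqrt_mult power_mult_distrib field_simps)
  qed
  have "(\<integral>\<^sup>+ \<omega>. ennreal (exp ((X \<omega>)\<^sup>2 / (4 * v))) \<partial>M) = (\<integral>\<^sup>+ x. ennreal (normal_density 0 (sqrt v) x) * ennreal (exp (x\<^sup>2 / (4 * v))) \<partial>lborel)"
    by (rule distributed_nn_integral[OF D, symmetric]) simp
  also have "\<dots> = (\<integral>\<^sup>+ x. ennreal (sqrt 2) * ennreal (normal_density 0 (sqrt (2 * v)) x) \<partial>lborel)"
    by (simp add: ennreal_mult[symmetric] eq)
  also have "\<dots> = ennreal (sqrt 2)"
    using assms(2) by (subst nn_integral_cmult) (auto simp: nn_integral_normal_density)
  finally show ?thesis .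
qed

section \<open>Standard normal families and chi-square tails\<close>

lemma std_normal_exp_mix:
  "(\<integral>\<^sup>+ g. ennreal (std_normal_density g * exp (g * z)) \<partial>lborel) = ennreal (exp (z\<^sup>2 / 2))"
proof -
  have eq: "std_normal_density g * exp (g * z) = exp (z\<^sup>2 / 2) * normal_density z 1 g" for g
  proof -
    have "- (g\<^sup>2) / 2 + g * z = z\<^sup>2 / 2 - (g - z)\<^sup>2 / 2"
      by (simp add: field_simps power2_eq_square)
    then have "exp (- (g\<^sup>2) / 2) * exp (g * z) = exp (z\<^sup>2 / 2) * exp (- (g - z)\<^sup>2 / 2)"
      by (simp add: exp_add[symmetric])
    then show ?thesis by (simp add: normal_density_def)
  qed
  show ?thesis unfolding eq
    by (simp add: ennreal_mult nn_integral_cmult nn_integral_normal_density)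
qed

lemma std_normal_exp_square:
  assumes "s < 1 / 2"
  shows "(\<integral>\<^sup>+ g. ennreal (std_normal_density g * exp (s * g\<^sup>2)) \<partial>lborel) = ennreal (1 / sqrt (1 - 2 * s))"
proof -
  define r where "r = 1 / sqrt (1 - 2 * s)"
  have p: "0 < 1 - 2 * s" using assms by simp
  then have r: "0 < r" by (simp add: r_def)
  have eq: "std_normal_density g * exp (s * g\<^sup>2) = r * normal_density 0 r g" for g
  proof -
    have "exp (- (g\<^sup>2) / 2) * exp (s * g\<^sup>2) = exp (- (g\<^sup>2) * (1 - 2 * s) / 2)"
      by (simp add: exp_add[symmetric] field_simps)
    then show ?thesis using p by (simp add: r_def normal_density_def real_sqrt_divide power_divide)
  qed
  have "(\<integral>\<^sup>+ g. ennreal (r * normal_density 0 r g) \<partial>lborel) = (\<integral>\<^sup>+ g. ennreal r * ennreal (normal_density 0 r g) \<partial>lborel)"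
    using r by (intro nn_integral_cong ennreal_mult) auto
  also have "\<dots> = ennreal r" using r by (subst nn_integral_cmult) (auto simp: nn_integral_normal_density)
  finally show ?thesis unfolding eq by (simp only: r_def)
qed

text \<open>Joint standard normality in Cramer-Wold form, prescribing the law of every linear
  combination; this is the information that a Gaussian process provides directly.\<close>

definition std_family :: "'w measure \<Rightarrow> nat \<Rightarrow> (nat \<Rightarrow> 'w \<Rightarrow> real) \<Rightarrow> bool" where
  "std_family M n Z \<longleftrightarrow> (\<forall>k<n. Z k \<in> borel_measurable M) \<and>
    (\<forall>b. centred_normal M (\<lambda>\<omega>. \<Sum>k<n. b k * Z k \<omega>) (\<Sum>k<n. (b k)\<^sup>2))"

lemma sum_Suc_split:
  fixes f g :: "nat \<Rightarrow> real"
  assumes "m < n" shows "(\<Sum>k\<in>{m..<n}. f k) = f m + (\<Sum>k\<in>{Suc m..<n}. f k)"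
  using assms by (simp add: sum.atLeast_Suc_lessThan)

text \<open>The square $e^{s z^2}$ is a Gaussian mixture of $e^{\sqrt{2s} g z}$, so that the transform of a sum of
  squares only involves the laws of linear combinations; independence is never used.\<close>
lemma (in prob_space) std_family_exp:
  assumes Z: "std_family M n Z" and s: "0 \<le> s" "s < 1 / 2" and "m \<le> n"
  shows "(\<integral>\<^sup>+ \<omega>. ennreal (exp (s * (\<Sum>k<m. (Z k \<omega>)\<^sup>2) + (\<Sum>k\<in>{m..<n}. b k * Z k \<omega>))) \<partial>M)
    = ennreal ((1 / sqrt (1 - 2 * s)) ^ m * exp ((\<Sum>k\<in>{m..<n}. (b k)\<^sup>2) / 2))"
  using assms(4)
proof (induction m arbitrary: b)
  case 0
  have "centred_normal M (\<lambda>\<omega>. \<Sum>k<n. b k * Z k \<omega>) (\<Sum>k<n. (b k)\<^sup>2)" using Z by (simp add: std_family_def)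
  from centred_normal_exp[OF this] show ?case by (simp add: atLeast0LessThan)
next
  case (Suc m)
  then have mn: "m < n" by simp
  have [measurable]: "Z k \<in> borel_measurable M" if "k < n" for k using Z that by (simp add: std_family_def)
  have Zm [measurable]: "Z m \<in> borel_measurable M" using mn by measurable
  let ?r = "sqrt (2 * s)"
  define T where "T \<omega> = s * (\<Sum>k<m. (Z k \<omega>)\<^sup>2) + (\<Sum>k\<in>{Suc m..<n}. b k * Z k \<omega>)" for \<omega>
  let ?B = "\<Sum>k\<in>{Suc m..<n}. (b k)\<^sup>2"
  have Tm [measurable]: "T \<in> borel_measurable M" unfolding T_def
    using mn by (intro borel_measurable_add borel_measurable_times borel_measurable_sum borel_measurable_power) auto
  interpret P: pair_sigma_finite "lborel :: real measure" M ..
  \<comment> \<open>The mixing variable g replaces the square of \<open>Z m\<close> by a linear term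
    with coefficient sqrt(2s) g, so the induction hypothesis applies with an updated coefficient
    vector.\<close>
  have upd: "(\<Sum>k\<in>{m..<n}. (b(m := ?r * g)) k * Z k \<omega>) = ?r * g * Z m \<omega> + (\<Sum>k\<in>{Suc m..<n}. b k * Z k \<omega>)"
    and updsq: "(\<Sum>k\<in>{m..<n}. ((b(m := ?r * g)) k)\<^sup>2) = 2 * s * g\<^sup>2 + ?B" for g \<omega>
    using s by (simp_all add: sum_Suc_split[OF mn] power_mult_distrib)
  have "(\<integral>\<^sup>+ \<omega>. ennreal (exp (s * (\<Sum>k<Suc m. (Z k \<omega>)\<^sup>2) + (\<Sum>k\<in>{Suc m..<n}. b k * Z k \<omega>))) \<partial>M)
     = (\<integral>\<^sup>+ \<omega>. \<integral>\<^sup>+ g. ennreal (std_normal_density g * exp (T \<omega> + ?r * g * Z m \<omega>)) \<partial>lborel \<partial>M)"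
  proof (intro nn_integral_cong)
    fix \<omega>
    have "(\<integral>\<^sup>+ g. ennreal (std_normal_density g * exp (T \<omega> + ?r * g * Z m \<omega>)) \<partial>lborel) =
      (\<integral>\<^sup>+ g. ennreal (exp (T \<omega>)) * ennreal (std_normal_density g * exp (g * (?r * Z m \<omega>))) \<partial>lborel)"
      by (intro nn_integral_cong) (simp add: ennreal_mult[symmetric] exp_add mult_ac)
    also have "\<dots> = ennreal (exp (T \<omega>)) * ennreal (exp ((?r * Z m \<omega>)\<^sup>2 / 2))"
      by (subst nn_integral_cmult) (auto simp: std_normal_exp_mix)
    also have "\<dots> = ennreal (exp (s * (\<Sum>k<Suc m. (Z k \<omega>)\<^sup>2) + (\<Sum>k\<in>{Suc m..<n}. b k * Z k \<omega>)))"
      using s by (simp add: T_def ennreal_mult[symmetric] exp_add[symmetric] power_mult_distrib algebra_simps)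
    finally show "ennreal (exp (s * (\<Sum>k<Suc m. (Z k \<omega>)\<^sup>2) + (\<Sum>k\<in>{Suc m..<n}. b k * Z k \<omega>))) =
      (\<integral>\<^sup>+ g. ennreal (std_normal_density g * exp (T \<omega> + ?r * g * Z m \<omega>)) \<partial>lborel)" ..
  qed
  also have "\<dots> = (\<integral>\<^sup>+ g. \<integral>\<^sup>+ \<omega>. ennreal (std_normal_density g * exp (T \<omega> + ?r * g * Z m \<omega>)) \<partial>M \<partial>lborel)"
    by (rule P.Fubini') measurable
  also have "\<dots> = (\<integral>\<^sup>+ g. ennreal ((1 / sqrt (1 - 2 * s)) ^ m * exp (?B / 2)) * ennreal (std_normal_density g * exp (s * g\<^sup>2)) \<partial>lborel)"
  proof (intro nn_integral_cong)
    fix g :: real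
    have "(\<integral>\<^sup>+ \<omega>. ennreal (std_normal_density g * exp (T \<omega> + ?r * g * Z m \<omega>)) \<partial>M) =
      ennreal (std_normal_density g) * (\<integral>\<^sup>+ \<omega>. ennreal (exp (s * (\<Sum>k<m. (Z k \<omega>)\<^sup>2) + (\<Sum>k\<in>{m..<n}. (b(m := ?r * g)) k * Z k \<omega>))) \<partial>M)"
    proof -
      have "s * (\<Sum>k<m. (Z k \<omega>)\<^sup>2) + (\<Sum>k\<in>{m..<n}. (b(m := ?r * g)) k * Z k \<omega>) = T \<omega> + ?r * g * Z m \<omega>" for \<omega>
        unfolding upd T_def by simp
      then show ?thesis by (subst nn_integral_cmult[symmetric]) (auto simp: ennreal_mult[symmetric])
    qed
    also have "\<dots> = ennreal (std_normal_density g) * ennreal ((1 / sqrt (1 - 2 * s)) ^ m * exp ((2 * s * g\<^sup>2 + ?B) / 2))"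
      using Suc.IH[of "b(m := ?r * g)"] mn unfolding updsq by simp
    also have "\<dots> = ennreal ((1 / sqrt (1 - 2 * s)) ^ m * exp (?B / 2)) * ennreal (std_normal_density g * exp (s * g\<^sup>2))"
      using s by (simp add: ennreal_mult[symmetric] exp_add add_divide_distrib mult_ac)
    finally show "(\<integral>\<^sup>+ \<omega>. ennreal (std_normal_density g * exp (T \<omega> + ?r * g * Z m \<omega>)) \<partial>M) = 
      ennreal ((1 / sqrt (1 - 2 * s)) ^ m * exp (?B / 2)) * ennreal (std_normal_density g * exp (s * g\<^sup>2))" .
  qed
  also have "\<dots> = ennreal ((1 / sqrt (1 - 2 * s)) ^ m * exp (?B / 2)) * ennreal (1 / sqrt (1 - 2 * s))"
    by (subst nn_integral_cmult) (use s in \<open>simp_all add: std_normal_exp_square\<close>)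
  also have "\<dots> = ennreal ((1 / sqrt (1 - 2 * s)) ^ Suc m * exp (?B / 2))"
    using s by (subst ennreal_mult[symmetric]) (auto simp: mult_ac)
  finally show ?case .
qed

lemma std_normal_iexp_mix:
  "(CLBINT g. of_real (std_normal_density g) * iexp (g * z)) = of_real (exp (- (z\<^sup>2) / 2))"
  and std_normal_iexp_integrable: "integrable lborel (\<lambda>g. complex_of_real (std_normal_density g) * iexp (g * z))"
  using normal_iexp[of 1 z] by simp_all

text \<open>With a negative sign the square is a Gaussian mixture of e^(i sqrt(2s) g z). The
  integrands become complex but stay bounded by the normal density in g, so Fubini's theorem applies
  for every s >= 0.\<close>

lemma (in prob_space) std_family_exp_neg:
  assumes Z: "std_family M n Z" and s: "0 \<le> s" and "m \<le> n"
  shows "(LINT \<omega>|M. of_real (exp (- s * (\<Sum>k<m. (Z k \<omega>)\<^sup>2))) * iexp (\<Sum>k\<in>{m..<n}. b k * Z k \<omega>))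
    = complex_of_real ((1 / sqrt (1 + 2 * s)) ^ m * exp (- (\<Sum>k\<in>{m..<n}. (b k)\<^sup>2) / 2))"
  using assms(3)
proof (induction m arbitrary: b)
  case 0
  have "centred_normal M (\<lambda>\<omega>. \<Sum>k<n. b k * Z k \<omega>) (\<Sum>k<n. (b k)\<^sup>2)" using Z by (simp add: std_family_def)
  from centred_normal_iexp[OF this] show ?case by (simp add: atLeast0LessThan)
next
  case (Suc m)
  then have mn: "m < n" by simp
  have [measurable]: "Z k \<in> borel_measurable M" if "k < n" for k using Z that by (simp add: std_family_def)
  have Zm [measurable]: "Z m \<in> borel_measurable M" using mn by measurable
  let ?r = "sqrt (2 * s)"
  define E where "E \<omega> = exp (- s * (\<Sum>k<m. (Z k \<omega>)\<^sup>2))" for \<omega>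
  define L where "L \<omega> = (\<Sum>k\<in>{Suc m..<n}. b k * Z k \<omega>)" for \<omega>
  let ?B = "\<Sum>k\<in>{Suc m..<n}. (b k)\<^sup>2"
  have [measurable]: "(\<lambda>\<omega>. \<Sum>k<m. (Z k \<omega>)\<^sup>2) \<in> borel_measurable M"
    using mn by (intro borel_measurable_sum borel_measurable_power) auto
  have [measurable]: "E \<in> borel_measurable M" unfolding E_def by measurable
  have [measurable]: "L \<in> borel_measurable M" unfolding L_def
    using mn by (intro borel_measurable_times borel_measurable_sum) auto
  have E1: "0 \<le> E \<omega>" "E \<omega> \<le> 1" for \<omega> using s by (auto simp: E_def intro!: mult_nonneg_nonneg sum_nonneg)
  interpret P: pair_sigma_finite "lborel :: real measure" M ..
  have upd: "(\<Sum>k\<in>{m..<n}. (b(m := ?r * g)) k * Z k \<omega>) = g * (?r * Z m \<omega>) + L \<omega>"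
    and updsq: "(\<Sum>k\<in>{m..<n}. ((b(m := ?r * g)) k)\<^sup>2) = 2 * s * g\<^sup>2 + ?B" for g \<omega>
    using s by (simp_all add: sum_Suc_split[OF mn] power_mult_distrib L_def)
  let ?F = "\<lambda>g \<omega>. complex_of_real (E \<omega>) * iexp (L \<omega>) * (of_real (std_normal_density g) * iexp (g * (?r * Z m \<omega>)))"
  have "(LINT \<omega>|M. of_real (exp (- s * (\<Sum>k<Suc m. (Z k \<omega>)\<^sup>2))) * iexp (\<Sum>k\<in>{Suc m..<n}. b k * Z k \<omega>))
     = (LINT \<omega>|M. CLBINT g. ?F g \<omega>)"
  proof (intro Bochner_Integration.integral_cong refl)
    fix \<omega>
    have "(CLBINT g. ?F g \<omega>) = complex_of_real (E \<omega>) * iexp (L \<omega>) * of_real (exp (- ((?r * Z m \<omega>)\<^sup>2) / 2))"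
      unfolding std_normal_iexp_mix[symmetric] by (rule integral_mult_right_zero)
    moreover have "E \<omega> * exp (- ((?r * Z m \<omega>)\<^sup>2) / 2) = exp (- s * (\<Sum>k<Suc m. (Z k \<omega>)\<^sup>2))"
      using s by (simp add: E_def exp_add[symmetric] power_mult_distrib algebra_simps)
    ultimately have "(CLBINT g. ?F g \<omega>) = of_real (exp (- s * (\<Sum>k<Suc m. (Z k \<omega>)\<^sup>2))) * iexp (L \<omega>)"
      by (metis (no_types, lifting) mult.assoc mult.commute of_real_mult)
    then show "of_real (exp (- s * (\<Sum>k<Suc m. (Z k \<omega>)\<^sup>2))) * iexp (\<Sum>k\<in>{Suc m..<n}. b k * Z k \<omega>) = (CLBINT g. ?F g \<omega>)"
      by (simp only: L_def)
  qed
  also have "\<dots> = (CLBINT g. LINT \<omega>|M. ?F g \<omega>)"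
  proof (rule P.Fubini_integral)
    show "integrable (lborel \<Otimes>\<^sub>M M) (\<lambda>(g, \<omega>). ?F g \<omega>)"
    proof (rule P.Fubini_integrable)
      show "(\<lambda>(g, \<omega>). ?F g \<omega>) \<in> borel_measurable (lborel \<Otimes>\<^sub>M M)" by measurable
      show "AE g in lborel. integrable M (\<lambda>\<omega>. case (g, \<omega>) of (g, \<omega>) \<Rightarrow> ?F g \<omega>)"
      proof (intro AE_I2)
        fix g :: real
        show "integrable M (\<lambda>\<omega>. case (g, \<omega>) of (g, \<omega>) \<Rightarrow> ?F g \<omega>)"
          by (rule integrable_const_bound[of _ "std_normal_density g"])
            (use E1 in \<open>auto simp: norm_mult intro!: mult_left_le_one_le\<close>)
      qed
      show "integrable lborel (\<lambda>g. LINT \<omega>|M. norm (case (g, \<omega>) of (g, \<omega>) \<Rightarrow> ?F g \<omega>))"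
      proof -
        have "(LINT \<omega>|M. norm (?F g \<omega>)) = (LINT \<omega>|M. E \<omega>) * std_normal_density g" for g
          using E1 by (simp add: norm_mult)
        then show ?thesis by simp
      qed
    qed
  qed
  also have "\<dots> = (CLBINT g. of_real ((1 / sqrt (1 + 2 * s)) ^ m * exp (- ?B / 2)) * of_real (std_normal_density g * exp (- s * g\<^sup>2)))"
  proof (intro Bochner_Integration.integral_cong refl)
    fix g :: real
    have "(LINT \<omega>|M. ?F g \<omega>) = (LINT \<omega>|M. of_real (std_normal_density g) * (of_real (E \<omega>) * iexp (\<Sum>k\<in>{m..<n}. (b(m := ?r * g)) k * Z k \<omega>)))"
      unfolding upd by (intro Bochner_Integration.integral_cong refl) (simp add: exp_add distrib_left mult_ac)
    also have "\<dots> = of_real (std_normal_density g) * (LINT \<omega>|M. (of_real (E \<omega>) * iexp (\<Sum>k\<in>{m..<n}. (b(m := ?r * g)) k * Z k \<omega>)))"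
      by (rule integral_mult_right_zero)
    also have "(LINT \<omega>|M. (of_real (E \<omega>) * iexp (\<Sum>k\<in>{m..<n}. (b(m := ?r * g)) k * Z k \<omega>))) =
       of_real ((1 / sqrt (1 + 2 * s)) ^ m * exp (- (2 * s * g\<^sup>2 + ?B) / 2))"
      unfolding E_def updsq[symmetric] by (rule Suc.IH) (use mn in simp)
    also have "of_real (std_normal_density g) * complex_of_real ((1 / sqrt (1 + 2 * s)) ^ m * exp (- (2 * s * g\<^sup>2 + ?B) / 2)) = 
       of_real (std_normal_density g * ((1 / sqrt (1 + 2 * s)) ^ m * exp (- (2 * s * g\<^sup>2 + ?B) / 2)))"
      by (simp only: of_real_mult)
    also have "std_normal_density g * ((1 / sqrt (1 + 2 * s)) ^ m * exp (- (2 * s * g\<^sup>2 + ?B) / 2)) =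
       ((1 / sqrt (1 + 2 * s)) ^ m * exp (- ?B / 2)) * (std_normal_density g * exp (- s * g\<^sup>2))"
    proof -
      have "exp (- (2 * s * g\<^sup>2 + ?B) / 2) = exp (- ?B / 2) * exp (- s * g\<^sup>2)"
        by (simp add: exp_add[symmetric] field_simps)
      then show ?thesis by (simp only: mult_ac)
    qed
    finally show "(LINT \<omega>|M. ?F g \<omega>) = of_real ((1 / sqrt (1 + 2 * s)) ^ m * exp (- ?B / 2)) * of_real (std_normal_density g * exp (- s * g\<^sup>2))"
      by (simp only: of_real_mult)
  qed
  also have "\<dots> = of_real ((1 / sqrt (1 + 2 * s)) ^ m * exp (- ?B / 2)) * (CLBINT g. of_real (std_normal_density g * exp (- s * g\<^sup>2)))"
    by (rule integral_mult_right_zero)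
  also have "(CLBINT g. complex_of_real (std_normal_density g * exp (- s * g\<^sup>2))) = of_real (LBINT g. std_normal_density g * exp (- s * g\<^sup>2))"
    by (rule integral_complex_of_real)
  also have "(LBINT g. std_normal_density g * exp (- s * g\<^sup>2)) = 1 / sqrt (1 + 2 * s)"
    using std_normal_exp_square[of "- s"] s by (subst integral_eq_nn_integral) auto
  finally show ?case by (simp add: mult_ac)
qed


lemma (in prob_space) prob_le_of_nn_integral:
  assumes [measurable]: "X \<in> borel_measurable M" and "(\<integral>\<^sup>+ \<omega>. ennreal (exp (X \<omega>)) \<partial>M) \<le> ennreal K" "0 \<le> K"
  shows "prob {\<omega> \<in> space M. x \<le> X \<omega>} \<le> K * exp (- x)"
proof -
  have "emeasure M {\<omega> \<in> space M. 1 \<le> ennreal (exp (- x)) * ennreal (exp (X \<omega>))} \<le> ennreal (exp (- x)) * (\<integral>\<^sup>+ \<omega>. ennreal (exp (X \<omega>)) * indicator (space M) \<omega> \<partial>M)"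
    by (rule nn_integral_Markov_inequality) auto
  also have "(\<integral>\<^sup>+ \<omega>. ennreal (exp (X \<omega>)) * indicator (space M) \<omega> \<partial>M) = (\<integral>\<^sup>+ \<omega>. ennreal (exp (X \<omega>)) \<partial>M)"
    by (intro nn_integral_cong) auto
  also have "ennreal (exp (- x)) * (\<integral>\<^sup>+ \<omega>. ennreal (exp (X \<omega>)) \<partial>M) \<le> ennreal (exp (- x)) * ennreal K"
    by (intro mult_left_mono assms) auto
  also have "\<dots> = ennreal (K * exp (- x))" using assms(3) by (simp add: ennreal_mult[symmetric] mult.commute)
  also have "{\<omega> \<in> space M. 1 \<le> ennreal (exp (- x)) * ennreal (exp (X \<omega>))} = {\<omega> \<in> space M. x \<le> X \<omega>}"
    by (auto simp: ennreal_mult[symmetric] exp_add[symmetric] ennreal_1[symmetric] simp del: ennreal_1)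
  finally show ?thesis using assms(3) by (simp add: emeasure_eq_measure)
qed

lemma (in prob_space) std_family_measurable:
  assumes "std_family M n Z" shows "(\<lambda>\<omega>. \<Sum>k<n. (Z k \<omega>)\<^sup>2) \<in> borel_measurable M"
  using assms by (intro borel_measurable_sum borel_measurable_power) (auto simp: std_family_def)

text \<open>Chernoff bound with -ln(1 - 2s)/2 <= s + 4 s^2 for s <= 1/4. The parameter s stays free
  here and is later taken as 2/sqrt n.\<close>

lemma (in prob_space) std_family_upper_tail:
  assumes Z: "std_family M n Z" and s: "0 \<le> s" "s \<le> 1 / 4"
  shows "prob {\<omega> \<in> space M. real n + u \<le> (\<Sum>k<n. (Z k \<omega>)\<^sup>2)} \<le> exp (4 * real n * s\<^sup>2 - s * u)"
proof (cases "s = 0")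
  case False
  with s have s0: "0 < s" by simp
  note [measurable] = std_family_measurable[OF Z]
  have p: "0 < 1 - 2 * s" using s by simp
  have b: "(1 / sqrt (1 - 2 * s)) ^ n \<le> exp (real n * (s + 4 * s\<^sup>2))"
  proof -
    have "- (2 * s) - 2 * (2 * s)\<^sup>2 \<le> ln (1 - 2 * s)"
      by (rule ln_one_minus_pos_lower_bound) (use s in auto)
    then have "- (s + 4 * s\<^sup>2) \<le> ln (sqrt (1 - 2 * s))"
      using p by (simp add: ln_sqrt power_mult_distrib)
    then have "exp (- (s + 4 * s\<^sup>2)) \<le> sqrt (1 - 2 * s)" using p by (subst (asm) ln_ge_iff) auto
    moreover have "exp (s + 4 * s\<^sup>2) = 1 / exp (- (s + 4 * s\<^sup>2))" by (simp only: exp_minus inverse_eq_divide) simp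
    ultimately have "1 / sqrt (1 - 2 * s) \<le> exp (s + 4 * s\<^sup>2)"
      using p by (simp add: frac_le)
    then have "(1 / sqrt (1 - 2 * s)) ^ n \<le> exp (s + 4 * s\<^sup>2) ^ n" using p by (intro power_mono) auto
    then show ?thesis by (simp add: exp_of_nat_mult)
  qed
  have "prob {\<omega> \<in> space M. s * (real n + u) \<le> s * (\<Sum>k<n. (Z k \<omega>)\<^sup>2)} \<le> exp (real n * (s + 4 * s\<^sup>2)) * exp (- (s * (real n + u)))"
  proof (rule prob_le_of_nn_integral)
    have "(\<integral>\<^sup>+ \<omega>. ennreal (exp (s * (\<Sum>k<n. (Z k \<omega>)\<^sup>2))) \<partial>M) = ennreal ((1 / sqrt (1 - 2 * s)) ^ n)"
      using std_family_exp[OF Z s(1) _ order_refl] s by simp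
    then show "(\<integral>\<^sup>+ \<omega>. ennreal (exp (s * (\<Sum>k<n. (Z k \<omega>)\<^sup>2))) \<partial>M) \<le> ennreal (exp (real n * (s + 4 * s\<^sup>2)))"
      using b by (simp add: ennreal_leI)
  qed auto
  also have "exp (real n * (s + 4 * s\<^sup>2)) * exp (- (s * (real n + u))) = exp (4 * real n * s\<^sup>2 - s * u)"
    by (simp add: exp_add[symmetric] algebra_simps)
  finally show ?thesis using s0 by simp
qed simp

lemma (in prob_space) std_family_lower_tail:
  assumes Z: "std_family M n Z" and s: "0 \<le> s" "s \<le> 1 / 4"
  shows "prob {\<omega> \<in> space M. (\<Sum>k<n. (Z k \<omega>)\<^sup>2) \<le> real n - u} \<le> exp (4 * real n * s\<^sup>2 - s * u)"
proof (cases "s = 0")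
  case False
  with s have s0: "0 < s" by simp
  note [measurable] = std_family_measurable[OF Z]
  have p: "0 < 1 + 2 * s" using s by simp
  have b: "(1 / sqrt (1 + 2 * s)) ^ n \<le> exp (real n * (- s + 4 * s\<^sup>2))"
  proof -
    have "2 * s - (2 * s)\<^sup>2 \<le> ln (1 + 2 * s)"
      by (rule ln_one_plus_pos_lower_bound) (use s in auto)
    then have "s - 4 * s\<^sup>2 \<le> ln (sqrt (1 + 2 * s))"
      using p by (simp add: ln_sqrt power_mult_distrib) (use zero_le_power2[of s] in linarith)
    then have "exp (s - 4 * s\<^sup>2) \<le> sqrt (1 + 2 * s)" using p by (subst (asm) ln_ge_iff) auto
    moreover have "exp (- s + 4 * s\<^sup>2) = 1 / exp (s - 4 * s\<^sup>2)" by (simp add: exp_diff exp_add exp_minus field_simps)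
    ultimately have "1 / sqrt (1 + 2 * s) \<le> exp (- s + 4 * s\<^sup>2)"
      using p by (simp add: frac_le)
    then have "(1 / sqrt (1 + 2 * s)) ^ n \<le> exp (- s + 4 * s\<^sup>2) ^ n" using p by (intro power_mono) auto
    then show ?thesis by (simp only: exp_of_nat_mult)
  qed
  have "prob {\<omega> \<in> space M. - s * (real n - u) \<le> - s * (\<Sum>k<n. (Z k \<omega>)\<^sup>2)} \<le> exp (real n * (- s + 4 * s\<^sup>2)) * exp (- (- s * (real n - u)))"
  proof (rule prob_le_of_nn_integral)
    have int: "integrable M (\<lambda>\<omega>. exp (- s * (\<Sum>k<n. (Z k \<omega>)\<^sup>2)))"
      by (rule integrable_const_bound[of _ 1]) (use s in \<open>auto intro!: mult_nonneg_nonneg sum_nonneg\<close>)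
    have "(LINT \<omega>|M. complex_of_real (exp (- s * (\<Sum>k<n. (Z k \<omega>)\<^sup>2)))) = of_real ((1 / sqrt (1 + 2 * s)) ^ n)"
      using std_family_exp_neg[OF Z s(1) order_refl] by (simp del: of_real_power of_real_divide)
    then have "(LINT \<omega>|M. exp (- s * (\<Sum>k<n. (Z k \<omega>)\<^sup>2))) = (1 / sqrt (1 + 2 * s)) ^ n"
      unfolding integral_complex_of_real of_real_eq_iff .
    then have "(\<integral>\<^sup>+ \<omega>. ennreal (exp (- s * (\<Sum>k<n. (Z k \<omega>)\<^sup>2))) \<partial>M) = ennreal ((1 / sqrt (1 + 2 * s)) ^ n)"
      by (subst nn_integral_eq_integral[OF int]) auto
    then show "(\<integral>\<^sup>+ \<omega>. ennreal (exp (- s * (\<Sum>k<n. (Z k \<omega>)\<^sup>2))) \<partial>M) \<le> ennreal (exp (real n * (- s + 4 * s\<^sup>2)))"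
      using b by (simp only: ennreal_leI)
  qed auto
  also have "exp (real n * (- s + 4 * s\<^sup>2)) * exp (- (- s * (real n - u))) = exp (4 * real n * s\<^sup>2 - s * u)"
    by (simp add: exp_add[symmetric] algebra_simps)
  finally show ?thesis using s0 by simp
qed simp

text \<open>Jensen's inequality for $\exp$ only uses the marginal laws of the $W_k$.\<close>
lemma (in prob_space) sum_squares_tail:
  fixes p :: nat
  assumes W: "\<And>k. k < p \<Longrightarrow> centred_normal M (W k) (v k)" and h: "(\<Sum>k<p. v k) \<le> h" "0 < h"
  shows "prob {\<omega> \<in> space M. x \<le> (\<Sum>k<p. (W k \<omega>)\<^sup>2)} \<le> sqrt 2 * exp (- x / (4 * h))"
proof -
  have [measurable]: "W k \<in> borel_measurable M" if "k < p" for k using W[OF that] by (simp add: centred_normal_def)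
  have v0: "0 \<le> v k" if "k < p" for k using W[OF that] by (rule centred_normal_nonneg)
  have meas [measurable]: "(\<lambda>\<omega>. \<Sum>k<p. (W k \<omega>)\<^sup>2) \<in> borel_measurable M"
    by (intro borel_measurable_sum borel_measurable_power) auto
  let ?V = "\<Sum>k<p. v k"
  have V0: "0 \<le> ?V" by (intro sum_nonneg) (use v0 in auto)
  let ?y = "\<lambda>k \<omega>. (W k \<omega>)\<^sup>2 / (4 * v k)"
  \<comment> \<open>Where \<open>v k = 0\<close> the quotient \<open>?y k\<close> is 0 by
    convention, so the identity for the weighted sum below needs \<open>W k\<close> to vanish almost
    everywhere.\<close>
  have "AE \<omega> in M. \<forall>k\<in>{..<p}. v k = 0 \<longrightarrow> W k \<omega> = 0"
  proof (rule AE_finite_allI)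
    fix k assume "k \<in> {..<p}"
    then show "AE \<omega> in M. v k = 0 \<longrightarrow> W k \<omega> = 0"
      using W[of k] by (cases "v k = 0") (auto simp: centred_normal_def)
  qed simp
  then have ae: "AE \<omega> in M. ennreal (exp ((1 / (4 * h)) * (\<Sum>k<p. (W k \<omega>)\<^sup>2))) \<le> ennreal (1 - ?V / h) + (\<Sum>k<p. ennreal (v k / h) * ennreal (exp (?y k \<omega>)))"
  proof eventually_elim
    case (elim \<omega>)
    \<comment> \<open>The weights \<open>v k / h\<close> need not add up to 1; the index p carries
      the remaining mass, placed at the point 0.\<close>
    let ?a = "\<lambda>k. if k = p then 1 - ?V / h else v k / h"
    let ?z = "\<lambda>k. if k = p then 0 else ?y k \<omega>"
    have 1: "(\<Sum>k\<in>{..p}. ?a k *\<^sub>R ?z k) = (1 / (4 * h)) * (\<Sum>k<p. (W k \<omega>)\<^sup>2)"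
    proof -
      have "(\<Sum>k\<in>{..p}. ?a k *\<^sub>R ?z k) = (\<Sum>k<p. v k / h * ?y k \<omega>)"
        unfolding lessThan_Suc_atMost[symmetric] by simp
      also have "\<dots> = (\<Sum>k<p. (1 / (4 * h)) * (W k \<omega>)\<^sup>2)"
        by (intro sum.cong refl) (use elim h in \<open>auto simp: field_simps\<close>)
      finally show ?thesis by (simp add: sum_distrib_left)
    qed
    have 2: "(\<Sum>k\<in>{..p}. ?a k) = 1"
      unfolding lessThan_Suc_atMost[symmetric] by (simp add: sum_divide_distrib)
    have "exp (\<Sum>k\<in>{..p}. ?a k *\<^sub>R ?z k) \<le> (\<Sum>k\<in>{..p}. ?a k * exp (?z k))"
      by (rule convex_on_sum[OF _ _ exp_convex 2]) (use v0 h V0 in auto)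
    also have "\<dots> = (1 - ?V / h) + (\<Sum>k<p. v k / h * exp (?y k \<omega>))"
      unfolding lessThan_Suc_atMost[symmetric] by simp
    finally have "exp ((1 / (4 * h)) * (\<Sum>k<p. (W k \<omega>)\<^sup>2)) \<le> (1 - ?V / h) + (\<Sum>k<p. v k / h * exp (?y k \<omega>))"
      unfolding 1 .
    then have "ennreal (exp ((1 / (4 * h)) * (\<Sum>k<p. (W k \<omega>)\<^sup>2))) \<le> ennreal ((1 - ?V / h) + (\<Sum>k<p. v k / h * exp (?y k \<omega>)))"
      by (rule ennreal_leI)
    also have "\<dots> = ennreal (1 - ?V / h) + ennreal (\<Sum>k<p. v k / h * exp (?y k \<omega>))"
      by (rule ennreal_plus) (use h v0 in \<open>auto intro!: sum_nonneg\<close>)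
    also have "ennreal (\<Sum>k<p. v k / h * exp (?y k \<omega>)) = (\<Sum>k<p. ennreal (v k / h * exp (?y k \<omega>)))"
      by (rule sum_ennreal[symmetric]) (use h v0 in auto)
    also have "\<dots> = (\<Sum>k<p. ennreal (v k / h) * ennreal (exp (?y k \<omega>)))"
      by (intro sum.cong refl ennreal_mult) (use h v0 in auto)
    finally show ?case .
  qed
  have "(\<integral>\<^sup>+ \<omega>. ennreal (exp ((1 / (4 * h)) * (\<Sum>k<p. (W k \<omega>)\<^sup>2))) \<partial>M) \<le>
    (\<integral>\<^sup>+ \<omega>. ennreal (1 - ?V / h) + (\<Sum>k<p. ennreal (v k / h) * ennreal (exp (?y k \<omega>))) \<partial>M)"
    by (rule nn_integral_mono_AE[OF ae])
  also have "\<dots> = ennreal (1 - ?V / h) + (\<integral>\<^sup>+ \<omega>. (\<Sum>k<p. ennreal (v k / h) * ennreal (exp (?y k \<omega>))) \<partial>M)"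
    by (subst nn_integral_add) (auto simp: emeasure_space_1)
  also have "(\<integral>\<^sup>+ \<omega>. (\<Sum>k<p. ennreal (v k / h) * ennreal (exp (?y k \<omega>))) \<partial>M) = (\<Sum>k<p. \<integral>\<^sup>+ \<omega>. ennreal (v k / h) * ennreal (exp (?y k \<omega>)) \<partial>M)"
    by (rule nn_integral_sum) auto
  also have "\<dots> \<le> (\<Sum>k<p. ennreal (v k / h) * ennreal (sqrt 2))"
  proof (intro sum_mono)
    fix k assume "k \<in> {..<p}"
    then have k: "k < p" by simp
    show "(\<integral>\<^sup>+ \<omega>. ennreal (v k / h) * ennreal (exp (?y k \<omega>)) \<partial>M) \<le> ennreal (v k / h) * ennreal (sqrt 2)"
    proof (cases "v k = 0")
      case False
      then have "0 < v k" using v0[OF k] by simp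
      from centred_normal_exp_square[OF W[OF k] this]
      show ?thesis using k by (subst nn_integral_cmult) auto
    qed simp
  qed
  also have "(\<Sum>k<p. ennreal (v k / h) * ennreal (sqrt 2)) = ennreal (?V / h * sqrt 2)"
  proof -
    have "(\<Sum>k<p. ennreal (v k / h) * ennreal (sqrt 2)) = (\<Sum>k<p. ennreal (v k / h * sqrt 2))"
      by (intro sum.cong refl ennreal_mult[symmetric]) (use h v0 in auto)
    also have "\<dots> = ennreal (\<Sum>k<p. v k / h * sqrt 2)" by (rule sum_ennreal) (use h v0 in auto)
    finally show ?thesis by (simp add: sum_divide_distrib sum_distrib_right)
  qed
  also have "ennreal (1 - ?V / h) + ennreal (?V / h * sqrt 2) = ennreal (1 - ?V / h + ?V / h * sqrt 2)"
    by (rule ennreal_plus[symmetric]) (use h V0 in auto)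
  also have "\<dots> \<le> ennreal (sqrt 2)"
  proof (rule ennreal_leI)
    have "(1 - ?V / h) * 1 \<le> (1 - ?V / h) * sqrt 2" using h by (intro mult_left_mono) auto
    then show "1 - ?V / h + ?V / h * sqrt 2 \<le> sqrt 2" by (simp add: algebra_simps)
  qed
  finally have "(\<integral>\<^sup>+ \<omega>. ennreal (exp ((1 / (4 * h)) * (\<Sum>k<p. (W k \<omega>)\<^sup>2))) \<partial>M) \<le> ennreal (sqrt 2)" by (simp add: add_left_mono)
  then have "prob {\<omega> \<in> space M. (1 / (4 * h)) * x \<le> (1 / (4 * h)) * (\<Sum>k<p. (W k \<omega>)\<^sup>2)} \<le> sqrt 2 * exp (- ((1 / (4 * h)) * x))"
    by (intro prob_le_of_nn_integral) auto
  moreover have "{\<omega> \<in> space M. (1 / (4 * h)) * x \<le> (1 / (4 * h)) * (\<Sum>k<p. (W k \<omega>)\<^sup>2)} = {\<omega> \<in> space M. x \<le> (\<Sum>k<p. (W k \<omega>)\<^sup>2)}"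
    using h by (auto simp: divide_right_mono divide_le_cancel)
  ultimately show ?thesis by simp
qed

section \<open>Whitening and the deviation of a quadratic form\<close>

lemma qform_diff: "qform n (\<lambda>i j. A i j - B i j) c = qform n A c - qform n B c"
  by (simp add: qform_def right_diff_distrib sum_subtractf)

lemma tr_prod_diff: "tr_prod n A (\<lambda>i j. B i j - C i j) = tr_prod n A B - tr_prod n A C"
  by (simp add: tr_prod_def right_diff_distrib sum_subtractf)

definition gauss_vec :: "'w measure \<Rightarrow> nat \<Rightarrow> (nat \<Rightarrow> nat \<Rightarrow> real) \<Rightarrow> (nat \<Rightarrow> 'w \<Rightarrow> real) \<Rightarrow> bool" where
  "gauss_vec M n A Y \<longleftrightarrow> (\<forall>i<n. Y i \<in> borel_measurable M) \<and>
     (\<forall>c. centred_normal M (\<lambda>\<omega>. \<Sum>i<n. c i * Y i \<omega>) (qform n A c))"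

text \<open>From U^T U A = 1 follows U A U^T = 1, since a one-sided inverse of a square matrix is
  two-sided. Hence U Y has identity covariance when Y has covariance A.\<close>

lemma whitening:
  assumes A: "pd n A" and U: "\<And>i j. i < n \<Longrightarrow> j < n \<Longrightarrow> finv n A i j = (\<Sum>k<n. U k i * U k j)"
  shows "qform n A (\<lambda>i. \<Sum>k<n. b k * U k i) = (\<Sum>k<n. (b k)\<^sup>2)"
proof -
  let ?Ut = "fmat n (\<lambda>i k. U k i)" and ?U = "fmat n U"
  have 1: "fmat n (finv n A) = ?Ut * ?U" unfolding fmat_mult by (rule fmat_cong) (rule U)
  have "?Ut * (?U * fmat n A) = 1\<^sub>m n"
    using finv_mat(3)[OF A] unfolding 1 by (subst assoc_mult_mat[symmetric, of _ n n _ n _ n]) auto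
  then have "(?U * fmat n A) * ?Ut = 1\<^sub>m n"
    by (rule mat_mult_left_right_inverse[rotated 2]) (intro mult_carrier_mat[of _ n n] fmat_carrier)+
  then have "fmat n (\<lambda>k l. \<Sum>j<n. (\<Sum>i<n. U k i * A i j) * U l j) = 1\<^sub>m n" by (simp add: fmat_mult)
  then have e: "(\<Sum>j<n. (\<Sum>i<n. U k i * A i j) * U l j) = (if k = l then 1 else 0)" if "k < n" "l < n" for k l
  proof -
    have "fmat n (\<lambda>k l. \<Sum>j<n. (\<Sum>i<n. U k i * A i j) * U l j) $$ (k, l) = (1\<^sub>m n :: real mat) $$ (k, l)"
      using \<open>fmat n _ = 1\<^sub>m n\<close> by simp
    then show ?thesis using that by (simp add: fmat_def)
  qed
  have e': "(\<Sum>i<n. \<Sum>j<n. U k i * U l j * A i j) = (if k = l then 1 else 0)" if "k < n" "l < n" for k l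
    unfolding e[OF that, symmetric] sum_distrib_right by (subst sum.swap) (simp add: mult_ac)
  have "qform n A (\<lambda>i. \<Sum>k<n. b k * U k i) = (\<Sum>i<n. \<Sum>j<n. \<Sum>k<n. \<Sum>l<n. b k * b l * (U k i * U l j * A i j))"
    unfolding qform_def sum_product by (intro sum.cong refl) (simp only: sum_distrib_left sum_distrib_right mult_ac)
  also have "\<dots> = (\<Sum>i<n. \<Sum>k<n. \<Sum>j<n. \<Sum>l<n. b k * b l * (U k i * U l j * A i j))"
    by (intro sum.cong refl sum.swap)
  also have "\<dots> = (\<Sum>k<n. \<Sum>i<n. \<Sum>j<n. \<Sum>l<n. b k * b l * (U k i * U l j * A i j))"
    by (rule sum.swap)
  also have "\<dots> = (\<Sum>k<n. \<Sum>i<n. \<Sum>l<n. \<Sum>j<n. b k * b l * (U k i * U l j * A i j))"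
    by (intro sum.cong refl sum.swap)
  also have "\<dots> = (\<Sum>k<n. \<Sum>l<n. \<Sum>i<n. \<Sum>j<n. b k * b l * (U k i * U l j * A i j))"
    by (intro sum.cong refl sum.swap)
  also have "\<dots> = (\<Sum>k<n. \<Sum>l<n. b k * b l * (\<Sum>i<n. \<Sum>j<n. U k i * U l j * A i j))"
    by (simp only: sum_distrib_left)
  also have "\<dots> = (\<Sum>k<n. \<Sum>l<n. b k * b l * (if k = l then 1 else 0))"
    by (intro sum.cong refl) (simp add: e')
  also have "\<dots> = (\<Sum>k<n. (b k)\<^sup>2)"
    by (intro sum.cong refl) (simp add: if_distrib power2_eq_square cong: if_cong)
  finally show ?thesis .
qed

text \<open>The forms of the two inverses differ by the nonnegative form of \<open>D\<close>, which
  is a sum of squares of normal variables with total variance tr(A0 D) <= h. The chi-square part is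
  allotted the margin u, the difference the margin x.\<close>

lemma (in prob_space) quadratic_form_deviation:
  assumes A0: "pd n A0" and A: "pd n A" and Y: "gauss_vec M n A0 Y"
    and ord: "(\<forall>c. qform n A0 c \<le> qform n A c) \<or> (\<forall>c. qform n A c \<le> qform n A0 c)"
    and h: "\<bar>tr_prod n (finv n A) A0 - real n\<bar> \<le> h" "0 < h" and s: "0 \<le> s" "s \<le> 1 / 4"
  shows "prob {\<omega> \<in> space M. u + x \<le> \<bar>qform n (finv n A) (\<lambda>i. Y i \<omega>) - real n\<bar>} \<le> 2 * exp (4 * real n * s\<^sup>2 - s * u) + sqrt 2 * exp (- x / (4 * h))"
proof -
  have Ym [measurable]: "Y i \<in> borel_measurable M" if "i < n" for i using Y that by (simp add: gauss_vec_def)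
  obtain U where U: "\<And>i j. i < n \<Longrightarrow> j < n \<Longrightarrow> finv n A0 i j = (\<Sum>k<n. U k i * U k j)"
    using psd_cholesky[OF pd_finv_psd[OF A0]] by metis
  define Z where "Z k \<omega> = (\<Sum>i<n. Y i \<omega> * U k i)" for k \<omega>
  have Q0: "qform n (finv n A0) (\<lambda>i. Y i \<omega>) = (\<Sum>k<n. (Z k \<omega>)\<^sup>2)" for \<omega>
    unfolding Z_def by (rule qform_gram) (rule U)
  have Zm: "Z k \<in> borel_measurable M" for k
    unfolding Z_def by (intro borel_measurable_sum borel_measurable_times) auto
  have Z: "std_family M n Z"
    unfolding std_family_def
  proof (intro conjI allI impI Zm)
    fix b
    have "(\<Sum>k<n. b k * Z k \<omega>) = (\<Sum>i<n. (\<Sum>k<n. b k * U k i) * Y i \<omega>)" for \<omega>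
      unfolding Z_def sum_distrib_left sum_distrib_right by (subst sum.swap) (simp add: mult_ac)
    moreover have "centred_normal M (\<lambda>\<omega>. \<Sum>i<n. (\<Sum>k<n. b k * U k i) * Y i \<omega>) (qform n A0 (\<lambda>i. \<Sum>k<n. b k * U k i))"
      using Y by (simp add: gauss_vec_def)
    ultimately show "centred_normal M (\<lambda>\<omega>. \<Sum>k<n. b k * Z k \<omega>) (\<Sum>k<n. (b k)\<^sup>2)"
      using whitening[OF A0 U] by simp
  qed
  \<comment> \<open>Records which of the two orders holds, so that \<open>D\<close> comes out
    nonnegative in either case.\<close>
  define P where "P \<longleftrightarrow> (\<forall>c. qform n A0 c \<le> qform n A c)"
  define D where "D i j = (if P then finv n A0 i j - finv n A i j else finv n A i j - finv n A0 i j)" for i j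
  have Dq: "qform n D c = \<bar>qform n (finv n A) c - qform n (finv n A0) c\<bar>" for c
  proof (cases P)
    case True
    then have "qform n (finv n A) c \<le> qform n (finv n A0) c" using finv_antimono[OF A0 A] unfolding P_def by blast
    then show ?thesis using True unfolding D_def by (simp add: qform_diff)
  next
    case False
    then have "qform n (finv n A0) c \<le> qform n (finv n A) c" using ord finv_antimono[OF A A0] unfolding P_def by blast
    then show ?thesis using False unfolding D_def by (simp add: qform_diff)
  qed
  have Dpsd: "psd n D"
    unfolding psd_def sym_on_def using finv_sym[OF A] finv_sym[OF A0] by (auto simp: Dq D_def)
  have Dtr: "tr_prod n A0 D \<le> h"
    using h(1) tr_prod_finv[OF A0] unfolding D_def
    by (cases P) (auto simp: tr_prod_diff tr_prod_commute[of n A0])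
  obtain V where V: "\<And>i j. i < n \<Longrightarrow> j < n \<Longrightarrow> D i j = (\<Sum>k<n. V k i * V k j)"
    using psd_cholesky[OF Dpsd] by metis
  define W where "W k \<omega> = (\<Sum>i<n. V k i * Y i \<omega>)" for k \<omega>
  have Wn: "centred_normal M (W k) (qform n A0 (V k))" for k
    using Y unfolding W_def[abs_def] gauss_vec_def by blast
  have XD: "qform n D (\<lambda>i. Y i \<omega>) = (\<Sum>k<n. (W k \<omega>)\<^sup>2)" for \<omega>
    unfolding W_def by (subst qform_gram[OF V]) (simp_all add: mult.commute)
  have trV: "(\<Sum>k<n. qform n A0 (V k)) \<le> h"
  proof -
    have "tr_prod n A0 D = (\<Sum>k<n. qform n A0 (V k))" by (rule tr_prod_gram) (rule V)
    then show ?thesis using Dtr by simp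
  qed
  note [measurable] = std_family_measurable[OF Z]
  have [measurable]: "W k \<in> borel_measurable M" for k using Wn by (rule centred_normal_measurable)
  let ?A = "{\<omega> \<in> space M. real n + u \<le> (\<Sum>k<n. (Z k \<omega>)\<^sup>2)}"
  let ?B = "{\<omega> \<in> space M. (\<Sum>k<n. (Z k \<omega>)\<^sup>2) \<le> real n - u}"
  let ?C = "{\<omega> \<in> space M. x \<le> (\<Sum>k<n. (W k \<omega>)\<^sup>2)}"
  have "{\<omega> \<in> space M. u + x \<le> \<bar>qform n (finv n A) (\<lambda>i. Y i \<omega>) - real n\<bar>} \<subseteq> ?A \<union> ?B \<union> ?C"
  proof
    fix \<omega> assume \<omega>: "\<omega> \<in> {\<omega> \<in> space M. u + x \<le> \<bar>qform n (finv n A) (\<lambda>i. Y i \<omega>) - real n\<bar>}"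
    have "\<bar>qform n (finv n A) (\<lambda>i. Y i \<omega>) - real n\<bar> \<le> \<bar>(\<Sum>k<n. (Z k \<omega>)\<^sup>2) - real n\<bar> + (\<Sum>k<n. (W k \<omega>)\<^sup>2)"
      unfolding XD[symmetric] Dq Q0[symmetric] by linarith
    with \<omega> show "\<omega> \<in> ?A \<union> ?B \<union> ?C" by (auto simp: abs_if split: if_splits)
  qed
  then have "prob {\<omega> \<in> space M. u + x \<le> \<bar>qform n (finv n A) (\<lambda>i. Y i \<omega>) - real n\<bar>} \<le> prob (?A \<union> ?B \<union> ?C)"
    by (rule finite_measure_mono) measurable
  also have "\<dots> \<le> prob (?A \<union> ?B) + prob ?C" by (rule measure_Un_le) measurable
  also have "prob (?A \<union> ?B) \<le> prob ?A + prob ?B" by (rule measure_Un_le) measurable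
  also have "prob ?A \<le> exp (4 * real n * s\<^sup>2 - s * u)" by (rule std_family_upper_tail[OF Z s])
  also have "prob ?B \<le> exp (4 * real n * s\<^sup>2 - s * u)" by (rule std_family_lower_tail[OF Z s])
  also have "prob ?C \<le> sqrt 2 * exp (- x / (4 * h))" by (rule sum_squares_tail[OF Wn trV h(2)])
  finally show ?thesis by simp
qed

section \<open>Quadratic forms and determinants of Matern matrices\<close>

definition kmat :: "real \<Rightarrow> (nat \<Rightarrow> 'a::real_normed_vector) \<Rightarrow> real \<Rightarrow> nat \<Rightarrow> nat \<Rightarrow> real" where
  "kmat \<nu> s \<alpha> = (\<lambda>i j. kern \<nu> \<alpha> (s i - s j))"

lemma qform_scale: "qform n (\<lambda>i j. a * A i j) c = a * qform n A c"
  by (simp add: qform_def sum_distrib_left mult_ac)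

lemma pd_scale: "pd n A \<Longrightarrow> 0 < a \<Longrightarrow> pd n (\<lambda>i j. a * A i j)"
  by (auto simp: pd_def sym_on_def qform_scale)

lemma qform_cong: "(\<And>i j. i < n \<Longrightarrow> j < n \<Longrightarrow> A i j = B i j) \<Longrightarrow> qform n A c = qform n B c"
  by (simp add: qform_def)

lemma qform_finv_scale:
  assumes "pd n A" "0 < a" shows "qform n (finv n (\<lambda>i j. a * A i j)) y = qform n (finv n A) y / a"
proof -
  have "qform n (finv n (\<lambda>i j. a * A i j)) y = qform n (\<lambda>i j. (1 / a) * finv n A i j) y"
    by (rule qform_cong) (simp add: finv_scale[OF assms])
  then show ?thesis unfolding qform_scale by simp
qed

lemma tr_prod_finv_scale:
  assumes "pd n A" "0 < a" shows "tr_prod n (finv n (\<lambda>i j. a * A i j)) (\<lambda>i j. a * B i j) = tr_prod n (finv n A) B"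
  unfolding tr_prod_def using assms(2) by (intro sum.cong refl) (simp add: finv_scale[OF assms])

text \<open>Means and covariances of the process are stated as integrals, which are informative only
  for integrable functions; integrability is recovered here from the normal marginals.\<close>

lemma gaussian_rv_square_integrable:
  assumes "prob_space M" "gaussian_rv M X"
  shows "integrable M X" "integrable M (\<lambda>\<omega>. (X \<omega>)\<^sup>2)"
proof -
  interpret prob_space M by fact
  have [measurable]: "X \<in> borel_measurable M" using assms(2) by (simp add: gaussian_rv_def)
  have "integrable M X \<and> integrable M (\<lambda>\<omega>. (X \<omega>)\<^sup>2)"
  proof (cases "\<exists>\<mu>. AE \<omega> in M. X \<omega> = \<mu>")
    case True
    then obtain \<mu> where \<mu>: "AE \<omega> in M. X \<omega> = \<mu>" by blast
    have "integrable M X \<longleftrightarrow> integrable M (\<lambda>_. \<mu>)"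
      by (rule integrable_cong_AE) (use \<mu> in auto)
    moreover have "integrable M (\<lambda>\<omega>. (X \<omega>)\<^sup>2) \<longleftrightarrow> integrable M (\<lambda>_. \<mu>\<^sup>2)"
      by (rule integrable_cong_AE) (use \<mu> in auto)
    ultimately show ?thesis by simp
  next
    case False
    then obtain \<mu> \<sigma> where \<sigma>: "0 < \<sigma>" and D: "distributed M lborel X (\<lambda>x. ennreal (normal_density \<mu> \<sigma> x))"
      using assms(2) by (auto simp: gaussian_rv_def)
    have i1: "integrable lborel (\<lambda>x. normal_density \<mu> \<sigma> x * x)" by (rule integrable_normal_moment_nz_1[OF \<sigma>])
    have i2: "integrable lborel (\<lambda>x. normal_density \<mu> \<sigma> x * x\<^sup>2)"
    proof -
      have "integrable lborel (\<lambda>x. normal_density \<mu> \<sigma> x * (x - \<mu>)\<^sup>2 + 2 * \<mu> * (normal_density \<mu> \<sigma> x * x) - \<mu>\<^sup>2 * normal_density \<mu> \<sigma> x)"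
        using integrable_normal_moment[OF \<sigma>, of \<mu> 2] i1 integrable_normal_density[OF \<sigma>, of \<mu>] by auto
      moreover have "normal_density \<mu> \<sigma> x * (x - \<mu>)\<^sup>2 + 2 * \<mu> * (normal_density \<mu> \<sigma> x * x) - \<mu>\<^sup>2 * normal_density \<mu> \<sigma> x = normal_density \<mu> \<sigma> x * x\<^sup>2" for x
        by (simp add: power2_eq_square algebra_simps)
      ultimately show ?thesis by simp
    qed
    show ?thesis
      using distributed_integrable[OF D, of "\<lambda>x. x"] distributed_integrable[OF D, of "\<lambda>x. x\<^sup>2"] i1 i2 by simp
  qed
  then show "integrable M X" "integrable M (\<lambda>\<omega>. (X \<omega>)\<^sup>2)" by auto
qed

lemma centred_normal_of_gaussian_rv:
  assumes "prob_space M" "gaussian_rv M X" "integral\<^sup>L M X = 0" "integral\<^sup>L M (\<lambda>\<omega>. (X \<omega>)\<^sup>2) = v"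
  shows "centred_normal M X v"
proof -
  interpret prob_space M by fact
  have [measurable]: "X \<in> borel_measurable M" using assms(2) by (simp add: gaussian_rv_def)
  show ?thesis
  proof (cases "\<exists>\<mu>. AE \<omega> in M. X \<omega> = \<mu>")
    case True
    then obtain \<mu> where \<mu>: "AE \<omega> in M. X \<omega> = \<mu>" by blast
    have "integral\<^sup>L M X = (LINT \<omega>|M. \<mu>)" by (rule integral_cong_AE) (use \<mu> in auto)
    then have "\<mu> = 0" using assms(3) by (simp add: prob_space)
    with \<mu> have X0: "AE \<omega> in M. X \<omega> = 0" by simp
    then have "integral\<^sup>L M (\<lambda>\<omega>. (X \<omega>)\<^sup>2) = (LINT \<omega>|M. 0)" by (intro integral_cong_AE) auto
    with assms(4) X0 show ?thesis by (simp add: centred_normal_def)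
  next
    case False
    then obtain \<mu> \<sigma> where \<sigma>: "0 < \<sigma>" and D: "distributed M lborel X (\<lambda>x. ennreal (normal_density \<mu> \<sigma> x))"
      using assms(2) by (auto simp: gaussian_rv_def)
    have "\<mu> = 0" using normal_distributed_expectation[OF \<sigma> D] assms(3) by simp
    moreover have "v = \<sigma>\<^sup>2" using normal_distributed_variance[OF \<sigma> D] assms(3,4) by simp
    ultimately show ?thesis using D \<sigma> by (simp add: centred_normal_def)
  qed
qed

lemma centred_gaussian_process_combination:
  "centred_gaussian_process M S C X \<Longrightarrow> finite F \<Longrightarrow> F \<subseteq> S \<Longrightarrow> gaussian_rv M (\<lambda>\<omega>. \<Sum>u\<in>F. c u * X u \<omega>)"
  by (simp add: centred_gaussian_process_def)

lemma centred_gaussian_process_integrable: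
  assumes "centred_gaussian_process M S C X" "u \<in> S" "v \<in> S"
  shows "integrable M (X u)" "integrable M (\<lambda>\<omega>. X u \<omega> * X v \<omega>)" "X u \<in> borel_measurable M"
proof -
  have g: "gaussian_rv M (X u)" if "u \<in> S" for u
  proof -
    show ?thesis using centred_gaussian_process_combination[OF assms(1), of "{u}" "\<lambda>_. 1"] that by simp
  qed
  have p: "prob_space M" using assms(1) by (simp add: centred_gaussian_process_def)
  note i = gaussian_rv_square_integrable[OF p g]
  show "integrable M (X u)" by (rule i(1)[OF assms(2)])
  then show m: "X u \<in> borel_measurable M" by simp
  have mv: "X v \<in> borel_measurable M" using i(1)[OF assms(3)] by simp
  show "integrable M (\<lambda>\<omega>. X u \<omega> * X v \<omega>)"
  proof (rule Bochner_Integration.integrable_bound)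
    show "integrable M (\<lambda>\<omega>. (X u \<omega>)\<^sup>2 + (X v \<omega>)\<^sup>2)" using i(2) assms(2,3) by auto
    show "(\<lambda>\<omega>. X u \<omega> * X v \<omega>) \<in> borel_measurable M" using m mv by measurable
    show "AE \<omega> in M. norm (X u \<omega> * X v \<omega>) \<le> norm ((X u \<omega>)\<^sup>2 + (X v \<omega>)\<^sup>2)"
    proof (intro AE_I2)
      fix \<omega>
      have "2 * (\<bar>X u \<omega>\<bar> * \<bar>X v \<omega>\<bar>) \<le> (X u \<omega>)\<^sup>2 + (X v \<omega>)\<^sup>2"
        using sum_squares_bound[of "\<bar>X u \<omega>\<bar>" "\<bar>X v \<omega>\<bar>"] by simp
      moreover have "0 \<le> \<bar>X u \<omega>\<bar> * \<bar>X v \<omega>\<bar>" by simp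
      ultimately have "\<bar>X u \<omega>\<bar> * \<bar>X v \<omega>\<bar> \<le> (X u \<omega>)\<^sup>2 + (X v \<omega>)\<^sup>2" by linarith
      then show "norm (X u \<omega> * X v \<omega>) \<le> norm ((X u \<omega>)\<^sup>2 + (X v \<omega>)\<^sup>2)" by (simp add: abs_mult)
    qed
  qed
qed

lemma gauss_vec_of_process:
  fixes s :: "nat \<Rightarrow> 'a"
  assumes "centred_gaussian_process M S C X" "s ` {..<n} \<subseteq> S" "inj_on s {..<n}"
  shows "gauss_vec M n (\<lambda>i j. C (s i) (s j)) (\<lambda>i. X (s i))"
  unfolding gauss_vec_def
proof (intro conjI allI impI)
  have sS: "s i \<in> S" if "i < n" for i using assms(2) that by auto
  note I = centred_gaussian_process_integrable[OF assms(1)]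
  show "X (s i) \<in> borel_measurable M" if "i < n" for i using I(3)[OF sS[OF that] sS[OF that]] .
  fix c :: "nat \<Rightarrow> real"
  let ?Z = "\<lambda>\<omega>. \<Sum>i<n. c i * X (s i) \<omega>"
  \<comment> \<open>The process speaks of combinations over finite sets of points; injectivity of
    the design lets the coefficients be indexed by points.\<close>
  have "?Z \<omega> = (\<Sum>u\<in>s ` {..<n}. c (inv_into {..<n} s u) * X u \<omega>)" for \<omega>
    by (subst sum.reindex[OF assms(3)]) (simp add: inv_into_f_f[OF assms(3)])
  moreover have "gaussian_rv M (\<lambda>\<omega>. \<Sum>u\<in>s ` {..<n}. c (inv_into {..<n} s u) * X u \<omega>)"
    by (rule centred_gaussian_process_combination[OF assms(1) _ assms(2)]) simp
  ultimately have g: "gaussian_rv M ?Z" by simp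
  show "centred_normal M ?Z (qform n (\<lambda>i j. C (s i) (s j)) c)"
  proof (rule centred_normal_of_gaussian_rv[OF _ g])
    show "prob_space M" using assms(1) by (simp add: centred_gaussian_process_def)
    have "integral\<^sup>L M ?Z = (\<Sum>i<n. LINT \<omega>|M. c i * X (s i) \<omega>)"
      by (rule Bochner_Integration.integral_sum) (use I(1) sS in auto)
    also have "\<dots> = 0"
      using assms(1) sS by (intro sum.neutral) (auto simp: centred_gaussian_process_def)
    finally show "integral\<^sup>L M ?Z = 0" .
    have "(?Z \<omega>)\<^sup>2 = (\<Sum>i<n. \<Sum>j<n. c i * c j * (X (s i) \<omega> * X (s j) \<omega>))" for \<omega>
      by (simp add: power2_eq_square sum_product mult_ac)
    then have "(LINT \<omega>|M. (?Z \<omega>)\<^sup>2) = (\<Sum>i<n. \<Sum>j<n. c i * c j * (LINT \<omega>|M. X (s i) \<omega> * X (s j) \<omega>))"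
      using integral_double_sum(2)[of n M "\<lambda>i j \<omega>. X (s i) \<omega> * X (s j) \<omega>" "\<lambda>i j. c i * c j"] I(2) sS by simp
    also have "\<dots> = qform n (\<lambda>i j. C (s i) (s j)) c"
      unfolding qform_def using assms(1) sS by (intro sum.cong refl) (auto simp: centred_gaussian_process_def)
    finally show "(LINT \<omega>|M. (?Z \<omega>)\<^sup>2) = qform n (\<lambda>i j. C (s i) (s j)) c" .
  qed
qed

section \<open>Monotonicity and scaling in the range parameter\<close>

lemma pd_kmat:
  fixes s :: "nat \<Rightarrow> real ^ 'd::finite"
  assumes "0 < \<nu>" "0 < \<alpha>" "inj_on s {..<n}" shows "pd n (kmat \<nu> s \<alpha>)"
  unfolding kmat_def by (rule pd_kern[OF assms])

lemma finv_kmat_mono: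
  fixes s :: "nat \<Rightarrow> real ^ 'd::finite"
  assumes "0 < \<nu>" "0 < \<alpha>" "\<alpha> \<le> \<beta>" "inj_on s {..<n}"
  shows "qform n (finv n (kmat \<nu> s \<alpha>)) y \<le> qform n (finv n (kmat \<nu> s \<beta>)) y"
proof -
  have b: "0 < \<beta>" using assms by simp
  show ?thesis
    using qform_kern_antimono[OF assms(1-3)]
    by (intro finv_antimono pd_kmat assms b) (simp add: kmat_def)
qed

lemma finv_kmat_scale:
  fixes s :: "nat \<Rightarrow> real ^ 'd::finite"
  assumes "0 < \<nu>" "0 < \<alpha>" "\<alpha> \<le> \<beta>" "inj_on s {..<n}"
  shows "(\<alpha> / \<beta>) powr (2 * \<nu> + real CARD('d)) * qform n (finv n (kmat \<nu> s \<beta>)) y \<le> qform n (finv n (kmat \<nu> s \<alpha>)) y"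
proof -
  have b: "0 < \<beta>" using assms by simp
  define k where "k = (\<alpha> / \<beta>) powr (2 * \<nu> + real CARD('d))"
  have k: "0 < k" using assms b by (simp add: k_def)
  have pa: "pd n (kmat \<nu> s \<alpha>)" and pb: "pd n (kmat \<nu> s \<beta>)" using pd_kmat[OF assms(1,2,4)] pd_kmat[OF assms(1) b assms(4)] by auto
  have "qform n (finv n (kmat \<nu> s \<beta>)) y \<le> qform n (finv n (\<lambda>i j. k * kmat \<nu> s \<alpha> i j)) y"
    using qform_kern_scale[OF assms(1-3)]
    by (intro finv_antimono pd_scale pa pb k) (simp add: qform_scale kmat_def k_def)
  then show ?thesis using k unfolding k_def[symmetric] by (simp add: qform_finv_scale[OF pa k] pos_le_divide_eq mult.commute)
qed

lemma fdet_kmat_antimono: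
  fixes s :: "nat \<Rightarrow> real ^ 'd::finite"
  assumes "0 < \<nu>" "0 < \<alpha>" "\<alpha> \<le> \<beta>" "inj_on s {..<n}"
  shows "ln (fdet n (kmat \<nu> s \<beta>)) \<le> ln (fdet n (kmat \<nu> s \<alpha>))"
proof -
  have b: "0 < \<beta>" using assms by simp
  show ?thesis using qform_kern_antimono[OF assms(1-3)]
    by (intro fdet_mono pd_kmat assms b) (simp add: kmat_def)
qed

lemma fdet_kmat_scale:
  fixes s :: "nat \<Rightarrow> real ^ 'd::finite"
  assumes "0 < \<nu>" "0 < \<alpha>" "\<alpha> \<le> \<beta>" "inj_on s {..<n}"
  shows "ln (fdet n (kmat \<nu> s \<alpha>)) - n * (2 * \<nu> + real CARD('d)) * ln (\<beta> / \<alpha>) \<le> ln (fdet n (kmat \<nu> s \<beta>))"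
proof -
  have b: "0 < \<beta>" using assms by simp
  define p where "p = 2 * \<nu> + real CARD('d)"
  define k where "k = (\<alpha> / \<beta>) powr p"
  have k: "0 < k" using assms b by (simp add: k_def)
  have pa: "pd n (kmat \<nu> s \<alpha>)" and pb: "pd n (kmat \<nu> s \<beta>)" using pd_kmat[OF assms(1,2,4)] pd_kmat[OF assms(1) b assms(4)] by auto
  have "ln (fdet n (\<lambda>i j. k * kmat \<nu> s \<alpha> i j)) \<le> ln (fdet n (kmat \<nu> s \<beta>))"
    using qform_kern_scale[OF assms(1-3)]
    by (intro fdet_mono pd_scale pa pb k) (simp add: qform_scale kmat_def k_def p_def)
  moreover have "ln (fdet n (\<lambda>i j. k * kmat \<nu> s \<alpha> i j)) = n * ln k + ln (fdet n (kmat \<nu> s \<alpha>))"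
    unfolding fdet_scale using k pd_det_pos[OF pa] by (simp add: ln_mult ln_realpow)
  moreover have "ln k = - (p * ln (\<beta> / \<alpha>))"
    using assms b by (simp add: k_def ln_powr ln_div right_diff_distrib)
  ultimately show ?thesis unfolding p_def[symmetric] by (simp add: mult.assoc)
qed

text \<open>Evaluates the trace bound at \<tau> = n^(-2/3), where n \<tau> and \<tau>^(-1/2) both
  equal n^(1/3). The conditions on \<kappa>1 and \<kappa>2 keep the powers of \<open>a n\<close>
  from lifting the total to n^(1/2).\<close>

lemma trace_deviation_rate:
  fixes s :: "nat \<Rightarrow> nat \<Rightarrow> real ^ 'd::finite" and a :: "nat \<Rightarrow> real"
  assumes "0 < \<nu>" "0 < \<alpha>\<^sub>0" "0 \<le> T" "CARD('d) \<le> 3"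
    and s: "\<And>n j i. j < n \<Longrightarrow> \<bar>s n j $ i\<bar> \<le> T" "\<And>n. inj_on (s n) {..<n}"
    and a: "\<forall>\<^sub>F n in sequentially. real n powr (- \<kappa>1) \<le> a n \<and> a n \<le> real n powr \<kappa>2"
    and k: "0 < \<kappa>1" "0 < \<kappa>2" "2 * \<nu> * \<kappa>1 < 1 / 3" "(2 * \<nu> + real CARD('d) + 2) * \<kappa>2 < 1 / 6"
  shows "\<forall>\<^sub>F n in sequentially. \<bar>tr_prod n (finv n (kmat \<nu> (s n) (a n))) (kmat \<nu> (s n) \<alpha>\<^sub>0) - real n\<bar> \<le> sqrt n / 8"
proof -
  let ?p = "2 * \<nu> + real CARD('d)"
  obtain C where C: "0 < C" and dev: "\<And>n (s :: nat \<Rightarrow> real ^ 'd) \<alpha> \<tau>. \<forall>j<n. \<forall>i. \<bar>s j $ i\<bar> \<le> T \<Longrightarrow> inj_on s {..<n} \<Longrightarrow> 0 < \<alpha> \<Longrightarrow> 0 < \<tau> \<Longrightarrow>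
     (max \<alpha> \<alpha>\<^sub>0)\<^sup>2 * \<tau> \<le> 1 \<Longrightarrow>
     \<bar>tr_prod n (finv n (\<lambda>i j. kern \<nu> \<alpha> (s i - s j))) (\<lambda>i j. kern \<nu> \<alpha>\<^sub>0 (s i - s j)) - real n\<bar>
      \<le> 2 * (max \<alpha> \<alpha>\<^sub>0)\<^sup>2 * \<tau> * n + C * (max \<alpha> \<alpha>\<^sub>0) powr ?p *
          ((min \<alpha> \<alpha>\<^sub>0) powr (- 2 * \<nu>) + (max \<alpha> \<alpha>\<^sub>0)\<^sup>2 * \<tau> powr (- 1 / 2))"
    using trace_deviation_bound[OF assms(1-4)] by blast
  define c where "c = 1 + \<alpha>\<^sub>0"
  \<comment> \<open>A growth exponent common to all terms, strictly below 1/2 by the condition on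
    \<kappa>2. The condition on \<kappa>1 puts the term with the power -2\<nu> of the smaller
    parameter under it.\<close>
  define e where "e = 1 / 2 - min (1 / 6 - (?p + 2) * \<kappa>2) (1 / 6)"
  have e: "(?p + 2) * \<kappa>2 + 1 / 3 \<le> e" "1 / 3 \<le> e" "e < 1 / 2" using k by (auto simp: e_def min_def)
  have p0: "0 < ?p" using assms(1) by (simp add: add_pos_pos)
  define K where "K = 2 * c\<^sup>2 + C * c powr ?p * (1 + \<alpha>\<^sub>0 powr (- 2 * \<nu>)) + C * c powr ?p * c\<^sup>2"
  have c: "1 \<le> c" "0 < c" using assms(2) by (auto simp: c_def)
  have K: "0 < K" using C c by (simp add: K_def add_pos_nonneg)
  have l1: "((\<lambda>n. real n powr (e - 1 / 2)) \<longlongrightarrow> 0) sequentially"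
    by (rule tendsto_neg_powr[OF _ filterlim_real_sequentially]) (use e in simp)
  have l2: "((\<lambda>n. real n powr (2 * \<kappa>2 - 2 / 3)) \<longlongrightarrow> 0) sequentially"
  proof (rule tendsto_neg_powr[OF _ filterlim_real_sequentially])
    have "2 * \<kappa>2 \<le> (?p + 2) * \<kappa>2" using p0 k by (intro mult_right_mono) auto
    then show "2 * \<kappa>2 - 2 / 3 < 0" using k(4) by linarith
  qed
  have ev1: "\<forall>\<^sub>F n in sequentially. real n powr (e - 1 / 2) < 1 / (8 * K)"
    by (rule order_tendstoD(2)[OF l1]) (use K in simp)
  have ev2: "\<forall>\<^sub>F n in sequentially. real n powr (2 * \<kappa>2 - 2 / 3) < 1 / c\<^sup>2"
    by (rule order_tendstoD(2)[OF l2]) (use c in simp)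
  show ?thesis
    using a ev1 ev2 eventually_ge_at_top[of 1]
  proof eventually_elim
    case (elim n)
    have n: "1 \<le> real n" using elim(4) by simp
    define x where "x = real n"
    have x: "1 \<le> x" "0 < x" using n by (auto simp: x_def)
    \<comment> \<open>With this choice the side condition on the squared larger parameter times
      \<tau> reads 2 \<kappa>2 < 2/3 in the exponents, up to a constant absorbed for large
      n.\<close>
    define \<tau> where "\<tau> = x powr (- 2 / 3)"
    have \<tau>: "0 < \<tau>" using x by (simp add: \<tau>_def)
    let ?b = "max (a n) \<alpha>\<^sub>0" and ?a = "min (a n) \<alpha>\<^sub>0"
    have an: "0 < a n" using elim(1) x less_le_trans[of 0 "real n powr (- \<kappa>1)" "a n"] by (simp add: x_def)
    have xk: "1 \<le> x powr \<kappa>2" "1 \<le> x powr (2 * \<nu> * \<kappa>1)" using x k assms(1) by (auto intro!: ge_one_powr_ge_zero)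
    have b: "0 < ?b" "?b \<le> c * x powr \<kappa>2"
    proof -
      show "0 < ?b" using an by simp
      have "\<alpha>\<^sub>0 * 1 \<le> \<alpha>\<^sub>0 * x powr \<kappa>2" using xk assms(2) by (intro mult_left_mono) auto
      moreover have "a n \<le> x powr \<kappa>2" using elim(1) by (simp add: x_def)
      moreover have "0 \<le> \<alpha>\<^sub>0 * x powr \<kappa>2" using assms(2) by simp
      moreover have "c * x powr \<kappa>2 = x powr \<kappa>2 + \<alpha>\<^sub>0 * x powr \<kappa>2" by (simp add: c_def distrib_right)
      ultimately show "?b \<le> c * x powr \<kappa>2" using xk by (intro max.boundedI) linarith+
    qed
    have b2: "?b\<^sup>2 \<le> c\<^sup>2 * x powr (2 * \<kappa>2)"
    proof -
      have "?b\<^sup>2 \<le> (c * x powr \<kappa>2)\<^sup>2" using b by (intro power_mono) auto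
      also have "\<dots> = c\<^sup>2 * x powr (2 * \<kappa>2)" by (simp add: power_mult_distrib power2_eq_square powr_add[symmetric])
      finally show ?thesis .
    qed
    have bp: "?b powr ?p \<le> c powr ?p * x powr (?p * \<kappa>2)"
    proof -
      have "?b powr ?p \<le> (c * x powr \<kappa>2) powr ?p" using b p0 by (intro powr_mono2) auto
      also have "\<dots> = c powr ?p * x powr (?p * \<kappa>2)" using c by (simp add: powr_mult powr_powr mult.commute)
      finally show ?thesis .
    qed
    have am: "?a powr (- 2 * \<nu>) \<le> (1 + \<alpha>\<^sub>0 powr (- 2 * \<nu>)) * x powr (2 * \<nu> * \<kappa>1)"
    proof (cases "a n \<le> \<alpha>\<^sub>0")
      case True
      have "a n powr (- 2 * \<nu>) \<le> (x powr (- \<kappa>1)) powr (- 2 * \<nu>)"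
        using elim(1) x assms(1) an unfolding x_def by (intro powr_mono2') auto
      also have "\<dots> = 1 * x powr (2 * \<nu> * \<kappa>1)" by (simp add: powr_powr mult_ac)
      also have "\<dots> \<le> (1 + \<alpha>\<^sub>0 powr (- 2 * \<nu>)) * x powr (2 * \<nu> * \<kappa>1)" by (intro mult_right_mono) auto
      finally show ?thesis using True by (simp add: min_absorb1)
    next
      case False
      have "\<alpha>\<^sub>0 powr (- 2 * \<nu>) * 1 \<le> (1 + \<alpha>\<^sub>0 powr (- 2 * \<nu>)) * x powr (2 * \<nu> * \<kappa>1)"
        using xk by (intro mult_mono) auto
      then show ?thesis using False by (simp add: min_absorb2)
    qed
    have bt: "?b\<^sup>2 * \<tau> \<le> 1"
    proof -
      have "?b\<^sup>2 * \<tau> \<le> c\<^sup>2 * x powr (2 * \<kappa>2) * \<tau>" using b2 \<tau> by (intro mult_right_mono) auto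
      also have "\<dots> = c\<^sup>2 * x powr (2 * \<kappa>2 - 2 / 3)" by (simp add: \<tau>_def powr_add[symmetric])
      also have "\<dots> \<le> c\<^sup>2 * (1 / c\<^sup>2)" using elim(3) by (intro mult_left_mono) (auto simp: x_def)
      finally show ?thesis using c by simp
    qed
    have t2: "\<tau> powr (- 1 / 2) = x powr (1 / 3)" "\<tau> * x = x powr (1 / 3)"
    proof -
      show "\<tau> powr (- 1 / 2) = x powr (1 / 3)" by (simp add: \<tau>_def powr_powr)
      have "\<tau> * x = x powr (- 2 / 3) * x powr 1" using x by (simp add: \<tau>_def)
      also have "\<dots> = x powr (- 2 / 3 + 1)" by (rule powr_add[symmetric])
      finally show "\<tau> * x = x powr (1 / 3)" by simp
    qed
    have E: "x powr (2 * \<kappa>2) * x powr (1 / 3) \<le> x powr e" "x powr (?p * \<kappa>2) * x powr (2 * \<nu> * \<kappa>1) \<le> x powr e"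
      "x powr (?p * \<kappa>2) * (x powr (2 * \<kappa>2) * x powr (1 / 3)) \<le> x powr e"
    proof -
      have q: "0 \<le> ?p * \<kappa>2" using p0 k by simp
      have q2: "(?p + 2) * \<kappa>2 = ?p * \<kappa>2 + 2 * \<kappa>2" by (simp add: distrib_right)
      show "x powr (2 * \<kappa>2) * x powr (1 / 3) \<le> x powr e"
        unfolding powr_add[symmetric] using e q q2 x by (intro powr_mono) auto
      show "x powr (?p * \<kappa>2) * x powr (2 * \<nu> * \<kappa>1) \<le> x powr e"
        unfolding powr_add[symmetric] using e q2 k x by (intro powr_mono) auto
      show "x powr (?p * \<kappa>2) * (x powr (2 * \<kappa>2) * x powr (1 / 3)) \<le> x powr e"
        unfolding powr_add[symmetric] using e q2 x by (intro powr_mono) auto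
    qed
    have "\<bar>tr_prod n (finv n (kmat \<nu> (s n) (a n))) (kmat \<nu> (s n) \<alpha>\<^sub>0) - real n\<bar>
      \<le> 2 * ?b\<^sup>2 * \<tau> * n + C * ?b powr ?p * (?a powr (- 2 * \<nu>) + ?b\<^sup>2 * \<tau> powr (- 1 / 2))"
      unfolding kmat_def by (rule dev) (use s an \<tau> bt in auto)
    also have "\<dots> = 2 * ?b\<^sup>2 * x powr (1 / 3) + C * ?b powr ?p * ?a powr (- 2 * \<nu>) + C * ?b powr ?p * (?b\<^sup>2 * x powr (1 / 3))"
      using t2 by (simp add: x_def[symmetric] algebra_simps)
    also have "\<dots> \<le> 2 * (c\<^sup>2 * x powr (2 * \<kappa>2)) * x powr (1 / 3) + C * (c powr ?p * x powr (?p * \<kappa>2)) * ((1 + \<alpha>\<^sub>0 powr (- 2 * \<nu>)) * x powr (2 * \<nu> * \<kappa>1))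
        + C * (c powr ?p * x powr (?p * \<kappa>2)) * ((c\<^sup>2 * x powr (2 * \<kappa>2)) * x powr (1 / 3))"
      using b2 bp am C by (intro add_mono mult_mono mult_left_mono) (auto intro!: mult_nonneg_nonneg)
    also have "\<dots> = 2 * c\<^sup>2 * (x powr (2 * \<kappa>2) * x powr (1 / 3)) + C * c powr ?p * (1 + \<alpha>\<^sub>0 powr (- 2 * \<nu>)) * (x powr (?p * \<kappa>2) * x powr (2 * \<nu> * \<kappa>1))
        + C * c powr ?p * c\<^sup>2 * (x powr (?p * \<kappa>2) * (x powr (2 * \<kappa>2) * x powr (1 / 3)))"
      by (simp only: mult_ac)
    also have "\<dots> \<le> 2 * c\<^sup>2 * x powr e + C * c powr ?p * (1 + \<alpha>\<^sub>0 powr (- 2 * \<nu>)) * x powr e + C * c powr ?p * c\<^sup>2 * x powr e"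
      using E C by (intro add_mono mult_left_mono) auto
    also have "\<dots> = K * x powr e" by (simp add: K_def algebra_simps)
    also have "\<dots> = K * x powr (e - 1 / 2) * x powr (1 / 2)" by (simp add: powr_add[symmetric])
    also have "\<dots> \<le> K * (1 / (8 * K)) * x powr (1 / 2)"
      using elim(2) K by (intro mult_right_mono mult_left_mono) (auto simp: x_def)
    also have "\<dots> = sqrt n / 8" using K x by (simp add: powr_half_sqrt x_def)
    finally show ?case .
  qed
qed

text \<open>Each n has its own exceptional event, and their probabilities are summable, so designs
  of different sizes need not be related. The margin 2 sqrt n ln n is split evenly between the
  chi-square part and the one-signed difference.\<close>

lemma quadratic_form_concentration:
  fixes s :: "nat \<Rightarrow> nat \<Rightarrow> real ^ 'd::finite" and a :: "nat \<Rightarrow> real" and Y :: "real ^ 'd \<Rightarrow> 'w \<Rightarrow> real"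
  assumes \<nu>: "0 < \<nu>" and \<alpha>\<^sub>0: "0 < \<alpha>\<^sub>0" and \<theta>: "0 < \<theta>"
    and Y: "centred_gaussian_process M S (\<lambda>u v. \<theta> * kern \<nu> \<alpha>\<^sub>0 (u - v)) Y"
    and s: "\<And>n. s n ` {..<n} \<subseteq> S" "\<And>n. inj_on (s n) {..<n}" and a: "\<And>n. 1 \<le> n \<Longrightarrow> 0 < a n"
    and tr: "\<forall>\<^sub>F n in sequentially. \<bar>tr_prod n (finv n (kmat \<nu> (s n) (a n))) (kmat \<nu> (s n) \<alpha>\<^sub>0) - real n\<bar> \<le> sqrt n / 8"
  shows "AE \<omega> in M. \<forall>\<^sub>F n in sequentially.
    \<bar>qform n (finv n (kmat \<nu> (s n) (a n))) (\<lambda>i. Y (s n i) \<omega>) / \<theta> - real n\<bar> \<le> 2 * sqrt n * ln n"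
proof -
  interpret prob_space M using Y by (simp add: centred_gaussian_process_def)
  let ?Q = "\<lambda>n \<omega>. qform n (finv n (kmat \<nu> (s n) (a n))) (\<lambda>i. Y (s n i) \<omega>) / \<theta>"
  let ?E = "\<lambda>n. {\<omega> \<in> space M. sqrt n * ln n + sqrt n * ln n \<le> \<bar>?Q n \<omega> - real n\<bar>}"
  have gv: "gauss_vec M n (\<lambda>i j. \<theta> * kmat \<nu> (s n) \<alpha>\<^sub>0 i j) (\<lambda>i. Y (s n i))" for n
    using gauss_vec_of_process[OF Y s] by (simp add: kmat_def)
  have E_sets [measurable]: "?E n \<in> sets M" for n
  proof -
    have [measurable]: "Y (s n i) \<in> borel_measurable M" if "i < n" for i using gv[of n] that by (simp add: gauss_vec_def)
    have [measurable]: "?Q n \<in> borel_measurable M"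
      unfolding qform_def by (intro borel_measurable_divide borel_measurable_sum borel_measurable_times) auto
    define f where "f \<omega> = \<bar>?Q n \<omega> - real n\<bar>" for \<omega>
    have [measurable]: "f \<in> borel_measurable M"
      unfolding f_def by (intro borel_measurable_abs borel_measurable_diff) auto
    show ?thesis unfolding f_def[symmetric] by measurable
  qed
  have bound: "\<forall>\<^sub>F n in sequentially. norm (prob (?E n)) \<le> (2 * exp 16 + sqrt 2) * real n powr (- 2)"
    using tr eventually_ge_at_top[of 64]
  proof eventually_elim
    case (elim n)
    have n: "64 \<le> n" using elim(2) .
    then have an: "0 < a n" using a by simp
    have sq: "0 < sqrt n" "8 \<le> sqrt n" using n real_le_rsqrt[of 8 "real n"] by auto
    \<comment> \<open>Both exponents become -2 ln n, up to the constant 16 in the first, and this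
      gives the summable n^(-2). The lower limit 64 for n ensures s <= 1/4.\<close>
    let ?s = "2 / sqrt n" and ?h = "sqrt n / 8"
    let ?R = "kmat \<nu> (s n) \<alpha>\<^sub>0" and ?A = "kmat \<nu> (s n) (a n)"
    have p0: "pd n ?R" by (rule pd_kmat[OF \<nu> \<alpha>\<^sub>0 s(2)])
    have pA: "pd n ?A" by (rule pd_kmat[OF \<nu> an s(2)])
    have ord: "(\<forall>c. qform n (\<lambda>i j. \<theta> * ?R i j) c \<le> qform n (\<lambda>i j. \<theta> * ?A i j) c) \<or> (\<forall>c. qform n (\<lambda>i j. \<theta> * ?A i j) c \<le> qform n (\<lambda>i j. \<theta> * ?R i j) c)"
    proof (cases "a n \<le> \<alpha>\<^sub>0")
      case True
      show ?thesis
        unfolding qform_scale kmat_def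
        by (rule disjI1, intro allI mult_left_mono qform_kern_antimono[OF \<nu> an True]) (use \<theta> in simp)
    next
      case False
      then have le: "\<alpha>\<^sub>0 \<le> a n" by simp
      show ?thesis
        unfolding qform_scale kmat_def
        by (rule disjI2, intro allI mult_left_mono qform_kern_antimono[OF \<nu> \<alpha>\<^sub>0 le]) (use \<theta> in simp)
    qed
    have Qeq: "?Q n \<omega> = qform n (finv n (\<lambda>i j. \<theta> * ?A i j)) (\<lambda>i. Y (s n i) \<omega>)" for \<omega>
      using qform_finv_scale[OF pA \<theta>] by simp
    have "prob {\<omega> \<in> space M. sqrt n * ln n + sqrt n * ln n \<le> \<bar>qform n (finv n (\<lambda>i j. \<theta> * ?A i j)) (\<lambda>i. Y (s n i) \<omega>) - real n\<bar>}
      \<le> 2 * exp (4 * real n * ?s\<^sup>2 - ?s * (sqrt n * ln n)) + sqrt 2 * exp (- (sqrt n * ln n) / (4 * ?h))"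
    proof (rule quadratic_form_deviation[OF pd_scale[OF p0 \<theta>] pd_scale[OF pA \<theta>] gv ord])
      show "\<bar>tr_prod n (finv n (\<lambda>i j. \<theta> * ?A i j)) (\<lambda>i j. \<theta> * ?R i j) - real n\<bar> \<le> ?h"
        using elim(1) by (simp add: tr_prod_finv_scale[OF pA \<theta>])
      show "?s \<le> 1 / 4" using sq by (simp add: divide_simps)
    qed (use sq in auto)
    also have "4 * real n * ?s\<^sup>2 - ?s * (sqrt n * ln n) = 16 - 2 * ln n" using sq n by (simp add: power_divide)
    also have "- (sqrt n * ln n) / (4 * ?h) = - 2 * ln n" using sq by simp
    also have "2 * exp (16 - 2 * ln n) + sqrt 2 * exp (- 2 * ln n) = (2 * exp 16 + sqrt 2) * exp (- 2 * ln n)"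
    proof -
      have "exp (16 - 2 * ln n) = exp 16 * exp (- 2 * ln n)" unfolding exp_add[symmetric] by simp
      then show ?thesis by (simp only: distrib_right mult.assoc)
    qed
    also have "exp (- 2 * ln n) = real n powr (- 2)" using n by (simp add: powr_def)
    finally show ?case unfolding Qeq by simp
  qed
  have "summable (\<lambda>n. prob (?E n))"
  proof (rule summable_comparison_test_ev[OF bound])
    show "summable (\<lambda>n. (2 * exp 16 + sqrt 2) * real n powr (- 2))"
      by (intro summable_mult) (simp add: summable_real_powr_iff)
  qed
  then have "AE \<omega> in M. \<forall>\<^sub>F n in sequentially. \<omega> \<in> space M - ?E n"
  proof (rule borel_cantelli_AE1[rotated 2])
    show "?E n \<in> sets M" for n by (rule E_sets)
    show "emeasure M (?E n) < \<infinity>" for n using emeasure_finite[of "?E n"] by (simp only: less_top infinity_ennreal_def)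
  qed
  then show ?thesis
  proof eventually_elim
    case (elim \<omega>)
    then show ?case
    proof eventually_elim
      case (elim n)
      then have "\<not> (sqrt n * ln n + sqrt n * ln n \<le> \<bar>?Q n \<omega> - real n\<bar>)" by blast
      then show ?case by linarith
    qed
  qed
qed

section \<open>The likelihood in the microergodic parameter\<close>

definition lik :: "real \<Rightarrow> real \<Rightarrow> real \<Rightarrow> real" where
  "lik n q \<theta> = exp (- q / (2 * \<theta>) - n / 2 * ln \<theta>)"

text \<open>The value of \<open>lik n q\<close> at its maximiser \<theta> = q/n.\<close>

definition lmax :: "real \<Rightarrow> real \<Rightarrow> real" where
  "lmax n q = exp (- (n / 2) * (1 + ln (q / n)))"

lemma lik_measurable [measurable]: "lik n q \<in> borel_measurable borel"
  unfolding lik_def[abs_def] by measurable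

lemma lik_nonneg: "0 \<le> lik n q \<theta>" by (simp add: lik_def)

lemma lmax_pos: "0 < lmax n q" by (simp add: lmax_def)

text \<open>Relative to the maximum, \<theta> enters only through w = q/(n \<theta>), with rate
  function w - 1 - ln w.\<close>

lemma lik_eq:
  assumes "0 < n" "0 < q" "0 < \<theta>"
  shows "lik n q \<theta> = lmax n q * exp (- (n / 2) * (q / (n * \<theta>) - 1 - ln (q / (n * \<theta>))))"
proof -
  have 1: "ln (q / n) = ln (q / (n * \<theta>)) + ln \<theta>" using assms by (simp add: ln_div ln_mult)
  have 2: "q / (2 * \<theta>) = n / 2 * (q / (n * \<theta>))" using assms by simp
  have "- q / (2 * \<theta>) - n / 2 * ln \<theta> = - (n / 2) * (1 + ln (q / n)) + - (n / 2) * (q / (n * \<theta>) - 1 - ln (q / (n * \<theta>)))"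
    unfolding 1 minus_divide_left[symmetric] 2 by (simp add: ring_distribs)
  then show ?thesis by (simp only: lik_def lmax_def exp_add[symmetric])
qed

lemma sub_one_ln_nonneg: "0 < (w::real) \<Longrightarrow> 0 \<le> w - 1 - ln w"
  using ln_le_minus_one[of w] by simp

lemma lik_le_lmax: "0 < n \<Longrightarrow> 0 < q \<Longrightarrow> 0 < \<theta> \<Longrightarrow> lik n q \<theta> \<le> lmax n q"
  using sub_one_ln_nonneg[of "q / (n * \<theta>)"] lmax_pos[of n q]
  by (simp add: lik_eq mult_le_cancel_left1)

lemma sub_one_ln_ge_sqrt: "0 < (w::real) \<Longrightarrow> (sqrt w - 1)\<^sup>2 \<le> w - 1 - ln w"
  using ln_le_minus_one[of "sqrt w"] by (simp add: ln_sqrt power2_eq_square algebra_simps)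

text \<open>By \<open>sub_one_ln_ge_sqrt\<close> it suffices to bound \<delta> by a multiple of
  |sqrt w - 1|. The worst case is w = 1 + \<delta> with \<delta> = 1, where the factor is sqrt 2 + 1
  < 61/25, and (61/25)^2 < 6.\<close>

lemma sub_one_ln_ge:
  fixes w \<delta> :: real
  assumes "0 < w" "0 < \<delta>" "\<delta> \<le> 1" "\<delta> \<le> \<bar>w - 1\<bar>"
  shows "\<delta>\<^sup>2 / 6 \<le> w - 1 - ln w"
proof -
  define e where "e = \<bar>sqrt w - 1\<bar>"
  have "\<delta> \<le> 12 / 5 * e \<or> \<delta> \<le> 61 / 25 * e"
  proof (cases "w \<le> 1")
    case True
    define r where "r = sqrt w"
    have r: "0 \<le> r" "r \<le> 1" "w = r * r" using True assms by (auto simp: r_def)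
    have "\<delta> \<le> (1 - r) * (1 + r)" using True assms(4) r by (simp add: algebra_simps)
    also have "\<dots> \<le> (1 - r) * 2" using r by (intro mult_left_mono) auto
    finally show ?thesis using r(2) by (simp add: e_def r_def[symmetric])
  next
    case False
    then have w: "1 + \<delta> \<le> w" using assms by simp
    define r where "r = sqrt (1 + \<delta>)"
    have r: "1 \<le> r" "r \<le> sqrt w" "r * r = 1 + \<delta>" using w assms by (auto simp: r_def)
    have "r \<le> 36 / 25" unfolding r_def using assms by (intro real_le_lsqrt) (auto simp: power2_eq_square)
    then have "(r - 1) * (r + 1) \<le> (r - 1) * (61 / 25)" using r by (intro mult_left_mono) auto
    then have "\<delta> \<le> 61 / 25 * (r - 1)" using r(3) by (simp add: algebra_simps)
    also have "\<dots> \<le> 61 / 25 * e" unfolding e_def using r by (intro mult_left_mono) linarith+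
    finally show ?thesis by simp
  qed
  moreover have "0 \<le> e" by (simp add: e_def)
  ultimately have "\<delta> \<le> 61 / 25 * e" by auto
  then have "\<delta>\<^sup>2 \<le> (61 / 25 * e)\<^sup>2" using assms by (intro power_mono) auto
  also have "\<dots> \<le> 6 * e\<^sup>2" by (simp add: power2_eq_square)
  finally show ?thesis using sub_one_ln_ge_sqrt[OF assms(1)] by (simp add: e_def)
qed

text \<open>Upper counterpart near the maximum, from 1/v - 1 + ln v <= (v - 1)^2 / v. At x = 1/sqrt
  n it shows that the likelihood loses only a constant factor.\<close>

lemma sub_one_ln_inverse_le:
  fixes v x :: real
  assumes "1 \<le> v" "v \<le> 1 + x" "0 \<le> x"
  shows "1 / v - 1 - ln (1 / v) \<le> x\<^sup>2"
proof -
  have "ln v \<le> v - 1" using ln_le_minus_one[of v] assms by simp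
  then have "1 / v - 1 - ln (1 / v) \<le> 1 / v - 1 + (v - 1)" using assms by (simp add: ln_div)
  also have "\<dots> = (v - 1)\<^sup>2 / v" using assms by (simp add: field_simps power2_eq_square)
  also have "\<dots> \<le> (v - 1)\<^sup>2 / 1" using assms by (intro divide_left_mono) auto
  also have "\<dots> \<le> x\<^sup>2" using assms by (auto intro: power_mono)
  finally show ?thesis .
qed

text \<open>An upper bound for the likelihood mass far from \<open>\<theta>\<^sub>0\<close>, divided
  by a lower bound for the total mass, both relative to \<open>lmax\<close>. The two summands belong
  to the ranges inside and outside \<open>(\<theta>\<^sub>0/2, 2\<theta>\<^sub>0)\<close>; the last
  factor is the inverse of \<open>exp (- 1) * b * \<theta>\<^sub>0 / (2 * sqrt n)\<close>.\<close>

definition bad_rate :: "real \<Rightarrow> real \<Rightarrow> real \<Rightarrow> real \<Rightarrow> real" where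
  "bad_rate \<theta>\<^sub>0 B b n = (2 * \<theta>\<^sub>0 * B * exp (- (ln n)\<^sup>2 / 12) + exp (- n / 192)) * (2 * exp 1 * sqrt n / (\<theta>\<^sub>0 * b))"

section \<open>Posterior mass of \<theta> for a fixed range parameter\<close>

context
  fixes \<theta>\<^sub>0 n q \<epsilon> :: real and f :: "real \<Rightarrow> real" and B b :: real
  assumes \<theta>\<^sub>0: "0 < \<theta>\<^sub>0" and n: "0 < n" "2 \<le> ln n" and \<epsilon>: "\<epsilon> = ln n / sqrt n" "\<epsilon> \<le> 1 / 20"
    and q: "\<bar>q / \<theta>\<^sub>0 - n\<bar> \<le> 2 * sqrt n * ln n"
    and f0: "\<And>\<theta>. 0 < \<theta> \<Longrightarrow> 0 \<le> f \<theta>" and fm: "(\<lambda>\<theta>. indicator {0<..} \<theta> * f \<theta>) \<in> borel_measurable borel"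
    and f1: "(\<integral>\<^sup>+ \<theta>\<in>{0<..}. ennreal (f \<theta>) \<partial>lborel) \<le> 1"
    and fB: "\<And>\<theta>. \<theta>\<^sub>0 / 2 < \<theta> \<Longrightarrow> \<theta> < 2 * \<theta>\<^sub>0 \<Longrightarrow> f \<theta> \<le> B"
    and fb: "\<And>\<theta>. \<bar>\<theta> / \<theta>\<^sub>0 - 1\<bar> \<le> 4 * \<epsilon> \<Longrightarrow> b \<le> f \<theta>" and b: "0 < b"
begin

lemma n_ge_1: "1 < n"
proof -
  have "0 < ln n" using n by linarith
  then show ?thesis using n(1) ln_gt_zero_iff[of n] by simp
qed

lemma eps_pos: "0 < \<epsilon>" using n n_ge_1 by (simp add: \<epsilon>)

lemma eps_sq: "n * \<epsilon>\<^sup>2 = (ln n)\<^sup>2" using n by (simp add: \<epsilon> power_divide)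

lemma q_ratio: "1 - 2 * \<epsilon> \<le> q / (\<theta>\<^sub>0 * n)" "q / (\<theta>\<^sub>0 * n) \<le> 1 + 2 * \<epsilon>"
proof -
  have "\<bar>q / (\<theta>\<^sub>0 * n) - 1\<bar> = \<bar>q / \<theta>\<^sub>0 - n\<bar> / n" using n \<theta>\<^sub>0 by (simp add: abs_if field_simps)
  also have "\<dots> \<le> 2 * sqrt n * ln n / n" using q n by (intro divide_right_mono) auto
  also have "\<dots> = 2 * \<epsilon>"
    using n real_sqrt_mult_self[of n] by (simp add: \<epsilon> field_simps)
  finally show "1 - 2 * \<epsilon> \<le> q / (\<theta>\<^sub>0 * n)" "q / (\<theta>\<^sub>0 * n) \<le> 1 + 2 * \<epsilon>" by linarith+
qed

lemma q_pos: "0 < q"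
proof -
  have "0 < q / (\<theta>\<^sub>0 * n)" using q_ratio(1) \<epsilon>(2) by linarith
  moreover have "0 < \<theta>\<^sub>0 * n" using \<theta>\<^sub>0 n by simp
  ultimately show ?thesis by (auto simp: zero_less_divide_iff)
qed

text \<open>Uses the interval of relative width 1/sqrt n to the right of the maximiser q/n. On it
  the likelihood is at least e^(-1) times its maximum, and ln n >= 2 keeps it within relative
  distance 4\<epsilon> of \<open>\<theta>\<^sub>0\<close>, where the prior density is at least
  b.\<close>

lemma lik_integral_ge: "ennreal (lmax n q * (exp (- 1) * b * \<theta>\<^sub>0 / (2 * sqrt n))) \<le> (\<integral>\<^sup>+ \<theta>\<in>{0<..}. ennreal (lik n q \<theta> * f \<theta>) \<partial>lborel)"
proof -
  define m where "m = q / n"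
  let ?I = "{m..m * (1 + 1 / sqrt n)}"
  have m: "0 < m" using q_pos n by (simp add: m_def)
  have mq: "m = \<theta>\<^sub>0 * (q / (\<theta>\<^sub>0 * n))" using \<theta>\<^sub>0 by (simp add: m_def)
  have sq: "1 / sqrt n \<le> \<epsilon> / 2"
  proof -
    have "1 * (1 / sqrt n) \<le> (ln n / 2) * (1 / sqrt n)" using n by (intro mult_right_mono) auto
    then show ?thesis by (simp add: \<epsilon>)
  qed
  have pt: "lmax n q * exp (- 1) * b \<le> lik n q \<theta> * f \<theta> \<and> 0 < \<theta>" if "\<theta> \<in> ?I" for \<theta>
  proof -
    have t0: "0 < \<theta>" using that m by auto
    define v where "v = \<theta> / m"
    have v: "1 \<le> v" "v \<le> 1 + 1 / sqrt n" using that m by (auto simp: v_def pos_le_divide_eq pos_divide_le_eq mult.commute)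
    have vw: "q / (n * \<theta>) = 1 / v" by (simp add: v_def m_def)
    have "1 / v - 1 - ln (1 / v) \<le> (1 / sqrt n)\<^sup>2" using v n by (intro sub_one_ln_inverse_le) auto
    also have "\<dots> = 1 / n" using n by (simp add: power_divide)
    finally have "n / 2 * (1 / v - 1 - ln (1 / v)) \<le> n / 2 * (1 / n)" using n by (intro mult_left_mono) auto
    then have "exp (- 1) \<le> exp (- (n / 2) * (q / (n * \<theta>) - 1 - ln (q / (n * \<theta>))))" unfolding vw using n by simp
    then have l: "lmax n q * exp (- 1) \<le> lik n q \<theta>"
      unfolding lik_eq[OF n(1) q_pos t0] using lmax_pos[of n q] by (intro mult_left_mono) auto
    have "\<theta> / \<theta>\<^sub>0 = q / (\<theta>\<^sub>0 * n) * v" using \<theta>\<^sub>0 m q_pos n by (simp add: v_def m_def)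
    moreover have "q / (\<theta>\<^sub>0 * n) * v \<le> (1 + 2 * \<epsilon>) * (1 + \<epsilon> / 2)"
      using q_ratio v sq eps_pos q_pos \<theta>\<^sub>0 n by (intro mult_mono) auto
    moreover have "(1 + 2 * \<epsilon>) * (1 + \<epsilon> / 2) \<le> 1 + 4 * \<epsilon>"
    proof -
      have "\<epsilon> * \<epsilon> \<le> (1 / 20) * \<epsilon>" using \<epsilon>(2) eps_pos by (intro mult_right_mono) auto
      moreover have "(1 + 2 * \<epsilon>) * (1 + \<epsilon> / 2) = 1 + 5 / 2 * \<epsilon> + \<epsilon> * \<epsilon>" by (simp add: algebra_simps)
      ultimately show ?thesis using eps_pos by linarith
    qed
    moreover have "(1 - 2 * \<epsilon>) * 1 \<le> q / (\<theta>\<^sub>0 * n) * v"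
      using q_ratio v \<epsilon>(2) q_pos \<theta>\<^sub>0 n by (intro mult_mono) auto
    ultimately have "\<bar>\<theta> / \<theta>\<^sub>0 - 1\<bar> \<le> 4 * \<epsilon>" using eps_pos by (auto simp: abs_le_iff)
    then have "b \<le> f \<theta>" by (rule fb)
    with l have "lmax n q * exp (- 1) * b \<le> lik n q \<theta> * f \<theta>"
      using b by (intro mult_mono lik_nonneg) auto
    then show ?thesis using t0 by simp
  qed
  have "ennreal (lmax n q * (exp (- 1) * b * \<theta>\<^sub>0 / (2 * sqrt n))) \<le> ennreal (lmax n q * exp (- 1) * b * (m * (1 / sqrt n)))"
  proof (rule ennreal_leI)
    have "1 / 2 \<le> q / (\<theta>\<^sub>0 * n)" using q_ratio(1) \<epsilon>(2) by simp
    then have "\<theta>\<^sub>0 * (1 / 2) \<le> m" unfolding mq using \<theta>\<^sub>0 by (intro mult_left_mono) auto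
    then have "lmax n q * exp (- 1) * b * ((\<theta>\<^sub>0 * (1 / 2)) * (1 / sqrt n)) \<le> lmax n q * exp (- 1) * b * (m * (1 / sqrt n))"
      using lmax_pos[of n q] b n by (intro mult_left_mono mult_right_mono) auto
    then show "lmax n q * (exp (- 1) * b * \<theta>\<^sub>0 / (2 * sqrt n)) \<le> lmax n q * exp (- 1) * b * (m * (1 / sqrt n))"
      by (simp add: mult_ac)
  qed
  also have "\<dots> = ennreal (lmax n q * exp (- 1) * b) * ennreal (m * (1 / sqrt n))"
    using lmax_pos[of n q] b m n by (intro ennreal_mult) auto
  also have "ennreal (m * (1 / sqrt n)) = emeasure lborel ?I"
    using m n by (subst emeasure_lborel_Icc) (auto simp: algebra_simps)
  also have "ennreal (lmax n q * exp (- 1) * b) * emeasure lborel ?I = (\<integral>\<^sup>+ \<theta>. ennreal (lmax n q * exp (- 1) * b) * indicator ?I \<theta> \<partial>lborel)"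
    by (rule nn_integral_cmult_indicator[symmetric]) simp
  also have "\<dots> \<le> (\<integral>\<^sup>+ \<theta>\<in>{0<..}. ennreal (lik n q \<theta> * f \<theta>) \<partial>lborel)"
    by (intro nn_integral_mono) (use pt in \<open>auto simp: indicator_def intro!: ennreal_leI\<close>)
  finally show ?thesis .
qed

text \<open>With \<open>u = \<theta>/\<theta>\<^sub>0\<close> and
  \<open>r = q/(\<theta>\<^sub>0 n)\<close>, |r - 1| <= 2\<epsilon> and |u - 1| > 5\<epsilon> force
  |r/u - 1| >= \<epsilon>, and n \<epsilon>^2 = (ln n)^2. Outside
  \<open>(\<theta>\<^sub>0/2, 2\<theta>\<^sub>0)\<close> the distance is at least 1/4, and (1/4)^2 /
  12 = 1/192.\<close>

lemma lik_bad_le: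
  assumes "0 < \<theta>" "5 * \<epsilon> < \<bar>\<theta> / \<theta>\<^sub>0 - 1\<bar>"
  shows "lik n q \<theta> \<le> lmax n q * exp (- (ln n)\<^sup>2 / 12)"
    and "\<not> (\<theta>\<^sub>0 / 2 < \<theta> \<and> \<theta> < 2 * \<theta>\<^sub>0) \<Longrightarrow> lik n q \<theta> \<le> lmax n q * exp (- n / 192)"
proof -
  define u where "u = \<theta> / \<theta>\<^sub>0"
  define r where "r = q / (\<theta>\<^sub>0 * n)"
  have u: "0 < u" "5 * \<epsilon> < \<bar>u - 1\<bar>" using assms \<theta>\<^sub>0 by (auto simp: u_def)
  have r: "1 - 2 * \<epsilon> \<le> r" "r \<le> 1 + 2 * \<epsilon>" using q_ratio by (auto simp: r_def)
  have w: "q / (n * \<theta>) = r / u" using \<theta>\<^sub>0 by (simp add: r_def u_def mult.commute)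
  have w0: "0 < r / u" using r \<epsilon>(2) u by simp
  have main: "lik n q \<theta> \<le> lmax n q * exp (- (n * \<delta>\<^sup>2 / 12))" if "0 < \<delta>" "\<delta> \<le> 1" "\<delta> \<le> \<bar>r / u - 1\<bar>" for \<delta>
  proof -
    have "\<delta>\<^sup>2 / 6 \<le> r / u - 1 - ln (r / u)" by (rule sub_one_ln_ge[OF w0 that])
    then have "n / 2 * (\<delta>\<^sup>2 / 6) \<le> n / 2 * (r / u - 1 - ln (r / u))" using n by (intro mult_left_mono) auto
    then show ?thesis unfolding lik_eq[OF n(1) q_pos assms(1)] w
      using lmax_pos[of n q] by (intro mult_left_mono) auto
  qed
  have "\<epsilon> \<le> \<bar>r / u - 1\<bar>"
  proof (cases "1 < u")
    case True
    then have "1 + 5 * \<epsilon> < u" using u by simp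
    then have "(1 - \<epsilon>) * (1 + 5 * \<epsilon>) \<le> (1 - \<epsilon>) * u" using \<epsilon>(2) by (intro mult_left_mono) auto
    moreover have "1 + 2 * \<epsilon> \<le> (1 - \<epsilon>) * (1 + 5 * \<epsilon>)"
    proof -
      have "\<epsilon> * \<epsilon> \<le> (1 / 20) * \<epsilon>" using \<epsilon>(2) eps_pos by (intro mult_right_mono) auto
      moreover have "(1 - \<epsilon>) * (1 + 5 * \<epsilon>) = 1 + 4 * \<epsilon> - 5 * (\<epsilon> * \<epsilon>)" by (simp add: algebra_simps)
      ultimately show ?thesis using eps_pos by linarith
    qed
    ultimately have "r \<le> (1 - \<epsilon>) * u" using r by linarith
    then have "r / u \<le> 1 - \<epsilon>" using u by (simp add: pos_divide_le_eq)
    then show ?thesis by simp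
  next
    case False
    then have "u < 1 - 5 * \<epsilon>" using u by simp
    then have "(1 + \<epsilon>) * u \<le> (1 + \<epsilon>) * (1 - 5 * \<epsilon>)" using eps_pos by (intro mult_left_mono) auto
    moreover have "(1 + \<epsilon>) * (1 - 5 * \<epsilon>) \<le> 1 - 2 * \<epsilon>"
      using eps_pos mult_pos_pos[OF eps_pos eps_pos] by (simp add: algebra_simps)
    ultimately have "(1 + \<epsilon>) * u \<le> r" using r by linarith
    then have "1 + \<epsilon> \<le> r / u" using u by (simp add: pos_le_divide_eq)
    then show ?thesis by simp
  qed
  from main[OF eps_pos _ this] \<epsilon>(2) show "lik n q \<theta> \<le> lmax n q * exp (- (ln n)\<^sup>2 / 12)"
    by (simp add: eps_sq)
  assume "\<not> (\<theta>\<^sub>0 / 2 < \<theta> \<and> \<theta> < 2 * \<theta>\<^sub>0)"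
  then have far: "u \<le> 1 / 2 \<or> 2 \<le> u" using \<theta>\<^sub>0 by (auto simp: u_def field_simps)
  have "1 / 4 \<le> \<bar>r / u - 1\<bar>"
    using far
  proof
    assume "u \<le> 1 / 2"
    then have "(5 / 4) * u \<le> r" using r \<epsilon>(2) by linarith
    then have "5 / 4 \<le> r / u" using u by (simp add: pos_le_divide_eq)
    then show ?thesis by linarith
  next
    assume "2 \<le> u"
    then have "r \<le> (3 / 4) * u" using r \<epsilon>(2) by linarith
    then have "r / u \<le> 3 / 4" using u by (simp add: pos_divide_le_eq)
    then show ?thesis by linarith
  qed
  from main[OF _ _ this] show "lik n q \<theta> \<le> lmax n q * exp (- n / 192)"
    by (simp add: power_divide)
qed

text \<open>Near \<open>\<theta>\<^sub>0\<close> the prior density is bounded by B, on an interval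
  of length at most \<open>2\<theta>\<^sub>0\<close>; elsewhere only its total mass is controlled,
  but there the likelihood is exponentially small in n.\<close>

lemma bad_ratio:
  "(\<integral>\<^sup>+ \<theta>\<in>{\<theta>. 0 < \<theta> \<and> 5 * \<epsilon> < \<bar>\<theta> / \<theta>\<^sub>0 - 1\<bar>}. ennreal (lik n q \<theta> * f \<theta>) \<partial>lborel)
    \<le> ennreal (bad_rate \<theta>\<^sub>0 B b n) * (\<integral>\<^sup>+ \<theta>\<in>{0<..}. ennreal (lik n q \<theta> * f \<theta>) \<partial>lborel)"
proof -
  let ?L = "lmax n q"
  let ?e1 = "exp (- (ln n)\<^sup>2 / 12)" and ?e2 = "exp (- n / 192)"
  have L: "0 < ?L" by (rule lmax_pos)
  have B: "0 \<le> B"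
  proof -
    have "f \<theta>\<^sub>0 \<le> B" using \<theta>\<^sub>0 by (intro fB) auto
    then show ?thesis using f0[OF \<theta>\<^sub>0] by simp
  qed
  have pt: "ennreal (lik n q \<theta> * f \<theta>) * indicator {\<theta>. 0 < \<theta> \<and> 5 * \<epsilon> < \<bar>\<theta> / \<theta>\<^sub>0 - 1\<bar>} \<theta> \<le>
      ennreal (?L * ?e1 * B) * indicator {0..2 * \<theta>\<^sub>0} \<theta> + ennreal (?L * ?e2) * (ennreal (f \<theta>) * indicator {0<..} \<theta>)" for \<theta>
  proof (cases "0 < \<theta> \<and> 5 * \<epsilon> < \<bar>\<theta> / \<theta>\<^sub>0 - 1\<bar>")
    case True
    then have t: "0 < \<theta>" "5 * \<epsilon> < \<bar>\<theta> / \<theta>\<^sub>0 - 1\<bar>" by auto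
    show ?thesis
    proof (cases "\<theta>\<^sub>0 / 2 < \<theta> \<and> \<theta> < 2 * \<theta>\<^sub>0")
      case near: True
      have "lik n q \<theta> * f \<theta> \<le> ?L * ?e1 * B"
        using near fB f0[OF t(1)] lik_bad_le(1)[OF t] L B by (intro mult_mono) auto
      then have "ennreal (lik n q \<theta> * f \<theta>) \<le> ennreal (?L * ?e1 * B)" by (rule ennreal_leI)
      then show ?thesis using t near by (simp add: add_increasing2)
    next
      case far: False
      have "lik n q \<theta> * f \<theta> \<le> ?L * ?e2 * f \<theta>"
        using f0[OF t(1)] lik_bad_le(2)[OF t far] by (intro mult_right_mono) auto
      then have "ennreal (lik n q \<theta> * f \<theta>) \<le> ennreal (?L * ?e2) * ennreal (f \<theta>)"
        using f0[OF t(1)] L by (simp add: ennreal_mult[symmetric] ennreal_leI)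
      then show ?thesis using t by (simp add: add_increasing)
    qed
  qed auto
  have fm' [measurable]: "(\<lambda>\<theta>. ennreal (f \<theta>) * indicator {0<..} \<theta>) \<in> borel_measurable lborel"
  proof -
    have "(\<lambda>\<theta>. ennreal (f \<theta>) * indicator {0<..} \<theta>) = (\<lambda>\<theta>. ennreal (indicator {0<..} \<theta> * f \<theta>))"
      by (auto simp: indicator_def)
    then show ?thesis using fm by simp
  qed
  have "(\<integral>\<^sup>+ \<theta>\<in>{\<theta>. 0 < \<theta> \<and> 5 * \<epsilon> < \<bar>\<theta> / \<theta>\<^sub>0 - 1\<bar>}. ennreal (lik n q \<theta> * f \<theta>) \<partial>lborel) \<le>
    (\<integral>\<^sup>+ \<theta>. ennreal (?L * ?e1 * B) * indicator {0..2 * \<theta>\<^sub>0} \<theta> + ennreal (?L * ?e2) * (ennreal (f \<theta>) * indicator {0<..} \<theta>) \<partial>lborel)"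
    by (intro nn_integral_mono pt)
  also have "\<dots> = ennreal (?L * ?e1 * B) * ennreal (2 * \<theta>\<^sub>0) + ennreal (?L * ?e2) * (\<integral>\<^sup>+ \<theta>\<in>{0<..}. ennreal (f \<theta>) \<partial>lborel)"
    using \<theta>\<^sub>0 by (simp add: nn_integral_add nn_integral_cmult nn_integral_cmult_indicator)
  also have "\<dots> \<le> ennreal (?L * ?e1 * B) * ennreal (2 * \<theta>\<^sub>0) + ennreal (?L * ?e2) * 1"
    by (intro add_left_mono mult_left_mono f1) auto
  also have "\<dots> = ennreal (?L * (2 * \<theta>\<^sub>0 * B * ?e1 + ?e2))"
    using L B \<theta>\<^sub>0 by (simp add: ennreal_mult[symmetric] ennreal_plus[symmetric] algebra_simps del: ennreal_plus)
  also have "\<dots> = ennreal (bad_rate \<theta>\<^sub>0 B b n * (?L * (exp (- 1) * b * \<theta>\<^sub>0 / (2 * sqrt n))))"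
  proof -
    define c where "c = 2 * exp 1 * sqrt n / (\<theta>\<^sub>0 * b)"
    define d where "d = exp (- 1) * b * \<theta>\<^sub>0 / (2 * sqrt n)"
    have cd: "c * d = 1"
      using \<theta>\<^sub>0 b n by (simp add: c_def d_def exp_minus field_simps)
    have "bad_rate \<theta>\<^sub>0 B b n * (?L * d) = ?L * (2 * \<theta>\<^sub>0 * B * ?e1 + ?e2) * (c * d)"
      unfolding bad_rate_def c_def[symmetric] by (simp only: mult_ac)
    then show ?thesis unfolding d_def[symmetric] cd by (simp only: mult_1_right)
  qed
  also have "\<dots> = ennreal (bad_rate \<theta>\<^sub>0 B b n) * ennreal (?L * (exp (- 1) * b * \<theta>\<^sub>0 / (2 * sqrt n)))"
    using \<theta>\<^sub>0 b n B L by (intro ennreal_mult) (auto simp: bad_rate_def intro!: mult_nonneg_nonneg add_nonneg_nonneg)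
  also have "\<dots> \<le> ennreal (bad_rate \<theta>\<^sub>0 B b n) * (\<integral>\<^sup>+ \<theta>\<in>{0<..}. ennreal (lik n q \<theta> * f \<theta>) \<partial>lborel)"
    by (intro mult_left_mono lik_integral_ge) auto
  finally show ?thesis .
qed

end

lemma bad_rate_const_tendsto_0: "(\<lambda>n. bad_rate \<theta>\<^sub>0 B b (real n)) \<longlonglongrightarrow> 0"
proof -
  have 1: "(\<lambda>n. exp (- (ln (real n))\<^sup>2 / 12) * sqrt n) \<longlonglongrightarrow> 0" by real_asymp
  have 2: "(\<lambda>n. exp (- real n / 192) * sqrt n) \<longlonglongrightarrow> 0" by real_asymp
  have "(\<lambda>n. 2 * \<theta>\<^sub>0 * B * (2 * exp 1 / (\<theta>\<^sub>0 * b)) * (exp (- (ln (real n))\<^sup>2 / 12) * sqrt n) +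
     (2 * exp 1 / (\<theta>\<^sub>0 * b)) * (exp (- real n / 192) * sqrt n)) \<longlonglongrightarrow> 2 * \<theta>\<^sub>0 * B * (2 * exp 1 / (\<theta>\<^sub>0 * b)) * 0 + (2 * exp 1 / (\<theta>\<^sub>0 * b)) * 0"
    by (intro tendsto_intros 1 2)
  moreover have "bad_rate \<theta>\<^sub>0 B b n = 2 * \<theta>\<^sub>0 * B * (2 * exp 1 / (\<theta>\<^sub>0 * b)) * (exp (- (ln n)\<^sup>2 / 12) * sqrt n) +
     (2 * exp 1 / (\<theta>\<^sub>0 * b)) * (exp (- n / 192) * sqrt n)" for n
  proof -
    define c where "c = 2 * exp 1 / (\<theta>\<^sub>0 * b)"
    have "2 * exp 1 * sqrt n / (\<theta>\<^sub>0 * b) = c * sqrt n" by (simp add: c_def)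
    then show ?thesis unfolding bad_rate_def c_def[symmetric] by (simp add: algebra_simps)
  qed
  ultimately show ?thesis by simp
qed

text \<open>Allows the prior bounds to grow with n: the power n^C2 is absorbed by exp(-(ln n)^2/12),
  and exp(n^C3) by exp(-n/192) because C3 < 1.\<close>

lemma bad_rate_growth_tendsto_0:
  fixes C2 C3 :: real
  assumes "C3 < 1"
  shows "(\<lambda>n. (2 * \<theta>\<^sub>0 * real n powr C2 * exp (- (ln (real n))\<^sup>2 / 12) + exp (real n powr C3 - real n / 192)) * (K * sqrt n)) \<longlonglongrightarrow> 0"
proof -
  have 1: "(\<lambda>n. real n powr C2 * exp (- (ln (real n))\<^sup>2 / 12) * sqrt n) \<longlonglongrightarrow> 0" by real_asymp
  have 2: "(\<lambda>n. exp (real n powr C3 - real n / 192) * sqrt n) \<longlonglongrightarrow> 0" using assms by real_asymp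
  have "(\<lambda>n. 2 * \<theta>\<^sub>0 * K * (real n powr C2 * exp (- (ln (real n))\<^sup>2 / 12) * sqrt n) + K * (exp (real n powr C3 - real n / 192) * sqrt n)) \<longlonglongrightarrow> 2 * \<theta>\<^sub>0 * K * 0 + K * 0"
    by (intro tendsto_intros 1 2)
  then show ?thesis by (simp add: algebra_simps)
qed

section \<open>Likelihood, prediction errors and normalized densities\<close>

text \<open>\<sigma>^2 times the correlation matrix equals \<theta> times the matrix of
  \<open>kern\<close>, so the powers of \<alpha> cancel between the quadratic form, the logarithm of
  \<sigma>^2 and the determinant.\<close>

lemma log_lik_eq:
  fixes s :: "nat \<Rightarrow> real ^ 'd::finite" and Y :: "real ^ 'd \<Rightarrow> 'w \<Rightarrow> real"
  assumes "0 < \<nu>" "0 < \<alpha>" "0 < \<theta>" "inj_on s {..<n}"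
  shows "exp (log_lik \<nu> n s (obs_vec n s Y \<omega>) (\<theta> / \<alpha> powr (2 * \<nu>)) \<alpha>) =
    lik n (qform n (finv n (kmat \<nu> s \<alpha>)) (\<lambda>i. Y (s i) \<omega>)) \<theta> * exp (- ln (fdet n (kmat \<nu> s \<alpha>)) / 2)"
proof -
  define c where "c = \<alpha> powr (2 * \<nu>)"
  have c: "0 < c" using assms(2) by (simp add: c_def)
  let ?A = "kmat \<nu> s \<alpha>"
  have pA: "pd n ?A" by (rule pd_kmat[OF assms(1,2,4)])
  have R: "corr_mat \<nu> n s \<alpha> = fmat n (\<lambda>i j. c * ?A i j)"
    unfolding corr_mat_def fmat_def kmat_def c_def using matern_eq_kern[OF assms(1,2)]
    by (intro cong_mat) auto
  have inv: "corr_inv \<nu> n s \<alpha> = fmat n (finv n (\<lambda>i j. c * ?A i j))"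
    unfolding corr_inv_def R by (rule finv_mat(1)[OF pd_scale[OF pA c]])
  have q: "scalar_prod (obs_vec n s Y \<omega>) (mult_mat_vec (corr_inv \<nu> n s \<alpha>) (obs_vec n s Y \<omega>)) = qform n (finv n ?A) (\<lambda>i. Y (s i) \<omega>) / c"
  proof -
    have "scalar_prod (obs_vec n s Y \<omega>) (mult_mat_vec (fmat n B) (obs_vec n s Y \<omega>)) = qform n B (\<lambda>i. Y (s i) \<omega>)" for B
      by (simp add: obs_vec_def fmat_def scalar_prod_def qform_def sum_distrib_left atLeast0LessThan mult_ac)
    then show ?thesis unfolding inv by (simp add: qform_finv_scale[OF pA c])
  qed
  have d: "ln (Determinant.det (corr_mat \<nu> n s \<alpha>)) = n * ln c + ln (fdet n ?A)"
    unfolding R fdet_def[symmetric] fdet_scale using c pd_det_pos[OF pA] by (simp add: ln_mult ln_realpow)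
  have "log_lik \<nu> n s (obs_vec n s Y \<omega>) (\<theta> / c) \<alpha> = (- qform n (finv n ?A) (\<lambda>i. Y (s i) \<omega>) / (2 * \<theta>) - n / 2 * ln \<theta>) + (- ln (fdet n ?A) / 2)"
    unfolding log_lik_def q d using c assms(3) by (simp add: ln_div field_simps)
  then show ?thesis unfolding c_def by (simp only: exp_add lik_def)
qed

text \<open>The weights of the predictor depend on the design and on \<alpha> but not on the law, so
  the error is one fixed linear combination of the process at n + 1 points, and its second moment is
  linear in the covariance.\<close>

lemma pred_mse_scale:
  fixes s :: "nat \<Rightarrow> real ^ 'd::finite" and Y :: "real ^ 'd \<Rightarrow> 'w \<Rightarrow> real"
  assumes "0 < \<nu>" "0 < \<alpha>" "inj_on s {..<n}" "s ` {..<n} \<subseteq> S"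
  shows "\<exists>K. \<forall>M \<sigma>2 x. x \<in> S \<longrightarrow> centred_gaussian_process M S (\<lambda>u v. \<sigma>2 * C u v) Y \<longrightarrow> pred_mse M \<nu> n s Y \<alpha> x = \<sigma>2 * K x"
proof -
  define c where "c = \<alpha> powr (2 * \<nu>)"
  have c: "0 < c" using assms(2) by (simp add: c_def)
  let ?A = "\<lambda>i j. c * kmat \<nu> s \<alpha> i j"
  have pA: "pd n ?A" by (rule pd_scale[OF pd_kmat[OF assms(1-3)] c])
  have R: "corr_mat \<nu> n s \<alpha> = fmat n ?A"
    unfolding corr_mat_def fmat_def kmat_def c_def using matern_eq_kern[OF assms(1,2)]
    by (intro cong_mat) auto
  have inv: "corr_inv \<nu> n s \<alpha> = fmat n (finv n ?A)"
    unfolding corr_inv_def R by (rule finv_mat(1)[OF pA])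
  \<comment> \<open>Index n stands for the prediction point, with coefficient -1.\<close>
  define w where "w x j = (if j < n then \<Sum>i<n. matern \<nu> \<alpha> (s i - x) * finv n ?A i j else - 1)" for x j
  define z where "z x j = (if j < n then s j else x)" for x j
  have err: "pred_error \<nu> n s Y x \<alpha> \<omega> = (\<Sum>j<Suc n. w x j * Y (z x j) \<omega>)" for x \<omega>
  proof -
    have "scalar_prod (corr_vec \<nu> n s \<alpha> x) (mult_mat_vec (fmat n (finv n ?A)) (obs_vec n s Y \<omega>)) =
      (\<Sum>i<n. \<Sum>j<n. matern \<nu> \<alpha> (s i - x) * finv n ?A i j * Y (s j) \<omega>)"
      by (simp add: corr_vec_def obs_vec_def fmat_def scalar_prod_def sum_distrib_left atLeast0LessThan mult_ac)
    also have "\<dots> = (\<Sum>j<n. w x j * Y (z x j) \<omega>)"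
      by (subst sum.swap) (simp add: w_def z_def sum_distrib_right)
    finally show ?thesis unfolding pred_error_def inv by (simp add: w_def z_def)
  qed
  show ?thesis
  proof (intro exI[of _ "\<lambda>x. qform (Suc n) (\<lambda>i j. C (z x i) (z x j)) (w x)"] allI impI)
    fix M :: "'w measure" and \<sigma>2 x assume x: "x \<in> S" and P: "centred_gaussian_process M S (\<lambda>u v. \<sigma>2 * C u v) Y"
    have zS: "z x j \<in> S" for j using x assms(4) by (auto simp: z_def)
    have "(pred_error \<nu> n s Y x \<alpha> \<omega>)\<^sup>2 = (\<Sum>i<Suc n. \<Sum>j<Suc n. (w x i * w x j) * (Y (z x i) \<omega> * Y (z x j) \<omega>))" for \<omega>
      unfolding err power2_eq_square sum_product by (simp only: mult_ac)
    then have "pred_mse M \<nu> n s Y \<alpha> x = (LINT \<omega>|M. (\<Sum>i<Suc n. \<Sum>j<Suc n. (w x i * w x j) * (Y (z x i) \<omega> * Y (z x j) \<omega>)))"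
      unfolding pred_mse_def by (simp only:)
    also have "\<dots> = (\<Sum>i<Suc n. \<Sum>j<Suc n. (w x i * w x j) * (LINT \<omega>|M. Y (z x i) \<omega> * Y (z x j) \<omega>))"
      by (rule integral_double_sum(2)) (rule centred_gaussian_process_integrable(2)[OF P zS zS])
    also have "\<dots> = (\<Sum>i<Suc n. \<Sum>j<Suc n. (w x i * w x j) * (\<sigma>2 * C (z x i) (z x j)))"
      using P zS unfolding centred_gaussian_process_def by (intro sum.cong refl) metis
    also have "\<dots> = \<sigma>2 * qform (Suc n) (\<lambda>i j. C (z x i) (z x j)) (w x)"
      unfolding qform_def sum_distrib_left by (simp only: mult_ac)
    finally show "pred_mse M \<nu> n s Y \<alpha> x = \<sigma>2 * qform (Suc n) (\<lambda>i j. C (z x i) (z x j)) (w x)" .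
  qed
qed

text \<open>With \<rho> the ratio before scaling, r \<rho> - 1 = (r - 1)(\<rho> - 1) + (r - 1) +
  (\<rho> - 1), which is at most 5\<epsilon> + (5/4) z in absolute value. If 8\<epsilon> <= z this
  is at most 2z, otherwise at most 16\<epsilon>. For infinite \<zeta> the bound itself is
  infinite.\<close>

lemma ratio_dev_scale_le:
  assumes u: "\<And>x. x \<in> A \<Longrightarrow> u x = r * u\<^sub>0 x" and r: "\<bar>r - 1\<bar> \<le> 5 * \<epsilon>" and \<epsilon>: "0 \<le> \<epsilon>" "\<epsilon> \<le> 1 / 20"
    and dev: "ratio_dev A u\<^sub>0 v \<le> \<zeta>"
  shows "ratio_dev A u v \<le> max (ereal (16 * \<epsilon>)) (2 * \<zeta>)"
  unfolding ratio_dev_def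
proof (rule SUP_least)
  fix x assume x: "x \<in> A"
  define \<rho> where "\<rho> = u\<^sub>0 x / v x"
  have \<rho>: "ereal \<bar>\<rho> - 1\<bar> \<le> \<zeta>"
    using dev x unfolding ratio_dev_def \<rho>_def by (meson SUP_upper order_trans)
  show "ereal \<bar>u x / v x - 1\<bar> \<le> max (ereal (16 * \<epsilon>)) (2 * \<zeta>)"
  proof (cases \<zeta>)
    case (real z)
    then have z: "\<bar>\<rho> - 1\<bar> \<le> z" "0 \<le> z" using \<rho> abs_ge_zero[of "\<rho> - 1"] by (auto intro: order_trans)
    have "u x / v x = r * \<rho>" using u[OF x] by (simp add: \<rho>_def)
    then have "u x / v x - 1 = (r - 1) * (\<rho> - 1) + (r - 1) + (\<rho> - 1)"
      by (simp add: algebra_simps)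
    then have "\<bar>u x / v x - 1\<bar> \<le> \<bar>r - 1\<bar> * \<bar>\<rho> - 1\<bar> + \<bar>r - 1\<bar> + \<bar>\<rho> - 1\<bar>"
      unfolding abs_mult[symmetric] by linarith
    also have "\<dots> \<le> (5 * \<epsilon>) * z + 5 * \<epsilon> + z"
      using r z \<epsilon> by (intro add_mono mult_mono) auto
    also have "\<dots> \<le> max (16 * \<epsilon>) (2 * z)"
    proof -
      have "(5 * \<epsilon>) * z \<le> (1 / 4) * z" using \<epsilon> z by (intro mult_right_mono) auto
      then show ?thesis using \<epsilon> z by (cases "8 * \<epsilon> \<le> z") auto
    qed
    finally show ?thesis using real by (simp add: max_def split: if_splits)
  qed (use \<rho> in auto)
qed

text \<open>\<open>A\<close> is only enclosed in a measurable \<open>B\<close>, because the sets of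
  the theorem involve suprema over all prediction points and are not shown to be measurable. A
  nonmeasurable set has measure 0 by convention.\<close>

lemma measure_normalized_density_le:
  assumes w: "w \<in> borel_measurable M" "A \<subseteq> B" "B \<in> sets M" and r: "0 \<le> r"
    and le: "(\<integral>\<^sup>+ x\<in>B. ennreal (w x) \<partial>M) \<le> ennreal r * (\<integral>\<^sup>+ x. ennreal (w x) \<partial>M)"
  shows "measure (normalized_density M w) A \<le> r"
proof (cases "A \<in> sets M")
  case False
  then show ?thesis using r by (simp add: normalized_density_def measure_notin_sets)
next
  case True
  let ?Z = "\<integral>\<^sup>+ x. ennreal (w x) \<partial>M"
  note [measurable] = w(1,3) True
  have "emeasure (normalized_density M w) A = (\<integral>\<^sup>+ x. ennreal (w x) / ?Z * indicator A x \<partial>M)"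
    unfolding normalized_density_def by (rule emeasure_density) measurable
  also have "\<dots> \<le> (\<integral>\<^sup>+ x. (ennreal (w x) * indicator B x) / ?Z \<partial>M)"
    by (intro nn_integral_mono) (use assms(2) in \<open>auto simp: indicator_def\<close>)
  also have "\<dots> = (\<integral>\<^sup>+ x\<in>B. ennreal (w x) \<partial>M) / ?Z"
    by (rule nn_integral_divide) measurable
  also have "\<dots> \<le> ennreal r * ?Z / ?Z" by (rule divide_right_mono_ennreal[OF le])
  also have "\<dots> \<le> ennreal r"
  \<comment> \<open>A normaliser of 0 or infinity makes the quotient 0 in the extended nonnegative
    reals.\<close>
  proof (cases "?Z = 0 \<or> ?Z = \<infinity>")
    case True
    then show ?thesis by (auto simp: divide_ennreal_def)
  next
    case False
    then show ?thesis by (simp add: ennreal_times_divide[symmetric] ennreal_divide_self less_top)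
  qed
  finally have "emeasure (normalized_density M w) A \<le> ennreal r" .
  then show ?thesis using r by (simp add: measure_def enn2real_leI)
qed

text \<open>Replacing \<theta> by the next point of the grid of mesh 1/(k + 1) leaves, for each k,
  countably many measurable functions of \<alpha>; continuity in \<theta> gives pointwise
  convergence. Separate continuity is what the assumptions on the conditional prior provide.\<close>

lemma caratheodory_measurable:
  fixes f :: "real \<Rightarrow> real \<Rightarrow> real"
  assumes c1: "\<And>\<alpha>. 0 < \<alpha> \<Longrightarrow> continuous_on {0<..} (\<lambda>\<theta>. f \<theta> \<alpha>)" and c2: "\<And>\<theta>. 0 < \<theta> \<Longrightarrow> continuous_on {0<..} (\<lambda>\<alpha>. f \<theta> \<alpha>)"
  shows "(\<lambda>(\<theta>, \<alpha>). if 0 < \<theta> \<and> 0 < \<alpha> then f \<theta> \<alpha> else 0) \<in> borel_measurable (borel \<Otimes>\<^sub>M borel)"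
proof -
  define G where "G k j \<alpha> = (if 0 < j then indicator {0<..} \<alpha> *\<^sub>R f (real_of_int j / real (Suc k)) \<alpha> else 0)" for k and j :: int and \<alpha>
  have Gm [measurable]: "G k j \<in> borel_measurable borel" for k j
  proof (cases "0 < j")
    case True
    then have "(\<lambda>\<alpha>. indicator {0<..} \<alpha> *\<^sub>R f (real_of_int j / real (Suc k)) \<alpha>) \<in> borel_measurable borel"
      by (intro borel_measurable_continuous_on_indicator c2) auto
    then show ?thesis unfolding G_def[abs_def] using True by simp
  next
    case False
    then show ?thesis unfolding G_def[abs_def] by simp
  qed
  let ?j = "\<lambda>k \<theta>. \<lceil>\<theta> * real (Suc k)\<rceil>"
  have "(\<lambda>(\<theta>, \<alpha>). G k (?j k \<theta>) \<alpha>) \<in> borel_measurable (borel \<Otimes>\<^sub>M borel)" for k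
    unfolding split_beta'
  proof (rule measurable_compose_countable[where f="\<lambda>j p. G k j (snd p)" and g="\<lambda>p. ?j k (fst p)"])
    show "(\<lambda>p. G k j (snd p)) \<in> borel_measurable (borel \<Otimes>\<^sub>M borel)" for j
      by (rule measurable_compose[OF measurable_snd Gm])
    show "(\<lambda>p. ?j k (fst p)) \<in> borel \<Otimes>\<^sub>M borel \<rightarrow>\<^sub>M count_space UNIV" by measurable
  qed
  then show ?thesis
  proof (rule borel_measurable_LIMSEQ_real[rotated])
    fix p :: "real \<times> real" 
    obtain \<theta> \<alpha> :: real where p: "p = (\<theta>, \<alpha>)" by (cases p)
    show "(\<lambda>k. case p of (\<theta>, \<alpha>) \<Rightarrow> G k (?j k \<theta>) \<alpha>) \<longlonglongrightarrow> (case p of (\<theta>, \<alpha>) \<Rightarrow> if 0 < \<theta> \<and> 0 < \<alpha> then f \<theta> \<alpha> else 0)"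
    proof (cases "0 < \<theta> \<and> 0 < \<alpha>")
      case True
      let ?t = "\<lambda>k. real_of_int (?j k \<theta>) / real (Suc k)"
      have jp: "0 < ?j k \<theta>" for k using True by simp
      have lim: "?t \<longlonglongrightarrow> \<theta>"
      proof (rule tendsto_sandwich[of "\<lambda>_. \<theta>" _ _ "\<lambda>k. \<theta> + 1 / real (Suc k)"])
        show "\<forall>\<^sub>F k in sequentially. \<theta> \<le> ?t k"
          by (intro always_eventually allI) (simp add: pos_le_divide_eq)
        show "\<forall>\<^sub>F k in sequentially. ?t k \<le> \<theta> + 1 / real (Suc k)"
        proof (intro always_eventually allI)
          fix k
          have "real_of_int (?j k \<theta>) \<le> \<theta> * real (Suc k) + 1" by (rule of_int_ceiling_le_add_one)
          then show "?t k \<le> \<theta> + 1 / real (Suc k)" by (simp add: pos_divide_le_eq distrib_right)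
        qed
        show "(\<lambda>k. \<theta> + 1 / real (Suc k)) \<longlonglongrightarrow> \<theta>"
          using tendsto_add[OF tendsto_const[of \<theta>] LIMSEQ_inverse_real_of_nat] by (simp add: inverse_eq_divide)
      qed simp
      have "isCont (\<lambda>\<theta>. f \<theta> \<alpha>) \<theta>" using c1[of \<alpha>] True by (simp add: continuous_on_eq_continuous_at)
      from isCont_tendsto_compose[OF this lim] show ?thesis
        using True jp by (simp add: p G_def)
    next
      case False
      have "G k (?j k \<theta>) \<alpha> = 0" for k
      proof (cases "0 < \<theta>")
        case True then show ?thesis using False by (simp add: G_def)
      next
        case False
        then have "\<theta> * real (Suc k) \<le> 0" by (simp add: mult_nonpos_nonneg)
        then have "?j k \<theta> \<le> 0" by (simp add: ceiling_le_iff)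
        then show ?thesis by (simp add: G_def)
      qed
      then show ?thesis using False by (auto simp: p)
    qed
  qed
qed

text \<open>Meant for q and for the determinant factor as functions of \<alpha>: monotonicity yields
  measurability without a study of the continuity of matrix inverses and determinants.\<close>

lemma mono_measurable_pos:
  fixes h :: "real \<Rightarrow> real"
  assumes "\<And>x y. 0 < x \<Longrightarrow> x \<le> y \<Longrightarrow> h x \<le> h y"
  shows "(\<lambda>x. if 0 < x then h x else 0) \<in> borel_measurable borel"
proof -
  have "h \<in> borel_measurable (restrict_space borel {0<..})"
    by (rule borel_measurable_mono_on_fnc) (auto simp: mono_on_def intro: assms)
  then have "(\<lambda>x. indicator {0<..} x *\<^sub>R h x) \<in> borel_measurable borel"
    by (subst (asm) borel_measurable_restrict_space_iff) auto
  also have "(\<lambda>x. indicator {0<..} x *\<^sub>R h x) = (\<lambda>x. if 0 < x then h x else 0)"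
    by (auto simp: indicator_def)
  finally show ?thesis .
qed

text \<open>The bound on the logarithmic derivative is used as $|f'| \le K f$, which also holds where $f$ vanishes, since there $f$ has a minimum.\<close>
lemma log_derivative_lower_bound:
  fixes f :: "real \<Rightarrow> real"
  assumes C1: "f C1_differentiable_on {0<..}" and f0: "\<And>t. 0 < t \<Longrightarrow> 0 \<le> f t" and lr: "0 \<le> l" "l < c" "c < r"
    and K: "\<And>t. l < t \<Longrightarrow> t < r \<Longrightarrow> \<bar>deriv (\<lambda>t. ln (f t)) t\<bar> \<le> K" and t: "l < t" "t < r"
  shows "f c * exp (- K * \<bar>t - c\<bar>) \<le> f t"
proof -
  obtain D where D: "\<And>x. 0 < x \<Longrightarrow> (f has_vector_derivative D x) (at x)"
    using C1 unfolding C1_differentiable_on_def by auto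
  have Df: "(f has_real_derivative D x) (at x)" if "0 < x" for x
    using D[OF that] by (simp add: has_real_derivative_iff_has_vector_derivative)
  have bd: "\<bar>D x\<bar> \<le> K * f x" if x: "l < x" "x < r" for x
  proof (cases "f x = 0")
    case True
    have x0: "0 < x" using x lr by simp
    have "D x = 0"
      by (rule DERIV_local_min[OF Df[OF x0], of x]) (use x0 f0 True in \<open>auto simp: abs_if split: if_splits\<close>)
    then show ?thesis using True by simp
  next
    case False
    have x0: "0 < x" using x lr by simp
    then have fx: "0 < f x" using f0[of x] False by simp
    have "((\<lambda>t. ln (f t)) has_real_derivative (1 / f x * D x)) (at x)"
      using Df[OF x0] fx by (auto intro!: derivative_eq_intros)
    then have "deriv (\<lambda>t. ln (f t)) x = D x / f x" by (simp add: DERIV_imp_deriv)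
    then have "\<bar>D x / f x\<bar> \<le> K" using K[OF x] by simp
    then show ?thesis using fx by (simp add: abs_divide pos_divide_le_eq)
  qed
  show ?thesis
  proof (cases "c \<le> t")
    case True
    \<comment> \<open>The integrating factor exp(Kx) turns |f'| <= K f into monotonicity; to the
      left of c the factor exp(-Kx) plays the same part.\<close>
    have "f c * exp (K * c) \<le> f t * exp (K * t)"
    proof (rule DERIV_nonneg_imp_nondecreasing[OF True])
      fix x assume x: "c \<le> x" "x \<le> t"
      then have x': "l < x" "x < r" "0 < x" using lr t by auto
      have "((\<lambda>x. f x * exp (K * x)) has_real_derivative ((D x + K * f x) * exp (K * x))) (at x)"
        using Df[OF x'(3)] by (auto intro!: derivative_eq_intros simp: algebra_simps)
      moreover have "0 \<le> (D x + K * f x) * exp (K * x)" using bd[OF x'(1,2)] by simp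
      ultimately show "\<exists>y. ((\<lambda>x. f x * exp (K * x)) has_real_derivative y) (at x) \<and> 0 \<le> y" by blast
    qed
    then have "f c * exp (K * c) * exp (- K * t) \<le> f t * exp (K * t) * exp (- K * t)" by (intro mult_right_mono) auto
    then show ?thesis using True by (simp add: mult.assoc exp_add[symmetric] algebra_simps)
  next
    case False
    then have tc: "t \<le> c" by simp
    have "f c * exp (- K * c) \<le> f t * exp (- K * t)"
    proof (rule DERIV_nonpos_imp_nonincreasing[OF tc])
      fix x assume x: "t \<le> x" "x \<le> c"
      then have x': "l < x" "x < r" "0 < x" using lr t by auto
      have "((\<lambda>x. f x * exp (- K * x)) has_real_derivative ((D x - K * f x) * exp (- K * x))) (at x)"
        using Df[OF x'(3)] by (auto intro!: derivative_eq_intros simp: algebra_simps)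
      moreover have "(D x - K * f x) * exp (- K * x) \<le> 0" using bd[OF x'(1,2)] by (auto intro!: mult_nonpos_nonneg)
      ultimately show "\<exists>y. ((\<lambda>x. f x * exp (- K * x)) has_real_derivative y) (at x) \<and> y \<le> 0" by blast
    qed
    then have "f c * exp (- K * c) * exp (K * t) \<le> f t * exp (- K * t) * exp (K * t)" by (intro mult_right_mono) auto
    then show ?thesis using False by (simp add: mult.assoc exp_add[symmetric] algebra_simps)
  qed
qed

section \<open>Concentration of the posterior\<close>

lemma nn_integral_quadrant:
  fixes h :: "real \<times> real \<Rightarrow> ennreal"
  assumes [measurable]: "(\<lambda>p. h p * indicator ({0<..} \<times> {0<..}) p) \<in> borel_measurable (borel \<Otimes>\<^sub>M borel)"
  shows "(\<integral>\<^sup>+ p. h p \<partial>restrict_space lborel ({0<..} \<times> {0<..})) =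
    (\<integral>\<^sup>+ \<alpha>\<in>{0<..}. (\<integral>\<^sup>+ \<theta>\<in>{0<..}. h (\<theta>, \<alpha>) \<partial>lborel) \<partial>lborel)"
proof -
  have "(\<integral>\<^sup>+ p. h p \<partial>restrict_space lborel ({0<..} \<times> {0<..})) = (\<integral>\<^sup>+ p. h p * indicator ({0<..} \<times> {0<..}) p \<partial>(lborel :: (real \<times> real) measure))"
    by (rule nn_integral_restrict_space) (simp add: borel_prod[symmetric] borel_open)
  also have "\<dots> = (\<integral>\<^sup>+ p. h p * indicator ({0<..} \<times> {0<..}) p \<partial>(lborel \<Otimes>\<^sub>M lborel))"
    by (simp add: lborel_prod)
  also have "\<dots> = (\<integral>\<^sup>+ \<alpha>. \<integral>\<^sup>+ \<theta>. h (\<theta>, \<alpha>) * indicator ({0<..} \<times> {0<..}) (\<theta>, \<alpha>) \<partial>lborel \<partial>lborel)"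
    by (rule lborel_pair.nn_integral_snd[symmetric]) measurable
  also have "\<dots> = (\<integral>\<^sup>+ \<alpha>\<in>{0<..}. (\<integral>\<^sup>+ \<theta>\<in>{0<..}. h (\<theta>, \<alpha>) \<partial>lborel) \<partial>lborel)"
    by (intro nn_integral_cong) (auto simp: indicator_def)
  finally show ?thesis .
qed

text \<open>Slices with lo <= \<alpha> <= hi contribute at most the fraction r of their own mass, so
  no lower bound on the marginal \<open>J\<close> enters there. The two outer strips are counted in
  full, each at the cost r'.\<close>

lemma joint_density_measure_le:
  fixes w :: "real \<Rightarrow> real \<Rightarrow> real"
  assumes w [measurable]: "(\<lambda>(\<theta>, \<alpha>). if 0 < \<theta> \<and> 0 < \<alpha> then w \<theta> \<alpha> else 0) \<in> borel_measurable (borel \<Otimes>\<^sub>M borel)"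
    and R [measurable]: "R \<in> sets borel"
    and A: "A \<subseteq> {(\<theta>, \<alpha>). 0 < \<theta> \<and> 0 < \<alpha> \<and> (lo \<le> \<alpha> \<longrightarrow> \<alpha> \<le> hi \<longrightarrow> \<theta> \<in> R)}"
    and J: "\<And>\<alpha>. J \<alpha> = (\<integral>\<^sup>+ \<theta>\<in>{0<..}. ennreal (w \<theta> \<alpha>) \<partial>lborel)"
    and mid: "\<And>\<alpha>. 0 < \<alpha> \<Longrightarrow> lo \<le> \<alpha> \<Longrightarrow> \<alpha> \<le> hi \<Longrightarrow> (\<integral>\<^sup>+ \<theta>\<in>{0<..}. ennreal (w \<theta> \<alpha>) * indicator R \<theta> \<partial>lborel) \<le> ennreal r * J \<alpha>"
    and low: "(\<integral>\<^sup>+ \<alpha>\<in>{0<..lo}. J \<alpha> \<partial>lborel) \<le> ennreal r' * (\<integral>\<^sup>+ \<alpha>\<in>{0<..}. J \<alpha> \<partial>lborel)"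
    and high: "0 < hi" "(\<integral>\<^sup>+ \<alpha>\<in>{hi..}. J \<alpha> \<partial>lborel) \<le> ennreal r' * (\<integral>\<^sup>+ \<alpha>\<in>{0<..}. J \<alpha> \<partial>lborel)"
    and r: "0 \<le> r" "0 \<le> r'"
  shows "measure (normalized_density (restrict_space lborel ({0<..} \<times> {0<..})) (\<lambda>(\<theta>, \<alpha>). w \<theta> \<alpha>)) A \<le> r + 2 * r'"
proof (rule measure_normalized_density_le)
  let ?Q = "{0<..} \<times> {0<..} :: (real \<times> real) set"
  let ?B = "{(\<theta>, \<alpha>). 0 < \<theta> \<and> 0 < \<alpha> \<and> (lo \<le> \<alpha> \<longrightarrow> \<alpha> \<le> hi \<longrightarrow> \<theta> \<in> R)}"
  have Q: "?Q \<in> sets borel" by (simp add: borel_open open_Times)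
  have Bs [measurable]: "?B \<in> sets (borel \<Otimes>\<^sub>M borel)"
  proof -
    have "{p \<in> space (borel \<Otimes>\<^sub>M borel :: (real \<times> real) measure). 0 < fst p \<and> 0 < snd p \<and> (lo \<le> snd p \<longrightarrow> snd p \<le> hi \<longrightarrow> fst p \<in> R)} \<in> sets (borel \<Otimes>\<^sub>M borel)"
      by measurable
    also have "{p \<in> space (borel \<Otimes>\<^sub>M borel :: (real \<times> real) measure). 0 < fst p \<and> 0 < snd p \<and> (lo \<le> snd p \<longrightarrow> snd p \<le> hi \<longrightarrow> fst p \<in> R)} = ?B"
      by (auto simp: space_pair_measure)
    finally show ?thesis .
  qed
  have ext: "indicator ?Q p *\<^sub>R (case p of (\<theta>, \<alpha>) \<Rightarrow> w \<theta> \<alpha>) = (case p of (\<theta>, \<alpha>) \<Rightarrow> if 0 < \<theta> \<and> 0 < \<alpha> then w \<theta> \<alpha> else 0)" for p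
    by (auto simp: indicator_def split: prod.splits)
  show wm: "(\<lambda>(\<theta>, \<alpha>). w \<theta> \<alpha>) \<in> borel_measurable (restrict_space lborel ?Q)"
  proof (rule iffD2[OF borel_measurable_restrict_space_iff])
    show "(\<lambda>p. indicator ?Q p *\<^sub>R (case p of (\<theta>, \<alpha>) \<Rightarrow> w \<theta> \<alpha>)) \<in> borel_measurable lborel"
      unfolding ext using w by (simp only: borel_prod measurable_lborel2)
  qed (use Q in simp)
  show "A \<subseteq> ?B" by (rule A)
  have "?B \<in> sets borel" using Bs unfolding borel_prod .
  moreover have "?B \<subseteq> ?Q" by auto
  ultimately show "?B \<in> sets (restrict_space lborel ?Q)" using Q by (simp add: sets_restrict_space_iff)
  show "0 \<le> r + 2 * r'" using r by simp
  have em: "(\<lambda>p. ennreal (case p of (\<theta>, \<alpha>) \<Rightarrow> w \<theta> \<alpha>) * indicator ?Q p) = (\<lambda>p. ennreal (case p of (\<theta>, \<alpha>) \<Rightarrow> if 0 < \<theta> \<and> 0 < \<alpha> then w \<theta> \<alpha> else 0))"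
    by (auto simp: indicator_def split: prod.splits)
  have Z: "(\<integral>\<^sup>+ p. ennreal (case p of (\<theta>, \<alpha>) \<Rightarrow> w \<theta> \<alpha>) \<partial>restrict_space lborel ?Q) = (\<integral>\<^sup>+ \<alpha>\<in>{0<..}. J \<alpha> \<partial>lborel)"
    by (subst nn_integral_quadrant) (simp_all only: em J, measurable)
  have em2: "(\<lambda>p. ennreal (case p of (\<theta>, \<alpha>) \<Rightarrow> w \<theta> \<alpha>) * indicator ?B p * indicator ?Q p) =
      (\<lambda>p. ennreal (case p of (\<theta>, \<alpha>) \<Rightarrow> if 0 < \<theta> \<and> 0 < \<alpha> then w \<theta> \<alpha> else 0) * indicator ?B p)"
    by (auto simp: indicator_def split: prod.splits)
  have "(\<integral>\<^sup>+ p\<in>?B. ennreal (case p of (\<theta>, \<alpha>) \<Rightarrow> w \<theta> \<alpha>) \<partial>restrict_space lborel ?Q) =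
      (\<integral>\<^sup>+ \<alpha>\<in>{0<..}. (\<integral>\<^sup>+ \<theta>\<in>{0<..}. (ennreal (w \<theta> \<alpha>) * indicator ?B (\<theta>, \<alpha>)) \<partial>lborel) \<partial>lborel)"
    by (subst nn_integral_quadrant) (simp_all only: em2 prod.case, measurable)
  also have "\<dots> \<le> (\<integral>\<^sup>+ \<alpha>. ennreal r * (J \<alpha> * indicator {0<..} \<alpha>) + (J \<alpha> * indicator {0<..lo} \<alpha> + J \<alpha> * indicator {hi..} \<alpha>) \<partial>lborel)"
  proof (rule nn_integral_mono)
    fix \<alpha> :: real
    show "(\<integral>\<^sup>+ \<theta>\<in>{0<..}. (ennreal (w \<theta> \<alpha>) * indicator ?B (\<theta>, \<alpha>)) \<partial>lborel) * indicator {0<..} \<alpha> \<le> ennreal r * (J \<alpha> * indicator {0<..} \<alpha>) + (J \<alpha> * indicator {0<..lo} \<alpha> + J \<alpha> * indicator {hi..} \<alpha>)"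
    proof (cases "0 < \<alpha>")
      case True
      show ?thesis
      proof (cases "lo \<le> \<alpha> \<and> \<alpha> \<le> hi")
        case m: True
        have "(\<integral>\<^sup>+ \<theta>\<in>{0<..}. (ennreal (w \<theta> \<alpha>) * indicator ?B (\<theta>, \<alpha>)) \<partial>lborel) = (\<integral>\<^sup>+ \<theta>\<in>{0<..}. ennreal (w \<theta> \<alpha>) * indicator R \<theta> \<partial>lborel)"
          using m True by (intro nn_integral_cong) (auto simp: indicator_def)
        also have "\<dots> \<le> ennreal r * J \<alpha>" using mid True m by simp
        finally show ?thesis using True by (simp add: add_increasing2)
      next
        case False
        have "(\<integral>\<^sup>+ \<theta>\<in>{0<..}. (ennreal (w \<theta> \<alpha>) * indicator ?B (\<theta>, \<alpha>)) \<partial>lborel) \<le> J \<alpha>"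
          unfolding J by (intro nn_integral_mono) (auto simp: indicator_def)
        also have "J \<alpha> \<le> J \<alpha> * indicator {0<..lo} \<alpha> + J \<alpha> * indicator {hi..} \<alpha>"
          using False True by (auto simp: indicator_def)
        finally show ?thesis using True by (simp add: add_increasing)
      qed
    qed simp
  qed
  also have "\<dots> = ennreal r * (\<integral>\<^sup>+ \<alpha>\<in>{0<..}. J \<alpha> \<partial>lborel) + ((\<integral>\<^sup>+ \<alpha>\<in>{0<..lo}. J \<alpha> \<partial>lborel) + (\<integral>\<^sup>+ \<alpha>\<in>{hi..}. J \<alpha> \<partial>lborel))"
  proof -
    let ?J = "\<lambda>\<alpha>. \<integral>\<^sup>+ \<theta>. ennreal (case (\<theta>, \<alpha>) of (\<theta>, \<alpha>) \<Rightarrow> if 0 < \<theta> \<and> 0 < \<alpha> then w \<theta> \<alpha> else 0) \<partial>lborel"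
    have Jm: "?J \<in> borel_measurable lborel"
      by (rule lborel.borel_measurable_nn_integral, unfold case_prod_beta', intro measurable_compose[OF _ measurable_ennreal] measurable_compose[OF _ w[unfolded case_prod_beta']]) measurable
    have eq: "J \<alpha> * indicator X \<alpha> = ?J \<alpha> * indicator X \<alpha>" if "X \<subseteq> {0<..}" for X \<alpha>
      using that by (auto simp: J indicator_def intro!: nn_integral_cong)
    have hi: "{hi..} \<subseteq> {0<..}" using high(1) by auto
    have m: "(\<lambda>\<alpha>. J \<alpha> * indicator X \<alpha>) \<in> borel_measurable lborel" if "X \<subseteq> {0<..}" "X \<in> sets borel" for X
      unfolding eq[OF that(1)] using Jm that(2) by simp
    have m': "(\<lambda>\<alpha>. J \<alpha> * indicator {0<..} \<alpha>) \<in> borel_measurable lborel" "(\<lambda>\<alpha>. J \<alpha> * indicator {0<..lo} \<alpha>) \<in> borel_measurable lborel" "(\<lambda>\<alpha>. J \<alpha> * indicator {hi..} \<alpha>) \<in> borel_measurable lborel"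
      by (intro m hi; auto)+
    show ?thesis by (simp only: nn_integral_add nn_integral_cmult m' borel_measurable_add borel_measurable_times_ennreal borel_measurable_const)
  qed
  also have "\<dots> \<le> ennreal r * (\<integral>\<^sup>+ \<alpha>\<in>{0<..}. J \<alpha> \<partial>lborel) + (ennreal r' * (\<integral>\<^sup>+ \<alpha>\<in>{0<..}. J \<alpha> \<partial>lborel) + ennreal r' * (\<integral>\<^sup>+ \<alpha>\<in>{0<..}. J \<alpha> \<partial>lborel))"
    by (intro add_mono order_refl low high)
  also have "\<dots> = ennreal (r + 2 * r') * (\<integral>\<^sup>+ \<alpha>\<in>{0<..}. J \<alpha> \<partial>lborel)"
    using r by (simp add: distrib_right[symmetric] ennreal_plus[symmetric] del: ennreal_plus)
  finally show "(\<integral>\<^sup>+ p\<in>?B. ennreal (case p of (\<theta>, \<alpha>) \<Rightarrow> w \<theta> \<alpha>) \<partial>restrict_space lborel ?Q) \<le> ennreal (r + 2 * r') * (\<integral>\<^sup>+ p. ennreal (case p of (\<theta>, \<alpha>) \<Rightarrow> w \<theta> \<alpha>) \<partial>restrict_space lborel ?Q)"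
    unfolding Z .
qed

lemma C1_indicator_measurable:
  fixes f :: "real \<Rightarrow> real"
  assumes "f C1_differentiable_on {0<..}" shows "(\<lambda>\<theta>. indicator {0<..} \<theta> * f \<theta>) \<in> borel_measurable borel"
  using borel_measurable_continuous_on_indicator[OF _ C1_differentiable_imp_continuous_on[OF assms]] by simp

text \<open>The factor in brackets is \<^term>\<open>bad_rate\<close> for $B = R f(\theta_0)$ and $b = e^{-1} f(\theta_0)$.\<close>
lemma slice_bounds:
  fixes f :: "real \<Rightarrow> real" and n q \<epsilon> :: real
  assumes \<theta>\<^sub>0: "0 < \<theta>\<^sub>0" and n: "0 < n" "2 \<le> ln n" and \<epsilon>: "\<epsilon> = ln n / sqrt n" "\<epsilon> \<le> 1 / 20"
    and q: "\<bar>q / \<theta>\<^sub>0 - n\<bar> \<le> 2 * sqrt n * ln n"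
    and f: "\<And>\<theta>. 0 < \<theta> \<Longrightarrow> 0 \<le> f \<theta>" "f C1_differentiable_on {0<..}" "(\<integral>\<^sup>+ \<theta>\<in>{0<..}. ennreal (f \<theta>) \<partial>lborel) \<le> 1" "0 < f \<theta>\<^sub>0"
    and K: "\<And>t. \<theta>\<^sub>0 / 2 < t \<Longrightarrow> t < 2 * \<theta>\<^sub>0 \<Longrightarrow> \<bar>deriv (\<lambda>t. ln (f t)) t\<bar> \<le> K" "K * (4 * \<epsilon> * \<theta>\<^sub>0) \<le> 1"
    and R: "\<And>t. \<theta>\<^sub>0 / 2 < t \<Longrightarrow> t < 2 * \<theta>\<^sub>0 \<Longrightarrow> f t / f \<theta>\<^sub>0 \<le> R" and L: "- L \<le> ln (f \<theta>\<^sub>0)"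
  shows "(\<integral>\<^sup>+ \<theta>\<in>{\<theta>. 0 < \<theta> \<and> 5 * \<epsilon> < \<bar>\<theta> / \<theta>\<^sub>0 - 1\<bar>}. ennreal (lik n q \<theta> * f \<theta>) \<partial>lborel) \<le>
      ennreal ((2 * \<theta>\<^sub>0 * R * exp (- (ln n)\<^sup>2 / 12) + exp (L - n / 192)) * (2 * exp 2 / \<theta>\<^sub>0 * sqrt n)) *
        (\<integral>\<^sup>+ \<theta>\<in>{0<..}. ennreal (lik n q \<theta> * f \<theta>) \<partial>lborel)"
    and "ennreal (exp (- (n / 2) * (1 + ln (2 * \<theta>\<^sub>0))) * (exp (- 2) * f \<theta>\<^sub>0 * \<theta>\<^sub>0 / (2 * sqrt n))) \<le>
        (\<integral>\<^sup>+ \<theta>\<in>{0<..}. ennreal (lik n q \<theta> * f \<theta>) \<partial>lborel)"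
    and "\<theta>\<^sub>0 * n / 2 \<le> q"
proof -
  define F where "F = f \<theta>\<^sub>0"
  have F: "0 < F" using f(4) by (simp add: F_def)
  have fm: "(\<lambda>\<theta>. indicator {0<..} \<theta> * f \<theta>) \<in> borel_measurable borel" by (rule C1_indicator_measurable[OF f(2)])
  have n1: "1 < n" using n ln_gt_zero_iff[of n] by linarith
  have K0: "0 \<le> K" using K(1)[of \<theta>\<^sub>0] \<theta>\<^sub>0 by (simp add: order_trans[OF abs_ge_zero])
  have fB: "f t \<le> R * F" if "\<theta>\<^sub>0 / 2 < t" "t < 2 * \<theta>\<^sub>0" for t
    using R[OF that] F by (simp add: F_def pos_divide_le_eq)
  \<comment> \<open>Over a distance of at most \<open>4 * \<epsilon> * \<theta>\<^sub>0\<close> the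
    bound K on the logarithmic derivative lets the density drop by at most a factor e, because
    \<open>K * (4 * \<epsilon> * \<theta>\<^sub>0) \<le> 1\<close>.\<close>
  have fb: "exp (- 1) * F \<le> f t" if t: "\<bar>t / \<theta>\<^sub>0 - 1\<bar> \<le> 4 * \<epsilon>" for t
  proof -
    have d: "\<bar>t - \<theta>\<^sub>0\<bar> \<le> 4 * \<epsilon> * \<theta>\<^sub>0"
    proof -
      have "t - \<theta>\<^sub>0 = (t / \<theta>\<^sub>0 - 1) * \<theta>\<^sub>0" using \<theta>\<^sub>0 by (simp add: field_simps)
      then have "\<bar>t - \<theta>\<^sub>0\<bar> = \<bar>t / \<theta>\<^sub>0 - 1\<bar> * \<theta>\<^sub>0" using \<theta>\<^sub>0 by (simp add: abs_mult)
      then show ?thesis using t \<theta>\<^sub>0 by (simp add: mult_right_mono)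
    qed
    have "4 * \<epsilon> * \<theta>\<^sub>0 \<le> 1 / 5 * \<theta>\<^sub>0" using \<epsilon>(2) \<theta>\<^sub>0 by (intro mult_right_mono) auto
    then have rng: "\<theta>\<^sub>0 / 2 < t" "t < 2 * \<theta>\<^sub>0" using d \<theta>\<^sub>0 by linarith+
    have "K * \<bar>t - \<theta>\<^sub>0\<bar> \<le> 1" using mult_left_mono[OF d K0] K(2) by simp
    then have "F * exp (- 1) \<le> F * exp (- K * \<bar>t - \<theta>\<^sub>0\<bar>)" using F by simp
    also have "\<dots> \<le> f t" unfolding F_def
      by (rule log_derivative_lower_bound[OF f(2) f(1) _ _ _ K(1) rng]) (use \<theta>\<^sub>0 in auto)
    finally show ?thesis by (simp add: mult.commute)
  qed
  have b: "0 < exp (- 1) * F" using F by simp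
  note ctx = \<theta>\<^sub>0 n \<epsilon> q f(1) fm f(3) fB fb b
  have br: "bad_rate \<theta>\<^sub>0 (R * F) (exp (- 1) * F) n \<le> (2 * \<theta>\<^sub>0 * R * exp (- (ln n)\<^sup>2 / 12) + exp (L - n / 192)) * (2 * exp 2 / \<theta>\<^sub>0 * sqrt n)"
  proof -
    have 1: "1 / F \<le> exp L"
    proof -
      have "exp (- L) \<le> exp (ln F)" using L by (simp add: F_def)
      then show ?thesis using F by (simp add: exp_minus divide_simps mult.commute)
    qed
    have "bad_rate \<theta>\<^sub>0 (R * F) (exp (- 1) * F) n = (2 * \<theta>\<^sub>0 * R * exp (- (ln n)\<^sup>2 / 12) + 1 / F * exp (- n / 192)) * (2 * exp 2 / \<theta>\<^sub>0 * sqrt n)"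
    proof -
      have "2 * exp 1 * sqrt n / (\<theta>\<^sub>0 * (exp (- 1) * F)) = 2 * exp 2 / \<theta>\<^sub>0 * sqrt n * (1 / F)"
        using F \<theta>\<^sub>0 by (simp add: exp_minus field_simps exp_add[symmetric])
      then have "bad_rate \<theta>\<^sub>0 (R * F) (exp (- 1) * F) n = (2 * \<theta>\<^sub>0 * R * exp (- (ln n)\<^sup>2 / 12) * F + exp (- n / 192)) * (1 / F) * (2 * exp 2 / \<theta>\<^sub>0 * sqrt n)"
        unfolding bad_rate_def by (simp only: mult_ac)
      also have "(2 * \<theta>\<^sub>0 * R * exp (- (ln n)\<^sup>2 / 12) * F + exp (- n / 192)) * (1 / F) = 2 * \<theta>\<^sub>0 * R * exp (- (ln n)\<^sup>2 / 12) + 1 / F * exp (- n / 192)"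
        using F by (simp add: field_simps)
      finally show ?thesis .
    qed
    also have "\<dots> \<le> (2 * \<theta>\<^sub>0 * R * exp (- (ln n)\<^sup>2 / 12) + exp L * exp (- n / 192)) * (2 * exp 2 / \<theta>\<^sub>0 * sqrt n)"
      using \<theta>\<^sub>0 n by (intro mult_right_mono add_left_mono 1) auto
    also have "exp L * exp (- n / 192) = exp (L - n / 192)" by (simp add: exp_add[symmetric])
    finally show ?thesis .
  qed
  have "(\<integral>\<^sup>+ \<theta>\<in>{\<theta>. 0 < \<theta> \<and> 5 * \<epsilon> < \<bar>\<theta> / \<theta>\<^sub>0 - 1\<bar>}. ennreal (lik n q \<theta> * f \<theta>) \<partial>lborel) \<le> ennreal (bad_rate \<theta>\<^sub>0 (R * F) (exp (- 1) * F) n) * (\<integral>\<^sup>+ \<theta>\<in>{0<..}. ennreal (lik n q \<theta> * f \<theta>) \<partial>lborel)"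
    by (rule bad_ratio[OF ctx])
  also have "\<dots> \<le> ennreal ((2 * \<theta>\<^sub>0 * R * exp (- (ln n)\<^sup>2 / 12) + exp (L - n / 192)) * (2 * exp 2 / \<theta>\<^sub>0 * sqrt n)) * (\<integral>\<^sup>+ \<theta>\<in>{0<..}. ennreal (lik n q \<theta> * f \<theta>) \<partial>lborel)"
    by (intro mult_right_mono ennreal_leI br) simp
  finally show "(\<integral>\<^sup>+ \<theta>\<in>{\<theta>. 0 < \<theta> \<and> 5 * \<epsilon> < \<bar>\<theta> / \<theta>\<^sub>0 - 1\<bar>}. ennreal (lik n q \<theta> * f \<theta>) \<partial>lborel) \<le>
      ennreal ((2 * \<theta>\<^sub>0 * R * exp (- (ln n)\<^sup>2 / 12) + exp (L - n / 192)) * (2 * exp 2 / \<theta>\<^sub>0 * sqrt n)) *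
        (\<integral>\<^sup>+ \<theta>\<in>{0<..}. ennreal (lik n q \<theta> * f \<theta>) \<partial>lborel)" .
  have q0: "0 < q" by (rule q_pos[OF ctx])
  have qn: "q / n \<le> 2 * \<theta>\<^sub>0" "\<theta>\<^sub>0 * n / 2 \<le> q"
  proof -
    have "q / (\<theta>\<^sub>0 * n) \<le> 2" using q_ratio(2)[OF ctx] \<epsilon>(2) by simp
    then show "q / n \<le> 2 * \<theta>\<^sub>0" using n \<theta>\<^sub>0 by (simp add: pos_divide_le_eq mult_ac)
    have "1 / 2 \<le> q / (\<theta>\<^sub>0 * n)" using q_ratio(1)[OF ctx] \<epsilon>(2) by simp
    then show "\<theta>\<^sub>0 * n / 2 \<le> q" using n \<theta>\<^sub>0 by (simp add: pos_le_divide_eq)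
  qed
  then show "\<theta>\<^sub>0 * n / 2 \<le> q" by simp
  \<comment> \<open>A lower bound free of q, so that slices with different \<alpha> can be
    compared.\<close>
  have "exp (- (n / 2) * (1 + ln (2 * \<theta>\<^sub>0))) \<le> lmax n q"
  proof -
    have "ln (q / n) \<le> ln (2 * \<theta>\<^sub>0)" using qn(1) q0 n by (intro ln_mono) auto
    then have "(n / 2) * (1 + ln (q / n)) \<le> (n / 2) * (1 + ln (2 * \<theta>\<^sub>0))" using n by (intro mult_left_mono) auto
    then show ?thesis unfolding lmax_def by simp
  qed
  then have "exp (- (n / 2) * (1 + ln (2 * \<theta>\<^sub>0))) * (exp (- 1) * (exp (- 1) * F) * \<theta>\<^sub>0 / (2 * sqrt n)) \<le> lmax n q * (exp (- 1) * (exp (- 1) * F) * \<theta>\<^sub>0 / (2 * sqrt n))"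
    using F \<theta>\<^sub>0 n by (intro mult_right_mono) auto
  moreover have "exp (- 2) * f \<theta>\<^sub>0 * \<theta>\<^sub>0 / (2 * sqrt n) = exp (- 1) * (exp (- 1) * F) * \<theta>\<^sub>0 / (2 * sqrt n)"
    by (simp add: F_def mult.assoc[symmetric] exp_add[symmetric])
  ultimately have "ennreal (exp (- (n / 2) * (1 + ln (2 * \<theta>\<^sub>0))) * (exp (- 2) * f \<theta>\<^sub>0 * \<theta>\<^sub>0 / (2 * sqrt n))) \<le> ennreal (lmax n q * (exp (- 1) * (exp (- 1) * F) * \<theta>\<^sub>0 / (2 * sqrt n)))"
    by (simp only: ennreal_leI)
  also have "\<dots> \<le> (\<integral>\<^sup>+ \<theta>\<in>{0<..}. ennreal (lik n q \<theta> * f \<theta>) \<partial>lborel)"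
    by (rule lik_integral_ge[OF ctx])
  finally show "ennreal (exp (- (n / 2) * (1 + ln (2 * \<theta>\<^sub>0))) * (exp (- 2) * f \<theta>\<^sub>0 * \<theta>\<^sub>0 / (2 * sqrt n))) \<le> (\<integral>\<^sup>+ \<theta>\<in>{0<..}. ennreal (lik n q \<theta> * f \<theta>) \<partial>lborel)" .
qed

lemma joint_weight_measurable:
  fixes q D g :: "real \<Rightarrow> real" and f :: "real \<Rightarrow> real \<Rightarrow> real"
  assumes q: "\<And>\<alpha> \<beta>. 0 < \<alpha> \<Longrightarrow> \<alpha> \<le> \<beta> \<Longrightarrow> q \<alpha> \<le> q \<beta>" and D: "\<And>\<alpha> \<beta>. 0 < \<alpha> \<Longrightarrow> \<alpha> \<le> \<beta> \<Longrightarrow> D \<beta> \<le> D \<alpha>"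
    and f: "\<And>\<alpha>. 0 < \<alpha> \<Longrightarrow> continuous_on {0<..} (\<lambda>\<theta>. f \<theta> \<alpha>)" "\<And>\<theta>. 0 < \<theta> \<Longrightarrow> continuous_on {0<..} (\<lambda>\<alpha>. f \<theta> \<alpha>)"
    and g: "continuous_on {0<..} g"
  shows "(\<lambda>(\<theta>, \<alpha>). if 0 < \<theta> \<and> 0 < \<alpha> then lik n (q \<alpha>) \<theta> * exp (- D \<alpha> / 2) * f \<theta> \<alpha> * g \<alpha> else 0) \<in> borel_measurable (borel \<Otimes>\<^sub>M borel)"
proof -
  define q' where "q' \<alpha> = (if 0 < \<alpha> then q \<alpha> else 0)" for \<alpha>
  define e' where "e' \<alpha> = (if 0 < \<alpha> then exp (- D \<alpha> / 2) else 0)" for \<alpha>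
  define g' where "g' \<alpha> = indicator {0<..} \<alpha> *\<^sub>R g \<alpha>" for \<alpha>
  define f' where "f' = (\<lambda>(\<theta>, \<alpha>). if 0 < \<theta> \<and> 0 < \<alpha> then f \<theta> \<alpha> else 0)"
  have [measurable]: "q' \<in> borel_measurable borel"
    unfolding q'_def[abs_def] by (rule mono_measurable_pos[OF q])
  have [measurable]: "e' \<in> borel_measurable borel"
    unfolding e'_def[abs_def] using D by (intro mono_measurable_pos) auto
  have [measurable]: "g' \<in> borel_measurable borel"
    unfolding g'_def[abs_def] by (intro borel_measurable_continuous_on_indicator g) auto
  have [measurable]: "f' \<in> borel_measurable (borel \<Otimes>\<^sub>M borel)"
    unfolding f'_def by (rule caratheodory_measurable[OF f])
  have "(\<lambda>p. exp (- q' (snd p) / (2 * fst p) - n / 2 * ln (fst p)) * e' (snd p) * f' p * g' (snd p)) \<in> borel_measurable (borel \<Otimes>\<^sub>M borel)"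
    by measurable
  also have "(\<lambda>p. exp (- q' (snd p) / (2 * fst p) - n / 2 * ln (fst p)) * e' (snd p) * f' p * g' (snd p)) =
     (\<lambda>(\<theta>, \<alpha>). if 0 < \<theta> \<and> 0 < \<alpha> then lik n (q \<alpha>) \<theta> * exp (- D \<alpha> / 2) * f \<theta> \<alpha> * g \<alpha> else 0)"
    by (auto simp: fun_eq_iff q'_def e'_def f'_def g'_def lik_def)
  finally show ?thesis .
qed

text \<open>Bound for a single n. Below \<open>lo\<close> the determinant only helps, while q
  decreases at most like (\<alpha>/lo)^p, so \<open>lmax\<close> grows at most like
  (lo/\<alpha>)^(np/2). Above \<open>hi\<close> it is q that only helps, while the determinant
  factor gains at most (\<alpha>/hi)^(np/2), up to a term of order sqrt n in the exponent. With p =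
  2\<nu> + d these are the powers in the tail assumptions.\<close>

lemma joint_posterior_le:
  fixes n \<epsilon> \<theta>\<^sub>0 \<alpha>\<^sub>0 lo hi \<delta> p m \<gamma> K R L G c1 c2 :: real and q D g :: "real \<Rightarrow> real" and f :: "real \<Rightarrow> real \<Rightarrow> real"
  assumes \<theta>\<^sub>0: "0 < \<theta>\<^sub>0" and n: "0 < n" "2 \<le> ln n" and \<epsilon>: "\<epsilon> = ln n / sqrt n" "\<epsilon> \<le> 1 / 20"
    and lh: "0 < lo" "lo \<le> \<alpha>\<^sub>0" "\<alpha>\<^sub>0 + \<delta> \<le> hi" "0 < \<delta>"
    and q: "\<And>\<alpha> \<beta>. 0 < \<alpha> \<Longrightarrow> \<alpha> \<le> \<beta> \<Longrightarrow> q \<alpha> \<le> q \<beta>" "\<And>\<alpha>. 0 < \<alpha> \<Longrightarrow> \<alpha> \<le> lo \<Longrightarrow> (\<alpha> / lo) powr p * q lo \<le> q \<alpha>"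
      "\<bar>q lo / \<theta>\<^sub>0 - n\<bar> \<le> 2 * sqrt n * ln n" "\<bar>q hi / \<theta>\<^sub>0 - n\<bar> \<le> 2 * sqrt n * ln n"
    and D: "\<And>\<alpha> \<beta>. 0 < \<alpha> \<Longrightarrow> \<alpha> \<le> \<beta> \<Longrightarrow> D \<beta> \<le> D \<alpha>" "\<And>\<alpha>. hi \<le> \<alpha> \<Longrightarrow> D hi - n * p * ln (\<alpha> / hi) \<le> D \<alpha>"
      "D \<alpha>\<^sub>0 - D hi \<le> sqrt n / 8"
    and f: "\<And>\<theta> \<alpha>. 0 < \<theta> \<Longrightarrow> 0 < \<alpha> \<Longrightarrow> 0 \<le> f \<theta> \<alpha>" "\<And>\<alpha>. 0 < \<alpha> \<Longrightarrow> (\<lambda>\<theta>. f \<theta> \<alpha>) C1_differentiable_on {0<..}"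
      "\<And>\<alpha>. 0 < \<alpha> \<Longrightarrow> (\<integral>\<^sup>+ \<theta>\<in>{0<..}. ennreal (f \<theta> \<alpha>) \<partial>lborel) \<le> 1" "\<And>\<alpha>. 0 < \<alpha> \<Longrightarrow> 0 < f \<theta>\<^sub>0 \<alpha>"
      "\<And>\<theta>. 0 < \<theta> \<Longrightarrow> continuous_on {0<..} (\<lambda>\<alpha>. f \<theta> \<alpha>)"
    and K: "\<And>t \<alpha>. lo \<le> \<alpha> \<Longrightarrow> \<alpha> \<le> hi \<Longrightarrow> \<theta>\<^sub>0 / 2 < t \<Longrightarrow> t < 2 * \<theta>\<^sub>0 \<Longrightarrow> \<bar>deriv (\<lambda>t. ln (f t \<alpha>)) t\<bar> \<le> K" "K * (4 * \<epsilon> * \<theta>\<^sub>0) \<le> 1"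
    and R: "\<And>t \<alpha>. lo \<le> \<alpha> \<Longrightarrow> \<alpha> \<le> hi \<Longrightarrow> \<theta>\<^sub>0 / 2 < t \<Longrightarrow> t < 2 * \<theta>\<^sub>0 \<Longrightarrow> f t \<alpha> / f \<theta>\<^sub>0 \<alpha> \<le> R"
    and L: "\<And>\<alpha>. lo \<le> \<alpha> \<Longrightarrow> \<alpha> \<le> hi \<Longrightarrow> - L \<le> ln (f \<theta>\<^sub>0 \<alpha>)"
    and g: "\<And>\<alpha>. 0 < \<alpha> \<Longrightarrow> 0 \<le> g \<alpha>" "continuous_on {0<..} g"
    and near: "\<And>\<alpha>. \<alpha>\<^sub>0 \<le> \<alpha> \<Longrightarrow> \<alpha> \<le> \<alpha>\<^sub>0 + \<delta> \<Longrightarrow> m \<le> f \<theta>\<^sub>0 \<alpha> \<and> \<gamma> \<le> g \<alpha>" "0 < m" "0 < \<gamma>"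
    and tails: "(\<integral>\<^sup>+ \<alpha>\<in>{0<..lo}. ennreal (\<alpha> powr (- (n * (p / 2))) * g \<alpha>) \<partial>lborel) \<le> ennreal (exp c1)"
      "(\<integral>\<^sup>+ \<alpha>\<in>{hi..}. ennreal (\<alpha> powr (n * (p / 2)) * g \<alpha>) \<partial>lborel) \<le> ennreal (exp c2)"
      "lo powr (n * (p / 2)) * exp c1 \<le> exp (- G)" "hi powr (- (n * (p / 2))) * exp c2 \<le> exp (- G)"
    and A: "A \<subseteq> {(\<theta>, \<alpha>). 0 < \<theta> \<and> 0 < \<alpha> \<and> (lo \<le> \<alpha> \<longrightarrow> \<alpha> \<le> hi \<longrightarrow> 5 * \<epsilon> < \<bar>\<theta> / \<theta>\<^sub>0 - 1\<bar>)}"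
    and R0: "0 \<le> R"
  shows "measure (normalized_density (restrict_space lborel ({0<..} \<times> {0<..})) (\<lambda>(\<theta>, \<alpha>). lik n (q \<alpha>) \<theta> * exp (- D \<alpha> / 2) * f \<theta> \<alpha> * g \<alpha>)) A \<le>
    (2 * \<theta>\<^sub>0 * R * exp (- (ln n)\<^sup>2 / 12) + exp (L - n / 192)) * (2 * exp 2 / \<theta>\<^sub>0 * sqrt n) +
    2 * (exp (sqrt n / 16 + n / 2 * ln 4 - G) * (2 * exp 2 / (\<gamma> * \<delta> * m * \<theta>\<^sub>0) * sqrt n))"
proof -
  have \<alpha>\<^sub>0: "0 < \<alpha>\<^sub>0" "0 < hi" "lo \<le> hi" "\<alpha>\<^sub>0 \<le> hi" using lh by auto
  define I where "I \<alpha> = (\<integral>\<^sup>+ \<theta>\<in>{0<..}. ennreal (lik n (q \<alpha>) \<theta> * f \<theta> \<alpha>) \<partial>lborel)" for \<alpha>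
  define J where "J \<alpha> = (\<integral>\<^sup>+ \<theta>\<in>{0<..}. ennreal (lik n (q \<alpha>) \<theta> * exp (- D \<alpha> / 2) * f \<theta> \<alpha> * g \<alpha>) \<partial>lborel)" for \<alpha>
  have fm [measurable]: "(\<lambda>\<theta>. indicator {0<..} \<theta> * f \<theta> \<alpha>) \<in> borel_measurable borel" if "0 < \<alpha>" for \<alpha>
    by (rule C1_indicator_measurable[OF f(2)[OF that]])
  have slice: "(\<integral>\<^sup>+ \<theta>. ennreal (lik n (q \<alpha>) \<theta> * exp (- D \<alpha> / 2) * f \<theta> \<alpha> * g \<alpha>) * indicator X \<theta> \<partial>lborel) =
      ennreal (exp (- D \<alpha> / 2) * g \<alpha>) * (\<integral>\<^sup>+ \<theta>. ennreal (lik n (q \<alpha>) \<theta> * f \<theta> \<alpha>) * indicator X \<theta> \<partial>lborel)"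
    if \<alpha>: "0 < \<alpha>" and X: "X \<subseteq> {0<..}" "X \<in> sets borel" for \<alpha> X
  proof -
    have eq: "ennreal (lik n (q \<alpha>) \<theta> * f \<theta> \<alpha>) * indicator X \<theta> = ennreal (lik n (q \<alpha>) \<theta> * (indicator {0<..} \<theta> * f \<theta> \<alpha>)) * indicator X \<theta>" for \<theta>
      using X(1) by (auto simp: indicator_def)
    have "(\<lambda>\<theta>. ennreal (lik n (q \<alpha>) \<theta> * f \<theta> \<alpha>) * indicator X \<theta>) \<in> borel_measurable lborel"
      unfolding eq using fm[OF \<alpha>] X(2) by measurable
    then have "ennreal (exp (- D \<alpha> / 2) * g \<alpha>) * (\<integral>\<^sup>+ \<theta>. ennreal (lik n (q \<alpha>) \<theta> * f \<theta> \<alpha>) * indicator X \<theta> \<partial>lborel) =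
        (\<integral>\<^sup>+ \<theta>. ennreal (exp (- D \<alpha> / 2) * g \<alpha>) * (ennreal (lik n (q \<alpha>) \<theta> * f \<theta> \<alpha>) * indicator X \<theta>) \<partial>lborel)"
      by (rule nn_integral_cmult[symmetric])
    also have "\<dots> = (\<integral>\<^sup>+ \<theta>. ennreal (lik n (q \<alpha>) \<theta> * exp (- D \<alpha> / 2) * f \<theta> \<alpha> * g \<alpha>) * indicator X \<theta> \<partial>lborel)"
    proof (intro nn_integral_cong)
      fix \<theta> :: real
      have "ennreal (exp (- D \<alpha> / 2) * g \<alpha>) * ennreal (lik n (q \<alpha>) \<theta> * f \<theta> \<alpha>) = ennreal (lik n (q \<alpha>) \<theta> * exp (- D \<alpha> / 2) * f \<theta> \<alpha> * g \<alpha>)" if "\<theta> \<in> X"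
      proof -
        have "0 < \<theta>" using that X by auto
        then have "0 \<le> lik n (q \<alpha>) \<theta> * f \<theta> \<alpha>" using f(1)[of \<theta> \<alpha>] \<alpha> by (simp add: lik_nonneg)
        moreover have "0 \<le> exp (- D \<alpha> / 2) * g \<alpha>" using g(1)[OF \<alpha>] by simp
        ultimately show ?thesis by (simp add: ennreal_mult[symmetric] mult_ac)
      qed
      then show "ennreal (exp (- D \<alpha> / 2) * g \<alpha>) * (ennreal (lik n (q \<alpha>) \<theta> * f \<theta> \<alpha>) * indicator X \<theta>) = ennreal (lik n (q \<alpha>) \<theta> * exp (- D \<alpha> / 2) * f \<theta> \<alpha> * g \<alpha>) * indicator X \<theta>"
        by (auto simp: indicator_def)
    qed
    finally show ?thesis by simp
  qed
  have JI: "J \<alpha> = ennreal (exp (- D \<alpha> / 2) * g \<alpha>) * I \<alpha>" if "0 < \<alpha>" for \<alpha>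
    unfolding J_def I_def using that by (intro slice) auto
  have qc: "\<bar>q \<alpha> / \<theta>\<^sub>0 - n\<bar> \<le> 2 * sqrt n * ln n" if "lo \<le> \<alpha>" "\<alpha> \<le> hi" for \<alpha>
  proof -
    have "q lo / \<theta>\<^sub>0 \<le> q \<alpha> / \<theta>\<^sub>0" "q \<alpha> / \<theta>\<^sub>0 \<le> q hi / \<theta>\<^sub>0"
      using that lh \<theta>\<^sub>0 by (auto intro!: divide_right_mono q(1))
    then show ?thesis using q(3,4) by linarith
  qed
  have sl: "(\<integral>\<^sup>+ \<theta>\<in>{\<theta>. 0 < \<theta> \<and> 5 * \<epsilon> < \<bar>\<theta> / \<theta>\<^sub>0 - 1\<bar>}. ennreal (lik n (q \<alpha>) \<theta> * f \<theta> \<alpha>) \<partial>lborel) \<le>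
      ennreal ((2 * \<theta>\<^sub>0 * R * exp (- (ln n)\<^sup>2 / 12) + exp (L - n / 192)) * (2 * exp 2 / \<theta>\<^sub>0 * sqrt n)) * I \<alpha>"
    "ennreal (exp (- (n / 2) * (1 + ln (2 * \<theta>\<^sub>0))) * (exp (- 2) * f \<theta>\<^sub>0 \<alpha> * \<theta>\<^sub>0 / (2 * sqrt n))) \<le> I \<alpha>"
    "\<theta>\<^sub>0 * n / 2 \<le> q \<alpha>"
    if "lo \<le> \<alpha>" "\<alpha> \<le> hi" for \<alpha>
  proof -
    have \<alpha>: "0 < \<alpha>" using that lh by simp
    show "(\<integral>\<^sup>+ \<theta>\<in>{\<theta>. 0 < \<theta> \<and> 5 * \<epsilon> < \<bar>\<theta> / \<theta>\<^sub>0 - 1\<bar>}. ennreal (lik n (q \<alpha>) \<theta> * f \<theta> \<alpha>) \<partial>lborel) \<le>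
      ennreal ((2 * \<theta>\<^sub>0 * R * exp (- (ln n)\<^sup>2 / 12) + exp (L - n / 192)) * (2 * exp 2 / \<theta>\<^sub>0 * sqrt n)) * I \<alpha>"
      "ennreal (exp (- (n / 2) * (1 + ln (2 * \<theta>\<^sub>0))) * (exp (- 2) * f \<theta>\<^sub>0 \<alpha> * \<theta>\<^sub>0 / (2 * sqrt n))) \<le> I \<alpha>"
      "\<theta>\<^sub>0 * n / 2 \<le> q \<alpha>"
      unfolding I_def
      by (rule slice_bounds[OF \<theta>\<^sub>0 n \<epsilon> qc[OF that] f(1)[OF _ \<alpha>] f(2)[OF \<alpha>] f(3)[OF \<alpha>] f(4)[OF \<alpha>] K(1)[OF that] K(2) R[OF that] L[OF that]]; assumption)+
  qed
  \<comment> \<open>Upper bound for \<open>lmax\<close> when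
    \<open>q/n \<ge> \<theta>\<^sub>0/2\<close>. Against the lower bound from
    \<open>q/n \<le> 2\<theta>\<^sub>0\<close> on the good slices it loses a factor 4^(n/2), which
    the gain exp(-G) of the tails has to beat.\<close>
  define M where "M = exp (- (n / 2) * (1 + ln (\<theta>\<^sub>0 / 2)))"
  have lmaxM: "lmax n Q \<le> M" if "\<theta>\<^sub>0 * n / 2 \<le> Q" for Q
  proof -
    have "\<theta>\<^sub>0 / 2 \<le> Q / n" using that n by (simp add: pos_le_divide_eq)
    then have "ln (\<theta>\<^sub>0 / 2) \<le> ln (Q / n)" using \<theta>\<^sub>0 by (intro ln_mono) auto
    then have "(n / 2) * (1 + ln (\<theta>\<^sub>0 / 2)) \<le> (n / 2) * (1 + ln (Q / n))" using n by (intro mult_left_mono) auto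
    then show ?thesis unfolding lmax_def M_def by simp
  qed
  have qn0: "0 < \<theta>\<^sub>0 * n / 2" using \<theta>\<^sub>0 n by simp
  have qlo: "\<theta>\<^sub>0 * n / 2 \<le> q lo" and qhi: "\<theta>\<^sub>0 * n / 2 \<le> q hi" using sl(3) \<alpha>\<^sub>0 by auto
  have qpos: "0 < q \<alpha>" if "0 < \<alpha>" for \<alpha>
  proof (cases "\<alpha> \<le> lo")
    case True
    have "0 < (\<alpha> / lo) powr p * q lo" using qlo qn0 that lh by (intro mult_pos_pos) auto
    then show ?thesis using q(2)[OF that True] by linarith
  next
    case False
    then show ?thesis using q(1)[of lo \<alpha>] lh qlo qn0 by linarith
  qed
  have Imax: "I \<alpha> \<le> ennreal (lmax n (q \<alpha>))" if \<alpha>: "0 < \<alpha>" for \<alpha>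
  proof -
    have "I \<alpha> \<le> (\<integral>\<^sup>+ \<theta>. ennreal (lmax n (q \<alpha>)) * (ennreal (indicator {0<..} \<theta> * f \<theta> \<alpha>)) \<partial>lborel)"
      unfolding I_def
    proof (intro nn_integral_mono)
      fix \<theta> :: real
      have "lik n (q \<alpha>) \<theta> * f \<theta> \<alpha> \<le> lmax n (q \<alpha>) * f \<theta> \<alpha>" if "0 < \<theta>"
        using f(1)[OF that \<alpha>] lik_le_lmax[OF n(1) qpos[OF \<alpha>] that] by (intro mult_right_mono)
      then show "ennreal (lik n (q \<alpha>) \<theta> * f \<theta> \<alpha>) * indicator {0<..} \<theta> \<le> ennreal (lmax n (q \<alpha>)) * ennreal (indicator {0<..} \<theta> * f \<theta> \<alpha>)"
        using f(1)[of \<theta> \<alpha>] \<alpha> lmax_pos[of n "q \<alpha>"] by (auto simp: indicator_def ennreal_mult[symmetric] intro!: ennreal_leI)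
    qed
    also have "\<dots> = ennreal (lmax n (q \<alpha>)) * (\<integral>\<^sup>+ \<theta>. ennreal (indicator {0<..} \<theta> * f \<theta> \<alpha>) \<partial>lborel)"
      using fm[OF \<alpha>] by (intro nn_integral_cmult) simp
    also have "(\<integral>\<^sup>+ \<theta>. ennreal (indicator {0<..} \<theta> * f \<theta> \<alpha>) \<partial>lborel) = (\<integral>\<^sup>+ \<theta>\<in>{0<..}. ennreal (f \<theta> \<alpha>) \<partial>lborel)"
      by (intro nn_integral_cong) (auto simp: indicator_def)
    also have "ennreal (lmax n (q \<alpha>)) * \<dots> \<le> ennreal (lmax n (q \<alpha>)) * 1"
      by (intro mult_left_mono f(3)[OF \<alpha>]) auto
    finally show ?thesis by simp
  qed
  \<comment> \<open>Reference size of the determinant factor; it stays symbolic and cancels between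
    the tails and the mass near \<open>\<alpha>\<^sub>0\<close>.\<close>
  define E where "E = exp (- D \<alpha>\<^sub>0 / 2)"
  have E0: "0 < E" by (simp add: E_def)
  have JE: "J \<alpha> \<le> ennreal (X * (Y * g \<alpha>))" if \<alpha>: "0 < \<alpha>" and "exp (- D \<alpha> / 2) * lmax n (q \<alpha>) \<le> X * Y" for \<alpha> X Y
  proof -
    have "J \<alpha> \<le> ennreal (exp (- D \<alpha> / 2) * g \<alpha>) * ennreal (lmax n (q \<alpha>))"
      unfolding JI[OF \<alpha>] by (intro mult_left_mono Imax \<alpha>) auto
    also have "\<dots> = ennreal (exp (- D \<alpha> / 2) * lmax n (q \<alpha>) * g \<alpha>)"
      using g(1)[OF \<alpha>] lmax_pos[of n "q \<alpha>"] by (simp add: ennreal_mult[symmetric] mult_ac)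
    also have "\<dots> \<le> ennreal (X * Y * g \<alpha>)" using that(2) g(1)[OF \<alpha>] by (intro ennreal_leI mult_right_mono)
    finally show ?thesis by (simp only: mult.assoc)
  qed
  have gm: "(\<lambda>\<alpha>. indicator {0<..} \<alpha> * g \<alpha>) \<in> borel_measurable borel"
    using borel_measurable_continuous_on_indicator[OF _ g(2)] by simp
  have tail: "(\<integral>\<^sup>+ \<alpha>\<in>X. J \<alpha> \<partial>lborel) \<le> ennreal (E * exp (sqrt n / 16) * M * exp (- G))"
    if X: "X \<subseteq> {0<..}" "X \<in> sets borel"
      and le: "\<And>\<alpha>. \<alpha> \<in> X \<Longrightarrow> exp (- D \<alpha> / 2) * lmax n (q \<alpha>) \<le> (E * exp (sqrt n / 16) * M * y) * (\<alpha> powr k)"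
      and c: "(\<integral>\<^sup>+ \<alpha>\<in>X. ennreal (\<alpha> powr k * g \<alpha>) \<partial>lborel) \<le> ennreal (exp c)" "y * exp c \<le> exp (- G)" and y: "0 \<le> y"
    for X y k c
  proof -
    let ?c = "E * exp (sqrt n / 16) * M * y"
    have c0: "0 \<le> ?c" using E0 y by (simp add: M_def)
    have eq: "ennreal (\<alpha> powr k * g \<alpha>) * indicator X \<alpha> = ennreal (\<alpha> powr k * (indicator {0<..} \<alpha> * g \<alpha>)) * indicator X \<alpha>" for \<alpha>
      using X(1) by (auto simp: indicator_def)
    have ms: "(\<lambda>\<alpha>. ennreal (\<alpha> powr k * g \<alpha>) * indicator X \<alpha>) \<in> borel_measurable lborel"
      unfolding eq using gm X(2) by measurable
    have "(\<integral>\<^sup>+ \<alpha>\<in>X. J \<alpha> \<partial>lborel) \<le> (\<integral>\<^sup>+ \<alpha>. ennreal ?c * (ennreal (\<alpha> powr k * g \<alpha>) * indicator X \<alpha>) \<partial>lborel)"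
    proof (rule nn_integral_mono)
      fix \<alpha> :: real
      show "J \<alpha> * indicator X \<alpha> \<le> ennreal ?c * (ennreal (\<alpha> powr k * g \<alpha>) * indicator X \<alpha>)"
      proof (cases "\<alpha> \<in> X")
        case True
        then have \<alpha>: "0 < \<alpha>" using X by auto
        have "J \<alpha> \<le> ennreal (?c * (\<alpha> powr k * g \<alpha>))" by (rule JE[OF \<alpha> le[OF True]])
        also have "\<dots> = ennreal ?c * ennreal (\<alpha> powr k * g \<alpha>)" using c0 g(1)[OF \<alpha>] by (intro ennreal_mult) auto
        finally show ?thesis using True by simp
      qed simp
    qed
    also have "\<dots> = ennreal ?c * (\<integral>\<^sup>+ \<alpha>\<in>X. ennreal (\<alpha> powr k * g \<alpha>) \<partial>lborel)" by (rule nn_integral_cmult[OF ms])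
    also have "\<dots> \<le> ennreal ?c * ennreal (exp c)" by (intro mult_left_mono c) auto
    also have "\<dots> = ennreal (E * exp (sqrt n / 16) * M * (y * exp c))" using c0 by (simp add: ennreal_mult[symmetric] mult.assoc)
    also have "\<dots> \<le> ennreal (E * exp (sqrt n / 16) * M * exp (- G))"
      using E0 by (intro ennreal_leI mult_left_mono c) (simp add: M_def)
    finally show ?thesis .
  qed
  have hib: "exp (- D \<alpha> / 2) * lmax n (q \<alpha>) \<le> (E * exp (sqrt n / 16) * M * hi powr (- (n * (p / 2)))) * (\<alpha> powr (n * (p / 2)))"
    if \<alpha>: "\<alpha> \<in> {hi..}" for \<alpha>
  proof -
    have a: "hi \<le> \<alpha>" "0 < \<alpha>" using that \<alpha>\<^sub>0 by auto
    \<comment> \<open>The log-determinant difference of at most sqrt n / 8 enters halved, as sqrt n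
      / 16.\<close>
    have "exp (- D \<alpha> / 2) \<le> exp (- D \<alpha>\<^sub>0 / 2 + sqrt n / 16 + n * (p / 2) * ln (\<alpha> / hi))"
    proof -
      have "n * p * ln (\<alpha> / hi) = 2 * (n * (p / 2) * ln (\<alpha> / hi))" by simp
      then show ?thesis using D(2)[OF a(1)] D(3) by simp
    qed
    also have "\<dots> = E * exp (sqrt n / 16) * (hi powr (- (n * (p / 2))) * \<alpha> powr (n * (p / 2)))"
    proof -
      have "n * (p / 2) * ln (\<alpha> / hi) = - (n * (p / 2)) * ln hi + n * (p / 2) * ln \<alpha>"
        using a \<alpha>\<^sub>0 by (simp add: ln_div right_diff_distrib)
      moreover have "hi powr k = exp (k * ln hi)" "\<alpha> powr k = exp (k * ln \<alpha>)" for k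
        using a \<alpha>\<^sub>0 by (simp_all add: powr_def)
      ultimately show ?thesis by (simp only: E_def exp_add mult.assoc)
    qed
    finally have "exp (- D \<alpha> / 2) * lmax n (q \<alpha>) \<le> E * exp (sqrt n / 16) * (hi powr (- (n * (p / 2))) * \<alpha> powr (n * (p / 2))) * M"
      using lmaxM[of "q \<alpha>"] q(1)[of hi \<alpha>] a \<alpha>\<^sub>0 qhi lmax_pos[of n "q \<alpha>"] E0 by (intro mult_mono) auto
    then show ?thesis by (simp only: mult_ac)
  qed
  have lob: "exp (- D \<alpha> / 2) * lmax n (q \<alpha>) \<le> (E * exp (sqrt n / 16) * M * lo powr (n * (p / 2))) * (\<alpha> powr (- (n * (p / 2))))"
    if \<alpha>: "\<alpha> \<in> {0<..lo}" for \<alpha>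
  proof -
    have a: "\<alpha> \<le> lo" "0 < \<alpha>" using that by auto
    have "exp (- D \<alpha> / 2) \<le> E" using D(1)[of \<alpha> \<alpha>\<^sub>0] a lh by (simp add: E_def)
    also have "\<dots> \<le> E * exp (sqrt n / 16)" using E0 n by simp
    finally have 1: "exp (- D \<alpha> / 2) \<le> E * exp (sqrt n / 16)" .
    have "lmax n (q \<alpha>) \<le> M * (lo powr (n * (p / 2)) * \<alpha> powr (- (n * (p / 2))))"
    proof -
      have "(\<alpha> / lo) powr p * (\<theta>\<^sub>0 / 2) \<le> q \<alpha> / n"
      proof -
        have "(\<alpha> / lo) powr p * (\<theta>\<^sub>0 * n / 2) \<le> q \<alpha>"
          by (rule order_trans[OF mult_left_mono[OF qlo] q(2)]) (use a in auto)
        then show ?thesis using n by (simp add: pos_le_divide_eq)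
      qed
      then have "ln ((\<alpha> / lo) powr p * (\<theta>\<^sub>0 / 2)) \<le> ln (q \<alpha> / n)"
        using a lh \<theta>\<^sub>0 by (intro ln_mono mult_pos_pos) auto
      moreover have "ln ((\<alpha> / lo) powr p * (\<theta>\<^sub>0 / 2)) = p * (ln \<alpha> - ln lo) + ln (\<theta>\<^sub>0 / 2)"
      proof -
        have "0 < (\<alpha> / lo) powr p" using a lh by simp
        then have "ln ((\<alpha> / lo) powr p * (\<theta>\<^sub>0 / 2)) = ln ((\<alpha> / lo) powr p) + ln (\<theta>\<^sub>0 / 2)"
          using \<theta>\<^sub>0 by (intro ln_mult_pos) auto
        then show ?thesis using a lh by (simp add: ln_powr ln_div)
      qed
      ultimately have "(n / 2) * (1 + (p * (ln \<alpha> - ln lo) + ln (\<theta>\<^sub>0 / 2))) \<le> (n / 2) * (1 + ln (q \<alpha> / n))"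
        using n by (intro mult_left_mono) auto
      then have "lmax n (q \<alpha>) \<le> exp (- (n / 2) * (1 + (p * (ln \<alpha> - ln lo) + ln (\<theta>\<^sub>0 / 2))))"
        unfolding lmax_def by simp
      also have "\<dots> = M * (lo powr (n * (p / 2)) * \<alpha> powr (- (n * (p / 2))))"
        using a lh by (simp add: M_def powr_def exp_add[symmetric] algebra_simps)
      finally show ?thesis .
    qed
    from mult_mono[OF 1 this] have "exp (- D \<alpha> / 2) * lmax n (q \<alpha>) \<le> E * exp (sqrt n / 16) * (M * (lo powr (n * (p / 2)) * \<alpha> powr (- (n * (p / 2)))))"
      using E0 lmax_pos[of n "q \<alpha>"] by simp
    then show ?thesis by (simp only: mult_ac)
  qed
  define tr where "tr = exp (sqrt n / 16 + n / 2 * ln 4 - G) * (2 * exp 2 / (\<gamma> * \<delta> * m * \<theta>\<^sub>0) * sqrt n)"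
  have tr0: "0 \<le> tr" using near(2,3) lh \<theta>\<^sub>0 n by (simp add: tr_def)
  have Zl: "ennreal (E * exp (sqrt n / 16) * M * exp (- G)) \<le> ennreal tr * (\<integral>\<^sup>+ \<alpha>\<in>{0<..}. J \<alpha> \<partial>lborel)"
  proof -
    define z where "z = exp (- (n / 2) * (1 + ln (2 * \<theta>\<^sub>0))) * (exp (- 2) * m * \<theta>\<^sub>0 / (2 * sqrt n))"
    have z0: "0 \<le> z" using near(2) \<theta>\<^sub>0 n by (simp add: z_def)
    \<comment> \<open>The window lies to the right of \<open>\<alpha>\<^sub>0\<close>: there the
      determinant is at most the one at \<open>\<alpha>\<^sub>0\<close>, so its factor is at least
      \<open>E\<close>.\<close>
    have "ennreal (E * \<gamma> * z) * indicator {\<alpha>\<^sub>0..\<alpha>\<^sub>0 + \<delta>} \<alpha> \<le> J \<alpha> * indicator {0<..} \<alpha>" for \<alpha>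
    proof (cases "\<alpha> \<in> {\<alpha>\<^sub>0..\<alpha>\<^sub>0 + \<delta>}")
      case True
      then have a: "\<alpha>\<^sub>0 \<le> \<alpha>" "\<alpha> \<le> \<alpha>\<^sub>0 + \<delta>" "0 < \<alpha>" "lo \<le> \<alpha>" "\<alpha> \<le> hi" using lh by auto
      note nr = near(1)[OF a(1,2)]
      have "z \<le> exp (- (n / 2) * (1 + ln (2 * \<theta>\<^sub>0))) * (exp (- 2) * f \<theta>\<^sub>0 \<alpha> * \<theta>\<^sub>0 / (2 * sqrt n))"
        unfolding z_def using nr \<theta>\<^sub>0 n by (intro mult_left_mono divide_right_mono mult_right_mono) auto
      then have "ennreal z \<le> I \<alpha>" using sl(2)[OF a(4,5)] by (meson ennreal_leI order_trans)
      moreover have "E * \<gamma> \<le> exp (- D \<alpha> / 2) * g \<alpha>"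
        using D(1)[of \<alpha>\<^sub>0 \<alpha>] a \<alpha>\<^sub>0 nr near(3) by (intro mult_mono) (auto simp: E_def)
      ultimately have "ennreal (E * \<gamma>) * ennreal z \<le> J \<alpha>"
        unfolding JI[OF a(3)] by (intro mult_mono[OF ennreal_leI]) auto
      then show ?thesis using True a(3) E0 near(3) z0 by (simp add: ennreal_mult)
    qed simp
    then have "(\<integral>\<^sup>+ \<alpha>. ennreal (E * \<gamma> * z) * indicator {\<alpha>\<^sub>0..\<alpha>\<^sub>0 + \<delta>} \<alpha> \<partial>lborel) \<le> (\<integral>\<^sup>+ \<alpha>\<in>{0<..}. J \<alpha> \<partial>lborel)"
      by (intro nn_integral_mono)
    also have "(\<integral>\<^sup>+ \<alpha>. ennreal (E * \<gamma> * z) * indicator {\<alpha>\<^sub>0..\<alpha>\<^sub>0 + \<delta>} \<alpha> \<partial>lborel) = ennreal (E * \<gamma> * z) * ennreal \<delta>"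
      using lh by (simp add: nn_integral_cmult_indicator)
    also have "\<dots> = ennreal (E * \<gamma> * z * \<delta>)"
      using lh z0 E0 near(3) by (simp add: ennreal_mult)
    finally have Z: "ennreal (E * \<gamma> * z * \<delta>) \<le> (\<integral>\<^sup>+ \<alpha>\<in>{0<..}. J \<alpha> \<partial>lborel)" .
    have "E * exp (sqrt n / 16) * M * exp (- G) = tr * (E * \<gamma> * z * \<delta>)"
    proof -
      have k: "(2 * exp 2 / (\<gamma> * \<delta> * m * \<theta>\<^sub>0) * sqrt n) * (\<gamma> * \<delta> * (exp (- 2) * m * \<theta>\<^sub>0 / (2 * sqrt n))) = 1"
        using near(2,3) lh \<theta>\<^sub>0 n by (simp add: field_simps exp_minus)
      \<comment> \<open>The 4 is the quotient of \<open>2\<theta>\<^sub>0\<close> and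
        \<open>\<theta>\<^sub>0/2\<close>, the two bounds used for q/n.\<close>
      have l4: "ln (4 :: real) = ln (2 * \<theta>\<^sub>0) - ln (\<theta>\<^sub>0 / 2)"
        using \<theta>\<^sub>0 by (subst ln_divide_pos[symmetric]) auto
      have ee: "exp (sqrt n / 16 + n / 2 * ln 4 - G) * exp (- (n / 2) * (1 + ln (2 * \<theta>\<^sub>0))) = exp (sqrt n / 16) * M * exp (- G)"
        unfolding M_def l4 exp_add[symmetric] by (simp add: algebra_simps)
      have "tr * (E * \<gamma> * z * \<delta>) = E * (exp (sqrt n / 16 + n / 2 * ln 4 - G) * exp (- (n / 2) * (1 + ln (2 * \<theta>\<^sub>0)))) * ((2 * exp 2 / (\<gamma> * \<delta> * m * \<theta>\<^sub>0) * sqrt n) * (\<gamma> * \<delta> * (exp (- 2) * m * \<theta>\<^sub>0 / (2 * sqrt n))))"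
        unfolding tr_def z_def by (simp only: mult_ac)
      also have "\<dots> = E * exp (sqrt n / 16) * M * exp (- G)" unfolding k ee by (simp only: mult.assoc mult_1_right)
      finally show ?thesis by (rule sym)
    qed
    then have "ennreal (E * exp (sqrt n / 16) * M * exp (- G)) = ennreal tr * ennreal (E * \<gamma> * z * \<delta>)"
      using tr0 E0 z0 near(3) lh by (simp only:) (intro ennreal_mult, auto)
    also have "\<dots> \<le> ennreal tr * (\<integral>\<^sup>+ \<alpha>\<in>{0<..}. J \<alpha> \<partial>lborel)" by (intro mult_left_mono Z) auto
    finally show ?thesis .
  qed
  have "measure (normalized_density (restrict_space lborel ({0<..} \<times> {0<..})) (\<lambda>(\<theta>, \<alpha>). lik n (q \<alpha>) \<theta> * exp (- D \<alpha> / 2) * f \<theta> \<alpha> * g \<alpha>)) A \<le>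
    (2 * \<theta>\<^sub>0 * R * exp (- (ln n)\<^sup>2 / 12) + exp (L - n / 192)) * (2 * exp 2 / \<theta>\<^sub>0 * sqrt n) + 2 * tr"
  proof (rule joint_density_measure_le[where R="{\<theta>. 0 < \<theta> \<and> 5 * \<epsilon> < \<bar>\<theta> / \<theta>\<^sub>0 - 1\<bar>}" and lo=lo and hi=hi and J=J])
    show "(\<lambda>(\<theta>, \<alpha>). if 0 < \<theta> \<and> 0 < \<alpha> then lik n (q \<alpha>) \<theta> * exp (- D \<alpha> / 2) * f \<theta> \<alpha> * g \<alpha> else 0) \<in> borel_measurable (borel \<Otimes>\<^sub>M borel)"
      by (intro joint_weight_measurable q(1) D(1) C1_differentiable_imp_continuous_on f(2,5) g(2))
    show Rs: "{\<theta>. 0 < \<theta> \<and> 5 * \<epsilon> < \<bar>\<theta> / \<theta>\<^sub>0 - 1\<bar>} \<in> sets borel" by measurable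
    show "A \<subseteq> {(\<theta>, \<alpha>). 0 < \<theta> \<and> 0 < \<alpha> \<and> (lo \<le> \<alpha> \<longrightarrow> \<alpha> \<le> hi \<longrightarrow> \<theta> \<in> {\<theta>. 0 < \<theta> \<and> 5 * \<epsilon> < \<bar>\<theta> / \<theta>\<^sub>0 - 1\<bar>})}"
      using A by auto
    show "J \<alpha> = (\<integral>\<^sup>+ \<theta>\<in>{0<..}. ennreal (lik n (q \<alpha>) \<theta> * exp (- D \<alpha> / 2) * f \<theta> \<alpha> * g \<alpha>) \<partial>lborel)" for \<alpha>
      by (rule J_def)
    show "(\<integral>\<^sup>+ \<alpha>\<in>{0<..lo}. J \<alpha> \<partial>lborel) \<le> ennreal tr * (\<integral>\<^sup>+ \<alpha>\<in>{0<..}. J \<alpha> \<partial>lborel)"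
      by (rule order_trans[OF tail[OF _ _ lob tails(1,3)] Zl]) auto
    show "(\<integral>\<^sup>+ \<alpha>\<in>{hi..}. J \<alpha> \<partial>lborel) \<le> ennreal tr * (\<integral>\<^sup>+ \<alpha>\<in>{0<..}. J \<alpha> \<partial>lborel)"
      by (rule order_trans[OF tail[OF _ _ hib tails(2,4)] Zl]) (use \<alpha>\<^sub>0 in auto)
    show "(\<integral>\<^sup>+ \<theta>\<in>{0<..}. ennreal (lik n (q \<alpha>) \<theta> * exp (- D \<alpha> / 2) * f \<theta> \<alpha> * g \<alpha>) * indicator {\<theta>. 0 < \<theta> \<and> 5 * \<epsilon> < \<bar>\<theta> / \<theta>\<^sub>0 - 1\<bar>} \<theta> \<partial>lborel) \<le>
      ennreal ((2 * \<theta>\<^sub>0 * R * exp (- (ln n)\<^sup>2 / 12) + exp (L - n / 192)) * (2 * exp 2 / \<theta>\<^sub>0 * sqrt n)) * J \<alpha>"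
      if a: "0 < \<alpha>" "lo \<le> \<alpha>" "\<alpha> \<le> hi" for \<alpha>
    proof -
      let ?R = "{\<theta>. 0 < \<theta> \<and> 5 * \<epsilon> < \<bar>\<theta> / \<theta>\<^sub>0 - 1\<bar>}"
      have "(\<integral>\<^sup>+ \<theta>\<in>{0<..}. ennreal (lik n (q \<alpha>) \<theta> * exp (- D \<alpha> / 2) * f \<theta> \<alpha> * g \<alpha>) * indicator ?R \<theta> \<partial>lborel) =
         (\<integral>\<^sup>+ \<theta>\<in>?R. ennreal (lik n (q \<alpha>) \<theta> * exp (- D \<alpha> / 2) * f \<theta> \<alpha> * g \<alpha>) \<partial>lborel)"
        by (intro nn_integral_cong) (auto simp: indicator_def)
      also have "\<dots> = ennreal (exp (- D \<alpha> / 2) * g \<alpha>) * (\<integral>\<^sup>+ \<theta>\<in>?R. ennreal (lik n (q \<alpha>) \<theta> * f \<theta> \<alpha>) \<partial>lborel)"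
        by (rule slice[OF a(1)]) (use Rs in auto)
      also have "\<dots> \<le> ennreal (exp (- D \<alpha> / 2) * g \<alpha>) * (ennreal ((2 * \<theta>\<^sub>0 * R * exp (- (ln n)\<^sup>2 / 12) + exp (L - n / 192)) * (2 * exp 2 / \<theta>\<^sub>0 * sqrt n)) * I \<alpha>)"
        by (intro mult_left_mono sl(1) a) auto
      finally show ?thesis unfolding JI[OF a(1)] by (simp only: mult_ac)
    qed
  qed (use \<alpha>\<^sub>0 tr0 R0 \<theta>\<^sub>0 n in auto)
  then show ?thesis unfolding tr_def .
qed

section \<open>Limits of the posterior probabilities\<close>

lemma normalized_density_cong:
  assumes "\<And>x. x \<in> space M \<Longrightarrow> w x = w' x"
  shows "normalized_density M w = normalized_density M w'"
proof -
  have Z: "(\<integral>\<^sup>+ z. ennreal (w z) \<partial>M) = (\<integral>\<^sup>+ z. ennreal (w' z) \<partial>M)"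
    using assms by (intro nn_integral_cong) simp
  show ?thesis
    unfolding normalized_density_def density_def Z
    using assms by (intro arg_cong[where f="measure_of _ _"] ext nn_integral_cong) simp
qed

text \<open>The entry 1/(4(3\<nu> + d)) of the minimum bounds the product in the second claim by
  \<nu>/(4(3\<nu> + d)) < 1/3, the condition on the lower exponent in
  \<open>trace_deviation_rate\<close>.\<close>

lemma kappa_lo_bounds:
  assumes "0 < \<nu>" "1 \<le> d"
  shows "0 < kappa_lo \<nu> d" "2 * \<nu> * kappa_lo \<nu> d < 1 / 3"
proof -
  have d: "1 \<le> real d" using assms by simp
  have "0 < 0.9 / ((2 * real d + 0.94) * (8 * \<nu> + 3 * real d - 0.9))"
    using d assms by (intro divide_pos_pos mult_pos_pos) auto
  then show "0 < kappa_lo \<nu> d" unfolding kappa_lo_def using d assms by simp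
  have "kappa_lo \<nu> d \<le> 1 / 2 * (1 / (4 * (3 * \<nu> + real d)))"
    unfolding kappa_lo_def by (intro mult_left_mono Min_le) auto
  then have "2 * \<nu> * kappa_lo \<nu> d \<le> 2 * \<nu> * (1 / 2 * (1 / (4 * (3 * \<nu> + real d))))"
    using assms by (intro mult_left_mono) auto
  also have "\<dots> < 1 / 3" using d assms by (simp add: field_simps)
  finally show "2 * \<nu> * kappa_lo \<nu> d < 1 / 3" .
qed

text \<open>Since 2\<nu> + d + 2 is at most the factor 8\<nu> + 5d + 0.9 in the first entry of the
  minimum, the product is at most 0.45/(2d + 0.94), and 0.45/2.94 < 1/6.\<close>

lemma kappa_hi_bounds:
  assumes "0 < \<nu>" "1 \<le> d"
  shows "0 < kappa_hi \<nu> d" "(2 * \<nu> + real d + 2) * kappa_hi \<nu> d < 1 / 6"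
proof -
  have d: "1 \<le> real d" using assms by simp
  define a b where "a = 2 * real d + 0.94" and "b = 8 * \<nu> + 5 * real d + 0.9"
  have ab: "2.94 \<le> a" "0 < b" "2 * \<nu> + real d + 2 \<le> b" using d assms by (auto simp: a_def b_def)
  show "0 < kappa_hi \<nu> d" unfolding kappa_hi_def a_def[symmetric] b_def[symmetric] using d assms ab by simp
  have "kappa_hi \<nu> d \<le> 1 / 2 * (0.9 / (a * b))"
    unfolding kappa_hi_def a_def b_def by (intro mult_left_mono Min_le) auto
  then have "(2 * \<nu> + real d + 2) * kappa_hi \<nu> d \<le> b * (1 / 2 * (0.9 / (a * b)))"
    using assms ab d \<open>0 < kappa_hi \<nu> d\<close> by (intro mult_mono) auto
  also have "\<dots> = 0.45 / a" using ab by simp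
  also have "\<dots> < 1 / 6" using ab(1) by (simp add: field_simps)
  finally show "(2 * \<nu> + real d + 2) * kappa_hi \<nu> d < 1 / 6" .
qed

lemma ratio_dev_near:
  fixes s :: "nat \<Rightarrow> real ^ 'd::finite" and Y :: "real ^ 'd \<Rightarrow> 'w \<Rightarrow> real"
  assumes "0 < \<nu>" "0 < \<alpha>" "0 < \<theta>" "0 < \<theta>\<^sub>0" "inj_on s {..<n}" "s ` {..<n} \<subseteq> S"
    and Y: "\<And>\<sigma>2 \<alpha>. 0 < \<sigma>2 \<Longrightarrow> 0 < \<alpha> \<Longrightarrow> centred_gaussian_process (P \<sigma>2 \<alpha>) S (\<lambda>u v. \<sigma>2 * matern \<nu> \<alpha> (u - v)) Y"
    and r: "\<bar>\<theta> / \<theta>\<^sub>0 - 1\<bar> \<le> 5 * \<epsilon>" "0 \<le> \<epsilon>" "\<epsilon> \<le> 1 / 20" and A: "A \<subseteq> S"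
    and z: "ratio_dev A (pred_mse (P (\<theta>\<^sub>0 / \<alpha> powr (2 * \<nu>)) \<alpha>) \<nu> n s Y \<alpha>) v \<le> z"
  shows "ratio_dev A (pred_mse (P (\<theta> / \<alpha> powr (2 * \<nu>)) \<alpha>) \<nu> n s Y \<alpha>) v \<le> max (ereal (16 * \<epsilon>)) (2 * z)"
proof (rule ratio_dev_scale_le[OF _ r z])
  fix x assume x: "x \<in> A"
  define c where "c = \<alpha> powr (2 * \<nu>)"
  have c: "0 < c" using assms(2) by (simp add: c_def)
  obtain K where K: "\<And>M \<sigma>2 x. x \<in> S \<Longrightarrow> centred_gaussian_process M S (\<lambda>u v. \<sigma>2 * matern \<nu> \<alpha> (u - v)) Y \<Longrightarrow> pred_mse M \<nu> n s Y \<alpha> x = \<sigma>2 * K x"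
    using pred_mse_scale[OF assms(1,2,5,6), of "\<lambda>u v. matern \<nu> \<alpha> (u - v)" Y] by blast
  have p: "pred_mse (P (\<tau> / c) \<alpha>) \<nu> n s Y \<alpha> x = (\<tau> / c) * K x" if "0 < \<tau>" for \<tau>
  proof (rule K)
    show "x \<in> S" using x A by auto
    show "centred_gaussian_process (P (\<tau> / c) \<alpha>) S (\<lambda>u v. \<tau> / c * matern \<nu> \<alpha> (u - v)) Y"
      by (rule Y) (use that c assms(2) in auto)
  qed
  show "pred_mse (P (\<theta> / \<alpha> powr (2 * \<nu>)) \<alpha>) \<nu> n s Y \<alpha> x = \<theta> / \<theta>\<^sub>0 * pred_mse (P (\<theta>\<^sub>0 / \<alpha> powr (2 * \<nu>)) \<alpha>) \<nu> n s Y \<alpha> x"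
    unfolding c_def[symmetric] p[OF assms(3)] p[OF assms(4)] using assms(4) by simp
qed

lemma eventually_ln_sqrt_le:
  assumes "0 < e" shows "\<forall>\<^sub>F n in sequentially. ln (real n) / sqrt n \<le> e"
proof -
  have "(\<lambda>n. ln (real n) / sqrt n) \<longlonglongrightarrow> 0" by real_asymp
  from order_tendstoD(2)[OF this assms] show ?thesis by (rule eventually_mono) simp
qed

lemma eventually_ln_ge: "\<forall>\<^sub>F n in sequentially. c \<le> ln (real n)"
proof -
  have "filterlim (\<lambda>n. ln (real n)) at_top sequentially" by real_asymp
  then show ?thesis by (simp add: filterlim_at_top)
qed

text \<open>For fixed \<alpha> the prior density is a single function: compactness bounds it around
  \<open>\<theta>\<^sub>0\<close>, and continuity keeps it above half its value there, so
  \<open>bad_rate\<close> applies with B and b independent of n.\<close>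

lemma posterior_given_concentrates:
  fixes s :: "nat \<Rightarrow> nat \<Rightarrow> real ^ 'd::finite" and Y :: "real ^ 'd \<Rightarrow> 'w \<Rightarrow> real"
  assumes \<nu>: "0 < \<nu>" and \<alpha>: "0 < \<alpha>" and \<theta>\<^sub>0: "0 < \<theta>\<^sub>0" and s: "\<And>n. inj_on (s n) {..<n}"
    and f: "cond_prior_regular \<theta>\<^sub>0 f"
    and q: "\<forall>\<^sub>F n in sequentially. \<bar>qform n (finv n (kmat \<nu> (s n) \<alpha>)) (\<lambda>i. Y (s n i) \<omega>) / \<theta>\<^sub>0 - real n\<bar> \<le> 2 * sqrt n * ln n"
    and A: "\<forall>\<^sub>F n in sequentially. A n \<subseteq> {\<theta>. 0 < \<theta> \<and> 5 * (ln (real n) / sqrt n) < \<bar>\<theta> / \<theta>\<^sub>0 - 1\<bar>}"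
  shows "(\<lambda>n. measure (posterior_given \<nu> f n (s n) (obs_vec n (s n) Y \<omega>) \<alpha>) (A n)) \<longlonglongrightarrow> 0"
proof -
  define h where "h \<theta> = f \<theta> \<alpha>" for \<theta>
  have h: "\<And>\<theta>. 0 < \<theta> \<Longrightarrow> 0 \<le> h \<theta>" "h C1_differentiable_on {0<..}" "(\<integral>\<^sup>+ \<theta>\<in>{0<..}. ennreal (h \<theta>) \<partial>lborel) \<le> 1" "0 < h \<theta>\<^sub>0"
    using f \<alpha> unfolding cond_prior_regular_def h_def[abs_def] by auto
  have hc: "continuous_on {0<..} h" by (rule C1_differentiable_imp_continuous_on[OF h(2)])
  have hm: "(\<lambda>\<theta>. indicator {0<..} \<theta> * h \<theta>) \<in> borel_measurable borel" by (rule C1_indicator_measurable[OF h(2)])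
  have "compact (h ` {\<theta>\<^sub>0 / 2..2 * \<theta>\<^sub>0})"
    using \<theta>\<^sub>0 by (intro compact_continuous_image continuous_on_subset[OF hc]) auto
  then obtain B where B: "\<And>\<theta>. \<theta> \<in> {\<theta>\<^sub>0 / 2..2 * \<theta>\<^sub>0} \<Longrightarrow> h \<theta> \<le> B"
    unfolding compact_eq_bounded_closed bounded_iff by (metis abs_le_D1 imageI real_norm_def)
  have "isCont h \<theta>\<^sub>0" using hc \<theta>\<^sub>0 by (simp add: continuous_on_eq_continuous_at)
  then obtain e where e: "0 < e" "\<And>\<theta>. \<bar>\<theta> - \<theta>\<^sub>0\<bar> < e \<Longrightarrow> \<bar>h \<theta> - h \<theta>\<^sub>0\<bar> < h \<theta>\<^sub>0 / 2"
    using h(4) unfolding continuous_at_real_range by (metis half_gt_zero real_norm_def)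
  \<comment> \<open>Once \<epsilon> is below this value, a relative deviation of 4\<epsilon> is an
    absolute one of at most e/2.\<close>
  have e': "0 < e / (8 * \<theta>\<^sub>0)" using e \<theta>\<^sub>0 by simp
  have e20: "\<forall>\<^sub>F n in sequentially. ln (real n) / sqrt n \<le> 1 / 20" by (rule eventually_ln_sqrt_le) simp
  have ev: "\<forall>\<^sub>F n in sequentially. measure (posterior_given \<nu> f n (s n) (obs_vec n (s n) Y \<omega>) \<alpha>) (A n) \<le> bad_rate \<theta>\<^sub>0 B (h \<theta>\<^sub>0 / 2) (real n)"
    using q A eventually_ln_ge[of 2] e20 eventually_ln_sqrt_le[OF e'] eventually_gt_at_top[of 0]
  proof eventually_elim
    case (elim n)
    let ?\<epsilon> = "ln (real n) / sqrt n"
    define Q where "Q = qform n (finv n (kmat \<nu> (s n) \<alpha>)) (\<lambda>i. Y (s n i) \<omega>)"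
    define H where "H = exp (- ln (fdet n (kmat \<nu> (s n) \<alpha>)) / 2)"
    define w where "w \<theta> = H * (lik n Q \<theta> * h \<theta>)" for \<theta>
    note en = elim(5)
    have post: "posterior_given \<nu> f n (s n) (obs_vec n (s n) Y \<omega>) \<alpha> = normalized_density (restrict_space lborel {0<..}) w"
      unfolding posterior_given_def
    proof (rule normalized_density_cong)
      fix \<theta> :: real assume "\<theta> \<in> space (restrict_space lborel {0<..})"
      then have "0 < \<theta>" by (simp add: space_restrict_space)
      then show "exp (log_lik \<nu> n (s n) (obs_vec n (s n) Y \<omega>) (\<theta> / \<alpha> powr (2 * \<nu>)) \<alpha>) * f \<theta> \<alpha> = w \<theta>"
        unfolding log_lik_eq[OF \<nu> \<alpha> \<open>0 < \<theta>\<close> s] w_def Q_def H_def h_def by (simp only: mult_ac)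
    qed
    have H0: "0 \<le> H" by (simp add: H_def)
    have nn: "(\<integral>\<^sup>+ \<theta>\<in>X. ennreal (w \<theta>) \<partial>restrict_space lborel {0<..}) = ennreal H * (\<integral>\<^sup>+ \<theta>\<in>X. ennreal (lik n Q \<theta> * h \<theta>) \<partial>lborel)"
      if X: "X \<subseteq> {0<..}" "X \<in> sets borel" for X
    proof -
      have eq: "ennreal (lik n Q \<theta> * h \<theta>) * indicator X \<theta> = ennreal (lik n Q \<theta> * (indicator {0<..} \<theta> * h \<theta>)) * indicator X \<theta>" for \<theta>
        using X(1) by (auto simp: indicator_def)
      have ms: "(\<lambda>\<theta>. ennreal (lik n Q \<theta> * h \<theta>) * indicator X \<theta>) \<in> borel_measurable lborel"
        unfolding eq using hm X(2) by measurable
      have "(\<integral>\<^sup>+ \<theta>\<in>X. ennreal (w \<theta>) \<partial>restrict_space lborel {0<..}) = (\<integral>\<^sup>+ \<theta>. ennreal (w \<theta>) * indicator X \<theta> * indicator {0<..} \<theta> \<partial>lborel)"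
        by (rule nn_integral_restrict_space) simp
      also have "\<dots> = (\<integral>\<^sup>+ \<theta>. ennreal H * (ennreal (lik n Q \<theta> * h \<theta>) * indicator X \<theta>) \<partial>lborel)"
        using X(1) H0 h(1) by (intro nn_integral_cong) (auto simp: indicator_def w_def ennreal_mult lik_nonneg)
      also have "\<dots> = ennreal H * (\<integral>\<^sup>+ \<theta>\<in>X. ennreal (lik n Q \<theta> * h \<theta>) \<partial>lborel)" by (rule nn_integral_cmult[OF ms])
      finally show ?thesis .
    qed
    have fb: "h \<theta>\<^sub>0 / 2 \<le> h t" if t: "\<bar>t / \<theta>\<^sub>0 - 1\<bar> \<le> 4 * ?\<epsilon>" for t
    proof -
      have "t - \<theta>\<^sub>0 = (t / \<theta>\<^sub>0 - 1) * \<theta>\<^sub>0" using \<theta>\<^sub>0 by (simp add: field_simps)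
      then have "\<bar>t - \<theta>\<^sub>0\<bar> = \<bar>t / \<theta>\<^sub>0 - 1\<bar> * \<theta>\<^sub>0" using \<theta>\<^sub>0 by (simp add: abs_mult)
      also have "\<dots> \<le> (4 * (e / (8 * \<theta>\<^sub>0))) * \<theta>\<^sub>0" using t en \<theta>\<^sub>0 by (intro mult_right_mono) auto
      also have "\<dots> < e" using \<theta>\<^sub>0 e(1) by simp
      finally show ?thesis using e(2)[of t] by linarith
    qed
    have n: "0 < real n" using elim(6) by simp
    have fB: "h t \<le> B" if "\<theta>\<^sub>0 / 2 < t" "t < 2 * \<theta>\<^sub>0" for t using B[of t] that by simp
    have br0: "0 \<le> bad_rate \<theta>\<^sub>0 B (h \<theta>\<^sub>0 / 2) n"
    proof -
      have "0 \<le> B" using fB[of \<theta>\<^sub>0] h(4) \<theta>\<^sub>0 by simp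
      then show ?thesis using \<theta>\<^sub>0 h(4) unfolding bad_rate_def by (intro mult_nonneg_nonneg add_nonneg_nonneg divide_nonneg_nonneg) auto
    qed
    let ?R = "{\<theta>. 0 < \<theta> \<and> 5 * ?\<epsilon> < \<bar>\<theta> / \<theta>\<^sub>0 - 1\<bar>}"
    have R: "?R \<in> sets borel" by measurable
    have "measure (normalized_density (restrict_space lborel {0<..}) w) (A n) \<le> bad_rate \<theta>\<^sub>0 B (h \<theta>\<^sub>0 / 2) n"
    proof (rule measure_normalized_density_le[where B="?R"])
      have "(\<lambda>\<theta>. H * (lik n Q \<theta> * (indicator {0<..} \<theta> * h \<theta>))) \<in> borel_measurable borel" using hm by measurable
      then have "(\<lambda>\<theta>. H * (lik n Q \<theta> * (indicator {0<..} \<theta> * h \<theta>))) \<in> borel_measurable (restrict_space lborel {0<..})"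
        by (intro measurable_restrict_space1) simp
      then show "w \<in> borel_measurable (restrict_space lborel {0<..})"
        by (rule measurable_cong[THEN iffD1, rotated]) (simp add: w_def space_restrict_space)
      show "A n \<subseteq> ?R" by (rule elim(2))
      show "?R \<in> sets (restrict_space lborel {0<..})" using R by (subst sets_restrict_space_iff) auto
      have "(\<integral>\<^sup>+ \<theta>\<in>?R. ennreal (lik n Q \<theta> * h \<theta>) \<partial>lborel) \<le> ennreal (bad_rate \<theta>\<^sub>0 B (h \<theta>\<^sub>0 / 2) n) * (\<integral>\<^sup>+ \<theta>\<in>{0<..}. ennreal (lik n Q \<theta> * h \<theta>) \<partial>lborel)"
        by (rule bad_ratio[OF \<theta>\<^sub>0 n elim(3) refl elim(4) elim(1)[folded Q_def] h(1) hm h(3) fB fb]) (use h(4) in auto)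
      then have "ennreal H * (\<integral>\<^sup>+ \<theta>\<in>?R. ennreal (lik n Q \<theta> * h \<theta>) \<partial>lborel) \<le> ennreal H * (ennreal (bad_rate \<theta>\<^sub>0 B (h \<theta>\<^sub>0 / 2) n) * (\<integral>\<^sup>+ \<theta>\<in>{0<..}. ennreal (lik n Q \<theta> * h \<theta>) \<partial>lborel))"
        by (rule mult_left_mono) simp
      also have "\<dots> = ennreal (bad_rate \<theta>\<^sub>0 B (h \<theta>\<^sub>0 / 2) n) * (\<integral>\<^sup>+ \<theta>\<in>{0<..}. ennreal (w \<theta>) \<partial>restrict_space lborel {0<..})"
        by (subst nn) (auto simp: mult_ac)
      also have "(\<integral>\<^sup>+ \<theta>\<in>{0<..}. ennreal (w \<theta>) \<partial>restrict_space lborel {0<..}) = (\<integral>\<^sup>+ \<theta>. ennreal (w \<theta>) \<partial>restrict_space lborel {0<..})"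
        by (intro nn_integral_cong) (simp add: space_restrict_space)
      finally show "(\<integral>\<^sup>+ \<theta>\<in>?R. ennreal (w \<theta>) \<partial>restrict_space lborel {0<..}) \<le> ennreal (bad_rate \<theta>\<^sub>0 B (h \<theta>\<^sub>0 / 2) n) * (\<integral>\<^sup>+ \<theta>. ennreal (w \<theta>) \<partial>restrict_space lborel {0<..})"
        using R by (subst nn) auto
    qed (rule br0)
    then show ?case unfolding post .
  qed
  show ?thesis
    by (rule tendsto_sandwich[OF _ ev tendsto_const bad_rate_const_tendsto_0]) simp
qed

text \<open>Collects the eventual conditions under which \<open>joint_posterior_le\<close> applies
  with K = n^C1, R = n^C2, L = n^C3 and G = \<gamma>' n ln n.\<close>

lemma posterior_concentrates:
  fixes s :: "nat \<Rightarrow> nat \<Rightarrow> real ^ 'd::finite" and Y :: "real ^ 'd \<Rightarrow> 'w \<Rightarrow> real" and f :: "real \<Rightarrow> real \<Rightarrow> real" and g :: "real \<Rightarrow> real"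
  assumes \<nu>: "0 < \<nu>" and \<alpha>\<^sub>0: "0 < \<alpha>\<^sub>0" and \<theta>\<^sub>0: "0 < \<theta>\<^sub>0" and s: "\<And>n. inj_on (s n) {..<n}"
    and f: "cond_prior_regular \<theta>\<^sub>0 f" "cond_prior_growth \<nu> CARD('d) \<theta>\<^sub>0 f" and g: "range_prior_tails \<nu> CARD('d) \<theta>\<^sub>0 \<alpha>\<^sub>0 f g"
    and tr: "\<forall>\<^sub>F n in sequentially. \<bar>tr_prod n (finv n (kmat \<nu> (s n) (alpha_hi \<nu> CARD('d) n))) (kmat \<nu> (s n) \<alpha>\<^sub>0) - real n\<bar> \<le> sqrt n / 8"
    and q: "\<forall>\<^sub>F n in sequentially. \<bar>qform n (finv n (kmat \<nu> (s n) (alpha_lo \<nu> CARD('d) n))) (\<lambda>i. Y (s n i) \<omega>) / \<theta>\<^sub>0 - real n\<bar> \<le> 2 * sqrt n * ln n"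
      "\<forall>\<^sub>F n in sequentially. \<bar>qform n (finv n (kmat \<nu> (s n) (alpha_hi \<nu> CARD('d) n))) (\<lambda>i. Y (s n i) \<omega>) / \<theta>\<^sub>0 - real n\<bar> \<le> 2 * sqrt n * ln n"
    and A: "\<forall>\<^sub>F n in sequentially. A n \<subseteq> {(\<theta>, \<alpha>). 0 < \<theta> \<and> 0 < \<alpha> \<and>
      (alpha_lo \<nu> CARD('d) n \<le> \<alpha> \<longrightarrow> \<alpha> \<le> alpha_hi \<nu> CARD('d) n \<longrightarrow> 5 * (ln (real n) / sqrt n) < \<bar>\<theta> / \<theta>\<^sub>0 - 1\<bar>)}"
  shows "(\<lambda>n. measure (posterior \<nu> f g n (s n) (obs_vec n (s n) Y \<omega>)) (A n)) \<longlonglongrightarrow> 0"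
proof -
  have reg: "\<And>\<theta> \<alpha>. 0 < \<theta> \<Longrightarrow> 0 < \<alpha> \<Longrightarrow> 0 \<le> f \<theta> \<alpha>" "\<And>\<alpha>. 0 < \<alpha> \<Longrightarrow> (\<lambda>\<theta>. f \<theta> \<alpha>) C1_differentiable_on {0<..}"
      "\<And>\<alpha>. 0 < \<alpha> \<Longrightarrow> (\<integral>\<^sup>+ \<theta>\<in>{0<..}. ennreal (f \<theta> \<alpha>) \<partial>lborel) \<le> 1" "\<And>\<alpha>. 0 < \<alpha> \<Longrightarrow> 0 < f \<theta>\<^sub>0 \<alpha>"
      "\<And>\<theta>. 0 < \<theta> \<Longrightarrow> continuous_on {0<..} (\<lambda>\<alpha>. f \<theta> \<alpha>)"
    using f(1) unfolding cond_prior_regular_def by simp_all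
  define p where "p = 2 * \<nu> + real CARD('d)"
  define lo where "lo = alpha_lo \<nu> CARD('d)"
  define hi where "hi = alpha_hi \<nu> CARD('d)"
  define kl where "kl = kappa_lo \<nu> CARD('d)"
  define kh where "kh = kappa_hi \<nu> CARD('d)"
  have lo: "lo n = real n powr (- kl)" and hi: "hi n = real n powr kh" for n
    by (simp_all add: lo_def hi_def alpha_lo_def alpha_hi_def kl_def kh_def)
  have k0: "0 < kl" "0 < kh" using kappa_lo_bounds(1)[OF \<nu>, of "CARD('d)"] kappa_hi_bounds(1)[OF \<nu>, of "CARD('d)"] by (simp_all add: kl_def kh_def Suc_leI)
  have p2: "\<nu> + real CARD('d) / 2 = p / 2" by (simp add: p_def)
  obtain C1 C2 C3 where C: "C1 < 1 / 2" "C3 < 1" and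
    growth: "\<forall>\<^sub>F n in sequentially.
         (SUP \<alpha>\<in>{lo n..hi n}. SUP \<theta>\<in>{\<theta>\<^sub>0 / 2<..<2 * \<theta>\<^sub>0}. ereal \<bar>deriv (\<lambda>t. ln (f t \<alpha>)) \<theta>\<bar>) \<le> ereal (real n powr C1) \<and>
         (SUP \<alpha>\<in>{lo n..hi n}. SUP \<theta>\<in>{\<theta>\<^sub>0 / 2<..<2 * \<theta>\<^sub>0}. ereal (f \<theta> \<alpha> / f \<theta>\<^sub>0 \<alpha>)) \<le> ereal (real n powr C2) \<and>
         (INF \<alpha>\<in>{lo n..hi n}. ereal (ln (f \<theta>\<^sub>0 \<alpha>))) \<ge> ereal (- (real n powr C3))"
    using f(2) unfolding cond_prior_growth_def lo_def hi_def by force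
  have g0: "\<And>\<alpha>. 0 < \<alpha> \<Longrightarrow> 0 \<le> g \<alpha>" "continuous_on {0<..} g" "0 < g \<alpha>\<^sub>0"
    using g unfolding range_prior_tails_def by auto
  obtain cl ch where c: "cl < p / 2 * kl" "ch < p / 2 * kh" and
    tails: "\<forall>\<^sub>F n in sequentially.
       (\<integral>\<^sup>+ \<alpha>\<in>{0<..lo n}. ennreal (\<alpha> powr (- (real n * (p / 2))) * g \<alpha>) \<partial>lborel) \<le> ennreal (exp (cl * real n * ln (real n))) \<and>
       (\<integral>\<^sup>+ \<alpha>\<in>{hi n..}. ennreal (\<alpha> powr (real n * (p / 2)) * g \<alpha>) \<partial>lborel) \<le> ennreal (exp (ch * real n * ln (real n)))"
  proof -
    obtain cl ch where *: "cl < (\<nu> + real CARD('d) / 2) * kl" "ch < (\<nu> + real CARD('d) / 2) * kh"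
       "\<forall>\<^sub>F n in sequentially.
         max (\<integral>\<^sup>+ \<alpha>\<in>{0<..lo n}. ennreal (\<alpha> powr (- (real n * (\<nu> + real CARD('d) / 2))) * g \<alpha>) \<partial>lborel)
             (\<integral>\<^sup>+ \<alpha>\<in>{0<..lo n}. ennreal (\<alpha> powr (- (real n * (\<nu> + real CARD('d) / 2))) * f \<theta>\<^sub>0 \<alpha> * g \<alpha>) \<partial>lborel)
           \<le> ennreal (exp (cl * real n * ln (real n))) \<and>
         max (\<integral>\<^sup>+ \<alpha>\<in>{hi n..}. ennreal (\<alpha> powr (real n * (\<nu> + real CARD('d) / 2)) * g \<alpha>) \<partial>lborel)
             (\<integral>\<^sup>+ \<alpha>\<in>{hi n..}. ennreal (\<alpha> powr (real n * (\<nu> + real CARD('d) / 2)) * f \<theta>\<^sub>0 \<alpha> * g \<alpha>) \<partial>lborel)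
           \<le> ennreal (exp (ch * real n * ln (real n)))"
      using g unfolding range_prior_tails_def lo_def[symmetric] hi_def[symmetric] kl_def[symmetric] kh_def[symmetric] by blast
    show ?thesis
      by (rule that[OF *(1,2)[unfolded p2]], rule eventually_mono[OF *(3)[unfolded p2]]) simp
  qed
  \<comment> \<open>The slack in the tail exponents; multiplied by n ln n it outgrows the losses
    (n/2) ln 4 and sqrt n / 16.\<close>
  define \<gamma>' where "\<gamma>' = min (p / 2 * kl - cl) (p / 2 * kh - ch)"
  have \<gamma>': "0 < \<gamma>'" using c by (simp add: \<gamma>'_def)
  obtain \<delta> where \<delta>: "0 < \<delta>" "\<And>\<alpha>. \<alpha>\<^sub>0 \<le> \<alpha> \<Longrightarrow> \<alpha> \<le> \<alpha>\<^sub>0 + \<delta> \<Longrightarrow> f \<theta>\<^sub>0 \<alpha>\<^sub>0 / 2 \<le> f \<theta>\<^sub>0 \<alpha> \<and> g \<alpha>\<^sub>0 / 2 \<le> g \<alpha>"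
  proof -
    have fc: "(f \<theta>\<^sub>0 \<longlongrightarrow> f \<theta>\<^sub>0 \<alpha>\<^sub>0) (at_right \<alpha>\<^sub>0)" and gc: "(g \<longlongrightarrow> g \<alpha>\<^sub>0) (at_right \<alpha>\<^sub>0)"
      using reg(5)[OF \<theta>\<^sub>0] g0(2) \<alpha>\<^sub>0
      by (auto simp: continuous_on_eq_continuous_at continuous_within[symmetric] intro: continuous_at_imp_continuous_at_within)
    have "f \<theta>\<^sub>0 \<alpha>\<^sub>0 / 2 < f \<theta>\<^sub>0 \<alpha>\<^sub>0" "g \<alpha>\<^sub>0 / 2 < g \<alpha>\<^sub>0" using reg(4)[OF \<alpha>\<^sub>0] g0(3) by auto
    then have "\<forall>\<^sub>F \<alpha> in at_right \<alpha>\<^sub>0. f \<theta>\<^sub>0 \<alpha>\<^sub>0 / 2 < f \<theta>\<^sub>0 \<alpha> \<and> g \<alpha>\<^sub>0 / 2 < g \<alpha>"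
      by (intro eventually_conj order_tendstoD(1)[OF fc] order_tendstoD(1)[OF gc])
    then obtain b where b: "\<alpha>\<^sub>0 < b" "\<And>\<alpha>. \<alpha>\<^sub>0 < \<alpha> \<Longrightarrow> \<alpha> < b \<Longrightarrow> f \<theta>\<^sub>0 \<alpha>\<^sub>0 / 2 < f \<theta>\<^sub>0 \<alpha> \<and> g \<alpha>\<^sub>0 / 2 < g \<alpha>"
      unfolding eventually_at_right_field by blast
    show thesis
    proof (rule that[of "(b - \<alpha>\<^sub>0) / 2"])
      fix \<alpha> assume a: "\<alpha>\<^sub>0 \<le> \<alpha>" "\<alpha> \<le> \<alpha>\<^sub>0 + (b - \<alpha>\<^sub>0) / 2"
      show "f \<theta>\<^sub>0 \<alpha>\<^sub>0 / 2 \<le> f \<theta>\<^sub>0 \<alpha> \<and> g \<alpha>\<^sub>0 / 2 \<le> g \<alpha>"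
      proof (cases "\<alpha> = \<alpha>\<^sub>0")
        case True
        then show ?thesis using reg(4)[OF \<alpha>\<^sub>0] g0(3) by simp
      next
        case False
        then show ?thesis using b(2)[of \<alpha>] a b(1) by (auto simp: field_simps)
      qed
    qed (use b in simp)
  qed
  define Kc where "Kc = 2 * exp 2 / (g \<alpha>\<^sub>0 / 2 * \<delta> * (f \<theta>\<^sub>0 \<alpha>\<^sub>0 / 2) * \<theta>\<^sub>0)"
  let ?r = "\<lambda>n. (2 * \<theta>\<^sub>0 * real n powr C2 * exp (- (ln (real n))\<^sup>2 / 12) + exp (real n powr C3 - real n / 192)) * (2 * exp 2 / \<theta>\<^sub>0 * sqrt n) +
    2 * (exp (sqrt n / 16 + real n / 2 * ln 4 - \<gamma>' * real n * ln (real n)) * (Kc * sqrt n))"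
  have lim: "?r \<longlonglongrightarrow> 0"
  proof -
    have "(\<lambda>n. exp (sqrt n / 16 + real n / 2 * ln 4 - \<gamma>' * real n * ln (real n)) * sqrt n) \<longlonglongrightarrow> 0"
      using \<gamma>' by real_asymp
    from tendsto_mult_left[OF this, of Kc]
    have "(\<lambda>n. exp (sqrt n / 16 + real n / 2 * ln 4 - \<gamma>' * real n * ln (real n)) * (Kc * sqrt n)) \<longlonglongrightarrow> 0"
      by (simp only: mult_zero_right mult.left_commute)
    from tendsto_add[OF bad_rate_growth_tendsto_0[OF C(2)] tendsto_mult_left[OF this]] show ?thesis
      by (simp only: mult_zero_right add_0_left)
  qed
  have ev_lo: "\<forall>\<^sub>F n in sequentially. lo n \<le> \<alpha>\<^sub>0"
  proof -
    have "lo \<longlonglongrightarrow> 0" unfolding lo[abs_def] using k0 by real_asymp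
    from order_tendstoD(2)[OF this \<alpha>\<^sub>0] show ?thesis by (rule eventually_mono) simp
  qed
  have ev_hi: "\<forall>\<^sub>F n in sequentially. \<alpha>\<^sub>0 + \<delta> \<le> hi n"
  proof -
    have "filterlim hi at_top sequentially" unfolding hi[abs_def] using k0 by real_asymp
    then show ?thesis by (simp add: filterlim_at_top)
  qed
  \<comment> \<open>The window around \<open>\<theta>\<^sub>0\<close> has width of order ln n / sqrt
    n, so C1 < 1/2 is what keeps the logarithm of the prior density from varying by more than 1 on
    it.\<close>
  have ev_K: "\<forall>\<^sub>F n in sequentially. real n powr C1 * (4 * (ln (real n) / sqrt n) * \<theta>\<^sub>0) \<le> 1"
  proof -
    have "(\<lambda>n. real n powr C1 * (ln (real n) / sqrt n)) \<longlonglongrightarrow> 0" using C(1) by real_asymp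
    from order_tendstoD(2)[OF this, of "1 / (4 * \<theta>\<^sub>0)"] \<theta>\<^sub>0
    have "\<forall>\<^sub>F n in sequentially. real n powr C1 * (ln (real n) / sqrt n) < 1 / (4 * \<theta>\<^sub>0)" by simp
    then show ?thesis
    proof eventually_elim
      case (elim n)
      then have "real n powr C1 * (ln (real n) / sqrt n) * (4 * \<theta>\<^sub>0) < 1" using \<theta>\<^sub>0 by (subst (asm) pos_less_divide_eq) auto
      moreover have "real n powr C1 * (4 * (ln (real n) / sqrt n) * \<theta>\<^sub>0) = real n powr C1 * (ln (real n) / sqrt n) * (4 * \<theta>\<^sub>0)" by (simp only: mult_ac)
      ultimately show ?case by (simp only: less_imp_le)
    qed
  qed
  have e20: "\<forall>\<^sub>F n in sequentially. ln (real n) / sqrt n \<le> 1 / 20" by (rule eventually_ln_sqrt_le) simp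
  have ev: "\<forall>\<^sub>F n in sequentially. measure (posterior \<nu> f g n (s n) (obs_vec n (s n) Y \<omega>)) (A n) \<le> ?r n"
    using tr[folded hi_def] q[folded lo_def hi_def] A[folded lo_def hi_def] growth tails ev_lo ev_hi ev_K e20 eventually_ln_ge[of 2] eventually_gt_at_top[of 0]
  proof eventually_elim
    case (elim n)
    have n: "0 < real n" using elim(12) by simp
    have lh: "0 < lo n" "0 < hi n" using n by (simp_all add: lo hi)
    define Q where "Q \<alpha> = qform n (finv n (kmat \<nu> (s n) \<alpha>)) (\<lambda>i. Y (s n i) \<omega>)" for \<alpha>
    define D where "D \<alpha> = ln (fdet n (kmat \<nu> (s n) \<alpha>))" for \<alpha>
    have post: "posterior \<nu> f g n (s n) (obs_vec n (s n) Y \<omega>) =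
        normalized_density (restrict_space lborel ({0<..} \<times> {0<..})) (\<lambda>(\<theta>, \<alpha>). lik n (Q \<alpha>) \<theta> * exp (- D \<alpha> / 2) * f \<theta> \<alpha> * g \<alpha>)"
      unfolding posterior_def
    proof (rule normalized_density_cong)
      fix x :: "real \<times> real" assume "x \<in> space (restrict_space lborel ({0<..} \<times> {0<..}))"
      then obtain \<theta> \<alpha> where x: "x = (\<theta>, \<alpha>)" "0 < \<theta>" "0 < \<alpha>" by (auto simp: space_restrict_space)
      show "(case x of (\<theta>, \<alpha>) \<Rightarrow> exp (log_lik \<nu> n (s n) (obs_vec n (s n) Y \<omega>) (\<theta> / \<alpha> powr (2 * \<nu>)) \<alpha>) * f \<theta> \<alpha> * g \<alpha>) =
          (case x of (\<theta>, \<alpha>) \<Rightarrow> lik n (Q \<alpha>) \<theta> * exp (- D \<alpha> / 2) * f \<theta> \<alpha> * g \<alpha>)"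
        unfolding x prod.case log_lik_eq[OF \<nu> x(3,2) s] Q_def D_def by (rule refl)
    qed
    note gr = elim(5)
    have "measure (normalized_density (restrict_space lborel ({0<..} \<times> {0<..})) (\<lambda>(\<theta>, \<alpha>). lik n (Q \<alpha>) \<theta> * exp (- D \<alpha> / 2) * f \<theta> \<alpha> * g \<alpha>)) (A n) \<le> ?r n"
      unfolding Kc_def
    proof (rule joint_posterior_le[OF \<theta>\<^sub>0 n elim(11) refl elim(10) lh(1) elim(7,8) \<delta>(1) _ _ elim(2)[folded Q_def] elim(3)[folded Q_def] _ _ _ reg _ elim(9) _ _ g0(1,2) \<delta>(2) _ _ _ _ _ _ elim(4)])
      show "Q \<alpha> \<le> Q \<beta>" if "0 < \<alpha>" "\<alpha> \<le> \<beta>" for \<alpha> \<beta>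
        unfolding Q_def by (rule finv_kmat_mono[OF \<nu> that s])
      show "(\<alpha> / lo n) powr p * Q (lo n) \<le> Q \<alpha>" if "0 < \<alpha>" "\<alpha> \<le> lo n" for \<alpha>
        unfolding Q_def p_def by (rule finv_kmat_scale[OF \<nu> that s])
      show "D \<beta> \<le> D \<alpha>" if "0 < \<alpha>" "\<alpha> \<le> \<beta>" for \<alpha> \<beta>
        unfolding D_def by (rule fdet_kmat_antimono[OF \<nu> that s])
      show "D (hi n) - n * p * ln (\<alpha> / hi n) \<le> D \<alpha>" if "hi n \<le> \<alpha>" for \<alpha>
        unfolding D_def p_def by (rule fdet_kmat_scale[OF \<nu> lh(2) that s])
      \<comment> \<open>The trace deviation at the upper end point also bounds the log-determinant
        difference.\<close>
      show "D \<alpha>\<^sub>0 - D (hi n) \<le> sqrt n / 8"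
        unfolding D_def using ln_det_diff_le[OF pd_kmat[OF \<nu> lh(2) s] pd_kmat[OF \<nu> \<alpha>\<^sub>0 s], of n] elim(1) by linarith
      show "\<bar>deriv (\<lambda>t. ln (f t \<alpha>)) t\<bar> \<le> real n powr C1" if "lo n \<le> \<alpha>" "\<alpha> \<le> hi n" "\<theta>\<^sub>0 / 2 < t" "t < 2 * \<theta>\<^sub>0" for t \<alpha>
        using gr that by (auto simp: SUP_le_iff)
      show "f t \<alpha> / f \<theta>\<^sub>0 \<alpha> \<le> real n powr C2" if "lo n \<le> \<alpha>" "\<alpha> \<le> hi n" "\<theta>\<^sub>0 / 2 < t" "t < 2 * \<theta>\<^sub>0" for t \<alpha>
        using gr that by (auto simp: SUP_le_iff)
      show "- (real n powr C3) \<le> ln (f \<theta>\<^sub>0 \<alpha>)" if "lo n \<le> \<alpha>" "\<alpha> \<le> hi n" for \<alpha>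
        using gr that by (auto simp: le_INF_iff)
      show "(\<integral>\<^sup>+ \<alpha>\<in>{0<..lo n}. ennreal (\<alpha> powr (- (real n * (p / 2))) * g \<alpha>) \<partial>lborel) \<le> ennreal (exp (cl * real n * ln (real n)))"
        "(\<integral>\<^sup>+ \<alpha>\<in>{hi n..}. ennreal (\<alpha> powr (real n * (p / 2)) * g \<alpha>) \<partial>lborel) \<le> ennreal (exp (ch * real n * ln (real n)))"
        using elim(6) by auto
      have nl: "0 \<le> real n * ln (real n)" using elim(11) n by (intro mult_nonneg_nonneg) auto
      have "\<gamma>' * (real n * ln (real n)) \<le> (p / 2 * kl - cl) * (real n * ln (real n))" "\<gamma>' * (real n * ln (real n)) \<le> (p / 2 * kh - ch) * (real n * ln (real n))"
        using nl by (auto simp: \<gamma>'_def intro!: mult_right_mono)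
      then show "lo n powr (real n * (p / 2)) * exp (cl * real n * ln (real n)) \<le> exp (- (\<gamma>' * real n * ln (real n)))"
        "hi n powr (- (real n * (p / 2))) * exp (ch * real n * ln (real n)) \<le> exp (- (\<gamma>' * real n * ln (real n)))"
        using n by (simp_all add: lo hi powr_powr powr_def exp_add[symmetric] algebra_simps)
      show "0 < f \<theta>\<^sub>0 \<alpha>\<^sub>0 / 2" "0 < g \<alpha>\<^sub>0 / 2" using reg(4)[OF \<alpha>\<^sub>0] g0(3) by auto
      show "0 \<le> real n powr C2" by simp
    qed
    then show ?case unfolding post .
  qed
  show ?thesis by (rule tendsto_sandwich[OF _ ev tendsto_const lim]) simp
qed

theorem theorem5:
  fixes T \<nu> \<sigma>2\<^sub>0 \<alpha>\<^sub>0 \<theta>\<^sub>0 :: real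
    and P :: "real \<Rightarrow> real \<Rightarrow> 'w measure"
    and Y :: "real ^ 'd \<Rightarrow> 'w \<Rightarrow> real"
    and S :: "(real ^ 'd) set"
    and s :: "nat \<Rightarrow> nat \<Rightarrow> real ^ 'd"
    and f :: "real \<Rightarrow> real \<Rightarrow> real"
    and g :: "real \<Rightarrow> real"
    and \<zeta> :: "nat \<Rightarrow> real"
  assumes d: "CARD('d) \<in> {1, 2, 3}"
    and T: "0 < T" and \<nu>: "0 < \<nu>" and \<sigma>2\<^sub>0: "0 < \<sigma>2\<^sub>0" and \<alpha>\<^sub>0: "0 < \<alpha>\<^sub>0"
    and \<theta>\<^sub>0: "\<theta>\<^sub>0 = \<sigma>2\<^sub>0 * \<alpha>\<^sub>0 powr (2 * \<nu>)"
    and S: "S = cube T"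
    and Y: "\<And>\<sigma>2 \<alpha>. 0 < \<sigma>2 \<Longrightarrow> 0 < \<alpha> \<Longrightarrow>
              centred_gaussian_process (P \<sigma>2 \<alpha>) S (\<lambda>u v. \<sigma>2 * matern \<nu> \<alpha> (u - v)) Y"
    and s: "\<And>n. s n ` {..<n} \<subseteq> S" "\<And>n. inj_on (s n) {..<n}"
  shows
    "(cond_prior_regular \<theta>\<^sub>0 f \<and> space_filling S s \<longrightarrow>
     (\<forall>\<alpha>>0. AE \<omega> in P \<sigma>2\<^sub>0 \<alpha>\<^sub>0.
        (\<lambda>n. measure (posterior_given \<nu> f n (s n) (obs_vec n (s n) Y \<omega>) \<alpha>)
           {\<theta>. 0 < \<theta> \<and>
              ratio_dev (S - s n ` {..<n})
                (pred_mse (P (\<theta> / \<alpha> powr (2 * \<nu>)) \<alpha>) \<nu> n (s n) Y \<alpha>)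
                (pred_mse (P \<sigma>2\<^sub>0 \<alpha>\<^sub>0) \<nu> n (s n) Y \<alpha>)
              > max (ereal (16 * real n powr (- 1 / 2) * ln (real n)))
                    (2 * varsigma P \<nu> \<sigma>2\<^sub>0 \<alpha>\<^sub>0 S n (s n) Y \<alpha>)}) \<longlonglongrightarrow> 0 \<and>
        (\<lambda>n. measure (posterior_given \<nu> f n (s n) (obs_vec n (s n) Y \<omega>) \<alpha>)
           {\<theta>. 0 < \<theta> \<and>
              ratio_dev (S - s n ` {..<n})
                (pred_mse (P (\<theta> / \<alpha> powr (2 * \<nu>)) \<alpha>) \<nu> n (s n) Y \<alpha>)
                (pred_mse (P \<sigma>2\<^sub>0 \<alpha>\<^sub>0) \<nu> n (s n) Y \<alpha>\<^sub>0)
              > max (ereal (16 * real n powr (- 1 / 2) * ln (real n)))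
                    (2 * varsigma P \<nu> \<sigma>2\<^sub>0 \<alpha>\<^sub>0 S n (s n) Y \<alpha>)}) \<longlonglongrightarrow> 0))
   \<and>
    (cond_prior_regular \<theta>\<^sub>0 f \<and> cond_prior_growth \<nu> CARD('d) \<theta>\<^sub>0 f \<and>
     range_prior_tails \<nu> CARD('d) \<theta>\<^sub>0 \<alpha>\<^sub>0 f g \<and> space_filling S s \<and>
     (\<forall>n. 0 < \<zeta> n) \<and> \<zeta> \<longlonglongrightarrow> 0 \<and>
     (\<forall>n\<ge>1. (SUP \<alpha>\<in>{alpha_lo \<nu> CARD('d) n..alpha_hi \<nu> CARD('d) n}.
               varsigma P \<nu> \<sigma>2\<^sub>0 \<alpha>\<^sub>0 S n (s n) Y \<alpha>) \<le> ereal (\<zeta> n)) \<longrightarrow>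
     (AE \<omega> in P \<sigma>2\<^sub>0 \<alpha>\<^sub>0.
        (\<lambda>n. measure (posterior \<nu> f g n (s n) (obs_vec n (s n) Y \<omega>))
           {(\<theta>, \<alpha>). 0 < \<theta> \<and> 0 < \<alpha> \<and>
              ratio_dev (S - s n ` {..<n})
                (pred_mse (P (\<theta> / \<alpha> powr (2 * \<nu>)) \<alpha>) \<nu> n (s n) Y \<alpha>)
                (pred_mse (P \<sigma>2\<^sub>0 \<alpha>\<^sub>0) \<nu> n (s n) Y \<alpha>)
              > ereal (max (16 * real n powr (- 1 / 2) * ln (real n)) (2 * \<zeta> n))}) \<longlonglongrightarrow> 0 \<and>
        (\<lambda>n. measure (posterior \<nu> f g n (s n) (obs_vec n (s n) Y \<omega>))
           {(\<theta>, \<alpha>). 0 < \<theta> \<and> 0 < \<alpha> \<and>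
              ratio_dev (S - s n ` {..<n})
                (pred_mse (P (\<theta> / \<alpha> powr (2 * \<nu>)) \<alpha>) \<nu> n (s n) Y \<alpha>)
                (pred_mse (P \<sigma>2\<^sub>0 \<alpha>\<^sub>0) \<nu> n (s n) Y \<alpha>\<^sub>0)
              > ereal (max (16 * real n powr (- 1 / 2) * ln (real n)) (2 * \<zeta> n))}) \<longlonglongrightarrow> 0))"
proof -
  have d3: "CARD('d) \<le> 3" using d by auto
  have t0: "0 < \<theta>\<^sub>0" using \<sigma>2\<^sub>0 \<alpha>\<^sub>0 by (simp add: \<theta>\<^sub>0)
  let ?M = "P \<sigma>2\<^sub>0 \<alpha>\<^sub>0"
  let ?lo = "alpha_lo \<nu> CARD('d)" and ?hi = "alpha_hi \<nu> CARD('d)"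
  \<comment> \<open>In terms of \<open>kern\<close>, the scale of the true covariance is
    \<open>\<theta>\<^sub>0\<close> alone, so the quadratic forms are to be compared with
    \<open>\<theta>\<^sub>0\<close> times n.\<close>
  have Y0: "centred_gaussian_process ?M S (\<lambda>u v. \<theta>\<^sub>0 * kern \<nu> \<alpha>\<^sub>0 (u - v)) Y"
    using Y[OF \<sigma>2\<^sub>0 \<alpha>\<^sub>0] by (simp only: matern_eq_kern[OF \<nu> \<alpha>\<^sub>0] \<theta>\<^sub>0 mult.assoc)
  have sT: "\<bar>s n j $ i\<bar> \<le> T" if "j < n" for n j i
  proof -
    have "s n j \<in> cube T" using s(1)[of n] S that by auto
    then show ?thesis by (auto simp: cube_def mem_box_cart)
  qed
  have rate: "\<forall>\<^sub>F n in sequentially. \<bar>tr_prod n (finv n (kmat \<nu> (s n) (a n))) (kmat \<nu> (s n) \<alpha>\<^sub>0) - real n\<bar> \<le> sqrt n / 8"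
    if "\<forall>\<^sub>F n in sequentially. real n powr (- \<kappa>1) \<le> a n \<and> a n \<le> real n powr \<kappa>2"
      "0 < \<kappa>1" "0 < \<kappa>2" "2 * \<nu> * \<kappa>1 < 1 / 3" "(2 * \<nu> + real CARD('d) + 2) * \<kappa>2 < 1 / 6" for a \<kappa>1 \<kappa>2
    by (rule trace_deviation_rate[OF \<nu> \<alpha>\<^sub>0 less_imp_le[OF T] d3 sT s(2) that])
  note conc = quadratic_form_concentration[where s=s, OF \<nu> \<alpha>\<^sub>0 t0 Y0 s]
  define \<epsilon> where "\<epsilon> n = ln (real n) / sqrt n" for n
  have e16: "16 * real n powr (- 1 / 2) * ln (real n) = 16 * \<epsilon> n" for n
    by (simp add: \<epsilon>_def powr_minus_divide powr_half_sqrt)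
  have e20: "\<forall>\<^sub>F n in sequentially. 0 \<le> \<epsilon> n \<and> \<epsilon> n \<le> 1 / 20"
  proof -
    have "\<forall>\<^sub>F n in sequentially. ln (real n) / sqrt n \<le> 1 / 20" by (rule eventually_ln_sqrt_le) simp
    then show ?thesis using eventually_ge_at_top[of 1] by eventually_elim (simp add: \<epsilon>_def)
  qed
  have vs: "ratio_dev (S - s n ` {..<n}) (pred_mse (P (\<theta>\<^sub>0 / \<alpha> powr (2 * \<nu>)) \<alpha>) \<nu> n (s n) Y \<alpha>) v \<le> varsigma P \<nu> \<sigma>2\<^sub>0 \<alpha>\<^sub>0 S n (s n) Y \<alpha>"
    if "v = pred_mse ?M \<nu> n (s n) Y \<alpha> \<or> v = pred_mse ?M \<nu> n (s n) Y \<alpha>\<^sub>0" for n \<alpha> v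
    using that by (auto simp: varsigma_def Let_def \<theta>\<^sub>0)
  \<comment> \<open>Contrapositive of \<open>ratio_dev_near\<close>: exceeding the threshold forces
    \<theta> away from \<open>\<theta>\<^sub>0\<close>. Both choices of the denominator
    \<open>v\<close> are covered, since \<open>varsigma\<close> is the maximum over them.\<close>
  have far: "5 * \<epsilon> n < \<bar>\<theta> / \<theta>\<^sub>0 - 1\<bar>"
    if "0 \<le> \<epsilon> n \<and> \<epsilon> n \<le> 1 / 20" "0 < \<alpha>" "0 < \<theta>" "varsigma P \<nu> \<sigma>2\<^sub>0 \<alpha>\<^sub>0 S n (s n) Y \<alpha> \<le> z"
      and v: "v = pred_mse ?M \<nu> n (s n) Y \<alpha> \<or> v = pred_mse ?M \<nu> n (s n) Y \<alpha>\<^sub>0"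
      and gt: "max (ereal (16 * \<epsilon> n)) (2 * z) < ratio_dev (S - s n ` {..<n}) (pred_mse (P (\<theta> / \<alpha> powr (2 * \<nu>)) \<alpha>) \<nu> n (s n) Y \<alpha>) v"
    for n \<alpha> \<theta> z v
  proof (rule ccontr)
    assume "\<not> 5 * \<epsilon> n < \<bar>\<theta> / \<theta>\<^sub>0 - 1\<bar>"
    then have "\<bar>\<theta> / \<theta>\<^sub>0 - 1\<bar> \<le> 5 * \<epsilon> n" by simp
    from leD[OF ratio_dev_near[where P=P, OF \<nu> that(2,3) t0 s(2,1) Y this conjunct1[OF that(1)] conjunct2[OF that(1)] Diff_subset order_trans[OF vs[OF v] that(4)]]] gt
    show False by blast
  qed
  show ?thesis
  proof (intro conjI impI allI)
    fix \<alpha> :: real assume f: "cond_prior_regular \<theta>\<^sub>0 f \<and> space_filling S s" and \<alpha>: "0 < \<alpha>"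
    \<comment> \<open>A fixed \<alpha> eventually lies between n^(-1/(12\<nu>)) and n^k2. The number
      12 is chosen to meet the exponent conditions, with products 1/6 < 1/3 and 1/12 < 1/6.\<close>
    define k2 where "k2 = 1 / (12 * (2 * \<nu> + real CARD('d) + 2))"
    have k2: "0 < k2" "(2 * \<nu> + real CARD('d) + 2) * k2 < 1 / 6"
      using \<nu> by (simp_all add: k2_def add_pos_nonneg)
    have k1: "0 < 1 / (12 * \<nu>)" "2 * \<nu> * (1 / (12 * \<nu>)) < 1 / 3" using \<nu> by simp_all
    have "\<forall>\<^sub>F n in sequentially. real n powr (- (1 / (12 * \<nu>))) \<le> \<alpha> \<and> \<alpha> \<le> real n powr k2"
    proof (rule eventually_conj)
      have "(\<lambda>n. real n powr (- (1 / (12 * \<nu>)))) \<longlonglongrightarrow> 0" using k1 by real_asymp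
      from order_tendstoD(2)[OF this \<alpha>] show "\<forall>\<^sub>F n in sequentially. real n powr (- (1 / (12 * \<nu>))) \<le> \<alpha>" by (rule eventually_mono) simp
      have "filterlim (\<lambda>n. real n powr k2) at_top sequentially" using k2 by real_asymp
      then show "\<forall>\<^sub>F n in sequentially. \<alpha> \<le> real n powr k2" by (simp add: filterlim_at_top)
    qed
    from conc[OF \<alpha> rate[OF this k1(1) k2(1) k1(2) k2(2)]]
    have q: "AE \<omega> in ?M. \<forall>\<^sub>F n in sequentially. \<bar>qform n (finv n (kmat \<nu> (s n) \<alpha>)) (\<lambda>i. Y (s n i) \<omega>) / \<theta>\<^sub>0 - real n\<bar> \<le> 2 * sqrt n * ln n" .
    \<comment> \<open>Encloses the exceptional set in one described by \<theta> alone, whose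
      measurability does not depend on the suprema.\<close>
    have sub: "\<forall>\<^sub>F n in sequentially. {\<theta>. 0 < \<theta> \<and> ratio_dev (S - s n ` {..<n}) (pred_mse (P (\<theta> / \<alpha> powr (2 * \<nu>)) \<alpha>) \<nu> n (s n) Y \<alpha>) (v n)
        > max (ereal (16 * real n powr (- 1 / 2) * ln (real n))) (2 * varsigma P \<nu> \<sigma>2\<^sub>0 \<alpha>\<^sub>0 S n (s n) Y \<alpha>)}
        \<subseteq> {\<theta>. 0 < \<theta> \<and> 5 * (ln (real n) / sqrt n) < \<bar>\<theta> / \<theta>\<^sub>0 - 1\<bar>}"
      if v: "\<And>n. v n = pred_mse ?M \<nu> n (s n) Y \<alpha> \<or> v n = pred_mse ?M \<nu> n (s n) Y \<alpha>\<^sub>0" for v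
      using e20
    proof eventually_elim
      case (elim n)
      show ?case unfolding e16 \<epsilon>_def[symmetric] using far[OF elim \<alpha> _ order_refl v] by blast
    qed
    note lim = posterior_given_concentrates[where s=s, OF \<nu> \<alpha> t0 s(2) conjunct1[OF f]]
    show "AE \<omega> in P \<sigma>2\<^sub>0 \<alpha>\<^sub>0.
        (\<lambda>n. measure (posterior_given \<nu> f n (s n) (obs_vec n (s n) Y \<omega>) \<alpha>)
           {\<theta>. 0 < \<theta> \<and>
              ratio_dev (S - s n ` {..<n})
                (pred_mse (P (\<theta> / \<alpha> powr (2 * \<nu>)) \<alpha>) \<nu> n (s n) Y \<alpha>)
                (pred_mse (P \<sigma>2\<^sub>0 \<alpha>\<^sub>0) \<nu> n (s n) Y \<alpha>)
              > max (ereal (16 * real n powr (- 1 / 2) * ln (real n)))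
                    (2 * varsigma P \<nu> \<sigma>2\<^sub>0 \<alpha>\<^sub>0 S n (s n) Y \<alpha>)}) \<longlonglongrightarrow> 0 \<and>
        (\<lambda>n. measure (posterior_given \<nu> f n (s n) (obs_vec n (s n) Y \<omega>) \<alpha>)
           {\<theta>. 0 < \<theta> \<and>
              ratio_dev (S - s n ` {..<n})
                (pred_mse (P (\<theta> / \<alpha> powr (2 * \<nu>)) \<alpha>) \<nu> n (s n) Y \<alpha>)
                (pred_mse (P \<sigma>2\<^sub>0 \<alpha>\<^sub>0) \<nu> n (s n) Y \<alpha>\<^sub>0)
              > max (ereal (16 * real n powr (- 1 / 2) * ln (real n)))
                    (2 * varsigma P \<nu> \<sigma>2\<^sub>0 \<alpha>\<^sub>0 S n (s n) Y \<alpha>)}) \<longlonglongrightarrow> 0"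
      using q
    proof eventually_elim
      case (elim \<omega>)
      show ?case by (intro conjI lim elim sub) auto
    qed
  next
    assume H: "cond_prior_regular \<theta>\<^sub>0 f \<and> cond_prior_growth \<nu> CARD('d) \<theta>\<^sub>0 f \<and>
     range_prior_tails \<nu> CARD('d) \<theta>\<^sub>0 \<alpha>\<^sub>0 f g \<and> space_filling S s \<and>
     (\<forall>n. 0 < \<zeta> n) \<and> \<zeta> \<longlonglongrightarrow> 0 \<and>
     (\<forall>n\<ge>1. (SUP \<alpha>\<in>{?lo n..?hi n}. varsigma P \<nu> \<sigma>2\<^sub>0 \<alpha>\<^sub>0 S n (s n) Y \<alpha>) \<le> ereal (\<zeta> n))"
    have d1: "1 \<le> CARD('d)" by (simp add: Suc_leI)
    note kl = kappa_lo_bounds[OF \<nu> d1] and kh = kappa_hi_bounds[OF \<nu> d1]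
    have range: "\<forall>\<^sub>F n in sequentially. real n powr (- kappa_lo \<nu> CARD('d)) \<le> ?lo n \<and> ?lo n \<le> real n powr kappa_hi \<nu> CARD('d)"
      "\<forall>\<^sub>F n in sequentially. real n powr (- kappa_lo \<nu> CARD('d)) \<le> ?hi n \<and> ?hi n \<le> real n powr kappa_hi \<nu> CARD('d)"
      using eventually_ge_at_top[of 1]
      by (eventually_elim, use kl kh in \<open>auto simp: alpha_lo_def alpha_hi_def intro!: powr_mono\<close>)+
    note tr = rate[OF range(1) kl(1) kh(1) kl(2) kh(2)] rate[OF range(2) kl(1) kh(1) kl(2) kh(2)]
    have ql: "AE \<omega> in ?M. \<forall>\<^sub>F n in sequentially. \<bar>qform n (finv n (kmat \<nu> (s n) (?lo n))) (\<lambda>i. Y (s n i) \<omega>) / \<theta>\<^sub>0 - real n\<bar> \<le> 2 * sqrt n * ln n"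
      by (rule conc[OF _ tr(1)]) (simp add: alpha_lo_def)
    have qh: "AE \<omega> in ?M. \<forall>\<^sub>F n in sequentially. \<bar>qform n (finv n (kmat \<nu> (s n) (?hi n))) (\<lambda>i. Y (s n i) \<omega>) / \<theta>\<^sub>0 - real n\<bar> \<le> 2 * sqrt n * ln n"
      by (rule conc[OF _ tr(2)]) (simp add: alpha_hi_def)
    \<comment> \<open>For \<alpha> outside the interval \<open>varsigma\<close> is not controlled,
      so the enclosing set claims nothing there; the tail bounds account for those \<alpha>.\<close>
    have sub: "\<forall>\<^sub>F n in sequentially. {(\<theta>, \<alpha>). 0 < \<theta> \<and> 0 < \<alpha> \<and> ratio_dev (S - s n ` {..<n}) (pred_mse (P (\<theta> / \<alpha> powr (2 * \<nu>)) \<alpha>) \<nu> n (s n) Y \<alpha>) (v n \<alpha>)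
        > ereal (max (16 * real n powr (- 1 / 2) * ln (real n)) (2 * \<zeta> n))}
        \<subseteq> {(\<theta>, \<alpha>). 0 < \<theta> \<and> 0 < \<alpha> \<and> (?lo n \<le> \<alpha> \<longrightarrow> \<alpha> \<le> ?hi n \<longrightarrow> 5 * (ln (real n) / sqrt n) < \<bar>\<theta> / \<theta>\<^sub>0 - 1\<bar>)}"
      if v: "\<And>n \<alpha>. v n \<alpha> = pred_mse ?M \<nu> n (s n) Y \<alpha> \<or> v n \<alpha> = pred_mse ?M \<nu> n (s n) Y \<alpha>\<^sub>0" for v
      using e20 eventually_ge_at_top[of 1]
    proof eventually_elim
      case (elim n)
      have "varsigma P \<nu> \<sigma>2\<^sub>0 \<alpha>\<^sub>0 S n (s n) Y \<alpha> \<le> ereal (\<zeta> n)" if "?lo n \<le> \<alpha>" "\<alpha> \<le> ?hi n" for \<alpha>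
        using H elim(2) that by (auto simp: SUP_le_iff)
      from far[OF elim(1) _ _ this v] show ?case
        unfolding e16 \<epsilon>_def[symmetric] by (auto simp: max_def split: if_splits)
    qed
    note lim = posterior_concentrates[where s=s, OF \<nu> \<alpha>\<^sub>0 t0 s(2) _ _ _ tr(2), of f g]
    show "AE \<omega> in P \<sigma>2\<^sub>0 \<alpha>\<^sub>0.
        (\<lambda>n. measure (posterior \<nu> f g n (s n) (obs_vec n (s n) Y \<omega>))
           {(\<theta>, \<alpha>). 0 < \<theta> \<and> 0 < \<alpha> \<and>
              ratio_dev (S - s n ` {..<n})
                (pred_mse (P (\<theta> / \<alpha> powr (2 * \<nu>)) \<alpha>) \<nu> n (s n) Y \<alpha>)
                (pred_mse (P \<sigma>2\<^sub>0 \<alpha>\<^sub>0) \<nu> n (s n) Y \<alpha>)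
              > ereal (max (16 * real n powr (- 1 / 2) * ln (real n)) (2 * \<zeta> n))}) \<longlonglongrightarrow> 0 \<and>
        (\<lambda>n. measure (posterior \<nu> f g n (s n) (obs_vec n (s n) Y \<omega>))
           {(\<theta>, \<alpha>). 0 < \<theta> \<and> 0 < \<alpha> \<and>
              ratio_dev (S - s n ` {..<n})
                (pred_mse (P (\<theta> / \<alpha> powr (2 * \<nu>)) \<alpha>) \<nu> n (s n) Y \<alpha>)
                (pred_mse (P \<sigma>2\<^sub>0 \<alpha>\<^sub>0) \<nu> n (s n) Y \<alpha>\<^sub>0)
              > ereal (max (16 * real n powr (- 1 / 2) * ln (real n)) (2 * \<zeta> n))}) \<longlonglongrightarrow> 0"
      using ql qh
    proof eventually_elim
      case (elim \<omega>)
      show ?case by (intro conjI lim elim sub) (use H in auto)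
    qed
  qed
qed

end
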